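(* Let $R$ be an algebra over $\mathbb{C}$, $\mathcal{B}$ a right $\times_R$-Hopf algebra, $T$ a right $\mathcal{B}$-comodule algebra, $S=T^{\mathcal{B}}$, $\mathcal{K}$ a left $\times_S$-Hopf algebra, and suppose $T$ is a left $\mathcal{K}$-module algebra which is a $\mathcal{K}$-equivariant $\mathcal{B}$-Galois extension of $S$. Let ${}^{\mathcal{K}}SAYD_{\mathcal{K}}$ be the category of right-left SAYD modules over $\mathcal{K}$ with $\mathcal{K}$-linear and $\mathcal{K}$-colinear maps, and ${}_{\mathcal{B}}SAYD^{\mathcal{B}}$ the category of left-right SAYD modules over $\mathcal{B}$ with $\mathcal{B}$-linear and $\mathcal{B}$-colinear maps. Then the assignment $$\digamma:\ {}^{\mathcal{K}}SAYD_{\mathcal{K}}\to{}_{\mathcal{B}}SAYD^{\mathcal{B}},\qquad \digamma(M)=M\otimes_{\mathcal{K}}T,\qquad \digamma(\phi)=\phi\otimes_{\mathcal{K}}\mathrm{Id}_T,$$ where $M\otimes_{\mathcal{K}}T$ carries the $\mathcal{B}$-action $b\triangleright(m\otimes_{\mathcal{K}}t)=m_{\langle 0\rangle}\otimes_{\mathcal{K}}b_{\langle +\rangle}\big(m_{\langle -1\rangle}\triangleright(t\,b_{\langle -\rangle})\big)$ and the $\mathcal{B}$-coaction $m\otimes_{\mathcal{K}}t\mapsto m\otimes_{\mathcal{K}}t_{\langle 0\rangle}\otimes_Rt_{\langle 1\rangle}$, defines a covariant functor.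
   Context: All algebras are unital associative over $\mathbb{C}$. Sweedler notation is used for coproducts ($\Delta(k)=k^{(1)}\otimes k^{(2)}$) and coactions ($m\mapsto m_{\langle -1\rangle}\otimes m_{\langle 0\rangle}$ or $m\mapsto m_{\langle 0\rangle}\otimes m_{\langle 1\rangle}$). **Left bialgebroids and left $\times_S$-Hopf algebras.** Let $S$ be an algebra. A left $S$-bialgebroid is an algebra $\mathcal{K}$ with algebra maps $\mathfrak{s}:S\to\mathcal{K}$, $\mathfrak{t}:S^{op}\to\mathcal{K}$ with commuting ranges, which is an $S$-coring $(\Delta,\varepsilon)$ for the bimodule structure $r_1kr_2=\mathfrak{s}(r_1)\mathfrak{t}(r_2)k$, such that $k^{(1)}\mathfrak{t}(r)\otimes_S k^{(2)}=k^{(1)}\otimes_S k^{(2)}\mathfrak{s}(r)$; $\Delta(1)=1\otimes_S1$, $\Delta(kk')=k^{(1)}k'^{(1)}\otimes_S k^{(2)}k'^{(2)}$; $\varepsilon(1)=1$, $\varepsilon(kk')=\varepsilon(k\,\mathfrak{s}(\varepsilon(k')))$. It is a left $\times_S$-Hopf algebra if $\nu:\mathcal{K}\otimes_{S^{op}}\mathcal{K}\to\mathcal{K}\otimes_S\mathcal{K}$, $k\otimes k'\mapsto k^{(1)}\otimes_S k^{(2)}k'$ is bijective (domain: $k\mathfrak{t}(r)\otimes k'=k\otimes\mathfrak{t}(r)k'$). Write $k^-\otimes_{S^{op}}k^+:=\nu^{-1}(k\otimes_S1)$. **Right bialgebroids and right $\times_R$-Hopf algebras.** A right $R$-bialgebroid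 is an algebra $\mathcal{B}$ with an algebra map $\mathfrak{s}:R\to\mathcal{B}$ and an anti-algebra map $\mathfrak{t}:R\to\mathcal{B}$ with commuting ranges, which is an $R$-coring for the bimodule structure $r b r'=b\,\mathfrak{s}(r')\mathfrak{t}(r)$, such that $b^{(1)}\otimes_R\mathfrak{t}(r)b^{(2)}=\mathfrak{s}(r)b^{(1)}\otimes_Rb^{(2)}$; $\Delta(1)=1\otimes_R1$, $\Delta(bb')=b^{(1)}b'^{(1)}\otimes_Rb^{(2)}b'^{(2)}$; $\varepsilon(1)=1$, $\varepsilon(bb')=\varepsilon(\mathfrak{s}(\varepsilon(b))b')$. It is a right $\times_R$-Hopf algebra if $\nu:\mathcal{B}\otimes_{R^{op}}\mathcal{B}\to\mathcal{B}\otimes_R\mathcal{B}$, $b\otimes b'\mapsto bb'^{(1)}\otimes_Rb'^{(2)}$ is bijective (domain: $b\mathfrak{t}(r)\otimes b'=b\otimes\mathfrak{t}(r)b'$). Write $b^-\otimes_{R^{op}}b^+:=\nu^{-1}(1\otimes_Rb)$. **Comodules.** A left $\mathcal{K}$-comodule is a left $S$-module $M$ with a left $S$-linear coassociative counital coaction $M\to\mathcal{K}\otimes_SM$; it has a canonical right $S$-action $mr=\varepsilon(m_{\langle -1\rangle}\mathfrak{s}(r))m_{\langle 0\rangle}$. A right $\mathcal{B}$-comodule is a right $R$-module $M$ with a right $R$-linear coassociative counital coaction $M\to M\otimes_R\mathcal{B}$; it has a canonical left $R$-action $rm=m_{\langle 0\rangle}\varepsilon(\mathfrak{s}(r)m_{\langle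 1\rangle})$. **SAYD (stable anti Yetter-Drinfeld) modules.** A right-left SAYD module over $\mathcal{K}$ is a right $\mathcal{K}$-module and left $\mathcal{K}$-comodule $M$ such that (i) $mr=m\triangleleft\mathfrak{s}(r)$ and $rm=m\triangleleft\mathfrak{t}(r)$, where the left sides are the comodule $S$-actions; (ii) $(m\triangleleft k)_{\langle -1\rangle}\otimes_S(m\triangleleft k)_{\langle 0\rangle}={k^{(2)}}^+m_{\langle -1\rangle}k^{(1)}\otimes_Sm_{\langle 0\rangle}\triangleleft{k^{(2)}}^-$; (iii) $m_{\langle 0\rangle}\triangleleft m_{\langle -1\rangle}=m$. A left-right SAYD module over $\mathcal{B}$ is a left $\mathcal{B}$-module and right $\mathcal{B}$-comodule $M$ such that (i) $mr=\mathfrak{t}(r)\triangleright m$ and $rm=\mathfrak{s}(r)\triangleright m$, where the left sides are the comodule $R$-actions; (ii) $(b\triangleright m)_{\langle 0\rangle}\otimes_R(b\triangleright m)_{\langle 1\rangle}={b^{(1)}}^+\triangleright m_{\langle 0\rangle}\otimes_Rb^{(2)}m_{\langle 1\rangle}{b^{(1)}}^-$; (iii) $m_{\langle 1\rangle}\triangleright m_{\langle 0\rangle}=m$. **Module algebras.** A left $\mathcal{K}$-module algebra is an algebra $T$ that is a left $\mathcal{K}$-module with $k\triangleright1=\mathfrak{s}(\varepsilon(k))\triangleright1$, $k\triangleright(tt')=(k^{(1)}\triangleright t)(k^{(2)}\triangleright t')$, $(\mathfrak{t}(r)\triangleright t)t'=t(\mathfrak{s}(r)\triangleright t')$. It is an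 $S$-bimodule by $rt=\mathfrak{s}(r)\triangleright t$, $tr=\mathfrak{t}(r)\triangleright t$. **Comodule algebras.** A right $\mathcal{B}$-comodule algebra is an algebra $T$ that is a right $\mathcal{B}$-comodule (hence an $R$-bimodule, with the canonical left action) with $(tr)t'=t(rt')$, $1\mapsto1\otimes_R1$, and $(tt')_{\langle 0\rangle}\otimes_R(tt')_{\langle 1\rangle}=t_{\langle 0\rangle}t'_{\langle 0\rangle}\otimes_Rt_{\langle 1\rangle}t'_{\langle 1\rangle}$. Its coinvariants are $T^{\mathcal{B}}=\{s\in T: s_{\langle 0\rangle}\otimes_Rs_{\langle 1\rangle}=s\otimes_R1\}$. **Equivariant Galois extension.** With $S=T^{\mathcal{B}}$, $T$ a right $\mathcal{B}$-comodule algebra and a left $\mathcal{K}$-module algebra over a left $\times_S$-Hopf algebra $\mathcal{K}$ (the $S$-bimodule structure of $T$ induced by $\mathcal{K}$ being the one given by multiplication with $S\subseteq T$), $T$ is a $\mathcal{K}$-equivariant $\mathcal{B}$-Galois extension of $S$ if $can:T\otimes_ST\to T\otimes_R\mathcal{B}$, $t'\otimes_St\mapsto t't_{\langle 0\rangle}\otimes_Rt_{\langle 1\rangle}$ is bijective and $(k\triangleright t)_{\langle 0\rangle}\otimes_R(k\triangleright t)_{\langle 1\rangle}=k\triangleright t_{\langle 0\rangle}\otimes_Rt_{\langle 1\rangle}$ for all $k\in\mathcal{K},t\in T$ (the $\mathcal{K}$-action being understood to commute with the right $R$-action on $T$, so that this formula makes sense). Write $b_{\langle -\rangle}\otimes_Sb_{\langle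 +\rangle}:=can^{-1}(1\otimes_Rb)$. *)

theory Defs
  imports Complex_Main "HOL-Algebra.Algebra" "HOL-Algebra.Algebraic_Closure_Type"
begin

section \<open>Algebras over the complex numbers and their modules\<close>

definition complex_algebra :: "(complex, 'a, 'e) module_scheme \<Rightarrow> bool" where
  "complex_algebra A \<longleftrightarrow>
     Ring.ring A \<and> Module.module (ring_of_type_algebra :: complex ring) A \<and>
     (\<forall>c. \<forall>x\<in>carrier A. \<forall>y\<in>carrier A.
        (c \<odot>\<^bsub>A\<^esub> x) \<otimes>\<^bsub>A\<^esub> y = c \<odot>\<^bsub>A\<^esub> (x \<otimes>\<^bsub>A\<^esub> y) \<and>
        x \<otimes>\<^bsub>A\<^esub> (c \<odot>\<^bsub>A\<^esub> y) = c \<odot>\<^bsub>A\<^esub> (x \<otimes>\<^bsub>A\<^esub> y))"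

definition opposite :: "(complex, 'a, 'e) module_scheme \<Rightarrow> (complex, 'a, 'e) module_scheme" where
  "opposite A = A\<lparr>monoid.mult := \<lambda>x y. y \<otimes>\<^bsub>A\<^esub> x\<rparr>"

definition algebra_hom ::
  "(complex, 'a, 'e) module_scheme \<Rightarrow> (complex, 'b, 'f) module_scheme \<Rightarrow> ('a \<Rightarrow> 'b) set" where
  "algebra_hom A B =
     {f \<in> ring_hom A B. \<forall>c. \<forall>x\<in>carrier A. f (c \<odot>\<^bsub>A\<^esub> x) = c \<odot>\<^bsub>B\<^esub> f x}"

text \<open>
  The abelian group underlying a module is a \<^const>\<open>comm_group\<close>, hence written multiplicatively
  (as are \<^const>\<open>free_Abelian_group\<close> and its quotients below); rings contribute their
  \<^const>\<open>add_monoid\<close>. The complex vector space structure of a module over a complex algebra is the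
  one induced by the action, so it is not a separate datum and linear maps over the algebra respect it.
\<close>

definition left_module ::
  "('a, 'e) ring_scheme \<Rightarrow> ('m, 'f) monoid_scheme \<Rightarrow> ('a \<Rightarrow> 'm \<Rightarrow> 'm) \<Rightarrow> bool" where
  "left_module A M act \<longleftrightarrow>
     Ring.ring A \<and> comm_group M \<and>
     (\<forall>a\<in>carrier A. act a \<in> hom M M) \<and>
     (\<forall>a\<in>carrier A. \<forall>b\<in>carrier A. \<forall>m\<in>carrier M.
        act (a \<oplus>\<^bsub>A\<^esub> b) m = act a m \<otimes>\<^bsub>M\<^esub> act b m \<and>
        act (a \<otimes>\<^bsub>A\<^esub> b) m = act a (act b m)) \<and>
     (\<forall>m\<in>carrier M. act \<one>\<^bsub>A\<^esub> m = m)"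

definition right_module ::
  "('a, 'e) ring_scheme \<Rightarrow> ('m, 'f) monoid_scheme \<Rightarrow> ('m \<Rightarrow> 'a \<Rightarrow> 'm) \<Rightarrow> bool" where
  "right_module A M act \<longleftrightarrow>
     Ring.ring A \<and> comm_group M \<and>
     (\<forall>a\<in>carrier A. (\<lambda>m. act m a) \<in> hom M M) \<and>
     (\<forall>a\<in>carrier A. \<forall>b\<in>carrier A. \<forall>m\<in>carrier M.
        act m (a \<oplus>\<^bsub>A\<^esub> b) = act m a \<otimes>\<^bsub>M\<^esub> act m b \<and>
        act m (a \<otimes>\<^bsub>A\<^esub> b) = act (act m a) b) \<and>
     (\<forall>m\<in>carrier M. act m \<one>\<^bsub>A\<^esub> = m)"

section \<open>Balanced tensor products and Sweedler notation\<close>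

text \<open>
  An element of a tensor product is a coset of formal integer combinations of pairs (or triples).
  The set \<open>I\<close> indexes the balancing relations \<open>m i \<otimes> n = m \<otimes> i n\<close>; no algebra structure on \<open>I\<close>
  enters the construction.
\<close>

type_synonym 'a tensor = "('a \<Rightarrow>\<^sub>0 int) set"

definition tensor_rels ::
  "'i set \<Rightarrow> ('m, 'e) monoid_scheme \<Rightarrow> ('m \<Rightarrow> 'i \<Rightarrow> 'm) \<Rightarrow>
   ('n, 'f) monoid_scheme \<Rightarrow> ('i \<Rightarrow> 'n \<Rightarrow> 'n) \<Rightarrow> ('m \<times> 'n) tensor" where
  "tensor_rels I M ra N la =
     {frag_of (m \<otimes>\<^bsub>M\<^esub> m', n) - frag_of (m, n) - frag_of (m', n) | m m' n.
        m \<in> carrier M \<and> m' \<in> carrier M \<and> n \<in> carrier N} \<union>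
     {frag_of (m, n \<otimes>\<^bsub>N\<^esub> n') - frag_of (m, n) - frag_of (m, n') | m n n'.
        m \<in> carrier M \<and> n \<in> carrier N \<and> n' \<in> carrier N} \<union>
     {frag_of (ra m i, n) - frag_of (m, la i n) | m i n.
        m \<in> carrier M \<and> i \<in> I \<and> n \<in> carrier N}"

definition tensor ::
  "'i set \<Rightarrow> ('m, 'e) monoid_scheme \<Rightarrow> ('m \<Rightarrow> 'i \<Rightarrow> 'm) \<Rightarrow>
   ('n, 'f) monoid_scheme \<Rightarrow> ('i \<Rightarrow> 'n \<Rightarrow> 'n) \<Rightarrow> ('m \<times> 'n) tensor monoid" where
  "tensor I M ra N la =
     (let F = free_Abelian_group (carrier M \<times> carrier N)
      in F Mod generate F (tensor_rels I M ra N la))"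

definition tensor3_rels ::
  "'i set \<Rightarrow> ('l, 'e) monoid_scheme \<Rightarrow> ('l \<Rightarrow> 'i \<Rightarrow> 'l) \<Rightarrow>
   ('m, 'f) monoid_scheme \<Rightarrow> ('i \<Rightarrow> 'm \<Rightarrow> 'm) \<Rightarrow> ('m \<Rightarrow> 'i \<Rightarrow> 'm) \<Rightarrow>
   ('n, 'g) monoid_scheme \<Rightarrow> ('i \<Rightarrow> 'n \<Rightarrow> 'n) \<Rightarrow> ('l \<times> 'm \<times> 'n) tensor" where
  "tensor3_rels I L raL M laM raM N laN =
     {frag_of (l \<otimes>\<^bsub>L\<^esub> l', m, n) - frag_of (l, m, n) - frag_of (l', m, n) | l l' m n.
        l \<in> carrier L \<and> l' \<in> carrier L \<and> m \<in> carrier M \<and> n \<in> carrier N} \<union>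
     {frag_of (l, m \<otimes>\<^bsub>M\<^esub> m', n) - frag_of (l, m, n) - frag_of (l, m', n) | l m m' n.
        l \<in> carrier L \<and> m \<in> carrier M \<and> m' \<in> carrier M \<and> n \<in> carrier N} \<union>
     {frag_of (l, m, n \<otimes>\<^bsub>N\<^esub> n') - frag_of (l, m, n) - frag_of (l, m, n') | l m n n'.
        l \<in> carrier L \<and> m \<in> carrier M \<and> n \<in> carrier N \<and> n' \<in> carrier N} \<union>
     {frag_of (raL l i, m, n) - frag_of (l, laM i m, n) | l i m n.
        l \<in> carrier L \<and> i \<in> I \<and> m \<in> carrier M \<and> n \<in> carrier N} \<union>
     {frag_of (l, raM m i, n) - frag_of (l, m, laN i n) | l i m n.
        l \<in> carrier L \<and> i \<in> I \<and> m \<in> carrier M \<and> n \<in> carrier N}"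

definition tensor3 ::
  "'i set \<Rightarrow> ('l, 'e) monoid_scheme \<Rightarrow> ('l \<Rightarrow> 'i \<Rightarrow> 'l) \<Rightarrow>
   ('m, 'f) monoid_scheme \<Rightarrow> ('i \<Rightarrow> 'm \<Rightarrow> 'm) \<Rightarrow> ('m \<Rightarrow> 'i \<Rightarrow> 'm) \<Rightarrow>
   ('n, 'g) monoid_scheme \<Rightarrow> ('i \<Rightarrow> 'n \<Rightarrow> 'n) \<Rightarrow> ('l \<times> 'm \<times> 'n) tensor monoid" where
  "tensor3 I L raL M laM raM N laN =
     (let F = free_Abelian_group (carrier L \<times> carrier M \<times> carrier N)
      in F Mod generate F (tensor3_rels I L raL M laM raM N laN))"

text \<open>
  The class of a formal sum. The neutral element of a quotient \<open>Q\<close> is the subgroup of relations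
  itself, so it suffices to name \<open>Q\<close>.
\<close>

definition tclass :: "'a tensor monoid \<Rightarrow> ('a \<Rightarrow>\<^sub>0 int) \<Rightarrow> 'a tensor" where
  "tclass Q z = {h + z | h. h \<in> \<one>\<^bsub>Q\<^esub>}"

text \<open>
  Sweedler notation: a formal sum \<open>z \<in> \<Delta> k\<close> is a representative of \<open>\<Delta> k\<close>, and an expression
  \<open>\<Sum> \<dots> k\<^sup>1 \<dots> k\<^sup>2 \<dots>\<close> is \<open>sweedler z (\<lambda>k\<^sub>1 k\<^sub>2. \<dots>)\<close> when it is itself a formal sum of tensors, or
  \<open>value_sum G (\<lambda>k\<^sub>1 k\<^sub>2. \<dots>) z\<close> when it takes values in an abelian group \<open>G\<close>. An element
  \<open>D \<in> Pi (carrier K) \<Delta>\<close> is a simultaneous choice of representatives for all \<open>\<Delta> k\<close>. All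
  identities below are required for all choices of representatives, so that the independence of the
  choices is part of each identity.
\<close>

abbreviation sweedler ::
  "('a \<times> 'b \<Rightarrow>\<^sub>0 int) \<Rightarrow> ('a \<Rightarrow> 'b \<Rightarrow> 'c \<Rightarrow>\<^sub>0 int) \<Rightarrow> ('c \<Rightarrow>\<^sub>0 int)" where
  "sweedler z f \<equiv> frag_extend (\<lambda>(x, y). f x y) z"

definition value_sum ::
  "('g, 'e) monoid_scheme \<Rightarrow> ('a \<Rightarrow> 'b \<Rightarrow> 'g) \<Rightarrow> ('a \<times> 'b \<Rightarrow>\<^sub>0 int) \<Rightarrow> 'g" where
  "value_sum G f z =
     finprod G (\<lambda>(x, y). f x y [^]\<^bsub>G\<^esub> Poly_Mapping.lookup z (x, y)) (Poly_Mapping.keys z)"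

text \<open>
  Maps out of a tensor product that are given on representatives are defined below as
  \<^const>\<open>the_elem\<close> of the set of all values obtained from representatives; this is the common value
  whenever the prescription is well defined.
\<close>

section \<open>Left bialgebroids\<close>

record ('s, 'k) bialgebroid = "(complex, 'k) module" +
  source :: "'s \<Rightarrow> 'k"
  target :: "'s \<Rightarrow> 'k"
  comult :: "'k \<Rightarrow> ('k \<times> 'k) tensor"
  counit :: "'k \<Rightarrow> 's"

text \<open>
  \<open>left_tensor S K M la\<close> is \<open>K \<otimes>\<^sub>S M\<close> for the right \<open>S\<close>-module structure \<open>k r = t(r) k\<close> on \<open>K\<close>.
\<close>

definition left_tensor ::
  "(complex, 's, 'e) module_scheme \<Rightarrow> ('s, 'k, 'f) bialgebroid_scheme \<Rightarrow>
   ('m, 'g) monoid_scheme \<Rightarrow> ('s \<Rightarrow> 'm \<Rightarrow> 'm) \<Rightarrow> ('k \<times> 'm) tensor monoid" where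
  "left_tensor S K M la =
     tensor (carrier S) (add_monoid K) (\<lambda>k r. target K r \<otimes>\<^bsub>K\<^esub> k) M la"

definition left_square ::
  "(complex, 's, 'e) module_scheme \<Rightarrow> ('s, 'k, 'f) bialgebroid_scheme \<Rightarrow>
   ('k \<times> 'k) tensor monoid" where
  "left_square S K = left_tensor S K (add_monoid K) (\<lambda>r k. source K r \<otimes>\<^bsub>K\<^esub> k)"

definition left_coassociative ::
  "(complex, 's, 'e) module_scheme \<Rightarrow> ('s, 'k, 'f) bialgebroid_scheme \<Rightarrow>
   ('m, 'g) monoid_scheme \<Rightarrow> ('s \<Rightarrow> 'm \<Rightarrow> 'm) \<Rightarrow> ('m \<Rightarrow> ('k \<times> 'm) tensor) \<Rightarrow> bool" where
  "left_coassociative S K M la \<rho> \<longleftrightarrow>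
     (let KKM = tensor3 (carrier S)
                  (add_monoid K) (\<lambda>k r. target K r \<otimes>\<^bsub>K\<^esub> k)
                  (add_monoid K) (\<lambda>r k. source K r \<otimes>\<^bsub>K\<^esub> k) (\<lambda>k r. target K r \<otimes>\<^bsub>K\<^esub> k)
                  M la
      in \<forall>D \<in> Pi (carrier K) (comult K). \<forall>C \<in> Pi (carrier M) \<rho>. \<forall>m\<in>carrier M.
           tclass KKM (sweedler (C m) (\<lambda>k n. sweedler (D k) (\<lambda>k1 k2. frag_of (k1, k2, n)))) =
           tclass KKM (sweedler (C m) (\<lambda>k n. sweedler (C n) (\<lambda>k' n'. frag_of (k, k', n')))))"

definition left_coring ::
  "(complex, 's, 'e) module_scheme \<Rightarrow> ('s, 'k, 'f) bialgebroid_scheme \<Rightarrow> bool" where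
  "left_coring S K \<longleftrightarrow>
     comult K \<in> hom (add_monoid K) (left_square S K) \<and>
     (\<forall>D \<in> Pi (carrier K) (comult K). \<forall>k\<in>carrier K. \<forall>r\<in>carrier S. \<forall>r'\<in>carrier S.
        comult K (source K r \<otimes>\<^bsub>K\<^esub> (target K r' \<otimes>\<^bsub>K\<^esub> k)) =
        tclass (left_square S K)
          (sweedler (D k) (\<lambda>k1 k2. frag_of (source K r \<otimes>\<^bsub>K\<^esub> k1, target K r' \<otimes>\<^bsub>K\<^esub> k2)))) \<and>
     left_coassociative S K (add_monoid K) (\<lambda>r k. source K r \<otimes>\<^bsub>K\<^esub> k) (comult K) \<and>
     counit K \<in> hom (add_monoid K) (add_monoid S) \<and>
     (\<forall>k\<in>carrier K. \<forall>r\<in>carrier S. \<forall>r'\<in>carrier S.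
        counit K (source K r \<otimes>\<^bsub>K\<^esub> (target K r' \<otimes>\<^bsub>K\<^esub> k)) =
        r \<otimes>\<^bsub>S\<^esub> (counit K k \<otimes>\<^bsub>S\<^esub> r')) \<and>
     (\<forall>D \<in> Pi (carrier K) (comult K). \<forall>k\<in>carrier K.
        value_sum (add_monoid K) (\<lambda>k1 k2. source K (counit K k1) \<otimes>\<^bsub>K\<^esub> k2) (D k) = k \<and>
        value_sum (add_monoid K) (\<lambda>k1 k2. target K (counit K k2) \<otimes>\<^bsub>K\<^esub> k1) (D k) = k)"

definition left_bialgebroid ::
  "(complex, 's, 'e) module_scheme \<Rightarrow> ('s, 'k, 'f) bialgebroid_scheme \<Rightarrow> bool" where
  "left_bialgebroid S K \<longleftrightarrow>
     complex_algebra S \<and> complex_algebra K \<and>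
     source K \<in> algebra_hom S K \<and> target K \<in> algebra_hom (opposite S) K \<and>
     (\<forall>r\<in>carrier S. \<forall>r'\<in>carrier S.
        source K r \<otimes>\<^bsub>K\<^esub> target K r' = target K r' \<otimes>\<^bsub>K\<^esub> source K r) \<and>
     left_coring S K \<and>
     (\<forall>D \<in> Pi (carrier K) (comult K). \<forall>k\<in>carrier K. \<forall>r\<in>carrier S.
        tclass (left_square S K)
          (sweedler (D k) (\<lambda>k1 k2. frag_of (k1 \<otimes>\<^bsub>K\<^esub> target K r, k2))) =
        tclass (left_square S K)
          (sweedler (D k) (\<lambda>k1 k2. frag_of (k1, k2 \<otimes>\<^bsub>K\<^esub> source K r)))) \<and>
     comult K \<one>\<^bsub>K\<^esub> = tclass (left_square S K) (frag_of (\<one>\<^bsub>K\<^esub>, \<one>\<^bsub>K\<^esub>)) \<and>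
     (\<forall>D \<in> Pi (carrier K) (comult K). \<forall>k\<in>carrier K. \<forall>k'\<in>carrier K.
        comult K (k \<otimes>\<^bsub>K\<^esub> k') =
        tclass (left_square S K)
          (sweedler (D k) (\<lambda>k1 k2. sweedler (D k') (\<lambda>k1' k2'.
             frag_of (k1 \<otimes>\<^bsub>K\<^esub> k1', k2 \<otimes>\<^bsub>K\<^esub> k2'))))) \<and>
     counit K \<one>\<^bsub>K\<^esub> = \<one>\<^bsub>S\<^esub> \<and>
     (\<forall>k\<in>carrier K. \<forall>k'\<in>carrier K.
        counit K (k \<otimes>\<^bsub>K\<^esub> k') = counit K (k \<otimes>\<^bsub>K\<^esub> source K (counit K k')))"

text \<open>The domain \<open>K \<otimes> K\<close> over the opposite of \<open>S\<close>, with \<open>k t(r) \<otimes> k' = k \<otimes> t(r) k'\<close>.\<close>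

definition left_op_square ::
  "(complex, 's, 'e) module_scheme \<Rightarrow> ('s, 'k, 'f) bialgebroid_scheme \<Rightarrow>
   ('k \<times> 'k) tensor monoid" where
  "left_op_square S K =
     tensor (carrier S) (add_monoid K) (\<lambda>k r. k \<otimes>\<^bsub>K\<^esub> target K r)
       (add_monoid K) (\<lambda>r k. target K r \<otimes>\<^bsub>K\<^esub> k)"

definition left_nu ::
  "(complex, 's, 'e) module_scheme \<Rightarrow> ('s, 'k, 'f) bialgebroid_scheme \<Rightarrow>
   ('k \<times> 'k) tensor \<Rightarrow> ('k \<times> 'k) tensor" where
  "left_nu S K U =
     the_elem {tclass (left_square S K)
                 (sweedler z (\<lambda>k k'. sweedler (D k) (\<lambda>k1 k2. frag_of (k1, k2 \<otimes>\<^bsub>K\<^esub> k')))) | z D.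
               z \<in> U \<and> D \<in> Pi (carrier K) (comult K)}"

definition left_hopf_algebroid ::
  "(complex, 's, 'e) module_scheme \<Rightarrow> ('s, 'k, 'f) bialgebroid_scheme \<Rightarrow> bool" where
  "left_hopf_algebroid S K \<longleftrightarrow>
     left_bialgebroid S K \<and>
     bij_betw (left_nu S K) (carrier (left_op_square S K)) (carrier (left_square S K))"

text \<open>The tensor \<open>k\<^sup>- \<otimes> k\<^sup>+\<close>: the first components are \<open>k\<^sup>-\<close>, the second ones \<open>k\<^sup>+\<close>.\<close>

definition left_translation ::
  "(complex, 's, 'e) module_scheme \<Rightarrow> ('s, 'k, 'f) bialgebroid_scheme \<Rightarrow>
   'k \<Rightarrow> ('k \<times> 'k) tensor" where
  "left_translation S K k =
     inv_into (carrier (left_op_square S K)) (left_nu S K)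
       (tclass (left_square S K) (frag_of (k, \<one>\<^bsub>K\<^esub>)))"

section \<open>Right bialgebroids\<close>

text \<open>
  \<open>right_tensor R B M ra\<close> is \<open>M \<otimes>\<^sub>R B\<close> for the left \<open>R\<close>-module structure \<open>r b = b t(r)\<close> on \<open>B\<close>.
\<close>

definition right_tensor ::
  "(complex, 'r, 'e) module_scheme \<Rightarrow> ('r, 'b, 'f) bialgebroid_scheme \<Rightarrow>
   ('m, 'g) monoid_scheme \<Rightarrow> ('m \<Rightarrow> 'r \<Rightarrow> 'm) \<Rightarrow> ('m \<times> 'b) tensor monoid" where
  "right_tensor R B M ra =
     tensor (carrier R) M ra (add_monoid B) (\<lambda>r b. b \<otimes>\<^bsub>B\<^esub> target B r)"

definition right_square ::
  "(complex, 'r, 'e) module_scheme \<Rightarrow> ('r, 'b, 'f) bialgebroid_scheme \<Rightarrow>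
   ('b \<times> 'b) tensor monoid" where
  "right_square R B = right_tensor R B (add_monoid B) (\<lambda>b r. b \<otimes>\<^bsub>B\<^esub> source B r)"

definition right_coassociative ::
  "(complex, 'r, 'e) module_scheme \<Rightarrow> ('r, 'b, 'f) bialgebroid_scheme \<Rightarrow>
   ('m, 'g) monoid_scheme \<Rightarrow> ('m \<Rightarrow> 'r \<Rightarrow> 'm) \<Rightarrow> ('m \<Rightarrow> ('m \<times> 'b) tensor) \<Rightarrow> bool" where
  "right_coassociative R B M ra \<rho> \<longleftrightarrow>
     (let MBB = tensor3 (carrier R) M ra
                  (add_monoid B) (\<lambda>r b. b \<otimes>\<^bsub>B\<^esub> target B r) (\<lambda>b r. b \<otimes>\<^bsub>B\<^esub> source B r)
                  (add_monoid B) (\<lambda>r b. b \<otimes>\<^bsub>B\<^esub> target B r)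
      in \<forall>D \<in> Pi (carrier B) (comult B). \<forall>C \<in> Pi (carrier M) \<rho>. \<forall>m\<in>carrier M.
           tclass MBB (sweedler (C m) (\<lambda>n b. sweedler (D b) (\<lambda>b1 b2. frag_of (n, b1, b2)))) =
           tclass MBB (sweedler (C m) (\<lambda>n b. sweedler (C n) (\<lambda>n' b'. frag_of (n', b', b)))))"

definition right_coring ::
  "(complex, 'r, 'e) module_scheme \<Rightarrow> ('r, 'b, 'f) bialgebroid_scheme \<Rightarrow> bool" where
  "right_coring R B \<longleftrightarrow>
     comult B \<in> hom (add_monoid B) (right_square R B) \<and>
     (\<forall>D \<in> Pi (carrier B) (comult B). \<forall>b\<in>carrier B. \<forall>r\<in>carrier R. \<forall>r'\<in>carrier R.
        comult B ((b \<otimes>\<^bsub>B\<^esub> source B r') \<otimes>\<^bsub>B\<^esub> target B r) =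
        tclass (right_square R B)
          (sweedler (D b) (\<lambda>b1 b2. frag_of (b1 \<otimes>\<^bsub>B\<^esub> target B r, b2 \<otimes>\<^bsub>B\<^esub> source B r')))) \<and>
     right_coassociative R B (add_monoid B) (\<lambda>b r. b \<otimes>\<^bsub>B\<^esub> source B r) (comult B) \<and>
     counit B \<in> hom (add_monoid B) (add_monoid R) \<and>
     (\<forall>b\<in>carrier B. \<forall>r\<in>carrier R. \<forall>r'\<in>carrier R.
        counit B ((b \<otimes>\<^bsub>B\<^esub> source B r') \<otimes>\<^bsub>B\<^esub> target B r) =
        r \<otimes>\<^bsub>R\<^esub> (counit B b \<otimes>\<^bsub>R\<^esub> r')) \<and>
     (\<forall>D \<in> Pi (carrier B) (comult B). \<forall>b\<in>carrier B.
        value_sum (add_monoid B) (\<lambda>b1 b2. b2 \<otimes>\<^bsub>B\<^esub> target B (counit B b1)) (D b) = b \<and>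
        value_sum (add_monoid B) (\<lambda>b1 b2. b1 \<otimes>\<^bsub>B\<^esub> source B (counit B b2)) (D b) = b)"

definition right_bialgebroid ::
  "(complex, 'r, 'e) module_scheme \<Rightarrow> ('r, 'b, 'f) bialgebroid_scheme \<Rightarrow> bool" where
  "right_bialgebroid R B \<longleftrightarrow>
     complex_algebra R \<and> complex_algebra B \<and>
     source B \<in> algebra_hom R B \<and> target B \<in> algebra_hom (opposite R) B \<and>
     (\<forall>r\<in>carrier R. \<forall>r'\<in>carrier R.
        source B r \<otimes>\<^bsub>B\<^esub> target B r' = target B r' \<otimes>\<^bsub>B\<^esub> source B r) \<and>
     right_coring R B \<and>
     (\<forall>D \<in> Pi (carrier B) (comult B). \<forall>b\<in>carrier B. \<forall>r\<in>carrier R.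
        tclass (right_square R B)
          (sweedler (D b) (\<lambda>b1 b2. frag_of (b1, target B r \<otimes>\<^bsub>B\<^esub> b2))) =
        tclass (right_square R B)
          (sweedler (D b) (\<lambda>b1 b2. frag_of (source B r \<otimes>\<^bsub>B\<^esub> b1, b2)))) \<and>
     comult B \<one>\<^bsub>B\<^esub> = tclass (right_square R B) (frag_of (\<one>\<^bsub>B\<^esub>, \<one>\<^bsub>B\<^esub>)) \<and>
     (\<forall>D \<in> Pi (carrier B) (comult B). \<forall>b\<in>carrier B. \<forall>b'\<in>carrier B.
        comult B (b \<otimes>\<^bsub>B\<^esub> b') =
        tclass (right_square R B)
          (sweedler (D b) (\<lambda>b1 b2. sweedler (D b') (\<lambda>b1' b2'.
             frag_of (b1 \<otimes>\<^bsub>B\<^esub> b1', b2 \<otimes>\<^bsub>B\<^esub> b2'))))) \<and>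
     counit B \<one>\<^bsub>B\<^esub> = \<one>\<^bsub>R\<^esub> \<and>
     (\<forall>b\<in>carrier B. \<forall>b'\<in>carrier B.
        counit B (b \<otimes>\<^bsub>B\<^esub> b') = counit B (source B (counit B b) \<otimes>\<^bsub>B\<^esub> b'))"

text \<open>The domain \<open>B \<otimes> B\<close> over the opposite of \<open>R\<close>, with \<open>b t(r) \<otimes> b' = b \<otimes> t(r) b'\<close>.\<close>

definition right_op_square ::
  "(complex, 'r, 'e) module_scheme \<Rightarrow> ('r, 'b, 'f) bialgebroid_scheme \<Rightarrow>
   ('b \<times> 'b) tensor monoid" where
  "right_op_square R B =
     tensor (carrier R) (add_monoid B) (\<lambda>b r. b \<otimes>\<^bsub>B\<^esub> target B r)
       (add_monoid B) (\<lambda>r b. target B r \<otimes>\<^bsub>B\<^esub> b)"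

definition right_nu ::
  "(complex, 'r, 'e) module_scheme \<Rightarrow> ('r, 'b, 'f) bialgebroid_scheme \<Rightarrow>
   ('b \<times> 'b) tensor \<Rightarrow> ('b \<times> 'b) tensor" where
  "right_nu R B U =
     the_elem {tclass (right_square R B)
                 (sweedler z (\<lambda>b b'. sweedler (D b') (\<lambda>b1' b2'. frag_of (b \<otimes>\<^bsub>B\<^esub> b1', b2')))) | z D.
               z \<in> U \<and> D \<in> Pi (carrier B) (comult B)}"

definition right_hopf_algebroid ::
  "(complex, 'r, 'e) module_scheme \<Rightarrow> ('r, 'b, 'f) bialgebroid_scheme \<Rightarrow> bool" where
  "right_hopf_algebroid R B \<longleftrightarrow>
     right_bialgebroid R B \<and>
     bij_betw (right_nu R B) (carrier (right_op_square R B)) (carrier (right_square R B))"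

text \<open>The tensor \<open>b\<^sup>- \<otimes> b\<^sup>+\<close>: the first components are \<open>b\<^sup>-\<close>, the second ones \<open>b\<^sup>+\<close>.\<close>

definition right_translation ::
  "(complex, 'r, 'e) module_scheme \<Rightarrow> ('r, 'b, 'f) bialgebroid_scheme \<Rightarrow>
   'b \<Rightarrow> ('b \<times> 'b) tensor" where
  "right_translation R B b =
     inv_into (carrier (right_op_square R B)) (right_nu R B)
       (tclass (right_square R B) (frag_of (\<one>\<^bsub>B\<^esub>, b)))"

section \<open>Comodules\<close>

definition left_comodule ::
  "(complex, 's, 'e) module_scheme \<Rightarrow> ('s, 'k, 'f) bialgebroid_scheme \<Rightarrow>
   ('m, 'g) monoid_scheme \<Rightarrow> ('s \<Rightarrow> 'm \<Rightarrow> 'm) \<Rightarrow> ('m \<Rightarrow> ('k \<times> 'm) tensor) \<Rightarrow> bool" where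
  "left_comodule S K M la \<rho> \<longleftrightarrow>
     left_module S M la \<and>
     \<rho> \<in> hom M (left_tensor S K M la) \<and>
     (\<forall>C \<in> Pi (carrier M) \<rho>. \<forall>r\<in>carrier S. \<forall>m\<in>carrier M.
        \<rho> (la r m) =
        tclass (left_tensor S K M la)
          (sweedler (C m) (\<lambda>k n. frag_of (source K r \<otimes>\<^bsub>K\<^esub> k, n)))) \<and>
     left_coassociative S K M la \<rho> \<and>
     (\<forall>m\<in>carrier M. \<forall>z\<in>\<rho> m. value_sum M (\<lambda>k n. la (counit K k) n) z = m)"

definition left_comodule_right_action ::
  "('s, 'k, 'f) bialgebroid_scheme \<Rightarrow> ('m, 'g) monoid_scheme \<Rightarrow> ('s \<Rightarrow> 'm \<Rightarrow> 'm) \<Rightarrow>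
   ('m \<Rightarrow> ('k \<times> 'm) tensor) \<Rightarrow> 'm \<Rightarrow> 's \<Rightarrow> 'm" where
  "left_comodule_right_action K M la \<rho> m r =
     the_elem {value_sum M (\<lambda>k n. la (counit K (k \<otimes>\<^bsub>K\<^esub> source K r)) n) z | z. z \<in> \<rho> m}"

definition right_comodule ::
  "(complex, 'r, 'e) module_scheme \<Rightarrow> ('r, 'b, 'f) bialgebroid_scheme \<Rightarrow>
   ('m, 'g) monoid_scheme \<Rightarrow> ('m \<Rightarrow> 'r \<Rightarrow> 'm) \<Rightarrow> ('m \<Rightarrow> ('m \<times> 'b) tensor) \<Rightarrow> bool" where
  "right_comodule R B M ra \<rho> \<longleftrightarrow>
     right_module R M ra \<and>
     \<rho> \<in> hom M (right_tensor R B M ra) \<and>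
     (\<forall>C \<in> Pi (carrier M) \<rho>. \<forall>r\<in>carrier R. \<forall>m\<in>carrier M.
        \<rho> (ra m r) =
        tclass (right_tensor R B M ra)
          (sweedler (C m) (\<lambda>n b. frag_of (n, b \<otimes>\<^bsub>B\<^esub> source B r)))) \<and>
     right_coassociative R B M ra \<rho> \<and>
     (\<forall>m\<in>carrier M. \<forall>z\<in>\<rho> m. value_sum M (\<lambda>n b. ra n (counit B b)) z = m)"

definition right_comodule_left_action ::
  "('r, 'b, 'f) bialgebroid_scheme \<Rightarrow> ('m, 'g) monoid_scheme \<Rightarrow> ('m \<Rightarrow> 'r \<Rightarrow> 'm) \<Rightarrow>
   ('m \<Rightarrow> ('m \<times> 'b) tensor) \<Rightarrow> 'r \<Rightarrow> 'm \<Rightarrow> 'm" where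
  "right_comodule_left_action B M ra \<rho> r m =
     the_elem {value_sum M (\<lambda>n b. ra n (counit B (source B r \<otimes>\<^bsub>B\<^esub> b))) z | z. z \<in> \<rho> m}"

section \<open>Stable anti Yetter-Drinfeld modules\<close>

record ('s, 'k, 'm) rl_module = "'m monoid" +
  base_act :: "'s \<Rightarrow> 'm \<Rightarrow> 'm"
  alg_act :: "'m \<Rightarrow> 'k \<Rightarrow> 'm"
  coact :: "'m \<Rightarrow> ('k \<times> 'm) tensor"

definition rl_sayd ::
  "(complex, 's, 'e) module_scheme \<Rightarrow> ('s, 'k, 'f) bialgebroid_scheme \<Rightarrow>
   ('s, 'k, 'm) rl_module \<Rightarrow> bool" where
  "rl_sayd S K M \<longleftrightarrow>
     right_module K M (alg_act M) \<and>
     left_comodule S K M (base_act M) (coact M) \<and>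
     (\<forall>m\<in>carrier M. \<forall>r\<in>carrier S.
        left_comodule_right_action K M (base_act M) (coact M) m r = alg_act M m (source K r) \<and>
        base_act M r m = alg_act M m (target K r)) \<and>
     (\<forall>D \<in> Pi (carrier K) (comult K). \<forall>W \<in> Pi (carrier K) (left_translation S K).
      \<forall>C \<in> Pi (carrier M) (coact M). \<forall>m\<in>carrier M. \<forall>k\<in>carrier K.
        coact M (alg_act M m k) =
        tclass (left_tensor S K M (base_act M))
          (sweedler (D k) (\<lambda>k1 k2. sweedler (W k2) (\<lambda>k2_minus k2_plus. sweedler (C m) (\<lambda>h n.
             frag_of ((k2_plus \<otimes>\<^bsub>K\<^esub> h) \<otimes>\<^bsub>K\<^esub> k1, alg_act M n k2_minus)))))) \<and>
     (\<forall>m\<in>carrier M. \<forall>z\<in>coact M m. value_sum M (\<lambda>h n. alg_act M n h) z = m)"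

record ('r, 'b, 'm) lr_module = "'m monoid" +
  base_ract :: "'m \<Rightarrow> 'r \<Rightarrow> 'm"
  alg_lact :: "'b \<Rightarrow> 'm \<Rightarrow> 'm"
  rcoact :: "'m \<Rightarrow> ('m \<times> 'b) tensor"

definition lr_sayd ::
  "(complex, 'r, 'e) module_scheme \<Rightarrow> ('r, 'b, 'f) bialgebroid_scheme \<Rightarrow>
   ('r, 'b, 'm) lr_module \<Rightarrow> bool" where
  "lr_sayd R B M \<longleftrightarrow>
     left_module B M (alg_lact M) \<and>
     right_comodule R B M (base_ract M) (rcoact M) \<and>
     (\<forall>m\<in>carrier M. \<forall>r\<in>carrier R.
        base_ract M m r = alg_lact M (target B r) m \<and>
        right_comodule_left_action B M (base_ract M) (rcoact M) r m = alg_lact M (source B r) m) \<and>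
     (\<forall>D \<in> Pi (carrier B) (comult B). \<forall>W \<in> Pi (carrier B) (right_translation R B).
      \<forall>C \<in> Pi (carrier M) (rcoact M). \<forall>m\<in>carrier M. \<forall>b\<in>carrier B.
        rcoact M (alg_lact M b m) =
        tclass (right_tensor R B M (base_ract M))
          (sweedler (D b) (\<lambda>b1 b2. sweedler (W b1) (\<lambda>b1_minus b1_plus. sweedler (C m) (\<lambda>n h.
             frag_of (alg_lact M b1_plus n, (b2 \<otimes>\<^bsub>B\<^esub> h) \<otimes>\<^bsub>B\<^esub> b1_minus)))))) \<and>
     (\<forall>m\<in>carrier M. \<forall>z\<in>rcoact M m. value_sum M (\<lambda>n h. alg_lact M h n) z = m)"

section \<open>Categories and functors\<close>

text \<open>
  Composition takes the three objects involved as arguments because the morphisms of interest are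
  bare functions, restricted to the carrier of their domain.
\<close>

record ('o, 'f) category =
  Ob :: "'o set"
  Hom :: "'o \<Rightarrow> 'o \<Rightarrow> 'f set"
  Ident :: "'o \<Rightarrow> 'f"
  Comp :: "'o \<Rightarrow> 'o \<Rightarrow> 'o \<Rightarrow> 'f \<Rightarrow> 'f \<Rightarrow> 'f"

definition is_category :: "('o, 'f) category \<Rightarrow> bool" where
  "is_category \<C> \<longleftrightarrow>
     (\<forall>U\<in>Ob \<C>. Ident \<C> U \<in> Hom \<C> U U) \<and>
     (\<forall>U\<in>Ob \<C>. \<forall>V\<in>Ob \<C>. \<forall>W\<in>Ob \<C>. \<forall>f\<in>Hom \<C> U V. \<forall>g\<in>Hom \<C> V W.
        Comp \<C> U V W g f \<in> Hom \<C> U W) \<and>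
     (\<forall>U\<in>Ob \<C>. \<forall>V\<in>Ob \<C>. \<forall>f\<in>Hom \<C> U V.
        Comp \<C> U U V f (Ident \<C> U) = f \<and> Comp \<C> U V V (Ident \<C> V) f = f) \<and>
     (\<forall>U0\<in>Ob \<C>. \<forall>U\<in>Ob \<C>. \<forall>V\<in>Ob \<C>. \<forall>W\<in>Ob \<C>.
      \<forall>f\<in>Hom \<C> U0 U. \<forall>g\<in>Hom \<C> U V. \<forall>h\<in>Hom \<C> V W.
        Comp \<C> U0 U W (Comp \<C> U V W h g) f = Comp \<C> U0 V W h (Comp \<C> U0 U V g f))"

definition covariant_functor ::
  "('o, 'f) category \<Rightarrow> ('p, 'g) category \<Rightarrow> ('o \<Rightarrow> 'p) \<Rightarrow> ('o \<Rightarrow> 'o \<Rightarrow> 'f \<Rightarrow> 'g) \<Rightarrow> bool" where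
  "covariant_functor \<C> \<D> F\<^sub>o F\<^sub>m \<longleftrightarrow>
     is_category \<C> \<and> is_category \<D> \<and>
     (\<forall>U\<in>Ob \<C>. F\<^sub>o U \<in> Ob \<D>) \<and>
     (\<forall>U\<in>Ob \<C>. \<forall>V\<in>Ob \<C>. \<forall>f\<in>Hom \<C> U V. F\<^sub>m U V f \<in> Hom \<D> (F\<^sub>o U) (F\<^sub>o V)) \<and>
     (\<forall>U\<in>Ob \<C>. F\<^sub>m U U (Ident \<C> U) = Ident \<D> (F\<^sub>o U)) \<and>
     (\<forall>U\<in>Ob \<C>. \<forall>V\<in>Ob \<C>. \<forall>W\<in>Ob \<C>. \<forall>f\<in>Hom \<C> U V. \<forall>g\<in>Hom \<C> V W.
        F\<^sub>m U W (Comp \<C> U V W g f) =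
        Comp \<D> (F\<^sub>o U) (F\<^sub>o V) (F\<^sub>o W) (F\<^sub>m V W g) (F\<^sub>m U V f))"

definition rl_sayd_hom ::
  "(complex, 's, 'e) module_scheme \<Rightarrow> ('s, 'k, 'f) bialgebroid_scheme \<Rightarrow>
   ('s, 'k, 'm) rl_module \<Rightarrow> ('s, 'k, 'm) rl_module \<Rightarrow> ('m \<Rightarrow> 'm) set" where
  "rl_sayd_hom S K M N =
     {\<phi> \<in> hom M N \<inter> extensional (carrier M).
        (\<forall>m\<in>carrier M. \<forall>k\<in>carrier K. \<phi> (alg_act M m k) = alg_act N (\<phi> m) k) \<and>
        (\<forall>r\<in>carrier S. \<forall>m\<in>carrier M. \<phi> (base_act M r m) = base_act N r (\<phi> m)) \<and>
        (\<forall>m\<in>carrier M. \<forall>z\<in>coact M m.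
           coact N (\<phi> m) =
           tclass (left_tensor S K N (base_act N)) (sweedler z (\<lambda>k n. frag_of (k, \<phi> n))))}"

definition lr_sayd_hom ::
  "(complex, 'r, 'e) module_scheme \<Rightarrow> ('r, 'b, 'f) bialgebroid_scheme \<Rightarrow>
   ('r, 'b, 'm) lr_module \<Rightarrow> ('r, 'b, 'm) lr_module \<Rightarrow> ('m \<Rightarrow> 'm) set" where
  "lr_sayd_hom R B M N =
     {\<phi> \<in> hom M N \<inter> extensional (carrier M).
        (\<forall>b\<in>carrier B. \<forall>m\<in>carrier M. \<phi> (alg_lact M b m) = alg_lact N b (\<phi> m)) \<and>
        (\<forall>m\<in>carrier M. \<forall>r\<in>carrier R. \<phi> (base_ract M m r) = base_ract N (\<phi> m) r) \<and>
        (\<forall>m\<in>carrier M. \<forall>z\<in>rcoact M m.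
           rcoact N (\<phi> m) =
           tclass (right_tensor R B N (base_ract N)) (sweedler z (\<lambda>n b. frag_of (\<phi> n, b))))}"

definition rl_sayd_category ::
  "(complex, 's, 'e) module_scheme \<Rightarrow> ('s, 'k, 'f) bialgebroid_scheme \<Rightarrow>
   (('s, 'k, 'm) rl_module, 'm \<Rightarrow> 'm) category" where
  "rl_sayd_category S K =
     \<lparr>Ob = {M. rl_sayd S K M},
      Hom = rl_sayd_hom S K,
      Ident = (\<lambda>M. restrict (\<lambda>m. m) (carrier M)),
      Comp = (\<lambda>L M N \<psi> \<phi>. compose (carrier L) \<psi> \<phi>)\<rparr>"

definition lr_sayd_category ::
  "(complex, 'r, 'e) module_scheme \<Rightarrow> ('r, 'b, 'f) bialgebroid_scheme \<Rightarrow>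
   (('r, 'b, 'm) lr_module, 'm \<Rightarrow> 'm) category" where
  "lr_sayd_category R B =
     \<lparr>Ob = {M. lr_sayd R B M},
      Hom = lr_sayd_hom R B,
      Ident = (\<lambda>M. restrict (\<lambda>m. m) (carrier M)),
      Comp = (\<lambda>L M N \<psi> \<phi>. compose (carrier L) \<psi> \<phi>)\<rparr>"

section \<open>Module algebras, comodule algebras and equivariant Galois extensions\<close>

text \<open>
  In the next two definitions the clause involving \<open>c\<close> says that the action is linear over the
  complex numbers for the vector space structure that is part of the algebra \<open>T\<close>.
\<close>

definition left_module_algebra ::
  "(complex, 's, 'e) module_scheme \<Rightarrow> ('s, 'k, 'f) bialgebroid_scheme \<Rightarrow>
   (complex, 't, 'g) module_scheme \<Rightarrow> ('k \<Rightarrow> 't \<Rightarrow> 't) \<Rightarrow> bool" where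
  "left_module_algebra S K T act \<longleftrightarrow>
     complex_algebra T \<and> left_module K (add_monoid T) act \<and>
     (\<forall>c. \<forall>t\<in>carrier T. act (c \<odot>\<^bsub>K\<^esub> \<one>\<^bsub>K\<^esub>) t = c \<odot>\<^bsub>T\<^esub> t) \<and>
     (\<forall>k\<in>carrier K. act k \<one>\<^bsub>T\<^esub> = act (source K (counit K k)) \<one>\<^bsub>T\<^esub>) \<and>
     (\<forall>k\<in>carrier K. \<forall>z\<in>comult K k. \<forall>t\<in>carrier T. \<forall>t'\<in>carrier T.
        act k (t \<otimes>\<^bsub>T\<^esub> t') =
        value_sum (add_monoid T) (\<lambda>k1 k2. act k1 t \<otimes>\<^bsub>T\<^esub> act k2 t') z) \<and>
     (\<forall>r\<in>carrier S. \<forall>t\<in>carrier T. \<forall>t'\<in>carrier T.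
        act (target K r) t \<otimes>\<^bsub>T\<^esub> t' = t \<otimes>\<^bsub>T\<^esub> act (source K r) t')"

record ('r, 'b, 't) comodule_algebra = "(complex, 't) module" +
  right_act :: "'t \<Rightarrow> 'r \<Rightarrow> 't"
  coaction :: "'t \<Rightarrow> ('t \<times> 'b) tensor"

definition right_comodule_algebra ::
  "(complex, 'r, 'e) module_scheme \<Rightarrow> ('r, 'b, 'f) bialgebroid_scheme \<Rightarrow>
   ('r, 'b, 't) comodule_algebra \<Rightarrow> bool" where
  "right_comodule_algebra R B T \<longleftrightarrow>
     complex_algebra T \<and>
     right_comodule R B (add_monoid T) (right_act T) (coaction T) \<and>
     (\<forall>c. \<forall>t\<in>carrier T. right_act T t (c \<odot>\<^bsub>R\<^esub> \<one>\<^bsub>R\<^esub>) = c \<odot>\<^bsub>T\<^esub> t) \<and>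
     (\<forall>r\<in>carrier R. \<forall>t\<in>carrier T. \<forall>t'\<in>carrier T.
        right_act T t r \<otimes>\<^bsub>T\<^esub> t' =
        t \<otimes>\<^bsub>T\<^esub> right_comodule_left_action B (add_monoid T) (right_act T) (coaction T) r t') \<and>
     coaction T \<one>\<^bsub>T\<^esub> =
       tclass (right_tensor R B (add_monoid T) (right_act T)) (frag_of (\<one>\<^bsub>T\<^esub>, \<one>\<^bsub>B\<^esub>)) \<and>
     (\<forall>t\<in>carrier T. \<forall>t'\<in>carrier T. \<forall>z\<in>coaction T t. \<forall>z'\<in>coaction T t'.
        coaction T (t \<otimes>\<^bsub>T\<^esub> t') =
        tclass (right_tensor R B (add_monoid T) (right_act T))
          (sweedler z (\<lambda>t0 t1. sweedler z' (\<lambda>t0' t1'.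
             frag_of (t0 \<otimes>\<^bsub>T\<^esub> t0', t1 \<otimes>\<^bsub>B\<^esub> t1')))))"

definition coinvariants ::
  "(complex, 'r, 'e) module_scheme \<Rightarrow> ('r, 'b, 'f) bialgebroid_scheme \<Rightarrow>
   ('r, 'b, 't) comodule_algebra \<Rightarrow> (complex, 't) module" where
  "coinvariants R B T =
     \<lparr>carrier = {s \<in> carrier T. coaction T s =
                   tclass (right_tensor R B (add_monoid T) (right_act T)) (frag_of (s, \<one>\<^bsub>B\<^esub>))},
      monoid.mult = monoid.mult T, one = \<one>\<^bsub>T\<^esub>, ring.zero = \<zero>\<^bsub>T\<^esub>, add = add T, module.smult = module.smult T\<rparr>"

definition galois_domain ::
  "(complex, 't, 'e) module_scheme \<Rightarrow> ('r, 'b, 't) comodule_algebra \<Rightarrow>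
   ('t \<times> 't) tensor monoid" where
  "galois_domain S T =
     tensor (carrier S) (add_monoid T) (\<lambda>t s. t \<otimes>\<^bsub>T\<^esub> s) (add_monoid T) (\<lambda>s t. s \<otimes>\<^bsub>T\<^esub> t)"

definition canonical_map ::
  "(complex, 'r, 'e) module_scheme \<Rightarrow> ('r, 'b, 'f) bialgebroid_scheme \<Rightarrow>
   ('r, 'b, 't) comodule_algebra \<Rightarrow> ('t \<times> 't) tensor \<Rightarrow> ('t \<times> 'b) tensor" where
  "canonical_map R B T U =
     the_elem {tclass (right_tensor R B (add_monoid T) (right_act T))
                 (sweedler z (\<lambda>t' t. sweedler (C t) (\<lambda>t0 t1. frag_of (t' \<otimes>\<^bsub>T\<^esub> t0, t1)))) | z C.
               z \<in> U \<and> C \<in> Pi (carrier T) (coaction T)}"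

text \<open>\<open>K\<close> is a bialgebroid over \<open>coinvariants R B T\<close>, so its base lives on the type of \<open>T\<close>.\<close>

definition equivariant_galois_extension ::
  "(complex, 'r, 'e) module_scheme \<Rightarrow> ('r, 'b, 'f) bialgebroid_scheme \<Rightarrow>
   ('r, 'b, 't) comodule_algebra \<Rightarrow> ('t, 'k, 'g) bialgebroid_scheme \<Rightarrow>
   ('k \<Rightarrow> 't \<Rightarrow> 't) \<Rightarrow> bool" where
  "equivariant_galois_extension R B T K act \<longleftrightarrow>
     (let S = coinvariants R B T in
       (\<forall>s\<in>carrier S. \<forall>t\<in>carrier T.
          act (source K s) t = s \<otimes>\<^bsub>T\<^esub> t \<and> act (target K s) t = t \<otimes>\<^bsub>T\<^esub> s) \<and>
       bij_betw (canonical_map R B T) (carrier (galois_domain S T))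
         (carrier (right_tensor R B (add_monoid T) (right_act T))) \<and>
       (\<forall>k\<in>carrier K. \<forall>t\<in>carrier T. \<forall>r\<in>carrier R.
          act k (right_act T t r) = right_act T (act k t) r) \<and>
       (\<forall>k\<in>carrier K. \<forall>t\<in>carrier T. \<forall>z\<in>coaction T t.
          coaction T (act k t) =
          tclass (right_tensor R B (add_monoid T) (right_act T))
            (sweedler z (\<lambda>t0 t1. frag_of (act k t0, t1)))))"

text \<open>
  The tensor \<open>can\<^sup>-\<^sup>1(1 \<otimes> b)\<close> in \<open>T \<otimes>\<^sub>S T\<close>: the first components are \<open>b\<^sub>-\<close>, the second ones \<open>b\<^sub>+\<close>.
\<close>

definition galois_translation ::
  "(complex, 'r, 'e) module_scheme \<Rightarrow> ('r, 'b, 'f) bialgebroid_scheme \<Rightarrow>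
   ('r, 'b, 't) comodule_algebra \<Rightarrow> 'b \<Rightarrow> ('t \<times> 't) tensor" where
  "galois_translation R B T b =
     inv_into (carrier (galois_domain (coinvariants R B T) T)) (canonical_map R B T)
       (tclass (right_tensor R B (add_monoid T) (right_act T)) (frag_of (\<one>\<^bsub>T\<^esub>, b)))"

section \<open>The functor\<close>

definition digamma_group ::
  "('s, 'k, 'f) bialgebroid_scheme \<Rightarrow> ('r, 'b, 't) comodule_algebra \<Rightarrow> ('k \<Rightarrow> 't \<Rightarrow> 't) \<Rightarrow>
   ('s, 'k, 'm) rl_module \<Rightarrow> ('m \<times> 't) tensor monoid" where
  "digamma_group K T act M = tensor (carrier K) M (alg_act M) (add_monoid T) act"

definition digamma_ract ::
  "('s, 'k, 'f) bialgebroid_scheme \<Rightarrow> ('r, 'b, 't) comodule_algebra \<Rightarrow> ('k \<Rightarrow> 't \<Rightarrow> 't) \<Rightarrow>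
   ('s, 'k, 'm) rl_module \<Rightarrow> ('m \<times> 't) tensor \<Rightarrow> 'r \<Rightarrow> ('m \<times> 't) tensor" where
  "digamma_ract K T act M U r =
     the_elem {tclass (digamma_group K T act M)
                 (sweedler z (\<lambda>m t. frag_of (m, right_act T t r))) | z. z \<in> U}"

definition digamma_lact ::
  "(complex, 'r, 'e) module_scheme \<Rightarrow> ('r, 'b, 'f) bialgebroid_scheme \<Rightarrow>
   ('s, 'k, 'g) bialgebroid_scheme \<Rightarrow> ('r, 'b, 't) comodule_algebra \<Rightarrow> ('k \<Rightarrow> 't \<Rightarrow> 't) \<Rightarrow>
   ('s, 'k, 'm) rl_module \<Rightarrow> 'b \<Rightarrow> ('m \<times> 't) tensor \<Rightarrow> ('m \<times> 't) tensor" where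
  "digamma_lact R B K T act M b U =
     the_elem {tclass (digamma_group K T act M)
                 (sweedler z (\<lambda>m t. sweedler (C m) (\<lambda>h n. sweedler w (\<lambda>b_minus b_plus.
                    frag_of (n, b_plus \<otimes>\<^bsub>T\<^esub> act h (t \<otimes>\<^bsub>T\<^esub> b_minus)))))) | z C w.
               z \<in> U \<and> C \<in> Pi (carrier M) (coact M) \<and> w \<in> galois_translation R B T b}"

definition digamma_coact ::
  "(complex, 'r, 'e) module_scheme \<Rightarrow> ('r, 'b, 'f) bialgebroid_scheme \<Rightarrow>
   ('s, 'k, 'g) bialgebroid_scheme \<Rightarrow> ('r, 'b, 't) comodule_algebra \<Rightarrow> ('k \<Rightarrow> 't \<Rightarrow> 't) \<Rightarrow>
   ('s, 'k, 'm) rl_module \<Rightarrow> ('m \<times> 't) tensor \<Rightarrow> (('m \<times> 't) tensor \<times> 'b) tensor" where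
  "digamma_coact R B K T act M U =
     (let Q = digamma_group K T act M
      in the_elem {tclass (right_tensor R B Q (digamma_ract K T act M))
                     (sweedler z (\<lambda>m t. sweedler (C t) (\<lambda>t0 t1.
                        frag_of (tclass Q (frag_of (m, t0)), t1)))) | z C.
                   z \<in> U \<and> C \<in> Pi (carrier T) (coaction T)})"

definition digamma_obj ::
  "(complex, 'r, 'e) module_scheme \<Rightarrow> ('r, 'b, 'f) bialgebroid_scheme \<Rightarrow>
   ('s, 'k, 'g) bialgebroid_scheme \<Rightarrow> ('r, 'b, 't) comodule_algebra \<Rightarrow> ('k \<Rightarrow> 't \<Rightarrow> 't) \<Rightarrow>
   ('s, 'k, 'm) rl_module \<Rightarrow> ('r, 'b, ('m \<times> 't) tensor) lr_module" where
  "digamma_obj R B K T act M =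
     (let Q = digamma_group K T act M
      in \<lparr>carrier = carrier Q, monoid.mult = monoid.mult Q, one = \<one>\<^bsub>Q\<^esub>,
          base_ract = digamma_ract K T act M,
          alg_lact = digamma_lact R B K T act M,
          rcoact = digamma_coact R B K T act M\<rparr>)"

definition digamma_mor ::
  "('s, 'k, 'g) bialgebroid_scheme \<Rightarrow> ('r, 'b, 't) comodule_algebra \<Rightarrow> ('k \<Rightarrow> 't \<Rightarrow> 't) \<Rightarrow>
   ('s, 'k, 'm) rl_module \<Rightarrow> ('s, 'k, 'm) rl_module \<Rightarrow> ('m \<Rightarrow> 'm) \<Rightarrow>
   ('m \<times> 't) tensor \<Rightarrow> ('m \<times> 't) tensor" where
  "digamma_mor K T act M N \<phi> =
     restrict
       (\<lambda>U. the_elem {tclass (digamma_group K T act N)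
                        (sweedler z (\<lambda>m t. frag_of (\<phi> m, t))) | z. z \<in> U})
       (carrier (digamma_group K T act M))"

end

theory Submission
  imports Defs
begin

text \<open>
  A map out of a tensor product is determined by its values on pure tensors, so identities in a
  tensor product are tested against balanced functionals \<open>f\<close>, whose values are formal sums
  modulo relations. Bijectivity of \<open>can\<close> gives \<open>can\<^sup>-\<^sup>1(t \<otimes> b) = t b\<^sub>- \<otimes> b\<^sub>+\<close>, and equivariance makes
  \<open>can\<^sup>-\<^sup>1\<close> intertwine the diagonal action of \<open>K\<close> on \<open>T \<otimes>\<^sub>S T\<close> with its action on \<open>T\<close>.
  Together with the anti Yetter-Drinfeld condition of \<open>M\<close> this makes the action of \<open>B\<close> on
  \<open>M \<otimes>\<^sub>K T\<close> well defined; associativity combines \<open>can\<^sup>-\<^sup>1(t \<otimes> b b')\<close> with stability of \<open>M\<close>. The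
  anti Yetter-Drinfeld condition of \<open>M \<otimes>\<^sub>K T\<close> comes from the formulas for the coaction of \<open>B\<close> on the
  two legs of \<open>t b\<^sub>- \<otimes> b\<^sub>+\<close>: on \<open>b\<^sub>+\<close> it comultiplies \<open>b\<close>, on \<open>b\<^sub>-\<close> it involves \<open>\<nu>\<^sup>-\<^sup>1\<close>.
\<close>

text \<open>The modulus \<open>H\<close> of a test functional is arbitrary, of any type. With the
  relations of a tensor product and the universal map, a congruence becomes equality of tensors;
  with \<open>group_rels G\<close> it becomes equality in an ordinary abelian group. A functional
  may be built from another functional, which is how iterated actions and a coaction after an action
  are handled.

  Inverting \<open>can\<close> at \<open>1 \<otimes> b\<close> alone is too little: as a function of
  \<open>b\<close> it cannot be put under a sum over \<open>T \<otimes>_R B\<close>. So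
  \<open>can^-1(t \<otimes> b)\<close> keeps a free first leg, and likewise
  \<open>\<nu>^-1(c \<otimes> b)\<close>. Neither inverse has a formula, so most of their laws share
  one proof: write the integrand as \<open>can^-1\<close> of \<open>can\<close>, apply a law of the
  coaction, and collapse \<open>can\<close> after \<open>can^-1\<close>.

  The action of \<open>B\<close> composes \<open>can^-1\<close> with \<open>x \<otimes> y \<mapsto>
  m_0 \<otimes> y (m_{-1} \<triangleright> x)\<close>, a map from \<open>T \<otimes>_S T\<close> to
  \<open>M \<otimes>_K T\<close>. Its balance over \<open>S\<close> is not formal: it uses that the
  canonical right \<open>S\<close>-action of the comodule \<open>M\<close> is the action of source
  elements.\<close>

inductive_set zspan :: "'c tensor \<Rightarrow> 'c tensor" for H :: "'c tensor" where
  zero: "0 \<in> zspan H"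
| base: "x \<in> H \<Longrightarrow> x \<in> zspan H"
| diff: "x \<in> zspan H \<Longrightarrow> y \<in> zspan H \<Longrightarrow> x - y \<in> zspan H"

text \<open>No ambient group occurs in the relation, so transitivity and addition carry no side
  conditions on supports; these come in only when classes of a concrete quotient are formed or sums
  are compared term by term.\<close>

definition cong_mod :: "('c \<Rightarrow>\<^sub>0 int) \<Rightarrow> 'c tensor \<Rightarrow> ('c \<Rightarrow>\<^sub>0 int) \<Rightarrow> bool"
    (\<open>(_/ \<approx>\<^bsub>_\<^esub> _)\<close> [51, 0, 51] 50) where
  "x \<approx>\<^bsub>E\<^esub> y \<longleftrightarrow> x - y \<in> zspan E"

lemma zspan_uminus: "x \<in> zspan E \<Longrightarrow> - x \<in> zspan E"
  using zspan.diff[OF zspan.zero, of x E] by simp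

lemma zspan_add: "x \<in> zspan E \<Longrightarrow> y \<in> zspan E \<Longrightarrow> x + y \<in> zspan E"
  using zspan.diff[OF _ zspan_uminus, of x E y] by simp

lemma cong_mod_refl [simp, intro]: "x \<approx>\<^bsub>E\<^esub> x"
  by (simp add: cong_mod_def zspan.zero)

lemma cong_mod_eq: "x = y \<Longrightarrow> x \<approx>\<^bsub>E\<^esub> y"
  by simp

lemma cong_mod_sym: "x \<approx>\<^bsub>E\<^esub> y \<Longrightarrow> y \<approx>\<^bsub>E\<^esub> x"
  unfolding cong_mod_def using zspan_uminus by fastforce

lemma cong_mod_trans [trans]: "x \<approx>\<^bsub>E\<^esub> y \<Longrightarrow> y \<approx>\<^bsub>E\<^esub> z \<Longrightarrow> x \<approx>\<^bsub>E\<^esub> z"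
  unfolding cong_mod_def using zspan_add by fastforce

lemma cong_mod_add: "x \<approx>\<^bsub>E\<^esub> y \<Longrightarrow> x' \<approx>\<^bsub>E\<^esub> y' \<Longrightarrow> x + x' \<approx>\<^bsub>E\<^esub> y + y'"
  unfolding cong_mod_def using zspan_add by (metis add_diff_add)

lemma cong_mod_diff: "x \<approx>\<^bsub>E\<^esub> y \<Longrightarrow> x' \<approx>\<^bsub>E\<^esub> y' \<Longrightarrow> x - x' \<approx>\<^bsub>E\<^esub> y - y'"
  unfolding cong_mod_def using zspan.diff[of "x - y" E "x' - y'"] by (simp add: algebra_simps)

lemma frag_extend_add_fun:
  "frag_extend (\<lambda>p. f p + g p) z = frag_extend f z + frag_extend g z"
  by (simp add: frag_extend_def frag_cmul_distrib2 sum.distrib)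

lemma frag_extend_frag_extend:
  "frag_extend f (frag_extend g z) = frag_extend (\<lambda>p. frag_extend f (g p)) z"
  using subset_refl[of "Poly_Mapping.keys z"]
  by (induction z rule: frag_induction) (simp_all add: frag_extend_diff)

text \<open>Fubini for formal sums. It is an equality for arbitrary integrands, so two Sweedler sums
  over unrelated tensors can later be interchanged without any balance condition.\<close>

lemma frag_extend_swap:
  "frag_extend (\<lambda>p. frag_extend (\<lambda>q. f p q) w) z = frag_extend (\<lambda>q. frag_extend (\<lambda>p. f p q) z) w"
  using subset_UNIV[of "Poly_Mapping.keys z"]
proof (induction z rule: frag_induction)
  case zero
  then show ?case by (simp add: frag_extend_eq_0)
next
  case (one x)
  then show ?case by simp
next
  case (diff a b)
  \<comment> \<open>The difference case needs the sum to be subtractive in its integrand. Adding the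
    sum for \<open>b\<close> back reduces this to \<open>frag_extend_add_fun\<close>.\<close>
  have "frag_extend (\<lambda>q. frag_extend (\<lambda>p. f p q) (a - b)) w + frag_extend (\<lambda>q. frag_extend (\<lambda>p. f p q) b) w
      = frag_extend (\<lambda>q. frag_extend (\<lambda>p. f p q) a) w"
    by (simp add: frag_extend_diff flip: frag_extend_add_fun)
  then show ?case using diff by (simp add: frag_extend_diff algebra_simps)
qed

lemma frag_extend_in_zspan:
  assumes "\<And>p. p \<in> Poly_Mapping.keys z \<Longrightarrow> f p \<in> zspan E"
  shows "frag_extend f z \<in> zspan E"
proof -
  have "Poly_Mapping.keys z \<subseteq> {p. f p \<in> zspan E}" using assms by auto
  then show ?thesis
    by (induction z rule: frag_induction) (auto simp: frag_extend_diff intro: zspan.intros)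
qed

lemma frag_extend_cong_mod:
  assumes "\<And>p. p \<in> Poly_Mapping.keys z \<Longrightarrow> f p \<approx>\<^bsub>E\<^esub> g p"
  shows "frag_extend f z \<approx>\<^bsub>E\<^esub> frag_extend g z"
proof -
  have "frag_extend (\<lambda>p. (f p - g p) + g p) z = frag_extend (\<lambda>p. f p - g p) z + frag_extend g z"
    by (rule frag_extend_add_fun)
  moreover have "frag_extend (\<lambda>p. f p - g p) z \<in> zspan E"
    using assms by (intro frag_extend_in_zspan) (auto simp: cong_mod_def)
  ultimately show ?thesis by (simp add: cong_mod_def)
qed

lemma sweedler_cong_mod:
  assumes "Poly_Mapping.keys z \<subseteq> A \<times> A'" "\<And>x y. x \<in> A \<Longrightarrow> y \<in> A' \<Longrightarrow> f x y \<approx>\<^bsub>E\<^esub> g x y"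
  shows "sweedler z f \<approx>\<^bsub>E\<^esub> sweedler z g"
  by (rule frag_extend_cong_mod) (use assms in auto)

text \<open>This makes the linear extension of \<open>f\<close> induce a homomorphism from the
  quotient by \<open>E\<close> to the quotient by \<open>H\<close>.\<close>

definition descends :: "'a tensor \<Rightarrow> 'c tensor \<Rightarrow> ('a \<Rightarrow> 'c \<Rightarrow>\<^sub>0 int) \<Rightarrow> bool" where
  "descends E H f \<longleftrightarrow> (\<forall>r\<in>E. frag_extend f r \<in> zspan H)"

lemma descends_cong_mod:
  assumes "descends E H f" "z \<approx>\<^bsub>E\<^esub> z'"
  shows "frag_extend f z \<approx>\<^bsub>H\<^esub> frag_extend f z'"
proof -
  have "frag_extend f w \<in> zspan H" if "w \<in> zspan E" for w
    using that by induction (use assms(1) in \<open>auto simp: descends_def frag_extend_diff intro: zspan.intros\<close>)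
  then show ?thesis using assms(2) by (simp add: cong_mod_def flip: frag_extend_diff)
qed

section \<open>Groups given by generators and relations\<close>

text \<open>The support condition puts every relation into the free group on \<open>A\<close>; then
  \<open>generate\<close>, which takes its inverses in that free group, agrees with
  \<open>zspan E\<close>.\<close>

definition presented :: "'a tensor monoid \<Rightarrow> 'a set \<Rightarrow> 'a tensor \<Rightarrow> bool" where
  "presented Q A E \<longleftrightarrow> Q = free_Abelian_group A Mod generate (free_Abelian_group A) E \<and>
     (\<forall>x\<in>E. Poly_Mapping.keys x \<subseteq> A)"

lemma generate_eq_zspan:
  assumes "\<forall>x\<in>E. Poly_Mapping.keys x \<subseteq> A"
  shows "generate (free_Abelian_group A) E = zspan E" (is "generate ?F E = _")
proof
  show "generate ?F E \<subseteq> zspan E"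
  proof
    fix x assume "x \<in> generate ?F E" then show "x \<in> zspan E"
      by induction (use assms in \<open>auto intro: zspan.intros zspan_uminus zspan_add\<close>)
  qed
  have gr: "group ?F" by simp
  have E: "E \<subseteq> carrier ?F" using assms by auto
  show "zspan E \<subseteq> generate ?F E"
  proof
    fix x assume "x \<in> zspan E" then show "x \<in> generate ?F E"
    proof induction
      case (diff x y)
      have "inv\<^bsub>?F\<^esub> y \<in> generate ?F E"
        using group.generate_m_inv_closed[OF gr E diff(4)] .
      moreover have "inv\<^bsub>?F\<^esub> y = - y"
        using subsetD[OF group.generate_incl[OF gr E] diff(4)] by (intro inv_free_Abelian_group) simp
      ultimately show ?case
        using generate.eng[OF diff(3), of "- y"] by simp
    qed (use generate.one[of ?F E] in \<open>auto intro: generate.incl\<close>)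
  qed
qed

lemma presented_one: "presented Q A E \<Longrightarrow> \<one>\<^bsub>Q\<^esub> = zspan E"
  by (auto simp: presented_def FactGroup_def generate_eq_zspan)

lemma zspan_keys:
  assumes "presented Q A E" "x \<in> zspan E" shows "Poly_Mapping.keys x \<subseteq> A"
  using assms(2)
proof induction
  case (diff x y) then show ?case by (meson Un_least keys_diff order_trans)
qed (use assms(1) in \<open>auto simp: presented_def\<close>)

lemma mem_tclass: "presented Q A E \<Longrightarrow> z' \<in> tclass Q z \<longleftrightarrow> z' \<approx>\<^bsub>E\<^esub> z"
  unfolding tclass_def cong_mod_def presented_one by (auto simp: presented_one) (metis diff_add_cancel)

lemma self_mem_tclass: "presented Q A E \<Longrightarrow> z \<in> tclass Q z"
  by (simp add: mem_tclass)

lemma tclass_eq_iff: "presented Q A E \<Longrightarrow> tclass Q z = tclass Q z' \<longleftrightarrow> z \<approx>\<^bsub>E\<^esub> z'"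
  by (auto simp: mem_tclass set_eq_iff intro: cong_mod_trans cong_mod_sym)

lemma tclass_eqI: "presented Q A E \<Longrightarrow> z \<approx>\<^bsub>E\<^esub> z' \<Longrightarrow> tclass Q z = tclass Q z'"
  by (simp add: tclass_eq_iff)

context
  fixes Q :: "'a tensor monoid" and A E
  assumes pres: "presented Q A E"
begin

private abbreviation "F \<equiv> free_Abelian_group A"

lemma presented_subgroup: "subgroup (zspan E) F"
proof -
  have "zspan E = generate F E" using pres generate_eq_zspan by (metis presented_def)
  moreover have "subgroup (generate F E) F"
    by (rule group.generate_is_subgroup) (use pres in \<open>auto simp: presented_def\<close>)
  ultimately show ?thesis by simp
qed

lemma presented_normal: "zspan E \<lhd> F"
  by (rule comm_group.subgroup_imp_normal) (simp_all add: abelian_free_Abelian_group presented_subgroup)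

lemma presented_eq: "Q = F Mod zspan E"
  using pres generate_eq_zspan by (metis presented_def)

lemma tclass_rcoset: "tclass Q z = zspan E #>\<^bsub>F\<^esub> z"
  by (auto simp: tclass_def presented_one[OF pres] r_coset_def)

lemma presented_carrier_iff: "U \<in> carrier Q \<longleftrightarrow> (\<exists>z. Poly_Mapping.keys z \<subseteq> A \<and> U = tclass Q z)"
proof -
  have "carrier Q = (\<Union>z\<in>carrier F. {zspan E #>\<^bsub>F\<^esub> z})"
    by (subst presented_eq) (simp add: FactGroup_def RCOSETS_def)
  then have "U \<in> carrier Q \<longleftrightarrow> (\<exists>z\<in>carrier F. U = zspan E #>\<^bsub>F\<^esub> z)" by simp
  then show ?thesis by (simp add: tclass_rcoset Bex_def)
qed

lemma tclass_closed: "Poly_Mapping.keys z \<subseteq> A \<Longrightarrow> tclass Q z \<in> carrier Q"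
  using presented_carrier_iff by auto

text \<open>Two members of a coset differ by a relation, and relations are supported on
  \<open>A\<close>. So every representative is supported on \<open>A\<close>, not only the one from
  which the class was formed.\<close>

lemma mem_carrier_keys: "U \<in> carrier Q \<Longrightarrow> z \<in> U \<Longrightarrow> Poly_Mapping.keys z \<subseteq> A"
proof -
  assume "U \<in> carrier Q" "z \<in> U"
  then obtain w where w: "Poly_Mapping.keys w \<subseteq> A" "z \<in> tclass Q w"
    using presented_carrier_iff by auto
  then have "z - w \<in> zspan E" using mem_tclass[OF pres] by (simp add: cong_mod_def)
  then have "Poly_Mapping.keys (z - w) \<subseteq> A" using zspan_keys[OF pres] by simp
  then have "Poly_Mapping.keys ((z - w) + w) \<subseteq> A"
    using keys_add[of "z - w" w] w(1) by blast
  then show ?thesis by simp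
qed

lemma mem_carrier_tclass: "U \<in> carrier Q \<Longrightarrow> z \<in> U \<Longrightarrow> U = tclass Q z"
  using presented_carrier_iff mem_tclass[OF pres] tclass_eq_iff[OF pres] by (metis cong_mod_sym)

lemma tclass_mult:
  assumes "Poly_Mapping.keys z \<subseteq> A" "Poly_Mapping.keys z' \<subseteq> A"
  shows "tclass Q z \<otimes>\<^bsub>Q\<^esub> tclass Q z' = tclass Q (z + z')"
proof -
  have "tclass Q z \<otimes>\<^bsub>Q\<^esub> tclass Q z' = (zspan E #>\<^bsub>F\<^esub> z) <#>\<^bsub>F\<^esub> (zspan E #>\<^bsub>F\<^esub> z')"
    by (subst presented_eq) (simp add: tclass_rcoset FactGroup_def)
  also have "\<dots> = zspan E #>\<^bsub>F\<^esub> (z \<otimes>\<^bsub>F\<^esub> z')"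
    by (rule normal.rcos_sum[OF presented_normal]) (use assms in auto)
  finally show ?thesis by (simp add: tclass_rcoset)
qed

lemma presented_comm_group: "comm_group Q"
proof (rule group.group_comm_groupI)
  show "group Q" using presented_eq normal.factorgroup_is_group[OF presented_normal] by simp
  fix U V assume "U \<in> carrier Q" "V \<in> carrier Q"
  then show "U \<otimes>\<^bsub>Q\<^esub> V = V \<otimes>\<^bsub>Q\<^esub> U"
    by (auto simp: presented_carrier_iff tclass_mult add.commute)
qed

end

section \<open>Sweedler sums over chosen representatives, and additive functionals\<close>

definition rep :: "'a tensor \<Rightarrow> 'a \<Rightarrow>\<^sub>0 int" where
  "rep U = (SOME z. z \<in> U)"

text \<open>Summing over one fixed representative gives a meaning for every \<open>f\<close>.
  Swapping and nesting are then plain equalities, and balance of \<open>f\<close> is invoked only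
  when the representative changes.\<close>

definition tsum :: "('a \<times> 'b) tensor \<Rightarrow> ('a \<Rightarrow> 'b \<Rightarrow> 'c \<Rightarrow>\<^sub>0 int) \<Rightarrow> 'c \<Rightarrow>\<^sub>0 int" where
  "tsum U f = sweedler (rep U) f"

lemma rep_mem: "presented Q A E \<Longrightarrow> U \<in> carrier Q \<Longrightarrow> rep U \<in> U"
  unfolding rep_def by (metis presented_carrier_iff self_mem_tclass someI)

lemma rep_keys: "presented Q A E \<Longrightarrow> U \<in> carrier Q \<Longrightarrow> Poly_Mapping.keys (rep U) \<subseteq> A"
  by (meson mem_carrier_keys rep_mem)

lemma tclass_rep: "presented Q A E \<Longrightarrow> U \<in> carrier Q \<Longrightarrow> tclass Q (rep U) = U"
  by (metis mem_carrier_tclass rep_mem)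

lemma rep_tclass: "presented Q A E \<Longrightarrow> rep (tclass Q z) \<approx>\<^bsub>E\<^esub> z"
  by (metis mem_tclass rep_def self_mem_tclass someI)

lemma mem_cong_rep: "presented Q A E \<Longrightarrow> U \<in> carrier Q \<Longrightarrow> z \<in> U \<Longrightarrow> z \<approx>\<^bsub>E\<^esub> rep U"
  by (metis mem_carrier_tclass mem_tclass rep_mem cong_mod_sym)

text \<open>A homomorphism from \<open>G\<close> to the quotient by \<open>H\<close>, presented by a
  lift \<open>u\<close> to formal sums that need not be additive itself.\<close>

definition additive_mod :: "('g, 'e) monoid_scheme \<Rightarrow> 'c tensor \<Rightarrow> ('g \<Rightarrow> 'c \<Rightarrow>\<^sub>0 int) \<Rightarrow> bool" where
  "additive_mod G H u \<longleftrightarrow> (\<forall>a\<in>carrier G. \<forall>b\<in>carrier G. u (a \<otimes>\<^bsub>G\<^esub> b) \<approx>\<^bsub>H\<^esub> u a + u b)"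

lemma additive_modI:
  "(\<And>a b. a \<in> carrier G \<Longrightarrow> b \<in> carrier G \<Longrightarrow> u (a \<otimes>\<^bsub>G\<^esub> b) \<approx>\<^bsub>H\<^esub> u a + u b) \<Longrightarrow> additive_mod G H u"
  by (simp add: additive_mod_def)

lemma additive_modD:
  "additive_mod G H u \<Longrightarrow> a \<in> carrier G \<Longrightarrow> b \<in> carrier G \<Longrightarrow> u (a \<otimes>\<^bsub>G\<^esub> b) \<approx>\<^bsub>H\<^esub> u a + u b"
  by (simp add: additive_mod_def)

lemma additive_mod_comp:
  "additive_mod G H u \<Longrightarrow> g \<in> hom G' G \<Longrightarrow> additive_mod G' H (\<lambda>a. u (g a))"
  unfolding additive_mod_def hom_def by auto

lemma additive_mod_cong:
  assumes "Group.monoid G" "additive_mod G H u" "\<And>a. a \<in> carrier G \<Longrightarrow> v a \<approx>\<^bsub>H\<^esub> u a"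
  shows "additive_mod G H v"
proof (rule additive_modI)
  fix a b assume "a \<in> carrier G" "b \<in> carrier G"
  then have "v (a \<otimes>\<^bsub>G\<^esub> b) \<approx>\<^bsub>H\<^esub> u (a \<otimes>\<^bsub>G\<^esub> b)" "u (a \<otimes>\<^bsub>G\<^esub> b) \<approx>\<^bsub>H\<^esub> u a + u b"
    "u a + u b \<approx>\<^bsub>H\<^esub> v a + v b"
    using assms by (auto intro: Group.monoid.m_closed additive_modD cong_mod_add cong_mod_sym)
  then show "v (a \<otimes>\<^bsub>G\<^esub> b) \<approx>\<^bsub>H\<^esub> v a + v b" by (metis cong_mod_trans)
qed

lemma additive_mod_frag_extend:
  assumes "\<And>p. p \<in> Poly_Mapping.keys z \<Longrightarrow> additive_mod G H (\<lambda>a. f a p)"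
  shows "additive_mod G H (\<lambda>a. frag_extend (f a) z)"
proof (rule additive_modI)
  fix a b assume "a \<in> carrier G" "b \<in> carrier G"
  then show "frag_extend (f (a \<otimes>\<^bsub>G\<^esub> b)) z \<approx>\<^bsub>H\<^esub> frag_extend (f a) z + frag_extend (f b) z"
    unfolding frag_extend_add_fun[symmetric]
    by (intro frag_extend_cong_mod) (auto intro: additive_modD[OF assms])
qed

lemma additive_mod_one:
  assumes "Group.group G" "additive_mod G H u" shows "u \<one>\<^bsub>G\<^esub> \<approx>\<^bsub>H\<^esub> 0"
proof -
  interpret Group.group G by fact
  have "u (\<one>\<^bsub>G\<^esub> \<otimes>\<^bsub>G\<^esub> \<one>\<^bsub>G\<^esub>) \<approx>\<^bsub>H\<^esub> u \<one>\<^bsub>G\<^esub> + u \<one>\<^bsub>G\<^esub>"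
    by (rule additive_modD[OF assms(2)]) auto
  then show ?thesis unfolding cong_mod_def using zspan_uminus by fastforce
qed

lemma additive_mod_inv:
  assumes "Group.group G" "additive_mod G H u" "a \<in> carrier G"
  shows "u (inv\<^bsub>G\<^esub> a) \<approx>\<^bsub>H\<^esub> - u a"
proof -
  interpret Group.group G by fact
  have "u (inv\<^bsub>G\<^esub> a \<otimes>\<^bsub>G\<^esub> a) \<approx>\<^bsub>H\<^esub> u (inv\<^bsub>G\<^esub> a) + u a"
    by (rule additive_modD[OF assms(2)]) (use assms in auto)
  then have "u (inv\<^bsub>G\<^esub> a) + u a \<approx>\<^bsub>H\<^esub> 0"
    using additive_mod_one[OF assms(1,2)] assms(3) by (metis l_inv cong_mod_sym cong_mod_trans)
  then show ?thesis by (simp add: cong_mod_def)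
qed

lemma additive_mod_nat_pow:
  assumes "Group.group G" "additive_mod G H u" "a \<in> carrier G"
  shows "u (a [^]\<^bsub>G\<^esub> (n::nat)) \<approx>\<^bsub>H\<^esub> frag_cmul (int n) (u a)"
proof (induction n)
  case 0
  then show ?case using additive_mod_one[OF assms(1,2)] by simp
next
  case (Suc n)
  interpret Group.group G by fact
  have "u (a [^]\<^bsub>G\<^esub> Suc n) \<approx>\<^bsub>H\<^esub> u (a [^]\<^bsub>G\<^esub> n) + u a"
    using additive_modD[OF assms(2)] assms(3) by simp
  also have "\<dots> \<approx>\<^bsub>H\<^esub> frag_cmul (int n) (u a) + u a"
    using Suc by (intro cong_mod_add) auto
  also have "\<dots> = frag_cmul (int (Suc n)) (u a)"
    using frag_cmul_distrib[of "int n" 1 "u a"] by (simp add: add.commute)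
  finally show ?case .
qed

lemma additive_mod_int_pow:
  assumes "Group.group G" "additive_mod G H u" "a \<in> carrier G"
  shows "u (a [^]\<^bsub>G\<^esub> (n::int)) \<approx>\<^bsub>H\<^esub> frag_cmul n (u a)"
proof (cases n)
  case (nonneg m)
  then show ?thesis using additive_mod_nat_pow[OF assms] by (simp add: int_pow_int)
next
  case (neg m)
  interpret Group.group G by fact
  have "u (inv\<^bsub>G\<^esub> (a [^]\<^bsub>G\<^esub> Suc m)) \<approx>\<^bsub>H\<^esub> - u (a [^]\<^bsub>G\<^esub> Suc m)"
    using assms by (intro additive_mod_inv) auto
  also have "\<dots> \<approx>\<^bsub>H\<^esub> - frag_cmul (int (Suc m)) (u a)"
    using cong_mod_diff[OF cong_mod_refl additive_mod_nat_pow[OF assms, of "Suc m"], of 0] by simp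
  finally have "u (inv\<^bsub>G\<^esub> (a [^]\<^bsub>G\<^esub> Suc m)) \<approx>\<^bsub>H\<^esub> frag_cmul n (u a)" using neg by simp
  moreover have "inv\<^bsub>G\<^esub> (a [^]\<^bsub>G\<^esub> Suc m) = a [^]\<^bsub>G\<^esub> n"
    unfolding neg int_pow_neg[OF assms(3)] int_pow_int ..
  ultimately show ?thesis by simp
qed

lemma additive_mod_finprod:
  assumes "comm_group G" "additive_mod G H u" "finite A" "\<And>p. p \<in> A \<Longrightarrow> f p \<in> carrier G"
  shows "u (finprod G f A) \<approx>\<^bsub>H\<^esub> (\<Sum>p\<in>A. u (f p))"
  using assms(3,4)
proof (induction A rule: finite_induct)
  case empty
  interpret comm_group G by fact
  show ?case using additive_mod_one[OF _ assms(2)] by simp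
next
  case (insert p A)
  interpret comm_group G by fact
  have "u (finprod G f (insert p A)) = u (f p \<otimes>\<^bsub>G\<^esub> finprod G f A)"
    using insert by (subst finprod_insert) auto
  also have "\<dots> \<approx>\<^bsub>H\<^esub> u (f p) + u (finprod G f A)"
    using insert by (intro additive_modD[OF assms(2)]) (auto intro!: finprod_closed)
  also have "\<dots> \<approx>\<^bsub>H\<^esub> u (f p) + (\<Sum>p\<in>A. u (f p))"
    using insert by (intro cong_mod_add) auto
  finally show ?case using insert by simp
qed

lemma sum_cong_mod:
  assumes "\<And>p. p \<in> A \<Longrightarrow> f p \<approx>\<^bsub>H\<^esub> g p"
  shows "(\<Sum>p\<in>A. f p) \<approx>\<^bsub>H\<^esub> (\<Sum>p\<in>A. g p)"
  using assms by (induction A rule: infinite_finite_induct) (auto intro: cong_mod_add)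

text \<open>Links the two encodings of a Sweedler expression, with values in a group and as a formal
  sum. The integer coefficients of \<open>z\<close> are powers in \<open>G\<close> on the left and
  scalar multiples on the right.\<close>

lemma additive_mod_value_sum:
  assumes G: "comm_group G" and u: "additive_mod G H u"
    and f: "\<And>x y. (x, y) \<in> Poly_Mapping.keys z \<Longrightarrow> f x y \<in> carrier G"
  shows "u (value_sum G f z) \<approx>\<^bsub>H\<^esub> sweedler z (\<lambda>x y. u (f x y))"
proof -
  interpret comm_group G by fact
  have "u (value_sum G f z) \<approx>\<^bsub>H\<^esub>
      (\<Sum>p\<in>Poly_Mapping.keys z. u (case p of (x, y) \<Rightarrow> f x y [^]\<^bsub>G\<^esub> Poly_Mapping.lookup z (x, y)))"
    unfolding value_sum_def using f by (intro additive_mod_finprod[OF G u]) auto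
  also have "\<dots> \<approx>\<^bsub>H\<^esub> (\<Sum>p\<in>Poly_Mapping.keys z. frag_cmul (Poly_Mapping.lookup z p) (u (case p of (x, y) \<Rightarrow> f x y)))"
    by (rule sum_cong_mod) (use f in \<open>auto intro!: additive_mod_int_pow[OF _ u]\<close>)
  also have "\<dots> = sweedler z (\<lambda>x y. u (f x y))"
    unfolding frag_extend_def by (intro sum.cong) auto
  finally show ?thesis .
qed

lemma value_sum_closed:
  assumes "comm_group G" "\<And>x y. (x, y) \<in> Poly_Mapping.keys z \<Longrightarrow> f x y \<in> carrier G"
  shows "value_sum G f z \<in> carrier G"
proof -
  interpret comm_group G by fact
  show ?thesis unfolding value_sum_def using assms by (intro finprod_closed) auto
qed

text \<open>For abelian \<open>G\<close> these relations collapse the free abelian group on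
  \<open>G\<close> to \<open>G\<close> itself, so \<open>frag_of\<close> becomes the universal
  additive functional on \<open>G\<close>.\<close>

definition group_rels :: "('g, 'e) monoid_scheme \<Rightarrow> 'g tensor" where
  "group_rels G = {frag_of (a \<otimes>\<^bsub>G\<^esub> b) - frag_of a - frag_of b | a b. a \<in> carrier G \<and> b \<in> carrier G}"

lemma additive_mod_frag_of: "additive_mod G (group_rels G) frag_of"
  by (rule additive_modI)
     (auto simp: cong_mod_def group_rels_def diff_diff_eq intro!: zspan.base)

text \<open>The homomorphism from the free group that sends each generator to the element it names
  kills the relations. This is how calculations with functionals return equations between elements
  of an ordinary group.\<close>

lemma group_rels_separate:
  assumes G: "comm_group G" and ab: "a \<in> carrier G" "b \<in> carrier G"
    and "frag_of a \<approx>\<^bsub>group_rels G\<^esub> frag_of b"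
  shows "a = b"
proof -
  interpret comm_group G by fact
  let ?F = "free_Abelian_group (carrier G)"
  obtain h where h: "h \<in> hom ?F G" "\<And>x. x \<in> carrier G \<Longrightarrow> h (frag_of x) = x"
    using free_Abelian_group_universal[of "\<lambda>x. x" "carrier G"] by auto
  have hd: "h (x - y) = h x \<otimes>\<^bsub>G\<^esub> inv\<^bsub>G\<^esub> h y" if "Poly_Mapping.keys x \<subseteq> carrier G" "Poly_Mapping.keys y \<subseteq> carrier G" for x y
  proof -
    have gh: "group_hom ?F G h" using h(1) is_group by (simp add: group_hom_def group_hom_axioms_def)
    have "h (x \<otimes>\<^bsub>?F\<^esub> inv\<^bsub>?F\<^esub> y) = h x \<otimes>\<^bsub>G\<^esub> inv\<^bsub>G\<^esub> h y"
      using group_hom.hom_mult[OF gh, of x "inv\<^bsub>?F\<^esub> y"] group_hom.hom_inv[OF gh, of y] that by simp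
    then show ?thesis using that by simp
  qed
  \<comment> \<open>The support is carried through the induction together with the value, because
    \<open>h\<close> is multiplicative only on the carrier of the free group.\<close>
  have "Poly_Mapping.keys w \<subseteq> carrier G \<and> h w = \<one>\<^bsub>G\<^esub>" if "w \<in> zspan (group_rels G)" for w
    using that
  proof induction
    case zero
    have "h \<one>\<^bsub>?F\<^esub> = \<one>\<^bsub>G\<^esub>" by (rule hom_one[OF h(1)]) auto
    then show ?case by simp
  next
    case (base w)
    then obtain x y where xy: "x \<in> carrier G" "y \<in> carrier G" "w = frag_of (x \<otimes>\<^bsub>G\<^esub> y) - frag_of x - frag_of y"
      by (auto simp: group_rels_def)
    have k: "Poly_Mapping.keys (frag_of (x \<otimes>\<^bsub>G\<^esub> y) - frag_of x) \<subseteq> carrier G"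
      using xy keys_diff[of "frag_of (x \<otimes>\<^bsub>G\<^esub> y)" "frag_of x"] by auto
    then have "Poly_Mapping.keys w \<subseteq> carrier G"
      using xy keys_diff[of "frag_of (x \<otimes>\<^bsub>G\<^esub> y) - frag_of x" "frag_of y"] by auto
    moreover have "h w = (x \<otimes>\<^bsub>G\<^esub> y) \<otimes>\<^bsub>G\<^esub> inv\<^bsub>G\<^esub> x \<otimes>\<^bsub>G\<^esub> inv\<^bsub>G\<^esub> y"
      using xy k by (simp add: hd h(2))
    moreover have "(x \<otimes>\<^bsub>G\<^esub> y) \<otimes>\<^bsub>G\<^esub> inv\<^bsub>G\<^esub> x = y"
      using xy m_comm[of x y] m_assoc[of y x "inv\<^bsub>G\<^esub> x"] by simp
    ultimately show ?case using xy by simp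
  next
    case (diff x y)
    then show ?case using hd keys_diff[of x y] by auto
  qed
  then have "h (frag_of a - frag_of b) = \<one>\<^bsub>G\<^esub>" using assms(4) by (simp add: cong_mod_def)
  then have "a \<otimes>\<^bsub>G\<^esub> inv\<^bsub>G\<^esub> b = \<one>\<^bsub>G\<^esub>" using ab by (simp add: hd h(2))
  then have "inv\<^bsub>G\<^esub> (inv\<^bsub>G\<^esub> b) = a" using ab by (intro inv_equality) auto
  then show ?thesis using ab by simp
qed

section \<open>Tensor products\<close>

text \<open>What keeps every defining relation inside the free group on the product of the
  carriers.\<close>

definition tensor_ok where
  "tensor_ok I M ra N la \<longleftrightarrow> Group.monoid M \<and> Group.monoid N \<and>
     (\<forall>m\<in>carrier M. \<forall>i\<in>I. ra m i \<in> carrier M) \<and> (\<forall>n\<in>carrier N. \<forall>i\<in>I. la i n \<in> carrier N)"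

text \<open>By the universal property these are the homomorphisms from the tensor product to the
  quotient by \<open>H\<close>, given on pairs.\<close>

definition balanced where
  "balanced I M ra N la H f \<longleftrightarrow>
     (\<forall>n\<in>carrier N. additive_mod M H (\<lambda>m. f m n)) \<and>
     (\<forall>m\<in>carrier M. additive_mod N H (f m)) \<and>
     (\<forall>m\<in>carrier M. \<forall>i\<in>I. \<forall>n\<in>carrier N. f (ra m i) n \<approx>\<^bsub>H\<^esub> f m (la i n))"

definition balanced3 where
  "balanced3 I L raL M laM raM N laN H f \<longleftrightarrow>
     (\<forall>m\<in>carrier M. \<forall>n\<in>carrier N. additive_mod L H (\<lambda>l. f l m n)) \<and>
     (\<forall>l\<in>carrier L. \<forall>n\<in>carrier N. additive_mod M H (\<lambda>m. f l m n)) \<and>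
     (\<forall>l\<in>carrier L. \<forall>m\<in>carrier M. additive_mod N H (f l m)) \<and>
     (\<forall>l\<in>carrier L. \<forall>i\<in>I. \<forall>m\<in>carrier M. \<forall>n\<in>carrier N. f (raL l i) m n \<approx>\<^bsub>H\<^esub> f l (laM i m) n) \<and>
     (\<forall>l\<in>carrier L. \<forall>i\<in>I. \<forall>m\<in>carrier M. \<forall>n\<in>carrier N. f l (raM m i) n \<approx>\<^bsub>H\<^esub> f l m (laN i n))"

lemma keys_frag_of_diff: "Poly_Mapping.keys (frag_of p - frag_of q) \<subseteq> {p, q}"
  using keys_diff[of "frag_of p" "frag_of q"] by auto

lemma keys_frag_of_diff2: "Poly_Mapping.keys (frag_of p - frag_of q - frag_of r) \<subseteq> {p, q, r}"
  using keys_diff[of "frag_of p - frag_of q" "frag_of r"] keys_frag_of_diff[of p q] by auto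

lemma presented_tensor:
  assumes "tensor_ok I M ra N la"
  shows "presented (tensor I M ra N la) (carrier M \<times> carrier N) (tensor_rels I M ra N la)"
  unfolding presented_def tensor_def Let_def
proof (intro conjI refl ballI)
  fix x assume "x \<in> tensor_rels I M ra N la"
  then show "Poly_Mapping.keys x \<subseteq> carrier M \<times> carrier N"
    unfolding tensor_rels_def Un_iff
  proof (elim disjE CollectE exE conjE)
    fix m m' n assume "x = frag_of (m \<otimes>\<^bsub>M\<^esub> m', n) - frag_of (m, n) - frag_of (m', n)"
      "m \<in> carrier M" "m' \<in> carrier M" "n \<in> carrier N"
    then show ?thesis
      using assms by (simp, intro order_trans[OF keys_frag_of_diff2]) (simp add: tensor_ok_def Group.monoid.m_closed)
  next
    fix m n n' assume "x = frag_of (m, n \<otimes>\<^bsub>N\<^esub> n') - frag_of (m, n) - frag_of (m, n')"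
      "m \<in> carrier M" "n \<in> carrier N" "n' \<in> carrier N"
    then show ?thesis
      using assms by (simp, intro order_trans[OF keys_frag_of_diff2]) (simp add: tensor_ok_def Group.monoid.m_closed)
  next
    fix m i n assume "x = frag_of (ra m i, n) - frag_of (m, la i n)"
      "m \<in> carrier M" "i \<in> I" "n \<in> carrier N"
    then show ?thesis
      using assms by (simp, intro order_trans[OF keys_frag_of_diff]) (simp add: tensor_ok_def Group.monoid.m_closed)
  qed
qed

lemma presented_tensor3:
  assumes "Group.monoid L" "Group.monoid M" "Group.monoid N"
    "\<And>l i. l \<in> carrier L \<Longrightarrow> i \<in> I \<Longrightarrow> raL l i \<in> carrier L"
    "\<And>m i. m \<in> carrier M \<Longrightarrow> i \<in> I \<Longrightarrow> laM i m \<in> carrier M"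
    "\<And>m i. m \<in> carrier M \<Longrightarrow> i \<in> I \<Longrightarrow> raM m i \<in> carrier M"
    "\<And>n i. n \<in> carrier N \<Longrightarrow> i \<in> I \<Longrightarrow> laN i n \<in> carrier N"
  shows "presented (tensor3 I L raL M laM raM N laN) (carrier L \<times> carrier M \<times> carrier N)
    (tensor3_rels I L raL M laM raM N laN)"
  unfolding presented_def tensor3_def Let_def
proof (intro conjI refl ballI)
  fix x assume "x \<in> tensor3_rels I L raL M laM raM N laN"
  then show "Poly_Mapping.keys x \<subseteq> carrier L \<times> carrier M \<times> carrier N"
    unfolding tensor3_rels_def Un_iff
  proof (elim disjE CollectE exE conjE)
    fix l l' m n assume "x = frag_of (l \<otimes>\<^bsub>L\<^esub> l', m, n) - frag_of (l, m, n) - frag_of (l', m, n)"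
      "l \<in> carrier L" "l' \<in> carrier L" "m \<in> carrier M" "n \<in> carrier N"
    then show ?thesis
      using assms by (simp, intro order_trans[OF keys_frag_of_diff2]) (simp add: Group.monoid.m_closed)
  next
    fix l m m' n assume "x = frag_of (l, m \<otimes>\<^bsub>M\<^esub> m', n) - frag_of (l, m, n) - frag_of (l, m', n)"
      "l \<in> carrier L" "m \<in> carrier M" "m' \<in> carrier M" "n \<in> carrier N"
    then show ?thesis
      using assms by (simp, intro order_trans[OF keys_frag_of_diff2]) (simp add: Group.monoid.m_closed)
  next
    fix l m n n' assume "x = frag_of (l, m, n \<otimes>\<^bsub>N\<^esub> n') - frag_of (l, m, n) - frag_of (l, m, n')"
      "l \<in> carrier L" "m \<in> carrier M" "n \<in> carrier N" "n' \<in> carrier N"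
    then show ?thesis
      using assms by (simp, intro order_trans[OF keys_frag_of_diff2]) (simp add: Group.monoid.m_closed)
  next
    fix l i m n assume "x = frag_of (raL l i, m, n) - frag_of (l, laM i m, n)"
      "l \<in> carrier L" "i \<in> I" "m \<in> carrier M" "n \<in> carrier N"
    then show ?thesis
      using assms by (simp, intro order_trans[OF keys_frag_of_diff]) (simp add: Group.monoid.m_closed)
  next
    fix l i m n assume "x = frag_of (l, raM m i, n) - frag_of (l, m, laN i n)"
      "l \<in> carrier L" "i \<in> I" "m \<in> carrier M" "n \<in> carrier N"
    then show ?thesis
      using assms by (simp, intro order_trans[OF keys_frag_of_diff]) (simp add: Group.monoid.m_closed)
  qed
qed

text \<open>The three families of relations match the three clauses of \<open>balanced\<close> one
  by one.\<close>

lemma balanced_descends: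
  assumes "balanced I M ra N la H f"
  shows "descends (tensor_rels I M ra N la) H (\<lambda>(x, y). f x y)"
  unfolding descends_def
proof
  fix r assume "r \<in> tensor_rels I M ra N la"
  then show "frag_extend (\<lambda>(x, y). f x y) r \<in> zspan H"
    unfolding tensor_rels_def Un_iff using assms
    by (elim disjE CollectE exE conjE)
       (simp_all add: frag_extend_diff frag_extend_add balanced_def additive_mod_def cong_mod_def diff_diff_eq)
qed

lemma balanced3_descends:
  assumes "balanced3 I L raL M laM raM N laN H f"
  shows "descends (tensor3_rels I L raL M laM raM N laN) H (\<lambda>(x, y, z). f x y z)"
  unfolding descends_def
proof
  fix r assume "r \<in> tensor3_rels I L raL M laM raM N laN"
  then show "frag_extend (\<lambda>(x, y, z). f x y z) r \<in> zspan H"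
    unfolding tensor3_rels_def Un_iff using assms
    by (elim disjE CollectE exE conjE)
       (simp_all add: frag_extend_diff frag_extend_add balanced3_def additive_mod_def cong_mod_def diff_diff_eq)
qed

text \<open>The universal balanced map. Inserting it as test functional turns a congruence proved
  for all functionals into an equation in the tensor product.\<close>

lemma balanced_frag_of: "balanced I M ra N la (tensor_rels I M ra N la) (\<lambda>x y. frag_of (x, y))"
  unfolding balanced_def additive_mod_def cong_mod_def diff_diff_eq[symmetric]
  by (intro conjI ballI zspan.base; unfold tensor_rels_def; blast)

lemma balanced3_frag_of:
  "balanced3 I L raL M laM raM N laN (tensor3_rels I L raL M laM raM N laN) (\<lambda>x y z. frag_of (x, y, z))"
  unfolding balanced3_def additive_mod_def cong_mod_def diff_diff_eq[symmetric]
  by (intro conjI ballI zspan.base; unfold tensor3_rels_def; blast)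

lemma sweedler_sweedler:
  "sweedler (sweedler z g) f = sweedler z (\<lambda>x y. sweedler (g x y) f)"
  unfolding frag_extend_frag_extend by (simp add: case_prod_unfold)

lemma sweedler_swap:
  "sweedler z (\<lambda>x y. sweedler w (\<lambda>a b. f x y a b)) = sweedler w (\<lambda>a b. sweedler z (\<lambda>x y. f x y a b))"
  unfolding case_prod_unfold by (rule frag_extend_swap)

lemma tsum_swap: "tsum U (\<lambda>x y. tsum V (\<lambda>a b. f x y a b)) = tsum V (\<lambda>a b. tsum U (\<lambda>x y. f x y a b))"
  unfolding tsum_def by (rule sweedler_swap)

lemma sweedler_tsum: "sweedler (tsum U g) f = tsum U (\<lambda>x y. sweedler (g x y) f)"
  unfolding tsum_def by (rule sweedler_sweedler)

lemma sweedler_sweedler3: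
  "frag_extend (\<lambda>(x, y, z). f x y z) (sweedler w g) = sweedler w (\<lambda>a b. frag_extend (\<lambda>(x, y, z). f x y z) (g a b))"
  unfolding frag_extend_frag_extend by (simp add: case_prod_unfold)

lemma keys_sweedler:
  assumes "Poly_Mapping.keys z \<subseteq> A \<times> A'" "\<And>x y. x \<in> A \<Longrightarrow> y \<in> A' \<Longrightarrow> Poly_Mapping.keys (g x y) \<subseteq> C"
  shows "Poly_Mapping.keys (sweedler z g) \<subseteq> C"
proof (rule order_trans[OF keys_frag_extend], rule UN_least)
  fix p assume "p \<in> Poly_Mapping.keys z"
  then show "Poly_Mapping.keys (case p of (x, y) \<Rightarrow> g x y) \<subseteq> C" using assms by (cases p) auto
qed

lemma the_elem_eqI: "c \<in> A \<Longrightarrow> (\<And>x. x \<in> A \<Longrightarrow> x = c) \<Longrightarrow> the_elem A = c"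
proof -
  assume "c \<in> A" "\<And>x. x \<in> A \<Longrightarrow> x = c"
  then have "A = {c}" by blast
  then show ?thesis by simp
qed

lemma balancedI:
  assumes "\<And>n. n \<in> carrier N \<Longrightarrow> additive_mod M H (\<lambda>m. f m n)"
    and "\<And>m. m \<in> carrier M \<Longrightarrow> additive_mod N H (f m)"
    and "\<And>m i n. m \<in> carrier M \<Longrightarrow> i \<in> I \<Longrightarrow> n \<in> carrier N \<Longrightarrow> f (ra m i) n \<approx>\<^bsub>H\<^esub> f m (la i n)"
  shows "balanced I M ra N la H f"
  using assms by (simp add: balanced_def)

lemma balanced_left: "balanced I M ra N la H f \<Longrightarrow> n \<in> carrier N \<Longrightarrow> additive_mod M H (\<lambda>m. f m n)"
  by (simp add: balanced_def)

lemma balanced_right: "balanced I M ra N la H f \<Longrightarrow> m \<in> carrier M \<Longrightarrow> additive_mod N H (f m)"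
  by (simp add: balanced_def)

lemma balanced_middle:
  "balanced I M ra N la H f \<Longrightarrow> m \<in> carrier M \<Longrightarrow> i \<in> I \<Longrightarrow> n \<in> carrier N \<Longrightarrow> f (ra m i) n \<approx>\<^bsub>H\<^esub> f m (la i n)"
  by (simp add: balanced_def)

lemma balanced3I:
  assumes "\<And>m n. m \<in> carrier M \<Longrightarrow> n \<in> carrier N \<Longrightarrow> additive_mod L H (\<lambda>l. f l m n)"
    and "\<And>l n. l \<in> carrier L \<Longrightarrow> n \<in> carrier N \<Longrightarrow> additive_mod M H (\<lambda>m. f l m n)"
    and "\<And>l m. l \<in> carrier L \<Longrightarrow> m \<in> carrier M \<Longrightarrow> additive_mod N H (f l m)"
    and "\<And>l i m n. l \<in> carrier L \<Longrightarrow> i \<in> I \<Longrightarrow> m \<in> carrier M \<Longrightarrow> n \<in> carrier N \<Longrightarrow> f (raL l i) m n \<approx>\<^bsub>H\<^esub> f l (laM i m) n"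
    and "\<And>l i m n. l \<in> carrier L \<Longrightarrow> i \<in> I \<Longrightarrow> m \<in> carrier M \<Longrightarrow> n \<in> carrier N \<Longrightarrow> f l (raM m i) n \<approx>\<^bsub>H\<^esub> f l m (laN i n)"
  shows "balanced3 I L raL M laM raM N laN H f"
  using assms by (simp add: balanced3_def)

text \<open>\<open>Q\<close> is a parameter tied to \<open>tensor\<close> by an equation, so that
  each concrete tensor product keeps its own name when the locale is interpreted.\<close>

locale tensor_space =
  fixes Q :: "('m \<times> 'n) tensor monoid" and I :: "'i set"
    and M :: "('m, 'e) monoid_scheme" and ra :: "'m \<Rightarrow> 'i \<Rightarrow> 'm"
    and N :: "('n, 'f) monoid_scheme" and la :: "'i \<Rightarrow> 'n \<Rightarrow> 'n"
  assumes space_eq: "Q = tensor I M ra N la" and space_ok: "tensor_ok I M ra N la"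
begin

abbreviation "bal \<equiv> balanced I M ra N la"
abbreviation "rels \<equiv> tensor_rels I M ra N la"
abbreviation "pure x y \<equiv> tclass Q (frag_of (x, y))"

lemma pres: "presented Q (carrier M \<times> carrier N) rels"
  using presented_tensor[OF space_ok] space_eq by simp

lemma group: "comm_group Q" "Group.group Q" "Group.monoid Q"
  using presented_comm_group[OF pres] by (auto simp: comm_group_def group_def)

lemma pure_closed: "x \<in> carrier M \<Longrightarrow> y \<in> carrier N \<Longrightarrow> pure x y \<in> carrier Q"
  by (intro tclass_closed[OF pres]) simp

lemma tsum_welldef:
  assumes "bal H f" "U \<in> carrier Q" "z \<in> U"
  shows "sweedler z f \<approx>\<^bsub>H\<^esub> tsum U f"
  unfolding tsum_def by (rule descends_cong_mod[OF balanced_descends[OF assms(1)] mem_cong_rep[OF pres assms(2,3)]])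

lemma tsum_tclass: "bal H f \<Longrightarrow> tsum (tclass Q z) f \<approx>\<^bsub>H\<^esub> sweedler z f"
  unfolding tsum_def by (rule descends_cong_mod[OF balanced_descends rep_tclass[OF pres]])

lemma tsum_pure: "bal H f \<Longrightarrow> tsum (pure x y) f \<approx>\<^bsub>H\<^esub> f x y"
  using tsum_tclass[of H f "frag_of (x, y)"] by simp

lemma tsum_cong:
  assumes "U \<in> carrier Q" "\<And>x y. x \<in> carrier M \<Longrightarrow> y \<in> carrier N \<Longrightarrow> f x y \<approx>\<^bsub>H\<^esub> g x y"
  shows "tsum U f \<approx>\<^bsub>H\<^esub> tsum U g"
  unfolding tsum_def by (rule sweedler_cong_mod[OF rep_keys[OF pres assms(1)] assms(2)])

lemma additive_tsum_param:
  assumes "U \<in> carrier Q" "\<And>x y. x \<in> carrier M \<Longrightarrow> y \<in> carrier N \<Longrightarrow> additive_mod G H (\<lambda>a. f a x y)"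
  shows "additive_mod G H (\<lambda>a. tsum U (f a))"
proof -
  have "additive_mod G H (\<lambda>a. frag_extend (\<lambda>p. f a (fst p) (snd p)) (rep U))"
    by (rule additive_mod_frag_extend) (use rep_keys[OF pres assms(1)] in \<open>auto intro!: assms(2)\<close>)
  then show ?thesis by (simp add: tsum_def case_prod_unfold)
qed

lemma tsum_additive:
  assumes "bal H f" shows "additive_mod Q H (\<lambda>U. tsum U f)"
proof (rule additive_modI)
  fix U V assume UV: "U \<in> carrier Q" "V \<in> carrier Q"
  have "U \<otimes>\<^bsub>Q\<^esub> V = tclass Q (rep U + rep V)"
    using tclass_mult[OF pres rep_keys[OF pres UV(1)] rep_keys[OF pres UV(2)]] UV
    by (simp add: tclass_rep[OF pres])
  then show "tsum (U \<otimes>\<^bsub>Q\<^esub> V) f \<approx>\<^bsub>H\<^esub> tsum U f + tsum V f"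
    using tsum_tclass[OF assms, of "rep U + rep V"] by (simp add: tsum_def frag_extend_add)
qed

text \<open>Pure tensors generate the tensor product. Induction on formal sums proceeds by
  differences, so the value at a difference is recovered by adding the subtrahend back.\<close>

lemma additive_tclass:
  assumes u: "additive_mod Q H u" and z: "Poly_Mapping.keys z \<subseteq> carrier M \<times> carrier N"
  shows "u (tclass Q z) \<approx>\<^bsub>H\<^esub> sweedler z (\<lambda>x y. u (pure x y))"
  using z
proof (induction z rule: free_Abelian_group_induct[consumes 1])
  case 1
  have "tclass Q 0 = \<one>\<^bsub>Q\<^esub>" unfolding tclass_def by simp
  then show ?case using additive_mod_one[OF group(2) u] by simp
next
  case (2 a b)
  then have k: "Poly_Mapping.keys a \<subseteq> carrier M \<times> carrier N" "Poly_Mapping.keys b \<subseteq> carrier M \<times> carrier N"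
    by auto
  then have kd: "Poly_Mapping.keys (a - b) \<subseteq> carrier M \<times> carrier N"
    using keys_diff[of a b] by blast
  have "u (tclass Q (a - b) \<otimes>\<^bsub>Q\<^esub> tclass Q b) \<approx>\<^bsub>H\<^esub> u (tclass Q (a - b)) + u (tclass Q b)"
    by (rule additive_modD[OF u]) (use k kd tclass_closed[OF pres] in auto)
  then have "u (tclass Q a) \<approx>\<^bsub>H\<^esub> u (tclass Q (a - b)) + u (tclass Q b)"
    using tclass_mult[OF pres kd k(2)] by simp
  then have "u (tclass Q (a - b)) \<approx>\<^bsub>H\<^esub> u (tclass Q a) - u (tclass Q b)"
    using cong_mod_diff[OF cong_mod_sym cong_mod_refl, of "u (tclass Q a)" H "u (tclass Q (a - b)) + u (tclass Q b)" "u (tclass Q b)"]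
    by simp
  also have "\<dots> \<approx>\<^bsub>H\<^esub> sweedler a (\<lambda>x y. u (pure x y)) - sweedler b (\<lambda>x y. u (pure x y))"
    by (rule cong_mod_diff[OF 2(3,4)])
  finally show ?case unfolding frag_extend_diff .
next
  case (3 x)
  then show ?case by (cases x) auto
qed

lemma additive_tsum:
  assumes "additive_mod Q H u" "U \<in> carrier Q"
  shows "u U \<approx>\<^bsub>H\<^esub> tsum U (\<lambda>x y. u (pure x y))"
  using additive_tclass[OF assms(1) rep_keys[OF pres assms(2)]] unfolding tsum_def tclass_rep[OF pres assms(2)] .

lemma pure_mult_left:
  assumes "m \<in> carrier M" "m' \<in> carrier M" "n \<in> carrier N"
  shows "pure (m \<otimes>\<^bsub>M\<^esub> m') n = pure m n \<otimes>\<^bsub>Q\<^esub> pure m' n"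
proof -
  have "frag_of (m \<otimes>\<^bsub>M\<^esub> m', n) \<approx>\<^bsub>rels\<^esub> frag_of (m, n) + frag_of (m', n)"
    by (rule additive_modD[OF balanced_left[OF balanced_frag_of]]) (fact assms)+
  then show ?thesis using assms by (simp add: tclass_mult[OF pres] tclass_eq_iff[OF pres])
qed

lemma pure_mult_right:
  assumes "m \<in> carrier M" "n \<in> carrier N" "n' \<in> carrier N"
  shows "pure m (n \<otimes>\<^bsub>N\<^esub> n') = pure m n \<otimes>\<^bsub>Q\<^esub> pure m n'"
proof -
  have "frag_of (m, n \<otimes>\<^bsub>N\<^esub> n') \<approx>\<^bsub>rels\<^esub> frag_of (m, n) + frag_of (m, n')"
    by (rule additive_modD[OF balanced_right[OF balanced_frag_of]]) (fact assms)+
  then show ?thesis using assms by (simp add: tclass_mult[OF pres] tclass_eq_iff[OF pres])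
qed

lemma pure_middle:
  assumes "m \<in> carrier M" "i \<in> I" "n \<in> carrier N"
  shows "pure (ra m i) n = pure m (la i n)"
  by (rule tclass_eqI[OF pres], rule balanced_middle[OF balanced_frag_of]) (fact assms)+

text \<open>Restriction of a homomorphism to pure tensors. With \<open>tsum_additive\<close> this
  passes freely between additive functionals on \<open>Q\<close> and balanced ones on pairs.\<close>

lemma balanced_additive:
  assumes "additive_mod Q H u"
  shows "bal H (\<lambda>x y. u (pure x y))"
proof (rule balancedI)
  fix n assume "n \<in> carrier N"
  then show "additive_mod M H (\<lambda>m. u (pure m n))"
    by (intro additive_modI, subst pure_mult_left) (auto intro: additive_modD[OF assms] pure_closed)
next
  fix m assume "m \<in> carrier M"
  then show "additive_mod N H (\<lambda>n. u (pure m n))"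
    by (intro additive_modI, subst pure_mult_right) (auto intro: additive_modD[OF assms] pure_closed)
next
  fix m i n assume "m \<in> carrier M" "i \<in> I" "n \<in> carrier N"
  then show "u (pure (ra m i) n) \<approx>\<^bsub>H\<^esub> u (pure m (la i n))"
    by (simp only: pure_middle cong_mod_refl)
qed

lemma tclass_tsum:
  assumes "U \<in> carrier Q" shows "tclass Q (tsum U (\<lambda>x y. frag_of (x, y))) = U"
proof -
  have "tsum U (\<lambda>x y. frag_of (x, y)) = frag_extend frag_of (rep U)" by (simp add: tsum_def case_prod_unfold)
  also have "\<dots> = rep U" by (rule frag_expansion[symmetric])
  finally have e: "tsum U (\<lambda>x y. frag_of (x, y)) = rep U" .
  show ?thesis unfolding e by (rule tclass_rep[OF pres assms])
qed

lemma carrier_eqI: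
  assumes "U \<in> carrier Q" "V \<in> carrier Q"
    and "tsum U (\<lambda>x y. frag_of (x, y)) \<approx>\<^bsub>rels\<^esub> tsum V (\<lambda>x y. frag_of (x, y))"
  shows "U = V"
  using tclass_eqI[OF pres assms(3)] unfolding tclass_tsum[OF assms(1)] tclass_tsum[OF assms(2)] .

text \<open>The comparison is made in the free group on \<open>G\<close>: both values are congruent
  to the same functional sum, and \<open>group_rels_separate\<close> turns this into
  equality.\<close>

lemma value_sum_welldef:
  assumes G: "comm_group G" and f: "bal (group_rels G) (\<lambda>x y. frag_of (f x y))"
    and closed: "\<And>x y. x \<in> carrier M \<Longrightarrow> y \<in> carrier N \<Longrightarrow> f x y \<in> carrier G"
    and U: "U \<in> carrier Q" "z \<in> U"
  shows "value_sum G f z = value_sum G f (rep U)" "value_sum G f z \<in> carrier G"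
proof -
  have c: "value_sum G f w \<in> carrier G" and v: "frag_of (value_sum G f w) \<approx>\<^bsub>group_rels G\<^esub> sweedler w (\<lambda>x y. frag_of (f x y))"
    if "Poly_Mapping.keys w \<subseteq> carrier M \<times> carrier N" for w
    using that by (auto intro!: value_sum_closed[OF G] additive_mod_value_sum[OF G additive_mod_frag_of] closed)
  have k: "Poly_Mapping.keys z \<subseteq> carrier M \<times> carrier N" "Poly_Mapping.keys (rep U) \<subseteq> carrier M \<times> carrier N"
    using mem_carrier_keys[OF pres U] rep_keys[OF pres U(1)] by auto
  have "frag_of (value_sum G f z) \<approx>\<^bsub>group_rels G\<^esub> frag_of (value_sum G f (rep U))"
    by (rule cong_mod_trans[OF v[OF k(1)] cong_mod_trans[OF tsum_welldef[OF f U, unfolded tsum_def] cong_mod_sym[OF v[OF k(2)]]]])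
  then show "value_sum G f z = value_sum G f (rep U)" "value_sum G f z \<in> carrier G"
    using group_rels_separate[OF G] c k by auto
qed

end

text \<open>Three maps have this shape: \<open>\<nu>\<close> of the right bialgebroid,
  \<open>\<nu>\<close> of the left one, and \<open>can\<close>. Each is bijective by hypothesis and
  given on pure tensors by formal sums \<open>w\<close>; this already makes the inverse a
  homomorphism.\<close>

locale tensor_iso =
  dom: tensor_space P I M ra N la + cod: tensor_space Q J M' ra' N' la'
  for P :: "('m \<times> 'n) tensor monoid" and I :: "'i set"
    and M :: "('m, 'e) monoid_scheme" and ra :: "'m \<Rightarrow> 'i \<Rightarrow> 'm"
    and N :: "('n, 'f) monoid_scheme" and la :: "'i \<Rightarrow> 'n \<Rightarrow> 'n"
    and Q :: "('m2 \<times> 'n2) tensor monoid" and J :: "'j set"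
    and M' :: "('m2, 'e2) monoid_scheme" and ra' :: "'m2 \<Rightarrow> 'j \<Rightarrow> 'm2"
    and N' :: "('n2, 'f2) monoid_scheme" and la' :: "'j \<Rightarrow> 'n2 \<Rightarrow> 'n2" +
  fixes h :: "('m \<times> 'n) tensor \<Rightarrow> ('m2 \<times> 'n2) tensor" and w :: "'m \<Rightarrow> 'n \<Rightarrow> 'm2 \<times> 'n2 \<Rightarrow>\<^sub>0 int"
  assumes w_keys: "\<And>x y. x \<in> carrier M \<Longrightarrow> y \<in> carrier N \<Longrightarrow> Poly_Mapping.keys (w x y) \<subseteq> carrier M' \<times> carrier N'"
    and w_bal: "dom.bal cod.rels w"
    and h_eq: "\<And>U. U \<in> carrier P \<Longrightarrow> h U = tclass Q (tsum U w)"
    and h_bij: "bij_betw h (carrier P) (carrier Q)"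
begin

abbreviation "h_inv \<equiv> inv_into (carrier P) h"

lemma h_pure: "x \<in> carrier M \<Longrightarrow> y \<in> carrier N \<Longrightarrow> h (dom.pure x y) = tclass Q (w x y)"
  by (simp add: h_eq dom.pure_closed tclass_eqI[OF cod.pres dom.tsum_pure[OF w_bal]])

lemma tsum_w_keys: "U \<in> carrier P \<Longrightarrow> Poly_Mapping.keys (tsum U w) \<subseteq> carrier M' \<times> carrier N'"
  unfolding tsum_def by (rule keys_sweedler[OF rep_keys[OF dom.pres]]) (auto dest: w_keys)

lemma h_hom: "h \<in> hom P Q"
proof (rule homI)
  fix U V assume UV: "U \<in> carrier P" "V \<in> carrier P"
  have "h (U \<otimes>\<^bsub>P\<^esub> V) = tclass Q (tsum (U \<otimes>\<^bsub>P\<^esub> V) w)"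
    using UV by (intro h_eq) (simp add: Group.monoid.m_closed[OF dom.group(3)])
  also have "\<dots> = tclass Q (tsum U w + tsum V w)"
    using UV by (intro tclass_eqI[OF cod.pres] additive_modD[OF dom.tsum_additive[OF w_bal]])
  also have "\<dots> = h U \<otimes>\<^bsub>Q\<^esub> h V"
    using UV by (simp add: h_eq tclass_mult[OF cod.pres] tsum_w_keys)
  finally show "h (U \<otimes>\<^bsub>P\<^esub> V) = h U \<otimes>\<^bsub>Q\<^esub> h V" .
qed (use h_bij in \<open>auto simp: bij_betw_def\<close>)

lemma h_inv_hom: "h_inv \<in> hom Q P"
  using group.iso_set_sym[OF dom.group(2), of h Q] h_hom h_bij by (auto simp: iso_def)

lemma h_inv_closed: "V \<in> carrier Q \<Longrightarrow> h_inv V \<in> carrier P"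
  using h_inv_hom by (auto simp: hom_def)

lemma h_h_inv: "V \<in> carrier Q \<Longrightarrow> h (h_inv V) = V"
  using h_bij by (simp add: bij_betw_inv_into_right)

lemma h_inv_h: "U \<in> carrier P \<Longrightarrow> h_inv (h U) = U"
  using h_bij by (simp add: bij_betw_inv_into_left)

lemma additive_h_inv: "dom.bal H g \<Longrightarrow> additive_mod Q H (\<lambda>V. tsum (h_inv V) g)"
  by (rule additive_mod_comp[OF dom.tsum_additive h_inv_hom])

text \<open>Makes the inverse usable inside a Sweedler sum over \<open>Q\<close>, although nothing
  but its existence is known.\<close>

lemma balanced_h_inv: "dom.bal H g \<Longrightarrow> cod.bal H (\<lambda>a b. tsum (h_inv (cod.pure a b)) g)"
  by (rule cod.balanced_additive[OF additive_h_inv])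

lemma tsum_h:
  assumes "cod.bal H f" "U \<in> carrier P"
  shows "tsum U (\<lambda>x y. sweedler (w x y) f) \<approx>\<^bsub>H\<^esub> tsum (h U) f"
proof -
  have "tsum (h U) f \<approx>\<^bsub>H\<^esub> tsum U (\<lambda>x y. tsum (h (dom.pure x y)) f)"
    by (rule dom.additive_tsum[OF additive_mod_comp[OF cod.tsum_additive h_hom]]) fact+
  also have "\<dots> \<approx>\<^bsub>H\<^esub> tsum U (\<lambda>x y. sweedler (w x y) f)"
    by (rule dom.tsum_cong) (simp_all add: assms h_pure cod.tsum_tclass)
  finally show ?thesis by (rule cong_mod_sym)
qed

text \<open>\<open>h\<close> after its inverse is the identity, read through a functional on the
  codomain. Apart from closure and balance, this and the mirror statement
  \<open>sweedler_h_inv\<close> carry all that is used of the inverses.\<close>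

lemma tsum_h_inv:
  assumes "cod.bal H f" "a \<in> carrier M'" "b \<in> carrier N'"
  shows "tsum (h_inv (cod.pure a b)) (\<lambda>x y. sweedler (w x y) f) \<approx>\<^bsub>H\<^esub> f a b"
  using tsum_h[OF assms(1) h_inv_closed[OF cod.pure_closed[OF assms(2,3)]]]
    cod.tsum_pure[OF assms(1), of a b] cod.pure_closed[OF assms(2,3)]
  by (simp add: h_h_inv) (rule cong_mod_trans)

text \<open>The inverse after \<open>h\<close> is the identity, read through a functional on the
  domain.\<close>

lemma sweedler_h_inv:
  assumes "dom.bal H g" "x \<in> carrier M" "y \<in> carrier N"
  shows "sweedler (w x y) (\<lambda>a b. tsum (h_inv (cod.pure a b)) g) \<approx>\<^bsub>H\<^esub> g x y"
proof -
  have "tsum (h_inv (tclass Q (w x y))) g \<approx>\<^bsub>H\<^esub> sweedler (w x y) (\<lambda>a b. tsum (h_inv (cod.pure a b)) g)"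
    by (rule cod.additive_tclass[OF additive_h_inv[OF assms(1)] w_keys]) fact+
  moreover have "h_inv (tclass Q (w x y)) = dom.pure x y"
    using h_inv_h[OF dom.pure_closed[OF assms(2,3)]] h_pure[OF assms(2,3)] by simp
  ultimately show ?thesis
    using cong_mod_trans[OF cong_mod_sym dom.tsum_pure[OF assms(1), of x y]] by simp
qed

end

section \<open>Additive functionals on rings, and algebra homomorphisms\<close>

lemma additive_mod_addI:
  "(\<And>a b. a \<in> carrier A \<Longrightarrow> b \<in> carrier A \<Longrightarrow> u (a \<oplus>\<^bsub>A\<^esub> b) \<approx>\<^bsub>H\<^esub> u a + u b) \<Longrightarrow> additive_mod (add_monoid A) H u"
  by (simp add: additive_mod_def)

lemma additive_mod_addD:
  "additive_mod (add_monoid A) H u \<Longrightarrow> a \<in> carrier A \<Longrightarrow> b \<in> carrier A \<Longrightarrow> u (a \<oplus>\<^bsub>A\<^esub> b) \<approx>\<^bsub>H\<^esub> u a + u b"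
  by (simp add: additive_mod_def)

lemma (in Ring.ring) additive_mod_lmult:
  "additive_mod (add_monoid R) H u \<Longrightarrow> x \<in> carrier R \<Longrightarrow> additive_mod (add_monoid R) H (\<lambda>t. u (x \<otimes> t))"
  by (rule additive_mod_addI) (simp add: r_distr additive_mod_addD)

lemma (in Ring.ring) additive_mod_rmult:
  "additive_mod (add_monoid R) H u \<Longrightarrow> x \<in> carrier R \<Longrightarrow> additive_mod (add_monoid R) H (\<lambda>t. u (t \<otimes> x))"
  by (rule additive_mod_addI) (simp add: l_distr additive_mod_addD)

lemma (in tensor_space) tsum_tclass_sweedler:
  "bal H f \<Longrightarrow> U = tclass Q (sweedler z g) \<Longrightarrow> tsum U f \<approx>\<^bsub>H\<^esub> sweedler z (\<lambda>x y. sweedler (g x y) f)"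
  using tsum_tclass[of H f "sweedler z g"] by (simp only: sweedler_sweedler)

lemma complex_algebra_ring: "complex_algebra A \<Longrightarrow> Ring.ring A"
  by (simp add: complex_algebra_def)

lemma algebra_hom_facts:
  assumes "f \<in> algebra_hom A B" "Ring.ring A" "Ring.ring B"
  shows "\<And>x. x \<in> carrier A \<Longrightarrow> f x \<in> carrier B"
    "\<And>x y. x \<in> carrier A \<Longrightarrow> y \<in> carrier A \<Longrightarrow> f (x \<otimes>\<^bsub>A\<^esub> y) = f x \<otimes>\<^bsub>B\<^esub> f y"
    "\<And>x y. x \<in> carrier A \<Longrightarrow> y \<in> carrier A \<Longrightarrow> f (x \<oplus>\<^bsub>A\<^esub> y) = f x \<oplus>\<^bsub>B\<^esub> f y"
    "f \<one>\<^bsub>A\<^esub> = \<one>\<^bsub>B\<^esub>"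
  using assms by (auto simp: algebra_hom_def ring_hom_def)

lemma algebra_hom_opposite_facts:
  assumes "f \<in> algebra_hom (opposite A) B"
  shows "\<And>x. x \<in> carrier A \<Longrightarrow> f x \<in> carrier B"
    "\<And>x y. x \<in> carrier A \<Longrightarrow> y \<in> carrier A \<Longrightarrow> f (x \<otimes>\<^bsub>A\<^esub> y) = f y \<otimes>\<^bsub>B\<^esub> f x"
    "\<And>x y. x \<in> carrier A \<Longrightarrow> y \<in> carrier A \<Longrightarrow> f (x \<oplus>\<^bsub>A\<^esub> y) = f x \<oplus>\<^bsub>B\<^esub> f y"
    "f \<one>\<^bsub>A\<^esub> = \<one>\<^bsub>B\<^esub>"
  using assms by (auto simp: algebra_hom_def ring_hom_def opposite_def)

section \<open>Right bialgebroids\<close>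

locale right_bialg =
  fixes R :: "(complex, 'r) module" and B :: "('r, 'b) bialgebroid"
  assumes bialgebroid: "right_bialgebroid R B"
begin

sublocale R: Ring.ring R
  using bialgebroid by (auto simp: right_bialgebroid_def intro: complex_algebra_ring)

sublocale B: Ring.ring B
  using bialgebroid by (auto simp: right_bialgebroid_def intro: complex_algebra_ring)

lemma source_hom: "source B \<in> algebra_hom R B" and target_hom: "target B \<in> algebra_hom (opposite R) B"
  using bialgebroid by (auto simp: right_bialgebroid_def)

lemmas source_simps [simp] = algebra_hom_facts[OF source_hom R.ring_axioms B.ring_axioms]
lemmas target_simps [simp] = algebra_hom_opposite_facts[OF target_hom]

lemma source_target_commute:
  "r \<in> carrier R \<Longrightarrow> r' \<in> carrier R \<Longrightarrow> source B r \<otimes>\<^bsub>B\<^esub> target B r' = target B r' \<otimes>\<^bsub>B\<^esub> source B r"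
  using bialgebroid by (auto simp: right_bialgebroid_def)

lemma coring: "right_coring R B"
  using bialgebroid by (simp add: right_bialgebroid_def)

lemma counit_closed [simp]: "b \<in> carrier B \<Longrightarrow> counit B b \<in> carrier R"
  using coring by (auto simp: right_coring_def hom_def)

lemma counit_add: "b \<in> carrier B \<Longrightarrow> c \<in> carrier B \<Longrightarrow> counit B (b \<oplus>\<^bsub>B\<^esub> c) = counit B b \<oplus>\<^bsub>R\<^esub> counit B c"
  using coring by (auto simp: right_coring_def hom_def)

lemma counit_source_target:
  "b \<in> carrier B \<Longrightarrow> r \<in> carrier R \<Longrightarrow> r' \<in> carrier R \<Longrightarrow>
    counit B ((b \<otimes>\<^bsub>B\<^esub> source B r') \<otimes>\<^bsub>B\<^esub> target B r) = r \<otimes>\<^bsub>R\<^esub> (counit B b \<otimes>\<^bsub>R\<^esub> r')"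
  using coring by (auto simp: right_coring_def)

lemma counit_source: "b \<in> carrier B \<Longrightarrow> r \<in> carrier R \<Longrightarrow> counit B (b \<otimes>\<^bsub>B\<^esub> source B r) = counit B b \<otimes>\<^bsub>R\<^esub> r"
  using counit_source_target[of b "\<one>\<^bsub>R\<^esub>" r] by simp

lemma counit_target: "b \<in> carrier B \<Longrightarrow> r \<in> carrier R \<Longrightarrow> counit B (b \<otimes>\<^bsub>B\<^esub> target B r) = r \<otimes>\<^bsub>R\<^esub> counit B b"
  using counit_source_target[of b r "\<one>\<^bsub>R\<^esub>"] by simp

sublocale BB: tensor_space "right_square R B" "carrier R"
  "add_monoid B" "\<lambda>b r. b \<otimes>\<^bsub>B\<^esub> source B r" "add_monoid B" "\<lambda>r b. b \<otimes>\<^bsub>B\<^esub> target B r"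
  by unfold_locales
     (auto simp: right_square_def right_tensor_def tensor_ok_def)

sublocale BoB: tensor_space "right_op_square R B" "carrier R"
  "add_monoid B" "\<lambda>b r. b \<otimes>\<^bsub>B\<^esub> target B r" "add_monoid B" "\<lambda>r b. target B r \<otimes>\<^bsub>B\<^esub> b"
  by unfold_locales
     (auto simp: right_op_square_def tensor_ok_def)

lemma comult_hom: "comult B \<in> hom (add_monoid B) (right_square R B)"
  using coring by (simp add: right_coring_def)

lemma comult_closed: "b \<in> carrier B \<Longrightarrow> comult B b \<in> carrier (right_square R B)"
  using comult_hom by (auto simp: hom_def)

lemma coring_axioms:
  assumes "D \<in> Pi (carrier B) (comult B)" "b \<in> carrier B"
  shows "\<And>r r'. r \<in> carrier R \<Longrightarrow> r' \<in> carrier R \<Longrightarrow>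
      comult B ((b \<otimes>\<^bsub>B\<^esub> source B r') \<otimes>\<^bsub>B\<^esub> target B r) = tclass (right_square R B)
        (sweedler (D b) (\<lambda>b1 b2. frag_of (b1 \<otimes>\<^bsub>B\<^esub> target B r, b2 \<otimes>\<^bsub>B\<^esub> source B r')))"
    and "value_sum (add_monoid B) (\<lambda>b1 b2. b2 \<otimes>\<^bsub>B\<^esub> target B (counit B b1)) (D b) = b"
    and "value_sum (add_monoid B) (\<lambda>b1 b2. b1 \<otimes>\<^bsub>B\<^esub> source B (counit B b2)) (D b) = b"
  using coring assms unfolding right_coring_def by blast+

lemma bialgebroid_axioms:
  assumes "D \<in> Pi (carrier B) (comult B)" "b \<in> carrier B"
  shows "\<And>r. r \<in> carrier R \<Longrightarrow>
      tclass (right_square R B) (sweedler (D b) (\<lambda>b1 b2. frag_of (b1, target B r \<otimes>\<^bsub>B\<^esub> b2))) =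
      tclass (right_square R B) (sweedler (D b) (\<lambda>b1 b2. frag_of (source B r \<otimes>\<^bsub>B\<^esub> b1, b2)))"
    and "\<And>b'. b' \<in> carrier B \<Longrightarrow> comult B (b \<otimes>\<^bsub>B\<^esub> b') = tclass (right_square R B)
        (sweedler (D b) (\<lambda>b1 b2. sweedler (D b') (\<lambda>b1' b2'. frag_of (b1 \<otimes>\<^bsub>B\<^esub> b1', b2 \<otimes>\<^bsub>B\<^esub> b2'))))"
  using bialgebroid assms unfolding right_bialgebroid_def by blast+

lemma rep_comult: "(\<lambda>b. rep (comult B b)) \<in> Pi (carrier B) (comult B)"
  by (auto intro: rep_mem[OF BB.pres] comult_closed)

lemma comult_additive: "BB.bal H f \<Longrightarrow> additive_mod (add_monoid B) H (\<lambda>b. tsum (comult B b) f)"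
  by (rule additive_mod_comp[OF BB.tsum_additive comult_hom])

lemma comult_source_target:
  assumes "BB.bal H f" "b \<in> carrier B" "r \<in> carrier R" "r' \<in> carrier R"
  shows "tsum (comult B ((b \<otimes>\<^bsub>B\<^esub> source B r') \<otimes>\<^bsub>B\<^esub> target B r)) f \<approx>\<^bsub>H\<^esub>
    tsum (comult B b) (\<lambda>b1 b2. f (b1 \<otimes>\<^bsub>B\<^esub> target B r) (b2 \<otimes>\<^bsub>B\<^esub> source B r'))"
proof -
  have "comult B ((b \<otimes>\<^bsub>B\<^esub> source B r') \<otimes>\<^bsub>B\<^esub> target B r) = tclass (right_square R B)
      (sweedler (rep (comult B b)) (\<lambda>b1 b2. frag_of (b1 \<otimes>\<^bsub>B\<^esub> target B r, b2 \<otimes>\<^bsub>B\<^esub> source B r')))"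
    using coring_axioms(1)[OF rep_comult] assms by simp
  from BB.tsum_tclass_sweedler[OF assms(1) this] show ?thesis by (simp add: tsum_def)
qed

lemma comult_source:
  assumes "BB.bal H f" "b \<in> carrier B" "r \<in> carrier R"
  shows "tsum (comult B (b \<otimes>\<^bsub>B\<^esub> source B r)) f \<approx>\<^bsub>H\<^esub> tsum (comult B b) (\<lambda>b1 b2. f b1 (b2 \<otimes>\<^bsub>B\<^esub> source B r))"
proof -
  have "tsum (comult B (b \<otimes>\<^bsub>B\<^esub> source B r)) f \<approx>\<^bsub>H\<^esub>
      tsum (comult B b) (\<lambda>b1 b2. f (b1 \<otimes>\<^bsub>B\<^esub> target B \<one>\<^bsub>R\<^esub>) (b2 \<otimes>\<^bsub>B\<^esub> source B r))"
    using comult_source_target[OF assms(1,2), of "\<one>\<^bsub>R\<^esub>" r] assms by simp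
  also have "\<dots> \<approx>\<^bsub>H\<^esub> tsum (comult B b) (\<lambda>b1 b2. f b1 (b2 \<otimes>\<^bsub>B\<^esub> source B r))"
    by (rule BB.tsum_cong[OF comult_closed[OF assms(2)]]) (simp add: assms)
  finally show ?thesis .
qed

lemma comult_target:
  assumes "BB.bal H f" "b \<in> carrier B" "r \<in> carrier R"
  shows "tsum (comult B (b \<otimes>\<^bsub>B\<^esub> target B r)) f \<approx>\<^bsub>H\<^esub> tsum (comult B b) (\<lambda>b1 b2. f (b1 \<otimes>\<^bsub>B\<^esub> target B r) b2)"
proof -
  have "tsum (comult B (b \<otimes>\<^bsub>B\<^esub> target B r)) f \<approx>\<^bsub>H\<^esub>
      tsum (comult B b) (\<lambda>b1 b2. f (b1 \<otimes>\<^bsub>B\<^esub> target B r) (b2 \<otimes>\<^bsub>B\<^esub> source B \<one>\<^bsub>R\<^esub>))"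
    using comult_source_target[OF assms(1,2), of r "\<one>\<^bsub>R\<^esub>"] assms by simp
  also have "\<dots> \<approx>\<^bsub>H\<^esub> tsum (comult B b) (\<lambda>b1 b2. f (b1 \<otimes>\<^bsub>B\<^esub> target B r) b2)"
    by (rule BB.tsum_cong[OF comult_closed[OF assms(2)]]) (simp add: assms)
  finally show ?thesis .
qed

text \<open>The axiom is an equality of classes in \<open>B \<otimes>_R B\<close>, so it can be
  pushed through any balanced \<open>f\<close>. It puts the values of \<open>\<Delta>\<close> into
  the Takeuchi product.\<close>

lemma takeuchi:
  assumes "BB.bal H f" "b \<in> carrier B" "r \<in> carrier R"
  shows "tsum (comult B b) (\<lambda>b1 b2. f b1 (target B r \<otimes>\<^bsub>B\<^esub> b2)) \<approx>\<^bsub>H\<^esub>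
    tsum (comult B b) (\<lambda>b1 b2. f (source B r \<otimes>\<^bsub>B\<^esub> b1) b2)"
proof -
  have "tclass (right_square R B) (sweedler (rep (comult B b)) (\<lambda>b1 b2. frag_of (b1, target B r \<otimes>\<^bsub>B\<^esub> b2)))
      = tclass (right_square R B) (sweedler (rep (comult B b)) (\<lambda>b1 b2. frag_of (source B r \<otimes>\<^bsub>B\<^esub> b1, b2)))"
    by (rule bialgebroid_axioms(1)[OF rep_comult assms(2,3)])
  from this[unfolded tclass_eq_iff[OF BB.pres]]
  show ?thesis
    using descends_cong_mod[OF balanced_descends[OF assms(1)]] by (fastforce simp: sweedler_sweedler tsum_def)
qed

lemma counit_left:
  assumes "additive_mod (add_monoid B) H u" "b \<in> carrier B"
  shows "tsum (comult B b) (\<lambda>b1 b2. u (b2 \<otimes>\<^bsub>B\<^esub> target B (counit B b1))) \<approx>\<^bsub>H\<^esub> u b"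
proof -
  have "value_sum (add_monoid B) (\<lambda>b1 b2. b2 \<otimes>\<^bsub>B\<^esub> target B (counit B b1)) (rep (comult B b)) = b"
    by (rule coring_axioms(2)[OF rep_comult assms(2)])
  moreover have "u (value_sum (add_monoid B) (\<lambda>b1 b2. b2 \<otimes>\<^bsub>B\<^esub> target B (counit B b1)) (rep (comult B b)))
      \<approx>\<^bsub>H\<^esub> tsum (comult B b) (\<lambda>b1 b2. u (b2 \<otimes>\<^bsub>B\<^esub> target B (counit B b1)))"
    unfolding tsum_def
    by (rule additive_mod_value_sum[OF B.a_comm_group assms(1)])
       (use rep_keys[OF BB.pres comult_closed[OF assms(2)]] in auto)
  ultimately show ?thesis by (metis cong_mod_sym)
qed

text \<open>Both \<open>R\<close>-actions that form \<open>B \<otimes>_R B\<close> are right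
  multiplications, so left multiplication on either factor commutes with them.\<close>

lemma BB_bal_lmult_left:
  assumes f: "BB.bal H f" and c: "c \<in> carrier B"
  shows "BB.bal H (\<lambda>x y. f (c \<otimes>\<^bsub>B\<^esub> x) y)"
proof (rule balancedI)
  fix n assume "n \<in> carrier (add_monoid B)"
  then show "additive_mod (add_monoid B) H (\<lambda>m. f (c \<otimes>\<^bsub>B\<^esub> m) n)"
    by (rule B.additive_mod_lmult[OF balanced_left[OF f] c])
next
  fix m assume "m \<in> carrier (add_monoid B)"
  then show "additive_mod (add_monoid B) H (f (c \<otimes>\<^bsub>B\<^esub> m))"
    using c by (intro balanced_right[OF f]) simp
next
  fix m i n assume "m \<in> carrier (add_monoid B)" "i \<in> carrier R" "n \<in> carrier (add_monoid B)"
  then show "f (c \<otimes>\<^bsub>B\<^esub> (m \<otimes>\<^bsub>B\<^esub> source B i)) n \<approx>\<^bsub>H\<^esub> f (c \<otimes>\<^bsub>B\<^esub> m) (n \<otimes>\<^bsub>B\<^esub> target B i)"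
    using balanced_middle[OF f, of "c \<otimes>\<^bsub>B\<^esub> m" i n] c by (simp add: B.m_assoc)
qed

lemma BB_bal_lmult_right:
  assumes f: "BB.bal H f" and c: "c \<in> carrier B"
  shows "BB.bal H (\<lambda>x y. f x (c \<otimes>\<^bsub>B\<^esub> y))"
proof (rule balancedI)
  fix n assume "n \<in> carrier (add_monoid B)"
  then show "additive_mod (add_monoid B) H (\<lambda>m. f m (c \<otimes>\<^bsub>B\<^esub> n))"
    using c by (intro balanced_left[OF f]) simp
next
  fix m assume "m \<in> carrier (add_monoid B)"
  then show "additive_mod (add_monoid B) H (\<lambda>n. f m (c \<otimes>\<^bsub>B\<^esub> n))"
    by (rule B.additive_mod_lmult[OF balanced_right[OF f] c])
next
  fix m i n assume "m \<in> carrier (add_monoid B)" "i \<in> carrier R" "n \<in> carrier (add_monoid B)"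
  then show "f (m \<otimes>\<^bsub>B\<^esub> source B i) (c \<otimes>\<^bsub>B\<^esub> n) \<approx>\<^bsub>H\<^esub> f m (c \<otimes>\<^bsub>B\<^esub> (n \<otimes>\<^bsub>B\<^esub> target B i))"
    using balanced_middle[OF f, of m i "c \<otimes>\<^bsub>B\<^esub> n"] c by (simp add: B.m_assoc)
qed

lemma comult_one_eq: "comult B \<one>\<^bsub>B\<^esub> = BB.pure \<one>\<^bsub>B\<^esub> \<one>\<^bsub>B\<^esub>"
  using bialgebroid by (simp add: right_bialgebroid_def)

text \<open>Bilinearity of \<open>\<Delta>\<close> over \<open>R\<close> at the unit, where it puts
  \<open>target B r\<close> on the first leg.\<close>

lemma comult_target_eq:
  assumes r: "r \<in> carrier R" shows "comult B (target B r) = BB.pure (target B r) \<one>\<^bsub>B\<^esub>"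
proof -
  \<comment> \<open>The axioms hold for every simultaneous choice of representatives; this one is
    \<open>1 \<otimes> 1\<close> at the unit, so the sum there has a single term.\<close>
  define D where "D = (\<lambda>b. if b = \<one>\<^bsub>B\<^esub> then frag_of (\<one>\<^bsub>B\<^esub>, \<one>\<^bsub>B\<^esub>) else rep (comult B b))"
  have "D \<in> Pi (carrier B) (comult B)"
    using rep_comult by (auto simp: D_def comult_one_eq self_mem_tclass[OF BB.pres])
  from coring_axioms(1)[OF this B.one_closed r R.one_closed] show ?thesis
    using r by (simp add: D_def)
qed

text \<open>Multiplicativity of \<open>\<Delta>\<close> combined with
  \<open>comult_target_eq\<close>.\<close>

lemma comult_target_left:
  assumes f: "BB.bal H f" and r: "r \<in> carrier R" and b: "b \<in> carrier B"
  shows "tsum (comult B (target B r \<otimes>\<^bsub>B\<^esub> b)) f \<approx>\<^bsub>H\<^esub> tsum (comult B b) (\<lambda>b1 b2. f (target B r \<otimes>\<^bsub>B\<^esub> b1) b2)"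
proof -
  \<comment> \<open>With a single pure tensor chosen at \<open>target B r\<close>, only left
    multiplications are applied to the sum over the coproduct of \<open>b\<close>, and these
    preserve balance.\<close>
  define D where "D = (\<lambda>c. if c = target B r then frag_of (target B r, \<one>\<^bsub>B\<^esub>) else rep (comult B c))"
  have D: "D \<in> Pi (carrier B) (comult B)"
    using rep_comult r by (auto simp: D_def comult_target_eq self_mem_tclass[OF BB.pres])
  have "tsum (comult B (target B r \<otimes>\<^bsub>B\<^esub> b)) f \<approx>\<^bsub>H\<^esub> sweedler (D (target B r))
      (\<lambda>b1 b2. sweedler (sweedler (D b) (\<lambda>b1' b2'. frag_of (b1 \<otimes>\<^bsub>B\<^esub> b1', b2 \<otimes>\<^bsub>B\<^esub> b2'))) f)"
    by (rule BB.tsum_tclass_sweedler[OF f bialgebroid_axioms(2)[OF D _ b]]) (simp add: r)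
  also have "\<dots> = sweedler (D b) (\<lambda>b1 b2. f (target B r \<otimes>\<^bsub>B\<^esub> b1) (\<one>\<^bsub>B\<^esub> \<otimes>\<^bsub>B\<^esub> b2))"
    unfolding sweedler_sweedler by (simp add: D_def)
  also have "\<dots> \<approx>\<^bsub>H\<^esub> tsum (comult B b) (\<lambda>b1 b2. f (target B r \<otimes>\<^bsub>B\<^esub> b1) (\<one>\<^bsub>B\<^esub> \<otimes>\<^bsub>B\<^esub> b2))"
    by (rule BB.tsum_welldef[OF BB_bal_lmult_right[OF BB_bal_lmult_left[OF f]]])
       (use D b r in \<open>auto intro: comult_closed\<close>)
  also have "\<dots> \<approx>\<^bsub>H\<^esub> tsum (comult B b) (\<lambda>b1 b2. f (target B r \<otimes>\<^bsub>B\<^esub> b1) b2)"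
    by (rule BB.tsum_cong[OF comult_closed[OF b]]) simp
  finally show ?thesis .
qed

text \<open>This is \<open>f\<close> after \<open>\<nu>\<close>. A left factor
  \<open>target B i\<close> of \<open>d\<close> comes out on the first leg of the coproduct, and
  associativity hands it to \<open>c\<close>; that is balance over the opposite of
  \<open>R\<close>.\<close>

lemma nu_functional_bal:
  assumes f: "BB.bal H f"
  shows "BoB.bal H (\<lambda>c d. tsum (comult B d) (\<lambda>d1 d2. f (c \<otimes>\<^bsub>B\<^esub> d1) d2))"
proof (rule balancedI)
  fix d assume "d \<in> carrier (add_monoid B)"
  then show "additive_mod (add_monoid B) H (\<lambda>c. tsum (comult B d) (\<lambda>d1 d2. f (c \<otimes>\<^bsub>B\<^esub> d1) d2))"
    by (intro BB.additive_tsum_param comult_closed B.additive_mod_rmult[OF balanced_left[OF f]]) auto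
next
  fix c assume "c \<in> carrier (add_monoid B)"
  then show "additive_mod (add_monoid B) H (\<lambda>d. tsum (comult B d) (\<lambda>d1 d2. f (c \<otimes>\<^bsub>B\<^esub> d1) d2))"
    by (intro comult_additive BB_bal_lmult_left f) simp
next
  fix c i d assume *: "c \<in> carrier (add_monoid B)" "i \<in> carrier R" "d \<in> carrier (add_monoid B)"
  have "tsum (comult B (target B i \<otimes>\<^bsub>B\<^esub> d)) (\<lambda>d1 d2. f (c \<otimes>\<^bsub>B\<^esub> d1) d2) \<approx>\<^bsub>H\<^esub>
      tsum (comult B d) (\<lambda>d1 d2. f (c \<otimes>\<^bsub>B\<^esub> (target B i \<otimes>\<^bsub>B\<^esub> d1)) d2)"
    using * by (intro comult_target_left BB_bal_lmult_left f) auto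
  also have "\<dots> \<approx>\<^bsub>H\<^esub> tsum (comult B d) (\<lambda>d1 d2. f ((c \<otimes>\<^bsub>B\<^esub> target B i) \<otimes>\<^bsub>B\<^esub> d1) d2)"
    using * by (intro BB.tsum_cong comult_closed) (auto simp: B.m_assoc)
  finally show "tsum (comult B d) (\<lambda>d1 d2. f ((c \<otimes>\<^bsub>B\<^esub> target B i) \<otimes>\<^bsub>B\<^esub> d1) d2) \<approx>\<^bsub>H\<^esub>
      tsum (comult B (target B i \<otimes>\<^bsub>B\<^esub> d)) (\<lambda>d1 d2. f (c \<otimes>\<^bsub>B\<^esub> d1) d2)"
    by (rule cong_mod_sym)
qed

text \<open>\<open>right_nu\<close> is \<open>the_elem\<close> of the values on all representatives.
  Balance shows that these values coincide, so the chosen representatives may be used.\<close>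

lemma right_nu_eq:
  assumes U: "U \<in> carrier (right_op_square R B)"
  shows "right_nu R B U = tclass (right_square R B)
    (tsum U (\<lambda>c d. tsum (comult B d) (\<lambda>d1 d2. frag_of (c \<otimes>\<^bsub>B\<^esub> d1, d2))))"
  unfolding right_nu_def
proof (rule the_elem_eqI, goal_cases)
  case 1
  show ?case unfolding tsum_def
    by (intro CollectI exI[of _ "rep U"] exI[of _ "\<lambda>b. rep (comult B b)"] conjI refl rep_comult rep_mem[OF BoB.pres U])
next
  case (2 V)
  then obtain z D where z: "z \<in> U" and D: "D \<in> Pi (carrier B) (comult B)"
    and V: "V = tclass (right_square R B) (sweedler z (\<lambda>b b'. sweedler (D b') (\<lambda>b1' b2'. frag_of (b \<otimes>\<^bsub>B\<^esub> b1', b2'))))"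
    by blast
  have "sweedler z (\<lambda>b b'. sweedler (D b') (\<lambda>b1' b2'. frag_of (b \<otimes>\<^bsub>B\<^esub> b1', b2'))) \<approx>\<^bsub>BB.rels\<^esub>
      sweedler z (\<lambda>c d. tsum (comult B d) (\<lambda>d1 d2. frag_of (c \<otimes>\<^bsub>B\<^esub> d1, d2)))"
    using D by (intro sweedler_cong_mod[OF mem_carrier_keys[OF BoB.pres U z]]
        BB.tsum_welldef BB_bal_lmult_left[OF balanced_frag_of] comult_closed) auto
  also have "\<dots> \<approx>\<^bsub>BB.rels\<^esub> tsum U (\<lambda>c d. tsum (comult B d) (\<lambda>d1 d2. frag_of (c \<otimes>\<^bsub>B\<^esub> d1, d2)))"
    by (rule BoB.tsum_welldef[OF nu_functional_bal[OF balanced_frag_of] U z])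
  finally show ?case unfolding V by (rule tclass_eqI[OF BB.pres])
qed

end

locale right_hopf = right_bialg R B for R :: "(complex, 'r) module" and B :: "('r, 'b) bialgebroid" +
  assumes nu_bij: "bij_betw (right_nu R B) (carrier (right_op_square R B)) (carrier (right_square R B))"
begin

sublocale nu: tensor_iso "right_op_square R B" "carrier R"
  "add_monoid B" "\<lambda>b r. b \<otimes>\<^bsub>B\<^esub> target B r" "add_monoid B" "\<lambda>r b. target B r \<otimes>\<^bsub>B\<^esub> b"
  "right_square R B" "carrier R"
  "add_monoid B" "\<lambda>b r. b \<otimes>\<^bsub>B\<^esub> source B r" "add_monoid B" "\<lambda>r b. b \<otimes>\<^bsub>B\<^esub> target B r"
  "right_nu R B" "\<lambda>c d. tsum (comult B d) (\<lambda>d1 d2. frag_of (c \<otimes>\<^bsub>B\<^esub> d1, d2))"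
proof (unfold_locales, goal_cases)
  case (1 x y)
  then show ?case unfolding tsum_def
    by (intro keys_sweedler[OF rep_keys[OF BB.pres comult_closed]]) auto
next
  case 2
  then show ?case by (rule nu_functional_bal[OF balanced_frag_of])
next
  case (3 U)
  then show ?case by (rule right_nu_eq)
next
  case 4
  then show ?case by (rule nu_bij)
qed

text \<open>In Sweedler notation \<open>c b^- \<otimes> b^+\<close>. The free first argument makes
  it balanced in the pair \<open>(c, b)\<close>, so that it can be applied under a sum over
  \<open>B \<otimes>_R B\<close>.\<close>

definition splitting :: "'b \<Rightarrow> 'b \<Rightarrow> ('b \<times> 'b) tensor" where
  "splitting c b = nu.h_inv (BB.pure c b)"

lemma right_translation_eq: "right_translation R B b = splitting \<one>\<^bsub>B\<^esub> b"
  by (simp add: right_translation_def splitting_def)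

lemma splitting_closed: "c \<in> carrier B \<Longrightarrow> b \<in> carrier B \<Longrightarrow> splitting c b \<in> carrier (right_op_square R B)"
  unfolding splitting_def by (intro nu.h_inv_closed BB.pure_closed) auto

lemma splitting_bal: "BoB.bal H g \<Longrightarrow> BB.bal H (\<lambda>c b. tsum (splitting c b) g)"
  unfolding splitting_def by (rule nu.balanced_h_inv)

lemma tsum_splitting:
  assumes "BB.bal H f" "c \<in> carrier B" "b \<in> carrier B"
  shows "tsum (splitting c b) (\<lambda>x y. tsum (comult B y) (\<lambda>y1 y2. f (x \<otimes>\<^bsub>B\<^esub> y1) y2)) \<approx>\<^bsub>H\<^esub> f c b"
  using nu.tsum_h_inv[OF assms(1)] assms(2,3) by (simp add: splitting_def sweedler_tsum)

lemma comult_splitting: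
  assumes "BoB.bal H g" "c \<in> carrier B" "d \<in> carrier B"
  shows "tsum (comult B d) (\<lambda>d1 d2. tsum (splitting (c \<otimes>\<^bsub>B\<^esub> d1) d2) g) \<approx>\<^bsub>H\<^esub> g c d"
  using nu.sweedler_h_inv[OF assms(1)] assms(2,3) by (simp add: splitting_def sweedler_tsum)

text \<open>\<open>\<nu>\<close> is left linear over \<open>B\<close>, hence so is its inverse. The
  argument is the pattern for most later laws: expand the integrand with
  \<open>comult_splitting\<close>, reassociate under the coproduct, collapse with
  \<open>tsum_splitting\<close>.\<close>

lemma splitting_lmult:
  assumes g: "BoB.bal H g" and c: "c \<in> carrier B" "c' \<in> carrier B" "b \<in> carrier B"
  shows "tsum (splitting (c \<otimes>\<^bsub>B\<^esub> c') b) g \<approx>\<^bsub>H\<^esub> tsum (splitting c' b) (\<lambda>x y. g (c \<otimes>\<^bsub>B\<^esub> x) y)"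
proof -
  have "tsum (splitting c' b) (\<lambda>x y. g (c \<otimes>\<^bsub>B\<^esub> x) y) \<approx>\<^bsub>H\<^esub>
      tsum (splitting c' b) (\<lambda>x y. tsum (comult B y) (\<lambda>y1 y2. tsum (splitting (c \<otimes>\<^bsub>B\<^esub> (x \<otimes>\<^bsub>B\<^esub> y1)) y2) g))"
  proof (rule BoB.tsum_cong[OF splitting_closed[OF c(2,3)]])
    fix x y assume xy: "x \<in> carrier (add_monoid B)" "y \<in> carrier (add_monoid B)"
    have "tsum (comult B y) (\<lambda>y1 y2. tsum (splitting ((c \<otimes>\<^bsub>B\<^esub> x) \<otimes>\<^bsub>B\<^esub> y1) y2) g) \<approx>\<^bsub>H\<^esub> g (c \<otimes>\<^bsub>B\<^esub> x) y"
      using xy c by (intro comult_splitting[OF g]) auto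
    moreover have "tsum (comult B y) (\<lambda>y1 y2. tsum (splitting ((c \<otimes>\<^bsub>B\<^esub> x) \<otimes>\<^bsub>B\<^esub> y1) y2) g) \<approx>\<^bsub>H\<^esub>
        tsum (comult B y) (\<lambda>y1 y2. tsum (splitting (c \<otimes>\<^bsub>B\<^esub> (x \<otimes>\<^bsub>B\<^esub> y1)) y2) g)"
      using xy c by (intro BB.tsum_cong comult_closed) (auto simp: B.m_assoc)
    ultimately show "g (c \<otimes>\<^bsub>B\<^esub> x) y \<approx>\<^bsub>H\<^esub>
        tsum (comult B y) (\<lambda>y1 y2. tsum (splitting (c \<otimes>\<^bsub>B\<^esub> (x \<otimes>\<^bsub>B\<^esub> y1)) y2) g)"
      by (rule cong_mod_trans[OF cong_mod_sym])
  qed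
  also have "\<dots> \<approx>\<^bsub>H\<^esub> tsum (splitting (c \<otimes>\<^bsub>B\<^esub> c') b) g"
    by (rule tsum_splitting[OF BB_bal_lmult_left[OF splitting_bal[OF g] c(1)] c(2,3)])
  finally show ?thesis by (rule cong_mod_sym)
qed

end

section \<open>Left bialgebroids\<close>

locale left_bialg =
  fixes S :: "(complex, 's) module" and K :: "('s, 'k) bialgebroid"
  assumes bialgebroid: "left_bialgebroid S K"
begin

sublocale S: Ring.ring S
  using bialgebroid by (auto simp: left_bialgebroid_def intro: complex_algebra_ring)

sublocale K: Ring.ring K
  using bialgebroid by (auto simp: left_bialgebroid_def intro: complex_algebra_ring)

lemma source_hom: "source K \<in> algebra_hom S K" and target_hom: "target K \<in> algebra_hom (opposite S) K"
  using bialgebroid by (auto simp: left_bialgebroid_def)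

lemmas source_simps [simp] = algebra_hom_facts[OF source_hom S.ring_axioms K.ring_axioms]
lemmas target_simps [simp] = algebra_hom_opposite_facts[OF target_hom]

lemma coring: "left_coring S K"
  using bialgebroid by (simp add: left_bialgebroid_def)

lemma counit_closed [simp]: "k \<in> carrier K \<Longrightarrow> counit K k \<in> carrier S"
  using coring by (auto simp: left_coring_def hom_def)

lemma counit_add: "k \<in> carrier K \<Longrightarrow> c \<in> carrier K \<Longrightarrow> counit K (k \<oplus>\<^bsub>K\<^esub> c) = counit K k \<oplus>\<^bsub>S\<^esub> counit K c"
  using coring by (auto simp: left_coring_def hom_def)

lemma counit_source_target:
  "k \<in> carrier K \<Longrightarrow> r \<in> carrier S \<Longrightarrow> r' \<in> carrier S \<Longrightarrow>
    counit K (source K r \<otimes>\<^bsub>K\<^esub> (target K r' \<otimes>\<^bsub>K\<^esub> k)) = r \<otimes>\<^bsub>S\<^esub> (counit K k \<otimes>\<^bsub>S\<^esub> r')"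
  using coring by (auto simp: left_coring_def)

lemma counit_source: "k \<in> carrier K \<Longrightarrow> r \<in> carrier S \<Longrightarrow> counit K (source K r \<otimes>\<^bsub>K\<^esub> k) = r \<otimes>\<^bsub>S\<^esub> counit K k"
  using counit_source_target[of k r "\<one>\<^bsub>S\<^esub>"] by simp

lemma counit_target: "k \<in> carrier K \<Longrightarrow> r \<in> carrier S \<Longrightarrow> counit K (target K r \<otimes>\<^bsub>K\<^esub> k) = counit K k \<otimes>\<^bsub>S\<^esub> r"
  using counit_source_target[of k "\<one>\<^bsub>S\<^esub>" r] by simp

sublocale KK: tensor_space "left_square S K" "carrier S"
  "add_monoid K" "\<lambda>k r. target K r \<otimes>\<^bsub>K\<^esub> k" "add_monoid K" "\<lambda>r k. source K r \<otimes>\<^bsub>K\<^esub> k"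
  by unfold_locales
     (auto simp: left_square_def left_tensor_def tensor_ok_def)

sublocale KoK: tensor_space "left_op_square S K" "carrier S"
  "add_monoid K" "\<lambda>k r. k \<otimes>\<^bsub>K\<^esub> target K r" "add_monoid K" "\<lambda>r k. target K r \<otimes>\<^bsub>K\<^esub> k"
  by unfold_locales
     (auto simp: left_op_square_def tensor_ok_def)

lemma comult_hom: "comult K \<in> hom (add_monoid K) (left_square S K)"
  using coring by (simp add: left_coring_def)

lemma comult_closed: "k \<in> carrier K \<Longrightarrow> comult K k \<in> carrier (left_square S K)"
  using comult_hom by (auto simp: hom_def)

lemma coring_axioms:
  assumes "D \<in> Pi (carrier K) (comult K)" "k \<in> carrier K"
  shows "\<And>r r'. r \<in> carrier S \<Longrightarrow> r' \<in> carrier S \<Longrightarrow>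
      comult K (source K r \<otimes>\<^bsub>K\<^esub> (target K r' \<otimes>\<^bsub>K\<^esub> k)) = tclass (left_square S K)
        (sweedler (D k) (\<lambda>k1 k2. frag_of (source K r \<otimes>\<^bsub>K\<^esub> k1, target K r' \<otimes>\<^bsub>K\<^esub> k2)))"
    and "value_sum (add_monoid K) (\<lambda>k1 k2. target K (counit K k2) \<otimes>\<^bsub>K\<^esub> k1) (D k) = k"
  using coring assms unfolding left_coring_def by blast+

lemma bialgebroid_axioms:
  assumes "D \<in> Pi (carrier K) (comult K)" "k \<in> carrier K"
  shows "\<And>r. r \<in> carrier S \<Longrightarrow>
      tclass (left_square S K) (sweedler (D k) (\<lambda>k1 k2. frag_of (k1 \<otimes>\<^bsub>K\<^esub> target K r, k2))) =
      tclass (left_square S K) (sweedler (D k) (\<lambda>k1 k2. frag_of (k1, k2 \<otimes>\<^bsub>K\<^esub> source K r)))"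
    and "\<And>k'. k' \<in> carrier K \<Longrightarrow> comult K (k \<otimes>\<^bsub>K\<^esub> k') = tclass (left_square S K)
        (sweedler (D k) (\<lambda>k1 k2. sweedler (D k') (\<lambda>k1' k2'. frag_of (k1 \<otimes>\<^bsub>K\<^esub> k1', k2 \<otimes>\<^bsub>K\<^esub> k2'))))"
  using bialgebroid assms unfolding left_bialgebroid_def by blast+

lemma rep_comult: "(\<lambda>k. rep (comult K k)) \<in> Pi (carrier K) (comult K)"
  by (auto intro: rep_mem[OF KK.pres] comult_closed)

lemma comult_additive: "KK.bal H f \<Longrightarrow> additive_mod (add_monoid K) H (\<lambda>k. tsum (comult K k) f)"
  by (rule additive_mod_comp[OF KK.tsum_additive comult_hom])

lemma takeuchi:
  assumes "KK.bal H f" "k \<in> carrier K" "r \<in> carrier S"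
  shows "tsum (comult K k) (\<lambda>k1 k2. f (k1 \<otimes>\<^bsub>K\<^esub> target K r) k2) \<approx>\<^bsub>H\<^esub>
    tsum (comult K k) (\<lambda>k1 k2. f k1 (k2 \<otimes>\<^bsub>K\<^esub> source K r))"
proof -
  have "tclass (left_square S K) (sweedler (rep (comult K k)) (\<lambda>k1 k2. frag_of (k1 \<otimes>\<^bsub>K\<^esub> target K r, k2))) =
      tclass (left_square S K) (sweedler (rep (comult K k)) (\<lambda>k1 k2. frag_of (k1, k2 \<otimes>\<^bsub>K\<^esub> source K r)))"
    by (rule bialgebroid_axioms(1)[OF rep_comult assms(2,3)])
  from this[unfolded tclass_eq_iff[OF KK.pres]]
  show ?thesis
    using descends_cong_mod[OF balanced_descends[OF assms(1)]] by (fastforce simp: sweedler_sweedler tsum_def)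
qed

lemma counit_right:
  assumes "additive_mod (add_monoid K) H u" "k \<in> carrier K"
  shows "tsum (comult K k) (\<lambda>k1 k2. u (target K (counit K k2) \<otimes>\<^bsub>K\<^esub> k1)) \<approx>\<^bsub>H\<^esub> u k"
proof -
  have "value_sum (add_monoid K) (\<lambda>k1 k2. target K (counit K k2) \<otimes>\<^bsub>K\<^esub> k1) (rep (comult K k)) = k"
    by (rule coring_axioms(2)[OF rep_comult assms(2)])
  moreover have "u (value_sum (add_monoid K) (\<lambda>k1 k2. target K (counit K k2) \<otimes>\<^bsub>K\<^esub> k1) (rep (comult K k)))
      \<approx>\<^bsub>H\<^esub> tsum (comult K k) (\<lambda>k1 k2. u (target K (counit K k2) \<otimes>\<^bsub>K\<^esub> k1))"
    unfolding tsum_def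
    by (rule additive_mod_value_sum[OF K.a_comm_group assms(1)])
       (use rep_keys[OF KK.pres comult_closed[OF assms(2)]] in auto)
  ultimately show ?thesis by (metis cong_mod_sym)
qed

text \<open>Mirror image of the right-handed case: both \<open>S\<close>-actions that form
  \<open>K \<otimes>_S K\<close> are left multiplications, so right multiplications preserve
  balance.\<close>

lemma KK_bal_rmult_left:
  assumes f: "KK.bal H f" and c: "c \<in> carrier K"
  shows "KK.bal H (\<lambda>x y. f (x \<otimes>\<^bsub>K\<^esub> c) y)"
proof (rule balancedI)
  fix n assume "n \<in> carrier (add_monoid K)"
  then show "additive_mod (add_monoid K) H (\<lambda>m. f (m \<otimes>\<^bsub>K\<^esub> c) n)"
    by (rule K.additive_mod_rmult[OF balanced_left[OF f] c])
next
  fix m assume "m \<in> carrier (add_monoid K)"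
  then show "additive_mod (add_monoid K) H (f (m \<otimes>\<^bsub>K\<^esub> c))"
    using c by (intro balanced_right[OF f]) simp
next
  fix m i n assume "m \<in> carrier (add_monoid K)" "i \<in> carrier S" "n \<in> carrier (add_monoid K)"
  then show "f ((target K i \<otimes>\<^bsub>K\<^esub> m) \<otimes>\<^bsub>K\<^esub> c) n \<approx>\<^bsub>H\<^esub> f (m \<otimes>\<^bsub>K\<^esub> c) (source K i \<otimes>\<^bsub>K\<^esub> n)"
    using balanced_middle[OF f, of "m \<otimes>\<^bsub>K\<^esub> c" i n] c by (simp add: K.m_assoc)
qed

lemma KK_bal_rmult_right:
  assumes f: "KK.bal H f" and c: "c \<in> carrier K"
  shows "KK.bal H (\<lambda>x y. f x (y \<otimes>\<^bsub>K\<^esub> c))"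
proof (rule balancedI)
  fix n assume "n \<in> carrier (add_monoid K)"
  then show "additive_mod (add_monoid K) H (\<lambda>m. f m (n \<otimes>\<^bsub>K\<^esub> c))"
    using c by (intro balanced_left[OF f]) simp
next
  fix m assume "m \<in> carrier (add_monoid K)"
  then show "additive_mod (add_monoid K) H (\<lambda>n. f m (n \<otimes>\<^bsub>K\<^esub> c))"
    by (rule K.additive_mod_rmult[OF balanced_right[OF f] c])
next
  fix m i n assume "m \<in> carrier (add_monoid K)" "i \<in> carrier S" "n \<in> carrier (add_monoid K)"
  then show "f (target K i \<otimes>\<^bsub>K\<^esub> m) (n \<otimes>\<^bsub>K\<^esub> c) \<approx>\<^bsub>H\<^esub> f m ((source K i \<otimes>\<^bsub>K\<^esub> n) \<otimes>\<^bsub>K\<^esub> c)"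
    using balanced_middle[OF f, of m i "n \<otimes>\<^bsub>K\<^esub> c"] c by (simp add: K.m_assoc)
qed

lemma comult_one_eq: "comult K \<one>\<^bsub>K\<^esub> = KK.pure \<one>\<^bsub>K\<^esub> \<one>\<^bsub>K\<^esub>"
  using bialgebroid by (simp add: left_bialgebroid_def)

text \<open>In a left bialgebroid bilinearity of \<open>\<Delta>\<close> puts target elements on the
  second leg, opposite to the right-handed case.\<close>

lemma comult_target_eq:
  assumes r: "r \<in> carrier S" shows "comult K (target K r) = KK.pure \<one>\<^bsub>K\<^esub> (target K r)"
proof -
  define D where "D = (\<lambda>k. if k = \<one>\<^bsub>K\<^esub> then frag_of (\<one>\<^bsub>K\<^esub>, \<one>\<^bsub>K\<^esub>) else rep (comult K k))"
  have "D \<in> Pi (carrier K) (comult K)"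
    using rep_comult by (auto simp: D_def comult_one_eq self_mem_tclass[OF KK.pres])
  from coring_axioms(1)[OF this K.one_closed S.one_closed r] show ?thesis
    using r by (simp add: D_def)
qed

lemma comult_target_right:
  assumes f: "KK.bal H f" and r: "r \<in> carrier S" and k: "k \<in> carrier K"
  shows "tsum (comult K (k \<otimes>\<^bsub>K\<^esub> target K r)) f \<approx>\<^bsub>H\<^esub> tsum (comult K k) (\<lambda>k1 k2. f k1 (k2 \<otimes>\<^bsub>K\<^esub> target K r))"
proof -
  define D where "D = (\<lambda>c. if c = target K r then frag_of (\<one>\<^bsub>K\<^esub>, target K r) else rep (comult K c))"
  have D: "D \<in> Pi (carrier K) (comult K)"
    using rep_comult r by (auto simp: D_def comult_target_eq self_mem_tclass[OF KK.pres])
  have "tsum (comult K (k \<otimes>\<^bsub>K\<^esub> target K r)) f \<approx>\<^bsub>H\<^esub> sweedler (D k)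
      (\<lambda>k1 k2. sweedler (sweedler (D (target K r)) (\<lambda>k1' k2'. frag_of (k1 \<otimes>\<^bsub>K\<^esub> k1', k2 \<otimes>\<^bsub>K\<^esub> k2'))) f)"
    by (rule KK.tsum_tclass_sweedler[OF f bialgebroid_axioms(2)[OF D k]]) (simp add: r)
  also have "\<dots> = sweedler (D k) (\<lambda>k1 k2. f (k1 \<otimes>\<^bsub>K\<^esub> \<one>\<^bsub>K\<^esub>) (k2 \<otimes>\<^bsub>K\<^esub> target K r))"
    unfolding sweedler_sweedler by (simp add: D_def)
  also have "\<dots> \<approx>\<^bsub>H\<^esub> tsum (comult K k) (\<lambda>k1 k2. f (k1 \<otimes>\<^bsub>K\<^esub> \<one>\<^bsub>K\<^esub>) (k2 \<otimes>\<^bsub>K\<^esub> target K r))"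
    by (rule KK.tsum_welldef[OF KK_bal_rmult_right[OF KK_bal_rmult_left[OF f]]])
       (use D k r in \<open>auto intro: comult_closed\<close>)
  also have "\<dots> \<approx>\<^bsub>H\<^esub> tsum (comult K k) (\<lambda>k1 k2. f k1 (k2 \<otimes>\<^bsub>K\<^esub> target K r))"
    by (rule KK.tsum_cong[OF comult_closed[OF k]]) simp
  finally show ?thesis .
qed

lemma nu_functional_bal:
  assumes f: "KK.bal H f"
  shows "KoK.bal H (\<lambda>c d. tsum (comult K c) (\<lambda>c1 c2. f c1 (c2 \<otimes>\<^bsub>K\<^esub> d)))"
proof (rule balancedI)
  fix d assume "d \<in> carrier (add_monoid K)"
  then show "additive_mod (add_monoid K) H (\<lambda>c. tsum (comult K c) (\<lambda>c1 c2. f c1 (c2 \<otimes>\<^bsub>K\<^esub> d)))"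
    by (intro comult_additive KK_bal_rmult_right f) simp
next
  fix c assume "c \<in> carrier (add_monoid K)"
  then show "additive_mod (add_monoid K) H (\<lambda>d. tsum (comult K c) (\<lambda>c1 c2. f c1 (c2 \<otimes>\<^bsub>K\<^esub> d)))"
    by (intro KK.additive_tsum_param comult_closed K.additive_mod_lmult[OF balanced_right[OF f]]) auto
next
  fix c i d assume *: "c \<in> carrier (add_monoid K)" "i \<in> carrier S" "d \<in> carrier (add_monoid K)"
  have "tsum (comult K (c \<otimes>\<^bsub>K\<^esub> target K i)) (\<lambda>c1 c2. f c1 (c2 \<otimes>\<^bsub>K\<^esub> d)) \<approx>\<^bsub>H\<^esub>
      tsum (comult K c) (\<lambda>c1 c2. f c1 ((c2 \<otimes>\<^bsub>K\<^esub> target K i) \<otimes>\<^bsub>K\<^esub> d))"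
    using * by (intro comult_target_right[OF KK_bal_rmult_right[OF f]]) auto
  also have "\<dots> \<approx>\<^bsub>H\<^esub> tsum (comult K c) (\<lambda>c1 c2. f c1 (c2 \<otimes>\<^bsub>K\<^esub> (target K i \<otimes>\<^bsub>K\<^esub> d)))"
    using * by (intro KK.tsum_cong comult_closed) (auto simp: K.m_assoc)
  finally show "tsum (comult K (c \<otimes>\<^bsub>K\<^esub> target K i)) (\<lambda>c1 c2. f c1 (c2 \<otimes>\<^bsub>K\<^esub> d)) \<approx>\<^bsub>H\<^esub>
      tsum (comult K c) (\<lambda>c1 c2. f c1 (c2 \<otimes>\<^bsub>K\<^esub> (target K i \<otimes>\<^bsub>K\<^esub> d)))" .
qed

lemma left_nu_eq:
  assumes U: "U \<in> carrier (left_op_square S K)"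
  shows "left_nu S K U = tclass (left_square S K)
    (tsum U (\<lambda>c d. tsum (comult K c) (\<lambda>c1 c2. frag_of (c1, c2 \<otimes>\<^bsub>K\<^esub> d))))"
  unfolding left_nu_def
proof (rule the_elem_eqI, goal_cases)
  case 1
  show ?case unfolding tsum_def
    by (intro CollectI exI[of _ "rep U"] exI[of _ "\<lambda>k. rep (comult K k)"] conjI refl rep_comult rep_mem[OF KoK.pres U])
next
  case (2 V)
  then obtain z D where z: "z \<in> U" and D: "D \<in> Pi (carrier K) (comult K)"
    and V: "V = tclass (left_square S K) (sweedler z (\<lambda>k k'. sweedler (D k) (\<lambda>k1 k2. frag_of (k1, k2 \<otimes>\<^bsub>K\<^esub> k'))))"
    by blast
  have "sweedler z (\<lambda>k k'. sweedler (D k) (\<lambda>k1 k2. frag_of (k1, k2 \<otimes>\<^bsub>K\<^esub> k'))) \<approx>\<^bsub>KK.rels\<^esub>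
      sweedler z (\<lambda>c d. tsum (comult K c) (\<lambda>c1 c2. frag_of (c1, c2 \<otimes>\<^bsub>K\<^esub> d)))"
    using D by (intro sweedler_cong_mod[OF mem_carrier_keys[OF KoK.pres U z]]
        KK.tsum_welldef KK_bal_rmult_right[OF balanced_frag_of] comult_closed) auto
  also have "\<dots> \<approx>\<^bsub>KK.rels\<^esub> tsum U (\<lambda>c d. tsum (comult K c) (\<lambda>c1 c2. frag_of (c1, c2 \<otimes>\<^bsub>K\<^esub> d)))"
    by (rule KoK.tsum_welldef[OF nu_functional_bal[OF balanced_frag_of] U z])
  finally show ?case unfolding V by (rule tclass_eqI[OF KK.pres])
qed

end

locale left_hopf = left_bialg S K for S :: "(complex, 's) module" and K :: "('s, 'k) bialgebroid" +
  assumes nu_bij: "bij_betw (left_nu S K) (carrier (left_op_square S K)) (carrier (left_square S K))"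
begin

sublocale nu: tensor_iso "left_op_square S K" "carrier S"
  "add_monoid K" "\<lambda>k r. k \<otimes>\<^bsub>K\<^esub> target K r" "add_monoid K" "\<lambda>r k. target K r \<otimes>\<^bsub>K\<^esub> k"
  "left_square S K" "carrier S"
  "add_monoid K" "\<lambda>k r. target K r \<otimes>\<^bsub>K\<^esub> k" "add_monoid K" "\<lambda>r k. source K r \<otimes>\<^bsub>K\<^esub> k"
  "left_nu S K" "\<lambda>c d. tsum (comult K c) (\<lambda>c1 c2. frag_of (c1, c2 \<otimes>\<^bsub>K\<^esub> d))"
proof (unfold_locales, goal_cases)
  case (1 x y)
  then show ?case unfolding tsum_def
    by (intro keys_sweedler[OF rep_keys[OF KK.pres comult_closed]]) auto
next
  case 2
  then show ?case by (rule nu_functional_bal[OF balanced_frag_of])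
next
  case (3 U)
  then show ?case by (rule left_nu_eq)
next
  case 4
  then show ?case by (rule nu_bij)
qed

lemma left_translation_eq: "left_translation S K k = nu.h_inv (KK.pure k \<one>\<^bsub>K\<^esub>)"
  by (simp add: left_translation_def)

lemma left_translation_closed: "k \<in> carrier K \<Longrightarrow> left_translation S K k \<in> carrier (left_op_square S K)"
  unfolding left_translation_eq by (intro nu.h_inv_closed KK.pure_closed) auto

lemma rep_left_translation: "(\<lambda>k. rep (left_translation S K k)) \<in> Pi (carrier K) (left_translation S K)"
  by (auto intro: rep_mem[OF KoK.pres] left_translation_closed)

text \<open>The identity \<open>(k^-)^1 \<otimes> (k^-)^2 k^+ = k \<otimes> 1\<close>. It is what
  cancels \<open>k^-\<close> against \<open>k^+\<close> in the anti Yetter-Drinfeld condition of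
  \<open>M\<close>.\<close>

lemma tsum_left_translation:
  assumes "KK.bal H f" "k \<in> carrier K"
  shows "tsum (left_translation S K k) (\<lambda>x y. tsum (comult K x) (\<lambda>x1 x2. f x1 (x2 \<otimes>\<^bsub>K\<^esub> y))) \<approx>\<^bsub>H\<^esub> f k \<one>\<^bsub>K\<^esub>"
  using nu.tsum_h_inv[OF assms(1)] assms(2) by (simp add: left_translation_eq sweedler_tsum)

end

section \<open>Right comodules\<close>

text \<open>Kept apart from the comodule locale because the tensor product with \<open>B\<close>
  must be available before a coaction into it can be shown to satisfy the comodule axioms. This
  order is needed for \<open>M \<otimes>_K T\<close>.\<close>

locale right_mod = right_bialg R B
  for R :: "(complex, 'r) module" and B :: "('r, 'b) bialgebroid" +
  fixes M :: "('m, 'g) monoid_scheme" and ra :: "'m \<Rightarrow> 'r \<Rightarrow> 'm"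
  assumes right_module: "right_module R M ra"
begin

lemma comm_group: "comm_group M"
  using right_module by (simp add: right_module_def)

lemma monoid: "Group.monoid M"
  using comm_group by (simp add: comm_group_def group_def)

lemma ra_closed [simp]: "m \<in> carrier M \<Longrightarrow> r \<in> carrier R \<Longrightarrow> ra m r \<in> carrier M"
  and ra_hom: "r \<in> carrier R \<Longrightarrow> (\<lambda>m. ra m r) \<in> hom M M"
  and ra_add: "m \<in> carrier M \<Longrightarrow> r \<in> carrier R \<Longrightarrow> r' \<in> carrier R \<Longrightarrow> ra m (r \<oplus>\<^bsub>R\<^esub> r') = ra m r \<otimes>\<^bsub>M\<^esub> ra m r'"
  and ra_mult: "m \<in> carrier M \<Longrightarrow> r \<in> carrier R \<Longrightarrow> r' \<in> carrier R \<Longrightarrow> ra m (r \<otimes>\<^bsub>R\<^esub> r') = ra (ra m r) r'"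
  and ra_one: "m \<in> carrier M \<Longrightarrow> ra m \<one>\<^bsub>R\<^esub> = m"
  using right_module by (auto simp: right_module_def hom_def)

sublocale MB: tensor_space "right_tensor R B M ra" "carrier R" M ra "add_monoid B" "\<lambda>r b. b \<otimes>\<^bsub>B\<^esub> target B r"
  by unfold_locales
     (auto simp: right_tensor_def tensor_ok_def monoid)

text \<open>Taking \<open>c\<close> to be \<open>source B r\<close> gives the integrand of the
  canonical left action, and \<open>c = 1\<close> gives that of the counit axiom.\<close>

lemma left_act_bal:
  assumes u: "additive_mod M H u" and c: "c \<in> carrier B"
  shows "MB.bal H (\<lambda>n b. u (ra n (counit B (c \<otimes>\<^bsub>B\<^esub> b))))"
proof (rule balancedI)
  fix b assume "b \<in> carrier (add_monoid B)"
  then show "additive_mod M H (\<lambda>n. u (ra n (counit B (c \<otimes>\<^bsub>B\<^esub> b))))"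
    using c by (intro additive_mod_comp[OF u ra_hom]) simp
next
  fix n assume "n \<in> carrier M"
  then show "additive_mod (add_monoid B) H (\<lambda>b. u (ra n (counit B (c \<otimes>\<^bsub>B\<^esub> b))))"
    using c by (intro additive_mod_addI) (simp add: B.r_distr counit_add ra_add additive_modD[OF u])
next
  fix n r b assume "n \<in> carrier M" "r \<in> carrier R" "b \<in> carrier (add_monoid B)"
  then show "u (ra (ra n r) (counit B (c \<otimes>\<^bsub>B\<^esub> b))) \<approx>\<^bsub>H\<^esub> u (ra n (counit B (c \<otimes>\<^bsub>B\<^esub> (b \<otimes>\<^bsub>B\<^esub> target B r))))"
    using c by (intro cong_mod_eq) (simp add: B.m_assoc[symmetric] counit_target ra_mult)
qed

end

locale right_comod = right_mod R B M ra
  for R :: "(complex, 'r) module" and B :: "('r, 'b) bialgebroid"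
    and M :: "('m, 'g) monoid_scheme" and ra :: "'m \<Rightarrow> 'r \<Rightarrow> 'm" +
  fixes \<rho> :: "'m \<Rightarrow> ('m \<times> 'b) tensor"
  assumes comodule: "right_comodule R B M ra \<rho>"
begin

lemma coact_hom: "\<rho> \<in> hom M (right_tensor R B M ra)"
  using comodule by (simp add: right_comodule_def)

lemma coact_closed: "m \<in> carrier M \<Longrightarrow> \<rho> m \<in> carrier (right_tensor R B M ra)"
  using coact_hom by (auto simp: hom_def)

lemma rep_coact: "(\<lambda>m. rep (\<rho> m)) \<in> Pi (carrier M) \<rho>"
  by (auto intro: rep_mem[OF MB.pres] coact_closed)

lemma coact_additive: "MB.bal H f \<Longrightarrow> additive_mod M H (\<lambda>m. tsum (\<rho> m) f)"
  by (rule additive_mod_comp[OF MB.tsum_additive coact_hom])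

lemma comodule_axioms:
  assumes "m \<in> carrier M"
  shows "\<And>C r. C \<in> Pi (carrier M) \<rho> \<Longrightarrow> r \<in> carrier R \<Longrightarrow>
      \<rho> (ra m r) = tclass (right_tensor R B M ra) (sweedler (C m) (\<lambda>n b. frag_of (n, b \<otimes>\<^bsub>B\<^esub> source B r)))"
    and "\<And>z. z \<in> \<rho> m \<Longrightarrow> value_sum M (\<lambda>n b. ra n (counit B b)) z = m"
  using comodule assms unfolding right_comodule_def by blast+

lemma coact_ra:
  assumes "MB.bal H f" "m \<in> carrier M" "r \<in> carrier R"
  shows "tsum (\<rho> (ra m r)) f \<approx>\<^bsub>H\<^esub> tsum (\<rho> m) (\<lambda>n b. f n (b \<otimes>\<^bsub>B\<^esub> source B r))"
  using MB.tsum_tclass_sweedler[OF assms(1) comodule_axioms(1)[OF assms(2) rep_coact assms(3)]]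
  by (simp add: tsum_def)

abbreviation "bal3 \<equiv> balanced3 (carrier R) M ra
  (add_monoid B) (\<lambda>r b. b \<otimes>\<^bsub>B\<^esub> target B r) (\<lambda>b r. b \<otimes>\<^bsub>B\<^esub> source B r)
  (add_monoid B) (\<lambda>r b. b \<otimes>\<^bsub>B\<^esub> target B r)"

abbreviation "MBB \<equiv> tensor3 (carrier R) M ra
  (add_monoid B) (\<lambda>r b. b \<otimes>\<^bsub>B\<^esub> target B r) (\<lambda>b r. b \<otimes>\<^bsub>B\<^esub> source B r)
  (add_monoid B) (\<lambda>r b. b \<otimes>\<^bsub>B\<^esub> target B r)"

abbreviation "rels3 \<equiv> tensor3_rels (carrier R) M ra
  (add_monoid B) (\<lambda>r b. b \<otimes>\<^bsub>B\<^esub> target B r) (\<lambda>b r. b \<otimes>\<^bsub>B\<^esub> source B r)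
  (add_monoid B) (\<lambda>r b. b \<otimes>\<^bsub>B\<^esub> target B r)"

lemma pres3: "presented MBB (carrier M \<times> carrier (add_monoid B) \<times> carrier (add_monoid B)) rels3"
  by (rule presented_tensor3) (auto simp: monoid)

lemma coact_coassoc:
  assumes f: "bal3 H f" and m: "m \<in> carrier M"
  shows "tsum (\<rho> m) (\<lambda>n b. tsum (comult B b) (\<lambda>b1 b2. f n b1 b2)) \<approx>\<^bsub>H\<^esub>
    tsum (\<rho> m) (\<lambda>n b. tsum (\<rho> n) (\<lambda>n' b'. f n' b' b))"
proof -
  have "\<And>D C. D \<in> Pi (carrier B) (comult B) \<Longrightarrow> C \<in> Pi (carrier M) \<rho> \<Longrightarrow>
      tclass MBB (sweedler (C m) (\<lambda>n b. sweedler (D b) (\<lambda>b1 b2. frag_of (n, b1, b2)))) =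
      tclass MBB (sweedler (C m) (\<lambda>n b. sweedler (C n) (\<lambda>n' b'. frag_of (n', b', b))))"
    using comodule m unfolding right_comodule_def right_coassociative_def Let_def by blast
  from this[OF rep_comult rep_coact, unfolded tclass_eq_iff[OF pres3]]
  have "frag_extend (\<lambda>(x, y, z). f x y z) (sweedler (rep (\<rho> m)) (\<lambda>n b. sweedler (rep (comult B b)) (\<lambda>b1 b2. frag_of (n, b1, b2)))) \<approx>\<^bsub>H\<^esub>
      frag_extend (\<lambda>(x, y, z). f x y z) (sweedler (rep (\<rho> m)) (\<lambda>n b. sweedler (rep (\<rho> n)) (\<lambda>n' b'. frag_of (n', b', b))))"
    by (rule descends_cong_mod[OF balanced3_descends[OF f]])
  then show ?thesis unfolding tsum_def sweedler_sweedler3 by simp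
qed

lemma coact_counit:
  assumes "additive_mod M H u" "m \<in> carrier M"
  shows "tsum (\<rho> m) (\<lambda>n b. u (ra n (counit B b))) \<approx>\<^bsub>H\<^esub> u m"
proof -
  have "value_sum M (\<lambda>n b. ra n (counit B b)) (rep (\<rho> m)) = m"
    using comodule_axioms(2)[OF assms(2) rep_mem[OF MB.pres coact_closed[OF assms(2)]]] .
  moreover have "u (value_sum M (\<lambda>n b. ra n (counit B b)) (rep (\<rho> m))) \<approx>\<^bsub>H\<^esub> tsum (\<rho> m) (\<lambda>n b. u (ra n (counit B b)))"
    unfolding tsum_def
    by (rule additive_mod_value_sum[OF comm_group assms(1)])
       (use rep_keys[OF MB.pres coact_closed[OF assms(2)]] in auto)
  ultimately show ?thesis by (metis cong_mod_sym)
qed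

abbreviation "left_act \<equiv> right_comodule_left_action B M ra \<rho>"

lemma left_act_eq:
  assumes "m \<in> carrier M" "r \<in> carrier R"
  shows "left_act r m = value_sum M (\<lambda>n b. ra n (counit B (source B r \<otimes>\<^bsub>B\<^esub> b))) (rep (\<rho> m))"
    and "left_act r m \<in> carrier M"
proof -
  let ?f = "\<lambda>n b. ra n (counit B (source B r \<otimes>\<^bsub>B\<^esub> b))"
  have bal: "MB.bal (group_rels M) (\<lambda>n b. frag_of (?f n b))"
    by (rule left_act_bal[OF additive_mod_frag_of]) (simp add: assms)
  have closed: "?f n b \<in> carrier M" if "n \<in> carrier M" "b \<in> carrier (add_monoid B)" for n b
    using that assms by simp
  have v: "value_sum M ?f z = value_sum M ?f (rep (\<rho> m))" "value_sum M ?f z \<in> carrier M" if "z \<in> \<rho> m" for z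
    by (rule MB.value_sum_welldef[OF comm_group bal closed coact_closed[OF assms(1)] that]; assumption)+
  have mem: "rep (\<rho> m) \<in> \<rho> m" by (rule rep_mem[OF MB.pres coact_closed[OF assms(1)]])
  show eq: "left_act r m = value_sum M ?f (rep (\<rho> m))"
    unfolding right_comodule_left_action_def
  proof (rule the_elem_eqI, goal_cases)
    case 1 show ?case using mem by blast
  next
    case (2 x) then show ?case using v(1) by blast
  qed
  show "left_act r m \<in> carrier M"
    unfolding eq by (rule v(2)[OF mem])
qed

lemma tsum_left_act:
  assumes u: "additive_mod M H u" and "m \<in> carrier M" "r \<in> carrier R"
  shows "u (left_act r m) \<approx>\<^bsub>H\<^esub> tsum (\<rho> m) (\<lambda>n b. u (ra n (counit B (source B r \<otimes>\<^bsub>B\<^esub> b))))"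
  unfolding left_act_eq(1)[OF assms(2,3)] tsum_def
  by (rule additive_mod_value_sum[OF comm_group u])
     (use rep_keys[OF MB.pres coact_closed[OF assms(2)]] assms(3) in auto)

text \<open>The functional that \<open>counit_left\<close> evaluates. Its balance is needed in order
  to apply the Takeuchi condition to it.\<close>

lemma counit_target_bal:
  assumes u: "additive_mod (add_monoid B) H u"
  shows "BB.bal H (\<lambda>b1 b2. u (b2 \<otimes>\<^bsub>B\<^esub> target B (counit B b1)))"
proof (rule balancedI)
  fix n assume "n \<in> carrier (add_monoid B)"
  then show "additive_mod (add_monoid B) H (\<lambda>m. u (n \<otimes>\<^bsub>B\<^esub> target B (counit B m)))"
    by (intro additive_mod_addI) (simp add: counit_add B.r_distr additive_mod_addD[OF u])
next
  fix m assume "m \<in> carrier (add_monoid B)"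
  then show "additive_mod (add_monoid B) H (\<lambda>n. u (n \<otimes>\<^bsub>B\<^esub> target B (counit B m)))"
    by (intro B.additive_mod_rmult[OF u]) simp
next
  fix m i n assume "m \<in> carrier (add_monoid B)" "i \<in> carrier R" "n \<in> carrier (add_monoid B)"
  then show "u (n \<otimes>\<^bsub>B\<^esub> target B (counit B (m \<otimes>\<^bsub>B\<^esub> source B i))) \<approx>\<^bsub>H\<^esub>
      u ((n \<otimes>\<^bsub>B\<^esub> target B i) \<otimes>\<^bsub>B\<^esub> target B (counit B m))"
    by (intro cong_mod_eq) (simp add: counit_source B.m_assoc)
qed

text \<open>Acting on \<open>m_0\<close> introduces a second coaction, which coassociativity turns
  into a coproduct. Balance moves the scalar \<open>\<epsilon>(s(r) b1)\<close> to the right of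
  \<open>b2\<close> as a target element, and the Takeuchi condition followed by the counit leaves
  \<open>t(r) b\<close>. So the coaction takes values in a Takeuchi-type subspace.\<close>

lemma coact_left_act:
  assumes f: "MB.bal H f" and m: "m \<in> carrier M" and r: "r \<in> carrier R"
  shows "tsum (\<rho> m) (\<lambda>n b. f (left_act r n) b) \<approx>\<^bsub>H\<^esub> tsum (\<rho> m) (\<lambda>n b. f n (target B r \<otimes>\<^bsub>B\<^esub> b))"
proof -
  let ?g = "\<lambda>n b b'. f (ra n (counit B (source B r \<otimes>\<^bsub>B\<^esub> b))) b'"
  have g: "bal3 H ?g"
  proof (rule balanced3I)
    fix b b' assume "b \<in> carrier (add_monoid B)" "b' \<in> carrier (add_monoid B)"
    then show "additive_mod M H (\<lambda>n. ?g n b b')"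
      using r by (intro additive_mod_comp[OF balanced_left[OF f] ra_hom]) auto
  next
    fix n b' assume "n \<in> carrier M" "b' \<in> carrier (add_monoid B)"
    then show "additive_mod (add_monoid B) H (\<lambda>b. ?g n b b')"
      using r by (intro balanced_right[OF left_act_bal[OF balanced_left[OF f]]]) auto
  next
    fix n b assume "n \<in> carrier M" "b \<in> carrier (add_monoid B)"
    then show "additive_mod (add_monoid B) H (?g n b)"
      using r by (intro balanced_right[OF f]) auto
  next
    fix n i b b' assume "n \<in> carrier M" "i \<in> carrier R" "b \<in> carrier (add_monoid B)" "b' \<in> carrier (add_monoid B)"
    then show "?g (ra n i) b b' \<approx>\<^bsub>H\<^esub> ?g n (b \<otimes>\<^bsub>B\<^esub> target B i) b'"
      using r by (intro balanced_middle[OF left_act_bal[OF balanced_left[OF f]]]) auto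
  next
    fix n i b b' assume *: "n \<in> carrier M" "i \<in> carrier R" "b \<in> carrier (add_monoid B)" "b' \<in> carrier (add_monoid B)"
    then have "?g n (b \<otimes>\<^bsub>B\<^esub> source B i) b' = f (ra (ra n (counit B (source B r \<otimes>\<^bsub>B\<^esub> b))) i) b'"
      using r by (simp add: B.m_assoc[symmetric] counit_source ra_mult)
    also have "\<dots> \<approx>\<^bsub>H\<^esub> ?g n b (b' \<otimes>\<^bsub>B\<^esub> target B i)"
      using * r by (intro balanced_middle[OF f]) auto
    finally show "?g n (b \<otimes>\<^bsub>B\<^esub> source B i) b' \<approx>\<^bsub>H\<^esub> ?g n b (b' \<otimes>\<^bsub>B\<^esub> target B i)" .
  qed
  have "tsum (\<rho> m) (\<lambda>n b. f (left_act r n) b) \<approx>\<^bsub>H\<^esub> tsum (\<rho> m) (\<lambda>n b. tsum (\<rho> n) (\<lambda>n' b'. ?g n' b' b))"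
    by (rule MB.tsum_cong[OF coact_closed[OF m]], rule tsum_left_act[OF balanced_left[OF f]]) (use r in auto)
  also have "\<dots> \<approx>\<^bsub>H\<^esub> tsum (\<rho> m) (\<lambda>n b. tsum (comult B b) (\<lambda>b1 b2. ?g n b1 b2))"
    by (rule cong_mod_sym, rule coact_coassoc[OF g m])
  also have "\<dots> \<approx>\<^bsub>H\<^esub> tsum (\<rho> m) (\<lambda>n b. f n (target B r \<otimes>\<^bsub>B\<^esub> b))"
  proof (rule MB.tsum_cong[OF coact_closed[OF m]])
    fix n b assume n: "n \<in> carrier M" and "b \<in> carrier (add_monoid B)"
    then have b: "b \<in> carrier B" by simp
    have "tsum (comult B b) (\<lambda>b1 b2. ?g n b1 b2) \<approx>\<^bsub>H\<^esub>
        tsum (comult B b) (\<lambda>b1 b2. f n (b2 \<otimes>\<^bsub>B\<^esub> target B (counit B (source B r \<otimes>\<^bsub>B\<^esub> b1))))"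
      using n r by (intro BB.tsum_cong[OF comult_closed[OF b]] balanced_middle[OF f]) auto
    also have "\<dots> \<approx>\<^bsub>H\<^esub> tsum (comult B b) (\<lambda>b1 b2. f n ((target B r \<otimes>\<^bsub>B\<^esub> b2) \<otimes>\<^bsub>B\<^esub> target B (counit B b1)))"
      by (rule cong_mod_sym, rule takeuchi[OF counit_target_bal[OF balanced_right[OF f n]] b r])
    also have "\<dots> \<approx>\<^bsub>H\<^esub> tsum (comult B b) (\<lambda>b1 b2. f n (target B r \<otimes>\<^bsub>B\<^esub> (b2 \<otimes>\<^bsub>B\<^esub> target B (counit B b1))))"
      using r by (intro BB.tsum_cong[OF comult_closed[OF b]]) (simp add: B.m_assoc)
    also have "\<dots> \<approx>\<^bsub>H\<^esub> f n (target B r \<otimes>\<^bsub>B\<^esub> b)"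
      using r by (intro counit_left[OF B.additive_mod_lmult[OF balanced_right[OF f n]] b]) simp
    finally show "tsum (comult B b) (\<lambda>b1 b2. ?g n b1 b2) \<approx>\<^bsub>H\<^esub> f n (target B r \<otimes>\<^bsub>B\<^esub> b)" .
  qed
  finally show ?thesis .
qed

end

section \<open>Equivariant Galois extensions\<close>

locale galois_setting = rb: right_hopf R B + lk: left_hopf S K
  for R :: "(complex, 'r) module" and B :: "('r, 'b) bialgebroid"
    and S :: "(complex, 't) module" and K :: "('t, 'k) bialgebroid" +
  fixes T :: "('r, 'b, 't) comodule_algebra" and act :: "'k \<Rightarrow> 't \<Rightarrow> 't"
  assumes comodule_algebra: "right_comodule_algebra R B T"
    and S_eq: "S = coinvariants R B T"
    and module_algebra: "left_module_algebra S K T act"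
    and galois: "equivariant_galois_extension R B T K act"
begin

sublocale T: Ring.ring T
  using comodule_algebra by (auto simp: right_comodule_algebra_def intro: complex_algebra_ring)

sublocale tc: right_comod R B "add_monoid T" "right_act T" "coaction T"
  by unfold_locales (use comodule_algebra in \<open>simp_all add: right_comodule_algebra_def right_comodule_def\<close>)

text \<open>Through this map both \<open>R\<close>-actions on \<open>T\<close> become
  multiplications in \<open>T\<close>, and associativity of \<open>T\<close> applies to
  them.\<close>

definition iota :: "'r \<Rightarrow> 't" where
  "iota r = right_act T \<one>\<^bsub>T\<^esub> r"

lemma iota_closed [simp]: "r \<in> carrier R \<Longrightarrow> iota r \<in> carrier T"
  using tc.ra_closed[of "\<one>\<^bsub>T\<^esub>" r] by (simp add: iota_def)

lemma right_act_balanced: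
  "r \<in> carrier R \<Longrightarrow> t \<in> carrier T \<Longrightarrow> t' \<in> carrier T \<Longrightarrow>
    right_act T t r \<otimes>\<^bsub>T\<^esub> t' = t \<otimes>\<^bsub>T\<^esub> tc.left_act r t'"
  using comodule_algebra by (auto simp: right_comodule_algebra_def)

text \<open>The axiom \<open>(t r) t' = t (r t')\<close> at \<open>t = 1\<close>. Its instance at
  \<open>t' = 1\<close> then gives the right-handed version.\<close>

lemma left_act_eq_iota: "r \<in> carrier R \<Longrightarrow> t \<in> carrier T \<Longrightarrow> tc.left_act r t = iota r \<otimes>\<^bsub>T\<^esub> t"
  using right_act_balanced[of r "\<one>\<^bsub>T\<^esub>" t] tc.left_act_eq(2)[of t r] by (simp add: iota_def)

lemma right_act_eq_iota: "r \<in> carrier R \<Longrightarrow> t \<in> carrier T \<Longrightarrow> right_act T t r = t \<otimes>\<^bsub>T\<^esub> iota r"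
  using right_act_balanced[of r t "\<one>\<^bsub>T\<^esub>"] left_act_eq_iota[of r "\<one>\<^bsub>T\<^esub>"] tc.ra_closed[of t r] by simp

lemma coaction_closed: "t \<in> carrier T \<Longrightarrow> coaction T t \<in> carrier (right_tensor R B (add_monoid T) (right_act T))"
  using tc.coact_closed by simp

lemma coaction_iota_right:
  assumes "tc.MB.bal H f" "t \<in> carrier T" "r \<in> carrier R" "b \<in> carrier B"
  shows "f (t \<otimes>\<^bsub>T\<^esub> iota r) b \<approx>\<^bsub>H\<^esub> f t (b \<otimes>\<^bsub>B\<^esub> target B r)"
  using balanced_middle[OF assms(1), of t r b] assms by (simp add: right_act_eq_iota)

lemma coaction_iota_left:
  assumes "tc.MB.bal H f" "t \<in> carrier T" "r \<in> carrier R"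
  shows "tsum (coaction T t) (\<lambda>a b. f (iota r \<otimes>\<^bsub>T\<^esub> a) b) \<approx>\<^bsub>H\<^esub> tsum (coaction T t) (\<lambda>a b. f a (target B r \<otimes>\<^bsub>B\<^esub> b))"
proof -
  have "tsum (coaction T t) (\<lambda>a b. f (iota r \<otimes>\<^bsub>T\<^esub> a) b) \<approx>\<^bsub>H\<^esub> tsum (coaction T t) (\<lambda>a b. f (tc.left_act r a) b)"
    using assms by (intro tc.MB.tsum_cong coaction_closed) (auto simp: left_act_eq_iota)
  also have "\<dots> \<approx>\<^bsub>H\<^esub> tsum (coaction T t) (\<lambda>a b. f a (target B r \<otimes>\<^bsub>B\<^esub> b))"
    by (rule tc.coact_left_act) (use assms in auto)
  finally show ?thesis .
qed

lemma coaction_one: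
  assumes "tc.MB.bal H f" shows "tsum (coaction T \<one>\<^bsub>T\<^esub>) f \<approx>\<^bsub>H\<^esub> f \<one>\<^bsub>T\<^esub> \<one>\<^bsub>B\<^esub>"
  using comodule_algebra tc.MB.tsum_pure[OF assms, of "\<one>\<^bsub>T\<^esub>" "\<one>\<^bsub>B\<^esub>"] by (simp add: right_comodule_algebra_def)

lemma coaction_mult_eq:
  assumes "t \<in> carrier T" "t' \<in> carrier T" "z \<in> coaction T t" "z' \<in> coaction T t'"
  shows "coaction T (t \<otimes>\<^bsub>T\<^esub> t') = tclass (right_tensor R B (add_monoid T) (right_act T))
    (sweedler z (\<lambda>a b. sweedler z' (\<lambda>a' b'. frag_of (a \<otimes>\<^bsub>T\<^esub> a', b \<otimes>\<^bsub>B\<^esub> b'))))"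
  using comodule_algebra assms unfolding right_comodule_algebra_def by blast

lemma rep_coaction: "t \<in> carrier T \<Longrightarrow> rep (coaction T t) \<in> coaction T t"
  by (rule rep_mem[OF tc.MB.pres coaction_closed])

text \<open>Arbitrary representatives are allowed so that \<open>s \<otimes> 1\<close> can be
  inserted when one factor is coinvariant.\<close>

lemma coaction_mult_sweedler:
  assumes "tc.MB.bal H f" "t \<in> carrier T" "t' \<in> carrier T" "z \<in> coaction T t" "z' \<in> coaction T t'"
  shows "tsum (coaction T (t \<otimes>\<^bsub>T\<^esub> t')) f \<approx>\<^bsub>H\<^esub>
    sweedler z (\<lambda>a b. sweedler z' (\<lambda>a' b'. f (a \<otimes>\<^bsub>T\<^esub> a') (b \<otimes>\<^bsub>B\<^esub> b')))"
  using tc.MB.tsum_tclass_sweedler[OF assms(1) coaction_mult_eq[OF assms(2-5)]]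
  unfolding sweedler_sweedler by simp

lemma coaction_mult:
  assumes "tc.MB.bal H f" "t \<in> carrier T" "t' \<in> carrier T"
  shows "tsum (coaction T (t \<otimes>\<^bsub>T\<^esub> t')) f \<approx>\<^bsub>H\<^esub>
    tsum (coaction T t) (\<lambda>a b. tsum (coaction T t') (\<lambda>a' b'. f (a \<otimes>\<^bsub>T\<^esub> a') (b \<otimes>\<^bsub>B\<^esub> b')))"
  using coaction_mult_sweedler[OF assms rep_coaction rep_coaction] assms by (simp add: tsum_def)

text \<open>Right linearity of the coaction over \<open>R\<close>, applied to the unit, whose
  representative is chosen as \<open>1 \<otimes> 1\<close>.\<close>

lemma coaction_iota:
  assumes "tc.MB.bal H f" "r \<in> carrier R"
  shows "tsum (coaction T (iota r)) f \<approx>\<^bsub>H\<^esub> f \<one>\<^bsub>T\<^esub> (source B r)"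
proof -
  define C where "C = (\<lambda>t. if t = \<one>\<^bsub>T\<^esub> then frag_of (\<one>\<^bsub>T\<^esub>, \<one>\<^bsub>B\<^esub>) else rep (coaction T t))"
  have one: "coaction T \<one>\<^bsub>T\<^esub> = tc.MB.pure \<one>\<^bsub>T\<^esub> \<one>\<^bsub>B\<^esub>"
    using comodule_algebra by (simp add: right_comodule_algebra_def)
  have "C \<in> Pi (carrier (add_monoid T)) (coaction T)"
    using rep_coaction by (auto simp: C_def one self_mem_tclass[OF tc.MB.pres])
  from tc.comodule_axioms(1)[OF _ this assms(2), of "\<one>\<^bsub>T\<^esub>"]
  have "coaction T (iota r) = tc.MB.pure \<one>\<^bsub>T\<^esub> (source B r)"
    using assms(2) by (simp add: C_def iota_def)
  then show ?thesis using tc.MB.tsum_pure[OF assms(1)] by simp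
qed

lemma S_carrier: "s \<in> carrier S \<Longrightarrow> s \<in> carrier T"
  and S_coaction: "s \<in> carrier S \<Longrightarrow> coaction T s = tc.MB.pure s \<one>\<^bsub>B\<^esub>"
  and S_ops: "a \<otimes>\<^bsub>S\<^esub> b = a \<otimes>\<^bsub>T\<^esub> b" "a \<oplus>\<^bsub>S\<^esub> b = a \<oplus>\<^bsub>T\<^esub> b" "\<one>\<^bsub>S\<^esub> = \<one>\<^bsub>T\<^esub>"
  by (auto simp: S_eq coinvariants_def)

lemma S_mem_coaction: "s \<in> carrier S \<Longrightarrow> frag_of (s, \<one>\<^bsub>B\<^esub>) \<in> coaction T s"
  by (simp add: S_coaction self_mem_tclass[OF tc.MB.pres])

text \<open>The right \<open>R\<close>-action on \<open>T\<close> is right multiplication by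
  \<open>iota\<close>, so left multiplication commutes with it.\<close>

lemma TB_bal_lmult:
  assumes f: "tc.MB.bal H f" and x: "x \<in> carrier T"
  shows "tc.MB.bal H (\<lambda>a b. f (x \<otimes>\<^bsub>T\<^esub> a) b)"
proof (rule balancedI)
  fix n assume "n \<in> carrier (add_monoid B)"
  then show "additive_mod (add_monoid T) H (\<lambda>m. f (x \<otimes>\<^bsub>T\<^esub> m) n)"
    by (rule T.additive_mod_lmult[OF balanced_left[OF f] x])
next
  fix m assume "m \<in> carrier (add_monoid T)"
  then show "additive_mod (add_monoid B) H (f (x \<otimes>\<^bsub>T\<^esub> m))"
    using x by (intro balanced_right[OF f]) simp
next
  fix m i n assume "m \<in> carrier (add_monoid T)" "i \<in> carrier R" "n \<in> carrier (add_monoid B)"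
  then show "f (x \<otimes>\<^bsub>T\<^esub> right_act T m i) n \<approx>\<^bsub>H\<^esub> f (x \<otimes>\<^bsub>T\<^esub> m) (n \<otimes>\<^bsub>B\<^esub> target B i)"
    using coaction_iota_right[OF f, of "x \<otimes>\<^bsub>T\<^esub> m" i n] x by (simp add: right_act_eq_iota T.m_assoc)
qed

lemma TB_bal_rmult:
  assumes f: "tc.MB.bal H f" and c: "c \<in> carrier B"
  shows "tc.MB.bal H (\<lambda>a b. f a (c \<otimes>\<^bsub>B\<^esub> b))"
proof (rule balancedI)
  fix n assume "n \<in> carrier (add_monoid B)"
  then show "additive_mod (add_monoid T) H (\<lambda>m. f m (c \<otimes>\<^bsub>B\<^esub> n))"
    using c by (intro balanced_left[OF f]) simp
next
  fix m assume "m \<in> carrier (add_monoid T)"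
  then show "additive_mod (add_monoid B) H (\<lambda>n. f m (c \<otimes>\<^bsub>B\<^esub> n))"
    by (intro rb.B.additive_mod_lmult[OF balanced_right[OF f] c])
next
  fix m i n assume "m \<in> carrier (add_monoid T)" "i \<in> carrier R" "n \<in> carrier (add_monoid B)"
  then show "f (right_act T m i) (c \<otimes>\<^bsub>B\<^esub> n) \<approx>\<^bsub>H\<^esub> f m (c \<otimes>\<^bsub>B\<^esub> (n \<otimes>\<^bsub>B\<^esub> target B i))"
    using balanced_middle[OF f, of m i "c \<otimes>\<^bsub>B\<^esub> n"] c by (simp add: rb.B.m_assoc)
qed

lemma coaction_S_left:
  assumes f: "tc.MB.bal H f" and s: "s \<in> carrier S" and t: "t \<in> carrier T"
  shows "tsum (coaction T (s \<otimes>\<^bsub>T\<^esub> t)) f \<approx>\<^bsub>H\<^esub> tsum (coaction T t) (\<lambda>a b. f (s \<otimes>\<^bsub>T\<^esub> a) b)"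
proof -
  have "tsum (coaction T (s \<otimes>\<^bsub>T\<^esub> t)) f \<approx>\<^bsub>H\<^esub> tsum (coaction T t) (\<lambda>a b. f (s \<otimes>\<^bsub>T\<^esub> a) (\<one>\<^bsub>B\<^esub> \<otimes>\<^bsub>B\<^esub> b))"
    using coaction_mult_sweedler[OF f S_carrier[OF s] t S_mem_coaction[OF s] rep_coaction[OF t]] by (simp add: tsum_def)
  also have "\<dots> \<approx>\<^bsub>H\<^esub> tsum (coaction T t) (\<lambda>a b. f (s \<otimes>\<^bsub>T\<^esub> a) b)"
    by (rule tc.MB.tsum_cong[OF coaction_closed[OF t]]) simp
  finally show ?thesis .
qed

lemma coaction_S_right:
  assumes f: "tc.MB.bal H f" and s: "s \<in> carrier S" and t: "t \<in> carrier T"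
  shows "tsum (coaction T (t \<otimes>\<^bsub>T\<^esub> s)) f \<approx>\<^bsub>H\<^esub> tsum (coaction T t) (\<lambda>a b. f (a \<otimes>\<^bsub>T\<^esub> s) b)"
proof -
  have "tsum (coaction T (t \<otimes>\<^bsub>T\<^esub> s)) f \<approx>\<^bsub>H\<^esub> tsum (coaction T t) (\<lambda>a b. f (a \<otimes>\<^bsub>T\<^esub> s) (b \<otimes>\<^bsub>B\<^esub> \<one>\<^bsub>B\<^esub>))"
    using coaction_mult_sweedler[OF f t S_carrier[OF s] rep_coaction[OF t] S_mem_coaction[OF s]] by (simp add: tsum_def)
  also have "\<dots> \<approx>\<^bsub>H\<^esub> tsum (coaction T t) (\<lambda>a b. f (a \<otimes>\<^bsub>T\<^esub> s) b)"
    by (rule tc.MB.tsum_cong[OF coaction_closed[OF t]]) simp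
  finally show ?thesis .
qed

section \<open>The action of \<open>K\<close> on \<open>T\<close> and its equivariance\<close>

lemma act_module: "left_module K (add_monoid T) act"
  using module_algebra by (simp add: left_module_algebra_def)

lemma act_closed [simp]: "k \<in> carrier K \<Longrightarrow> t \<in> carrier T \<Longrightarrow> act k t \<in> carrier T"
  and act_add_right: "k \<in> carrier K \<Longrightarrow> t \<in> carrier T \<Longrightarrow> t' \<in> carrier T \<Longrightarrow> act k (t \<oplus>\<^bsub>T\<^esub> t') = act k t \<oplus>\<^bsub>T\<^esub> act k t'"
  and act_add_left: "k \<in> carrier K \<Longrightarrow> k' \<in> carrier K \<Longrightarrow> t \<in> carrier T \<Longrightarrow> act (k \<oplus>\<^bsub>K\<^esub> k') t = act k t \<oplus>\<^bsub>T\<^esub> act k' t"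
  and act_mult: "k \<in> carrier K \<Longrightarrow> k' \<in> carrier K \<Longrightarrow> t \<in> carrier T \<Longrightarrow> act (k \<otimes>\<^bsub>K\<^esub> k') t = act k (act k' t)"
  and act_one: "t \<in> carrier T \<Longrightarrow> act \<one>\<^bsub>K\<^esub> t = t"
  using act_module by (auto simp: left_module_def hom_def)

lemma act_source: "s \<in> carrier S \<Longrightarrow> t \<in> carrier T \<Longrightarrow> act (source K s) t = s \<otimes>\<^bsub>T\<^esub> t"
  and act_target: "s \<in> carrier S \<Longrightarrow> t \<in> carrier T \<Longrightarrow> act (target K s) t = t \<otimes>\<^bsub>T\<^esub> s"
  and act_right_act: "k \<in> carrier K \<Longrightarrow> t \<in> carrier T \<Longrightarrow> r \<in> carrier R \<Longrightarrow> act k (right_act T t r) = right_act T (act k t) r"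
  and coaction_act_eq: "k \<in> carrier K \<Longrightarrow> t \<in> carrier T \<Longrightarrow> z \<in> coaction T t \<Longrightarrow> coaction T (act k t) =
        tclass (right_tensor R B (add_monoid T) (right_act T)) (sweedler z (\<lambda>t0 t1. frag_of (act k t0, t1)))"
  using galois by (auto simp: equivariant_galois_extension_def Let_def S_eq)

text \<open>The module algebra axiom reduces to the action of the source of the counit on 1, and
  source elements act by left multiplication. The equation makes sense because \<open>S\<close> lies
  inside \<open>T\<close>.\<close>

lemma act_unit: "k \<in> carrier K \<Longrightarrow> act k \<one>\<^bsub>T\<^esub> = counit K k"
  using module_algebra act_source[of "counit K k" "\<one>\<^bsub>T\<^esub>"] S_carrier by (auto simp: left_module_algebra_def)

lemma act_iota_right: "k \<in> carrier K \<Longrightarrow> t \<in> carrier T \<Longrightarrow> r \<in> carrier R \<Longrightarrow> act k (t \<otimes>\<^bsub>T\<^esub> iota r) = act k t \<otimes>\<^bsub>T\<^esub> iota r"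
  using act_right_act[of k t r] by (simp add: right_act_eq_iota)

lemma additive_act_right:
  "additive_mod (add_monoid T) H u \<Longrightarrow> k \<in> carrier K \<Longrightarrow> additive_mod (add_monoid T) H (\<lambda>t. u (act k t))"
  by (rule additive_mod_addI) (simp add: act_add_right additive_mod_addD)

lemma additive_act_left:
  "additive_mod (add_monoid T) H u \<Longrightarrow> t \<in> carrier T \<Longrightarrow> additive_mod (add_monoid K) H (\<lambda>k. u (act k t))"
  by (rule additive_mod_addI) (simp add: act_add_left additive_mod_addD)

lemma act_mult_algebra:
  assumes "additive_mod (add_monoid T) H u" "k \<in> carrier K" "t \<in> carrier T" "t' \<in> carrier T"
  shows "u (act k (t \<otimes>\<^bsub>T\<^esub> t')) \<approx>\<^bsub>H\<^esub> tsum (comult K k) (\<lambda>k1 k2. u (act k1 t \<otimes>\<^bsub>T\<^esub> act k2 t'))"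
proof -
  have "\<And>z. z \<in> comult K k \<Longrightarrow> act k (t \<otimes>\<^bsub>T\<^esub> t') = value_sum (add_monoid T) (\<lambda>k1 k2. act k1 t \<otimes>\<^bsub>T\<^esub> act k2 t') z"
    using module_algebra assms unfolding left_module_algebra_def by blast
  from this[OF rep_mem[OF lk.KK.pres lk.comult_closed[OF assms(2)]]]
  have eq: "act k (t \<otimes>\<^bsub>T\<^esub> t') = value_sum (add_monoid T) (\<lambda>k1 k2. act k1 t \<otimes>\<^bsub>T\<^esub> act k2 t') (rep (comult K k))" .
  show ?thesis
    unfolding eq tsum_def
    by (rule additive_mod_value_sum[OF T.a_comm_group assms(1)])
       (use rep_keys[OF lk.KK.pres lk.comult_closed[OF assms(2)]] assms(3,4) in auto)
qed

lemma coaction_act: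
  assumes "tc.MB.bal H f" "k \<in> carrier K" "t \<in> carrier T"
  shows "tsum (coaction T (act k t)) f \<approx>\<^bsub>H\<^esub> tsum (coaction T t) (\<lambda>a b. f (act k a) b)"
  using tc.MB.tsum_tclass_sweedler[OF assms(1) coaction_act_eq[OF assms(2,3) rep_coaction[OF assms(3)]]]
  by (simp add: tsum_def)

text \<open>The left \<open>R\<close>-action on \<open>T\<close> is built from the right one and the
  coaction, and \<open>act k\<close> is compatible with both. The equation is obtained by testing
  with the universal additive functional on \<open>T\<close>.\<close>

lemma act_iota_left:
  assumes k: "k \<in> carrier K" and t: "t \<in> carrier T" and r: "r \<in> carrier R"
  shows "act k (iota r \<otimes>\<^bsub>T\<^esub> t) = iota r \<otimes>\<^bsub>T\<^esub> act k t"
proof -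
  let ?u = "frag_of :: 't \<Rightarrow> 't \<Rightarrow>\<^sub>0 int" and ?H = "group_rels (add_monoid T)"
  have u: "additive_mod (add_monoid T) ?H ?u" by (rule additive_mod_frag_of)
  let ?g = "\<lambda>b. counit B (source B r \<otimes>\<^bsub>B\<^esub> b)"
  have "?u (act k (tc.left_act r t)) \<approx>\<^bsub>?H\<^esub> tsum (coaction T t) (\<lambda>a b. ?u (act k (right_act T a (?g b))))"
    by (rule tc.tsum_left_act[OF additive_act_right[OF u k]]) (use t r in auto)
  also have "\<dots> \<approx>\<^bsub>?H\<^esub> tsum (coaction T t) (\<lambda>a b. ?u (right_act T (act k a) (?g b)))"
    using k t r by (intro tc.MB.tsum_cong coaction_closed) (auto simp: act_right_act)
  also have "\<dots> \<approx>\<^bsub>?H\<^esub> tsum (coaction T (act k t)) (\<lambda>a b. ?u (right_act T a (?g b)))"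
    by (rule cong_mod_sym, rule coaction_act[OF tc.left_act_bal[OF u] k t]) (simp add: r)
  also have "\<dots> \<approx>\<^bsub>?H\<^esub> ?u (tc.left_act r (act k t))"
    by (rule cong_mod_sym, rule tc.tsum_left_act[OF u]) (use k t r in auto)
  finally have "?u (act k (iota r \<otimes>\<^bsub>T\<^esub> t)) \<approx>\<^bsub>?H\<^esub> ?u (iota r \<otimes>\<^bsub>T\<^esub> act k t)"
    using k t r by (simp add: left_act_eq_iota)
  then show ?thesis
    by (rule group_rels_separate[OF T.a_comm_group, rotated 2]) (use k t r in auto)
qed

section \<open>The canonical map\<close>

sublocale TT: tensor_space "galois_domain S T" "carrier S"
  "add_monoid T" "\<lambda>t s. t \<otimes>\<^bsub>T\<^esub> s" "add_monoid T" "\<lambda>s t. s \<otimes>\<^bsub>T\<^esub> t"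
  by unfold_locales
     (auto simp: galois_domain_def tensor_ok_def S_carrier)

text \<open>This is \<open>f\<close> after \<open>can\<close>. Coinvariant elements pass through the
  coaction unchanged, which is what balance over \<open>S\<close> requires.\<close>

lemma can_functional_bal:
  assumes f: "tc.MB.bal H f"
  shows "TT.bal H (\<lambda>x y. tsum (coaction T y) (\<lambda>a b. f (x \<otimes>\<^bsub>T\<^esub> a) b))"
proof (rule balancedI)
  fix y assume "y \<in> carrier (add_monoid T)"
  then show "additive_mod (add_monoid T) H (\<lambda>x. tsum (coaction T y) (\<lambda>a b. f (x \<otimes>\<^bsub>T\<^esub> a) b))"
    by (intro tc.MB.additive_tsum_param coaction_closed T.additive_mod_rmult[OF balanced_left[OF f]]) auto
next
  fix x assume "x \<in> carrier (add_monoid T)"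
  then show "additive_mod (add_monoid T) H (\<lambda>y. tsum (coaction T y) (\<lambda>a b. f (x \<otimes>\<^bsub>T\<^esub> a) b))"
    by (intro tc.coact_additive TB_bal_lmult f) simp
next
  fix x s y assume *: "x \<in> carrier (add_monoid T)" "s \<in> carrier S" "y \<in> carrier (add_monoid T)"
  have "tsum (coaction T (s \<otimes>\<^bsub>T\<^esub> y)) (\<lambda>a b. f (x \<otimes>\<^bsub>T\<^esub> a) b) \<approx>\<^bsub>H\<^esub>
      tsum (coaction T y) (\<lambda>a b. f (x \<otimes>\<^bsub>T\<^esub> (s \<otimes>\<^bsub>T\<^esub> a)) b)"
    using * by (intro coaction_S_left TB_bal_lmult f) auto
  also have "\<dots> \<approx>\<^bsub>H\<^esub> tsum (coaction T y) (\<lambda>a b. f ((x \<otimes>\<^bsub>T\<^esub> s) \<otimes>\<^bsub>T\<^esub> a) b)"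
    using * by (intro tc.MB.tsum_cong coaction_closed) (auto simp: T.m_assoc S_carrier)
  finally show "tsum (coaction T y) (\<lambda>a b. f ((x \<otimes>\<^bsub>T\<^esub> s) \<otimes>\<^bsub>T\<^esub> a) b) \<approx>\<^bsub>H\<^esub>
      tsum (coaction T (s \<otimes>\<^bsub>T\<^esub> y)) (\<lambda>a b. f (x \<otimes>\<^bsub>T\<^esub> a) b)"
    by (rule cong_mod_sym)
qed

lemma canonical_map_eq:
  assumes U: "U \<in> carrier (galois_domain S T)"
  shows "canonical_map R B T U = tclass (right_tensor R B (add_monoid T) (right_act T))
    (tsum U (\<lambda>x y. tsum (coaction T y) (\<lambda>a b. frag_of (x \<otimes>\<^bsub>T\<^esub> a, b))))"
  unfolding canonical_map_def
proof (rule the_elem_eqI, goal_cases)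
  case 1
  show ?case unfolding tsum_def
    by (intro CollectI exI[of _ "rep U"] exI[of _ "\<lambda>t. rep (coaction T t)"] conjI refl rep_mem[OF TT.pres U])
       (use rep_coaction in auto)
next
  case (2 V)
  then obtain z C where z: "z \<in> U" and C: "C \<in> Pi (carrier T) (coaction T)"
    and V: "V = tclass (right_tensor R B (add_monoid T) (right_act T))
      (sweedler z (\<lambda>x y. sweedler (C y) (\<lambda>a b. frag_of (x \<otimes>\<^bsub>T\<^esub> a, b))))"
    by blast
  have "sweedler z (\<lambda>x y. sweedler (C y) (\<lambda>a b. frag_of (x \<otimes>\<^bsub>T\<^esub> a, b))) \<approx>\<^bsub>tc.MB.rels\<^esub>
      sweedler z (\<lambda>x y. tsum (coaction T y) (\<lambda>a b. frag_of (x \<otimes>\<^bsub>T\<^esub> a, b)))"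
    using C by (intro sweedler_cong_mod[OF mem_carrier_keys[OF TT.pres U z]]
        tc.MB.tsum_welldef TB_bal_lmult[OF balanced_frag_of] coaction_closed) auto
  also have "\<dots> \<approx>\<^bsub>tc.MB.rels\<^esub> tsum U (\<lambda>x y. tsum (coaction T y) (\<lambda>a b. frag_of (x \<otimes>\<^bsub>T\<^esub> a, b)))"
    by (rule TT.tsum_welldef[OF can_functional_bal[OF balanced_frag_of] U z])
  finally show ?case unfolding V by (rule tclass_eqI[OF tc.MB.pres])
qed

sublocale can: tensor_iso "galois_domain S T" "carrier S"
  "add_monoid T" "\<lambda>t s. t \<otimes>\<^bsub>T\<^esub> s" "add_monoid T" "\<lambda>s t. s \<otimes>\<^bsub>T\<^esub> t"
  "right_tensor R B (add_monoid T) (right_act T)" "carrier R"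
  "add_monoid T" "right_act T" "add_monoid B" "\<lambda>r b. b \<otimes>\<^bsub>B\<^esub> target B r"
  "canonical_map R B T" "\<lambda>x y. tsum (coaction T y) (\<lambda>a b. frag_of (x \<otimes>\<^bsub>T\<^esub> a, b))"
proof (unfold_locales, goal_cases)
  case (1 x y)
  then show ?case unfolding tsum_def
    by (intro keys_sweedler[OF rep_keys[OF tc.MB.pres coaction_closed]]) auto
next
  case 2
  then show ?case by (rule can_functional_bal[OF balanced_frag_of])
next
  case (3 U)
  then show ?case by (rule canonical_map_eq)
next
  case 4
  then show ?case using galois by (simp add: equivariant_galois_extension_def Let_def S_eq)
qed

text \<open>In the notation of the paper, \<open>t b\<^sub>- \<otimes>\<^sub>S b\<^sub>+\<close>.\<close>

definition gal :: "'t \<Rightarrow> 'b \<Rightarrow> ('t \<times> 't) tensor" where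
  "gal t b = can.h_inv (tc.MB.pure t b)"

lemma galois_translation_eq: "galois_translation R B T b = gal \<one>\<^bsub>T\<^esub> b"
  unfolding galois_translation_def gal_def S_eq[symmetric] ..

lemma gal_closed: "t \<in> carrier T \<Longrightarrow> b \<in> carrier B \<Longrightarrow> gal t b \<in> carrier (galois_domain S T)"
  unfolding gal_def by (intro can.h_inv_closed tc.MB.pure_closed) auto

lemma gal_bal: "TT.bal H g \<Longrightarrow> tc.MB.bal H (\<lambda>t b. tsum (gal t b) g)"
  unfolding gal_def by (rule can.balanced_h_inv)

text \<open>\<open>can\<close> after its inverse: the collapsing step of later calculations.\<close>

lemma tsum_gal:
  assumes "tc.MB.bal H f" "t \<in> carrier T" "b \<in> carrier B"
  shows "tsum (gal t b) (\<lambda>x y. tsum (coaction T y) (\<lambda>a c. f (x \<otimes>\<^bsub>T\<^esub> a) c)) \<approx>\<^bsub>H\<^esub> f t b"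
  using can.tsum_h_inv[OF assms(1)] assms(2,3) by (simp add: gal_def sweedler_tsum)

text \<open>The inverse after \<open>can\<close>: the expanding step, which rewrites
  \<open>x \<otimes> y\<close> as \<open>can^-1(x y_0 \<otimes> y_1)\<close>.\<close>

lemma coaction_gal:
  assumes "TT.bal H g" "x \<in> carrier T" "y \<in> carrier T"
  shows "tsum (coaction T y) (\<lambda>a c. tsum (gal (x \<otimes>\<^bsub>T\<^esub> a) c) g) \<approx>\<^bsub>H\<^esub> g x y"
  using can.sweedler_h_inv[OF assms(1)] assms(2,3) by (simp add: gal_def sweedler_tsum)

end

section \<open>Calculus of the translation map\<close>

context right_hopf
begin

text \<open>Here a right multiplication on the first leg respects balance because the ranges of
  source and target commute.\<close>

lemma BB_bal_target:
  assumes f: "BB.bal H f" and r: "r \<in> carrier R"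
  shows "BB.bal H (\<lambda>x y. f (x \<otimes>\<^bsub>B\<^esub> target B r) y)"
proof (rule balancedI)
  fix n assume "n \<in> carrier (add_monoid B)"
  then show "additive_mod (add_monoid B) H (\<lambda>m. f (m \<otimes>\<^bsub>B\<^esub> target B r) n)"
    using r by (intro B.additive_mod_rmult[OF balanced_left[OF f]]) auto
next
  fix m assume "m \<in> carrier (add_monoid B)"
  then show "additive_mod (add_monoid B) H (f (m \<otimes>\<^bsub>B\<^esub> target B r))"
    using r by (intro balanced_right[OF f]) simp
next
  fix m i n assume *: "m \<in> carrier (add_monoid B)" "i \<in> carrier R" "n \<in> carrier (add_monoid B)"
  then have "(m \<otimes>\<^bsub>B\<^esub> source B i) \<otimes>\<^bsub>B\<^esub> target B r = (m \<otimes>\<^bsub>B\<^esub> target B r) \<otimes>\<^bsub>B\<^esub> source B i"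
    using r by (simp add: B.m_assoc source_target_commute)
  then show "f ((m \<otimes>\<^bsub>B\<^esub> source B i) \<otimes>\<^bsub>B\<^esub> target B r) n \<approx>\<^bsub>H\<^esub> f (m \<otimes>\<^bsub>B\<^esub> target B r) (n \<otimes>\<^bsub>B\<^esub> target B i)"
    using balanced_middle[OF f, of "m \<otimes>\<^bsub>B\<^esub> target B r" i n] * r by simp
qed

text \<open>The coproduct of \<open>y t(r)\<close> is \<open>y1 t(r) \<otimes> y2\<close>, so
  \<open>\<nu>\<close> turns a right factor \<open>t(r)\<close> of its second argument into one on
  the first leg of its value.\<close>

lemma splitting_target:
  assumes g: "BoB.bal H g" and c: "c \<in> carrier B" and r: "r \<in> carrier R" and b: "b \<in> carrier B"
  shows "tsum (splitting (c \<otimes>\<^bsub>B\<^esub> target B r) b) g \<approx>\<^bsub>H\<^esub> tsum (splitting c b) (\<lambda>x y. g x (y \<otimes>\<^bsub>B\<^esub> target B r))"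
proof -
  have "tsum (splitting c b) (\<lambda>x y. g x (y \<otimes>\<^bsub>B\<^esub> target B r)) \<approx>\<^bsub>H\<^esub>
      tsum (splitting c b) (\<lambda>x y. tsum (comult B y) (\<lambda>y1 y2. tsum (splitting ((x \<otimes>\<^bsub>B\<^esub> y1) \<otimes>\<^bsub>B\<^esub> target B r) y2) g))"
  proof (rule BoB.tsum_cong[OF splitting_closed[OF c b]])
    fix x y assume "x \<in> carrier (add_monoid B)" "y \<in> carrier (add_monoid B)"
    then have xy: "x \<in> carrier B" "y \<in> carrier B" by auto
    have "g x (y \<otimes>\<^bsub>B\<^esub> target B r) \<approx>\<^bsub>H\<^esub>
        tsum (comult B (y \<otimes>\<^bsub>B\<^esub> target B r)) (\<lambda>y1 y2. tsum (splitting (x \<otimes>\<^bsub>B\<^esub> y1) y2) g)"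
      using xy r by (intro cong_mod_sym[OF comult_splitting[OF g]]) auto
    also have "\<dots> \<approx>\<^bsub>H\<^esub> tsum (comult B y) (\<lambda>y1 y2. tsum (splitting (x \<otimes>\<^bsub>B\<^esub> (y1 \<otimes>\<^bsub>B\<^esub> target B r)) y2) g)"
      by (rule comult_target[OF BB_bal_lmult_left[OF splitting_bal[OF g] xy(1)] xy(2) r])
    also have "\<dots> \<approx>\<^bsub>H\<^esub> tsum (comult B y) (\<lambda>y1 y2. tsum (splitting ((x \<otimes>\<^bsub>B\<^esub> y1) \<otimes>\<^bsub>B\<^esub> target B r) y2) g)"
      using xy r by (intro BB.tsum_cong comult_closed) (auto simp: B.m_assoc)
    finally show "g x (y \<otimes>\<^bsub>B\<^esub> target B r) \<approx>\<^bsub>H\<^esub>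
        tsum (comult B y) (\<lambda>y1 y2. tsum (splitting ((x \<otimes>\<^bsub>B\<^esub> y1) \<otimes>\<^bsub>B\<^esub> target B r) y2) g)" .
  qed
  also have "\<dots> \<approx>\<^bsub>H\<^esub> tsum (splitting (c \<otimes>\<^bsub>B\<^esub> target B r) b) g"
    by (rule tsum_splitting[OF BB_bal_target[OF splitting_bal[OF g] r] c b])
  finally show ?thesis by (rule cong_mod_sym)
qed

end

lemma balanced3_fst:
  "balanced3 I L raL M laM raM N laN H f \<Longrightarrow> l \<in> carrier L \<Longrightarrow> balanced I M raM N laN H (f l)"
  by (simp add: balanced3_def balanced_def)

lemma balanced3_thd:
  "balanced3 I L raL M laM raM N laN H f \<Longrightarrow> n \<in> carrier N \<Longrightarrow> balanced I L raL M laM H (\<lambda>l m. f l m n)"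
  by (simp add: balanced3_def balanced_def)

lemma balanced3_additive_fst:
  "balanced3 I L raL M laM raM N laN H f \<Longrightarrow> m \<in> carrier M \<Longrightarrow> n \<in> carrier N \<Longrightarrow> additive_mod L H (\<lambda>l. f l m n)"
  by (simp add: balanced3_def)

lemma balanced3_middle1:
  "balanced3 I L raL M laM raM N laN H f \<Longrightarrow> l \<in> carrier L \<Longrightarrow> i \<in> I \<Longrightarrow> m \<in> carrier M \<Longrightarrow> n \<in> carrier N \<Longrightarrow>
    f (raL l i) m n \<approx>\<^bsub>H\<^esub> f l (laM i m) n"
  by (simp add: balanced3_def)

lemma balanced3_middle2:
  "balanced3 I L raL M laM raM N laN H f \<Longrightarrow> l \<in> carrier L \<Longrightarrow> i \<in> I \<Longrightarrow> m \<in> carrier M \<Longrightarrow> n \<in> carrier N \<Longrightarrow>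
    f l (raM m i) n \<approx>\<^bsub>H\<^esub> f l m (laN i n)"
  by (simp add: balanced3_def)

context right_comod
begin

text \<open>The two sides of coassociativity have to be functionals on the tensor product before
  they can be collapsed against an inverse. This one splits \<open>b\<close>;
  \<open>bal3_coact\<close> splits \<open>m\<close>.\<close>

lemma bal3_comult:
  assumes g: "bal3 H g" shows "MB.bal H (\<lambda>m b. tsum (comult B b) (\<lambda>b1 b2. g m b1 b2))"
proof (rule balancedI)
  fix b assume "b \<in> carrier (add_monoid B)"
  then show "additive_mod M H (\<lambda>m. tsum (comult B b) (\<lambda>b1 b2. g m b1 b2))"
    by (intro BB.additive_tsum_param comult_closed balanced3_additive_fst[OF g]) auto
next
  fix m assume "m \<in> carrier M"
  then show "additive_mod (add_monoid B) H (\<lambda>b. tsum (comult B b) (\<lambda>b1 b2. g m b1 b2))"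
    by (intro comult_additive balanced3_fst[OF g])
next
  fix m i b assume *: "m \<in> carrier M" "i \<in> carrier R" "b \<in> carrier (add_monoid B)"
  then have "tsum (comult B b) (\<lambda>b1 b2. g (ra m i) b1 b2) \<approx>\<^bsub>H\<^esub> tsum (comult B b) (\<lambda>b1 b2. g m (b1 \<otimes>\<^bsub>B\<^esub> target B i) b2)"
    by (intro BB.tsum_cong comult_closed balanced3_middle1[OF g]) auto
  also have "\<dots> \<approx>\<^bsub>H\<^esub> tsum (comult B (b \<otimes>\<^bsub>B\<^esub> target B i)) (\<lambda>b1 b2. g m b1 b2)"
    using * by (intro cong_mod_sym[OF comult_target] balanced3_fst[OF g]) auto
  finally show "tsum (comult B b) (\<lambda>b1 b2. g (ra m i) b1 b2) \<approx>\<^bsub>H\<^esub> tsum (comult B (b \<otimes>\<^bsub>B\<^esub> target B i)) (\<lambda>b1 b2. g m b1 b2)" .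
qed

lemma bal3_coact:
  assumes g: "bal3 H g" shows "MB.bal H (\<lambda>m b. tsum (\<rho> m) (\<lambda>n c. g n c b))"
proof (rule balancedI)
  fix b assume "b \<in> carrier (add_monoid B)"
  then show "additive_mod M H (\<lambda>m. tsum (\<rho> m) (\<lambda>n c. g n c b))"
    by (intro coact_additive balanced3_thd[OF g])
next
  fix m assume "m \<in> carrier M"
  then show "additive_mod (add_monoid B) H (\<lambda>b. tsum (\<rho> m) (\<lambda>n c. g n c b))"
    by (intro MB.additive_tsum_param coact_closed balanced_right[OF balanced3_fst[OF g]]) auto
next
  fix m i b assume *: "m \<in> carrier M" "i \<in> carrier R" "b \<in> carrier (add_monoid B)"
  then have "tsum (\<rho> (ra m i)) (\<lambda>n c. g n c b) \<approx>\<^bsub>H\<^esub> tsum (\<rho> m) (\<lambda>n c. g n (c \<otimes>\<^bsub>B\<^esub> source B i) b)"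
    by (intro coact_ra balanced3_thd[OF g]) auto
  also have "\<dots> \<approx>\<^bsub>H\<^esub> tsum (\<rho> m) (\<lambda>n c. g n c (b \<otimes>\<^bsub>B\<^esub> target B i))"
    using * by (intro MB.tsum_cong coact_closed balanced3_middle2[OF g]) auto
  finally show "tsum (\<rho> (ra m i)) (\<lambda>n c. g n c b) \<approx>\<^bsub>H\<^esub> tsum (\<rho> m) (\<lambda>n c. g n c (b \<otimes>\<^bsub>B\<^esub> target B i))" .
qed

end

section \<open>Transformation laws of the inverse canonical map\<close>

context galois_setting
begin

lemma TT_bal_lmult:
  assumes g: "TT.bal H g" and c: "c \<in> carrier T"
  shows "TT.bal H (\<lambda>x y. g (c \<otimes>\<^bsub>T\<^esub> x) y)"
proof (rule balancedI)
  fix n assume "n \<in> carrier (add_monoid T)"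
  then show "additive_mod (add_monoid T) H (\<lambda>m. g (c \<otimes>\<^bsub>T\<^esub> m) n)"
    by (rule T.additive_mod_lmult[OF balanced_left[OF g] c])
next
  fix m assume "m \<in> carrier (add_monoid T)"
  then show "additive_mod (add_monoid T) H (g (c \<otimes>\<^bsub>T\<^esub> m))"
    using c by (intro balanced_right[OF g]) simp
next
  fix m i n assume "m \<in> carrier (add_monoid T)" "i \<in> carrier S" "n \<in> carrier (add_monoid T)"
  then show "g (c \<otimes>\<^bsub>T\<^esub> (m \<otimes>\<^bsub>T\<^esub> i)) n \<approx>\<^bsub>H\<^esub> g (c \<otimes>\<^bsub>T\<^esub> m) (i \<otimes>\<^bsub>T\<^esub> n)"
    using balanced_middle[OF g, of "c \<otimes>\<^bsub>T\<^esub> m" i n] c by (simp add: T.m_assoc S_carrier)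
qed

text \<open>\<open>can\<close> is left linear over \<open>T\<close>; the argument is the one for
  \<open>\<nu>\<close>, with the coaction in place of the coproduct.\<close>

lemma gal_lmult:
  assumes g: "TT.bal H g" and t: "t \<in> carrier T" "t' \<in> carrier T" and b: "b \<in> carrier B"
  shows "tsum (gal (t \<otimes>\<^bsub>T\<^esub> t') b) g \<approx>\<^bsub>H\<^esub> tsum (gal t' b) (\<lambda>x y. g (t \<otimes>\<^bsub>T\<^esub> x) y)"
proof -
  have "tsum (gal t' b) (\<lambda>x y. g (t \<otimes>\<^bsub>T\<^esub> x) y) \<approx>\<^bsub>H\<^esub>
      tsum (gal t' b) (\<lambda>x y. tsum (coaction T y) (\<lambda>a c. tsum (gal (t \<otimes>\<^bsub>T\<^esub> (x \<otimes>\<^bsub>T\<^esub> a)) c) g))"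
  proof (rule TT.tsum_cong[OF gal_closed[OF t(2) b]])
    fix x y assume "x \<in> carrier (add_monoid T)" "y \<in> carrier (add_monoid T)"
    then have xy: "x \<in> carrier T" "y \<in> carrier T" by auto
    have "tsum (coaction T y) (\<lambda>a c. tsum (gal (t \<otimes>\<^bsub>T\<^esub> (x \<otimes>\<^bsub>T\<^esub> a)) c) g) \<approx>\<^bsub>H\<^esub>
        tsum (coaction T y) (\<lambda>a c. tsum (gal ((t \<otimes>\<^bsub>T\<^esub> x) \<otimes>\<^bsub>T\<^esub> a) c) g)"
      using xy t by (intro tc.MB.tsum_cong coaction_closed) (auto simp: T.m_assoc)
    also have "\<dots> \<approx>\<^bsub>H\<^esub> g (t \<otimes>\<^bsub>T\<^esub> x) y"
      using xy t by (intro coaction_gal[OF g]) auto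
    finally show "g (t \<otimes>\<^bsub>T\<^esub> x) y \<approx>\<^bsub>H\<^esub> tsum (coaction T y) (\<lambda>a c. tsum (gal (t \<otimes>\<^bsub>T\<^esub> (x \<otimes>\<^bsub>T\<^esub> a)) c) g)"
      by (rule cong_mod_sym)
  qed
  also have "\<dots> \<approx>\<^bsub>H\<^esub> tsum (gal (t \<otimes>\<^bsub>T\<^esub> t') b) g"
    by (rule tsum_gal[OF TB_bal_lmult[OF gal_bal[OF g] t(1)] t(2) b])
  finally show ?thesis by (rule cong_mod_sym)
qed

lemma TB_bal_act:
  assumes f: "tc.MB.bal H f" and k: "k \<in> carrier K"
  shows "tc.MB.bal H (\<lambda>t b. f (act k t) b)"
proof (rule balancedI)
  fix b assume "b \<in> carrier (add_monoid B)"
  then show "additive_mod (add_monoid T) H (\<lambda>t. f (act k t) b)"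
    by (rule additive_act_right[OF balanced_left[OF f] k])
next
  fix t assume "t \<in> carrier (add_monoid T)"
  then show "additive_mod (add_monoid B) H (f (act k t))"
    using k by (intro balanced_right[OF f]) simp
next
  fix t r b assume "t \<in> carrier (add_monoid T)" "r \<in> carrier R" "b \<in> carrier (add_monoid B)"
  then show "f (act k (right_act T t r)) b \<approx>\<^bsub>H\<^esub> f (act k t) (b \<otimes>\<^bsub>B\<^esub> target B r)"
    using balanced_middle[OF f, of "act k t" r b] k by (simp add: act_right_act)
qed

text \<open>By equivariance \<open>can\<close> sends
  \<open>k1 \<triangleright> x \<otimes> k2 \<triangleright> y\<close> to \<open>(k1
  \<triangleright> x) (k2 \<triangleright> y_0) \<otimes> y_1\<close>, and the module algebra axiom
  folds the product into \<open>k \<triangleright> (x y_0)\<close>.\<close>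

lemma gal_act:
  assumes g: "TT.bal H g" and k: "k \<in> carrier K" and t: "t \<in> carrier T" and b: "b \<in> carrier B"
  shows "tsum (gal (act k t) b) g \<approx>\<^bsub>H\<^esub>
    tsum (gal t b) (\<lambda>x y. tsum (comult K k) (\<lambda>k1 k2. g (act k1 x) (act k2 y)))"
proof -
  have "tsum (gal t b) (\<lambda>x y. tsum (comult K k) (\<lambda>k1 k2. g (act k1 x) (act k2 y))) \<approx>\<^bsub>H\<^esub>
      tsum (gal t b) (\<lambda>x y. tsum (coaction T y) (\<lambda>a c. tsum (gal (act k (x \<otimes>\<^bsub>T\<^esub> a)) c) g))"
  proof (rule TT.tsum_cong[OF gal_closed[OF t b]])
    fix x y assume "x \<in> carrier (add_monoid T)" "y \<in> carrier (add_monoid T)"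
    then have xy: "x \<in> carrier T" "y \<in> carrier T" by auto
    have "tsum (comult K k) (\<lambda>k1 k2. g (act k1 x) (act k2 y)) \<approx>\<^bsub>H\<^esub>
        tsum (comult K k) (\<lambda>k1 k2. tsum (coaction T y) (\<lambda>a c. tsum (gal (act k1 x \<otimes>\<^bsub>T\<^esub> act k2 a) c) g))"
    proof (rule lk.KK.tsum_cong[OF lk.comult_closed[OF k]])
      fix k1 k2 assume "k1 \<in> carrier (add_monoid K)" "k2 \<in> carrier (add_monoid K)"
      then have kk: "k1 \<in> carrier K" "k2 \<in> carrier K" by auto
      have "tsum (coaction T (act k2 y)) (\<lambda>a c. tsum (gal (act k1 x \<otimes>\<^bsub>T\<^esub> a) c) g) \<approx>\<^bsub>H\<^esub>
          g (act k1 x) (act k2 y)"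
        using xy kk by (intro coaction_gal[OF g]) auto
      moreover have "tsum (coaction T (act k2 y)) (\<lambda>a c. tsum (gal (act k1 x \<otimes>\<^bsub>T\<^esub> a) c) g) \<approx>\<^bsub>H\<^esub>
          tsum (coaction T y) (\<lambda>a c. tsum (gal (act k1 x \<otimes>\<^bsub>T\<^esub> act k2 a) c) g)"
        using xy kk by (intro coaction_act[OF TB_bal_lmult[OF gal_bal[OF g]]]) auto
      ultimately show "g (act k1 x) (act k2 y) \<approx>\<^bsub>H\<^esub>
          tsum (coaction T y) (\<lambda>a c. tsum (gal (act k1 x \<otimes>\<^bsub>T\<^esub> act k2 a) c) g)"
        by (rule cong_mod_trans[OF cong_mod_sym])
    qed
    also have "\<dots> = tsum (coaction T y) (\<lambda>a c. tsum (comult K k) (\<lambda>k1 k2. tsum (gal (act k1 x \<otimes>\<^bsub>T\<^esub> act k2 a) c) g))"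
      by (rule tsum_swap)
    also have "\<dots> \<approx>\<^bsub>H\<^esub> tsum (coaction T y) (\<lambda>a c. tsum (gal (act k (x \<otimes>\<^bsub>T\<^esub> a)) c) g)"
    proof (rule tc.MB.tsum_cong[OF coaction_closed[OF xy(2)]])
      fix a c assume "a \<in> carrier (add_monoid T)" "c \<in> carrier (add_monoid B)"
      then show "tsum (comult K k) (\<lambda>k1 k2. tsum (gal (act k1 x \<otimes>\<^bsub>T\<^esub> act k2 a) c) g) \<approx>\<^bsub>H\<^esub>
          tsum (gal (act k (x \<otimes>\<^bsub>T\<^esub> a)) c) g"
        using xy by (intro cong_mod_sym[OF act_mult_algebra[OF balanced_left[OF gal_bal[OF g]] k]]) auto
    qed
    finally show "tsum (comult K k) (\<lambda>k1 k2. g (act k1 x) (act k2 y)) \<approx>\<^bsub>H\<^esub>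
        tsum (coaction T y) (\<lambda>a c. tsum (gal (act k (x \<otimes>\<^bsub>T\<^esub> a)) c) g)" .
  qed
  also have "\<dots> \<approx>\<^bsub>H\<^esub> tsum (gal (act k t) b) g"
    by (rule tsum_gal[OF TB_bal_act[OF gal_bal[OF g] k] t b])
  finally show ?thesis by (rule cong_mod_sym)
qed

text \<open>Multiplicativity of the coaction of \<open>T\<close>. In Sweedler form \<open>t b'_- b_-
  \<otimes> b_+ b'_+ = t (b b')_- \<otimes> (b b')_+\<close>: the first legs multiply in reverse
  order.\<close>

lemma gal_mult:
  assumes g: "TT.bal H g" and t: "t \<in> carrier T" and b: "b \<in> carrier B" "b' \<in> carrier B"
  shows "tsum (gal t b') (\<lambda>x' y'. tsum (gal x' b) (\<lambda>x y. g x (y \<otimes>\<^bsub>T\<^esub> y'))) \<approx>\<^bsub>H\<^esub> tsum (gal t (b \<otimes>\<^bsub>B\<^esub> b')) g"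
proof -
  have "tsum (gal t b') (\<lambda>x' y'. tsum (gal x' b) (\<lambda>x y. g x (y \<otimes>\<^bsub>T\<^esub> y'))) \<approx>\<^bsub>H\<^esub>
      tsum (gal t b') (\<lambda>x' y'. tsum (coaction T y') (\<lambda>a' c'. tsum (gal (x' \<otimes>\<^bsub>T\<^esub> a') (b \<otimes>\<^bsub>B\<^esub> c')) g))"
  proof (rule TT.tsum_cong[OF gal_closed[OF t b(2)]])
    fix x' y' assume "x' \<in> carrier (add_monoid T)" "y' \<in> carrier (add_monoid T)"
    then have xy': "x' \<in> carrier T" "y' \<in> carrier T" by auto
    \<comment> \<open>The value of \<open>g\<close> at
      \<open>can^-1(t y'_0 \<otimes> c y'_1)\<close> as a function of \<open>t\<close> and
      \<open>c\<close>. Its balance over \<open>R\<close> is the identity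
      \<open>iota(r) y'_0 \<otimes> y'_1 = y'_0 \<otimes> t(r) y'_1\<close>.\<close>
    let ?f = "\<lambda>t c. tsum (coaction T y') (\<lambda>a' c'. tsum (gal (t \<otimes>\<^bsub>T\<^esub> a') (c \<otimes>\<^bsub>B\<^esub> c')) g)"
    have f: "tc.MB.bal H ?f"
    proof (rule balancedI)
      fix c assume "c \<in> carrier (add_monoid B)"
      then show "additive_mod (add_monoid T) H (\<lambda>t. ?f t c)"
        using xy' by (intro tc.MB.additive_tsum_param coaction_closed T.additive_mod_rmult[OF balanced_left[OF gal_bal[OF g]]]) auto
    next
      fix s assume "s \<in> carrier (add_monoid T)"
      then show "additive_mod (add_monoid B) H (?f s)"
        using xy' by (intro tc.MB.additive_tsum_param coaction_closed rb.B.additive_mod_rmult[OF balanced_right[OF gal_bal[OF g]]]) auto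
    next
      fix s r c assume *: "s \<in> carrier (add_monoid T)" "r \<in> carrier R" "c \<in> carrier (add_monoid B)"
      have "?f (right_act T s r) c \<approx>\<^bsub>H\<^esub>
          tsum (coaction T y') (\<lambda>a' c'. tsum (gal (s \<otimes>\<^bsub>T\<^esub> (iota r \<otimes>\<^bsub>T\<^esub> a')) (c \<otimes>\<^bsub>B\<^esub> c')) g)"
        using * xy' by (intro tc.MB.tsum_cong coaction_closed) (auto simp: right_act_eq_iota T.m_assoc)
      also have "\<dots> \<approx>\<^bsub>H\<^esub> tsum (coaction T y') (\<lambda>a' c'. tsum (gal (s \<otimes>\<^bsub>T\<^esub> a') (c \<otimes>\<^bsub>B\<^esub> (target B r \<otimes>\<^bsub>B\<^esub> c'))) g)"
        using * xy' by (intro coaction_iota_left[OF TB_bal_rmult[OF TB_bal_lmult[OF gal_bal[OF g]]]]) auto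
      also have "\<dots> \<approx>\<^bsub>H\<^esub> ?f s (c \<otimes>\<^bsub>B\<^esub> target B r)"
        using * xy' by (intro tc.MB.tsum_cong coaction_closed) (auto simp: rb.B.m_assoc)
      finally show "?f (right_act T s r) c \<approx>\<^bsub>H\<^esub> ?f s (c \<otimes>\<^bsub>B\<^esub> target B r)" .
    qed
    have "tsum (gal x' b) (\<lambda>x y. g x (y \<otimes>\<^bsub>T\<^esub> y')) \<approx>\<^bsub>H\<^esub>
        tsum (gal x' b) (\<lambda>x y. tsum (coaction T y) (\<lambda>a c. ?f (x \<otimes>\<^bsub>T\<^esub> a) c))"
    proof (rule TT.tsum_cong[OF gal_closed[OF xy'(1) b(1)]])
      fix x y assume "x \<in> carrier (add_monoid T)" "y \<in> carrier (add_monoid T)"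
      then have xy: "x \<in> carrier T" "y \<in> carrier T" by auto
      have "g x (y \<otimes>\<^bsub>T\<^esub> y') \<approx>\<^bsub>H\<^esub> tsum (coaction T (y \<otimes>\<^bsub>T\<^esub> y')) (\<lambda>a c. tsum (gal (x \<otimes>\<^bsub>T\<^esub> a) c) g)"
        using xy xy' by (intro cong_mod_sym[OF coaction_gal[OF g]]) auto
      also have "\<dots> \<approx>\<^bsub>H\<^esub> tsum (coaction T y) (\<lambda>a c. tsum (coaction T y')
          (\<lambda>a' c'. tsum (gal (x \<otimes>\<^bsub>T\<^esub> (a \<otimes>\<^bsub>T\<^esub> a')) (c \<otimes>\<^bsub>B\<^esub> c')) g))"
        by (rule coaction_mult[OF TB_bal_lmult[OF gal_bal[OF g] xy(1)] xy(2) xy'(2)])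
      also have "\<dots> \<approx>\<^bsub>H\<^esub> tsum (coaction T y) (\<lambda>a c. ?f (x \<otimes>\<^bsub>T\<^esub> a) c)"
        using xy xy' by (intro tc.MB.tsum_cong coaction_closed) (auto simp: T.m_assoc)
      finally show "g x (y \<otimes>\<^bsub>T\<^esub> y') \<approx>\<^bsub>H\<^esub> tsum (coaction T y) (\<lambda>a c. ?f (x \<otimes>\<^bsub>T\<^esub> a) c)" .
    qed
    also have "\<dots> \<approx>\<^bsub>H\<^esub> ?f x' b"
      by (rule tsum_gal[OF f xy'(1) b(1)])
    finally show "tsum (gal x' b) (\<lambda>x y. g x (y \<otimes>\<^bsub>T\<^esub> y')) \<approx>\<^bsub>H\<^esub> ?f x' b" .
  qed
  also have "\<dots> \<approx>\<^bsub>H\<^esub> tsum (gal t (b \<otimes>\<^bsub>B\<^esub> b')) g"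
    by (rule tsum_gal[OF TB_bal_rmult[OF gal_bal[OF g] b(1)] t b(2)])
  finally show ?thesis .
qed

text \<open>The unit of \<open>T\<close> is coinvariant, so \<open>can\<close> sends
  \<open>t \<otimes> 1\<close> to \<open>t \<otimes> 1\<close>.\<close>

lemma gal_one:
  assumes g: "TT.bal H g" and t: "t \<in> carrier T"
  shows "tsum (gal t \<one>\<^bsub>B\<^esub>) g \<approx>\<^bsub>H\<^esub> g t \<one>\<^bsub>T\<^esub>"
proof -
  have "tsum (gal (t \<otimes>\<^bsub>T\<^esub> \<one>\<^bsub>T\<^esub>) \<one>\<^bsub>B\<^esub>) g \<approx>\<^bsub>H\<^esub> tsum (coaction T \<one>\<^bsub>T\<^esub>) (\<lambda>a c. tsum (gal (t \<otimes>\<^bsub>T\<^esub> a) c) g)"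
    by (rule cong_mod_sym[OF coaction_one[OF TB_bal_lmult[OF gal_bal[OF g] t]]])
  also have "\<dots> \<approx>\<^bsub>H\<^esub> g t \<one>\<^bsub>T\<^esub>"
    by (rule coaction_gal[OF g t T.one_closed])
  finally show ?thesis using t by simp
qed

text \<open>The coaction sends \<open>iota r\<close> to \<open>1 \<otimes> s(r)\<close>.\<close>

lemma gal_source:
  assumes g: "TT.bal H g" and t: "t \<in> carrier T" and r: "r \<in> carrier R"
  shows "tsum (gal t (source B r)) g \<approx>\<^bsub>H\<^esub> g t (iota r)"
proof -
  have "tsum (gal (t \<otimes>\<^bsub>T\<^esub> \<one>\<^bsub>T\<^esub>) (source B r)) g \<approx>\<^bsub>H\<^esub> tsum (coaction T (iota r)) (\<lambda>a c. tsum (gal (t \<otimes>\<^bsub>T\<^esub> a) c) g)"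
    by (rule cong_mod_sym[OF coaction_iota[OF TB_bal_lmult[OF gal_bal[OF g] t] r]])
  also have "\<dots> \<approx>\<^bsub>H\<^esub> g t (iota r)"
    by (rule coaction_gal[OF g t]) (simp add: r)
  finally show ?thesis using t by simp
qed

text \<open>Already in \<open>T \<otimes>_R B\<close> the tensors \<open>t \<otimes> t(r)\<close>
  and \<open>t iota(r) \<otimes> 1\<close> agree, which reduces the claim to
  \<open>gal_one\<close>.\<close>

lemma gal_target:
  assumes g: "TT.bal H g" and t: "t \<in> carrier T" and r: "r \<in> carrier R"
  shows "tsum (gal t (target B r)) g \<approx>\<^bsub>H\<^esub> g (t \<otimes>\<^bsub>T\<^esub> iota r) \<one>\<^bsub>T\<^esub>"
proof -
  have "tsum (gal t (\<one>\<^bsub>B\<^esub> \<otimes>\<^bsub>B\<^esub> target B r)) g \<approx>\<^bsub>H\<^esub> tsum (gal (t \<otimes>\<^bsub>T\<^esub> iota r) \<one>\<^bsub>B\<^esub>) g"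
    by (rule cong_mod_sym[OF coaction_iota_right[OF gal_bal[OF g] t r rb.B.one_closed]])
  also have "\<dots> \<approx>\<^bsub>H\<^esub> g (t \<otimes>\<^bsub>T\<^esub> iota r) \<one>\<^bsub>T\<^esub>"
    by (rule gal_one[OF g]) (simp add: t r)
  finally show ?thesis using r by simp
qed

text \<open>The sum is \<open>can^-1\<close> of \<open>can(1 \<otimes> t)\<close>.\<close>

lemma coaction_gal_one:
  assumes g: "TT.bal H g" and t: "t \<in> carrier T"
  shows "tsum (coaction T t) (\<lambda>a c. tsum (gal a c) g) \<approx>\<^bsub>H\<^esub> g \<one>\<^bsub>T\<^esub> t"
proof -
  have "tsum (coaction T t) (\<lambda>a c. tsum (gal a c) g) \<approx>\<^bsub>H\<^esub> tsum (coaction T t) (\<lambda>a c. tsum (gal (\<one>\<^bsub>T\<^esub> \<otimes>\<^bsub>T\<^esub> a) c) g)"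
    by (rule tc.MB.tsum_cong[OF coaction_closed[OF t]]) simp
  also have "\<dots> \<approx>\<^bsub>H\<^esub> g \<one>\<^bsub>T\<^esub> t" by (rule coaction_gal[OF g T.one_closed t])
  finally show ?thesis .
qed

text \<open>\<open>can(x iota(r) \<otimes> y) = x iota(r) y_0 \<otimes> y_1 = x y_0 \<otimes> t(r)
  y_1\<close>. A left factor \<open>t(r)\<close> of \<open>d\<close> therefore shows up on the right
  of the first leg.\<close>

lemma gal_target_left:
  assumes g: "TT.bal H g" and t: "t \<in> carrier T" and r: "r \<in> carrier R" and d: "d \<in> carrier B"
  shows "tsum (gal t (target B r \<otimes>\<^bsub>B\<^esub> d)) g \<approx>\<^bsub>H\<^esub> tsum (gal t d) (\<lambda>x y. g (x \<otimes>\<^bsub>T\<^esub> iota r) y)"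
proof -
  have "tsum (gal t d) (\<lambda>x y. g (x \<otimes>\<^bsub>T\<^esub> iota r) y) \<approx>\<^bsub>H\<^esub>
      tsum (gal t d) (\<lambda>x y. tsum (coaction T y) (\<lambda>a c. tsum (gal (x \<otimes>\<^bsub>T\<^esub> a) (target B r \<otimes>\<^bsub>B\<^esub> c)) g))"
  proof (rule TT.tsum_cong[OF gal_closed[OF t d]])
    fix x y assume "x \<in> carrier (add_monoid T)" "y \<in> carrier (add_monoid T)"
    then have xy: "x \<in> carrier T" "y \<in> carrier T" by auto
    have "g (x \<otimes>\<^bsub>T\<^esub> iota r) y \<approx>\<^bsub>H\<^esub> tsum (coaction T y) (\<lambda>a c. tsum (gal ((x \<otimes>\<^bsub>T\<^esub> iota r) \<otimes>\<^bsub>T\<^esub> a) c) g)"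
      using xy r by (intro cong_mod_sym[OF coaction_gal[OF g]]) auto
    also have "\<dots> \<approx>\<^bsub>H\<^esub> tsum (coaction T y) (\<lambda>a c. tsum (gal (x \<otimes>\<^bsub>T\<^esub> (iota r \<otimes>\<^bsub>T\<^esub> a)) c) g)"
      using xy r by (intro tc.MB.tsum_cong coaction_closed) (auto simp: T.m_assoc)
    also have "\<dots> \<approx>\<^bsub>H\<^esub> tsum (coaction T y) (\<lambda>a c. tsum (gal (x \<otimes>\<^bsub>T\<^esub> a) (target B r \<otimes>\<^bsub>B\<^esub> c)) g)"
      by (rule coaction_iota_left[OF TB_bal_lmult[OF gal_bal[OF g] xy(1)] xy(2) r])
    finally show "g (x \<otimes>\<^bsub>T\<^esub> iota r) y \<approx>\<^bsub>H\<^esub> tsum (coaction T y) (\<lambda>a c. tsum (gal (x \<otimes>\<^bsub>T\<^esub> a) (target B r \<otimes>\<^bsub>B\<^esub> c)) g)" .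
  qed
  also have "\<dots> \<approx>\<^bsub>H\<^esub> tsum (gal t (target B r \<otimes>\<^bsub>B\<^esub> d)) g"
    using r by (intro tsum_gal[OF TB_bal_rmult[OF gal_bal[OF g]] t d]) simp
  finally show ?thesis by (rule cong_mod_sym)
qed

lemma TB_bal_source:
  assumes f: "tc.MB.bal H f" and r: "r \<in> carrier R"
  shows "tc.MB.bal H (\<lambda>t b. f t (b \<otimes>\<^bsub>B\<^esub> source B r))"
proof (rule balancedI)
  fix n assume "n \<in> carrier (add_monoid B)"
  then show "additive_mod (add_monoid T) H (\<lambda>m. f m (n \<otimes>\<^bsub>B\<^esub> source B r))"
    using r by (intro balanced_left[OF f]) simp
next
  fix m assume "m \<in> carrier (add_monoid T)"
  then show "additive_mod (add_monoid B) H (\<lambda>n. f m (n \<otimes>\<^bsub>B\<^esub> source B r))"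
    using r by (intro rb.B.additive_mod_rmult[OF balanced_right[OF f]]) auto
next
  fix m i n assume *: "m \<in> carrier (add_monoid T)" "i \<in> carrier R" "n \<in> carrier (add_monoid B)"
  then have "(n \<otimes>\<^bsub>B\<^esub> target B i) \<otimes>\<^bsub>B\<^esub> source B r = (n \<otimes>\<^bsub>B\<^esub> source B r) \<otimes>\<^bsub>B\<^esub> target B i"
    using r by (simp add: rb.B.m_assoc rb.source_target_commute)
  then show "f (right_act T m i) (n \<otimes>\<^bsub>B\<^esub> source B r) \<approx>\<^bsub>H\<^esub> f m ((n \<otimes>\<^bsub>B\<^esub> target B i) \<otimes>\<^bsub>B\<^esub> source B r)"
    using balanced_middle[OF f, of m i "n \<otimes>\<^bsub>B\<^esub> source B r"] * r by simp
qed

text \<open>The coaction of \<open>T\<close> is right linear over \<open>R\<close>, so a right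
  factor \<open>s(r)\<close> of \<open>b\<close> passes to the right of the second leg.\<close>

lemma gal_source_right:
  assumes g: "TT.bal H g" and t: "t \<in> carrier T" and r: "r \<in> carrier R" and b: "b \<in> carrier B"
  shows "tsum (gal t (b \<otimes>\<^bsub>B\<^esub> source B r)) g \<approx>\<^bsub>H\<^esub> tsum (gal t b) (\<lambda>x y. g x (y \<otimes>\<^bsub>T\<^esub> iota r))"
proof -
  have "tsum (gal t b) (\<lambda>x y. g x (y \<otimes>\<^bsub>T\<^esub> iota r)) \<approx>\<^bsub>H\<^esub>
      tsum (gal t b) (\<lambda>x y. tsum (coaction T y) (\<lambda>a c. tsum (gal (x \<otimes>\<^bsub>T\<^esub> a) (c \<otimes>\<^bsub>B\<^esub> source B r)) g))"
  proof (rule TT.tsum_cong[OF gal_closed[OF t b]])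
    fix x y assume "x \<in> carrier (add_monoid T)" "y \<in> carrier (add_monoid T)"
    then have xy: "x \<in> carrier T" "y \<in> carrier T" by auto
    have "g x (y \<otimes>\<^bsub>T\<^esub> iota r) \<approx>\<^bsub>H\<^esub> tsum (coaction T (right_act T y r)) (\<lambda>a c. tsum (gal (x \<otimes>\<^bsub>T\<^esub> a) c) g)"
      using xy r cong_mod_sym[OF coaction_gal[OF g, of x "y \<otimes>\<^bsub>T\<^esub> iota r"]] by (simp add: right_act_eq_iota)
    also have "\<dots> \<approx>\<^bsub>H\<^esub> tsum (coaction T y) (\<lambda>a c. tsum (gal (x \<otimes>\<^bsub>T\<^esub> a) (c \<otimes>\<^bsub>B\<^esub> source B r)) g)"
      using xy r by (intro tc.coact_ra[OF TB_bal_lmult[OF gal_bal[OF g]]]) auto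
    finally show "g x (y \<otimes>\<^bsub>T\<^esub> iota r) \<approx>\<^bsub>H\<^esub> tsum (coaction T y) (\<lambda>a c. tsum (gal (x \<otimes>\<^bsub>T\<^esub> a) (c \<otimes>\<^bsub>B\<^esub> source B r)) g)" .
  qed
  also have "\<dots> \<approx>\<^bsub>H\<^esub> tsum (gal t (b \<otimes>\<^bsub>B\<^esub> source B r)) g"
    by (rule tsum_gal[OF TB_bal_source[OF gal_bal[OF g] r] t b])
  finally show ?thesis by (rule cong_mod_sym)
qed

text \<open>The factor \<open>e\<close> serves the coaction on the first leg, where
  \<open>x_1\<close> multiplies \<open>y_1\<close> from the left. For the second leg it is the
  unit.\<close>

lemma bal3_lmult:
  assumes g: "tc.bal3 H g" and x: "x \<in> carrier T" and e: "e \<in> carrier B"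
  shows "tc.bal3 H (\<lambda>t b b'. g (x \<otimes>\<^bsub>T\<^esub> t) (e \<otimes>\<^bsub>B\<^esub> b) b')"
proof (rule balanced3I)
  fix b b' assume "b \<in> carrier (add_monoid B)" "b' \<in> carrier (add_monoid B)"
  then show "additive_mod (add_monoid T) H (\<lambda>t. g (x \<otimes>\<^bsub>T\<^esub> t) (e \<otimes>\<^bsub>B\<^esub> b) b')"
    using x e by (intro T.additive_mod_lmult[OF balanced3_additive_fst[OF g]]) auto
next
  fix t b' assume "t \<in> carrier (add_monoid T)" "b' \<in> carrier (add_monoid B)"
  then show "additive_mod (add_monoid B) H (\<lambda>b. g (x \<otimes>\<^bsub>T\<^esub> t) (e \<otimes>\<^bsub>B\<^esub> b) b')"
    using x e by (intro rb.B.additive_mod_lmult[OF balanced_left[OF balanced3_fst[OF g]]]) auto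
next
  fix t b assume "t \<in> carrier (add_monoid T)" "b \<in> carrier (add_monoid B)"
  then show "additive_mod (add_monoid B) H (g (x \<otimes>\<^bsub>T\<^esub> t) (e \<otimes>\<^bsub>B\<^esub> b))"
    using x e by (intro balanced_right[OF balanced3_fst[OF g]]) auto
next
  fix t i b b' assume "t \<in> carrier (add_monoid T)" "i \<in> carrier R" "b \<in> carrier (add_monoid B)" "b' \<in> carrier (add_monoid B)"
  then show "g (x \<otimes>\<^bsub>T\<^esub> right_act T t i) (e \<otimes>\<^bsub>B\<^esub> b) b' \<approx>\<^bsub>H\<^esub> g (x \<otimes>\<^bsub>T\<^esub> t) (e \<otimes>\<^bsub>B\<^esub> (b \<otimes>\<^bsub>B\<^esub> target B i)) b'"
    using balanced3_middle1[OF g, of "x \<otimes>\<^bsub>T\<^esub> t" i "e \<otimes>\<^bsub>B\<^esub> b" b'] x e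
    by (simp add: right_act_eq_iota T.m_assoc rb.B.m_assoc)
next
  fix t i b b' assume "t \<in> carrier (add_monoid T)" "i \<in> carrier R" "b \<in> carrier (add_monoid B)" "b' \<in> carrier (add_monoid B)"
  then show "g (x \<otimes>\<^bsub>T\<^esub> t) (e \<otimes>\<^bsub>B\<^esub> (b \<otimes>\<^bsub>B\<^esub> source B i)) b' \<approx>\<^bsub>H\<^esub> g (x \<otimes>\<^bsub>T\<^esub> t) (e \<otimes>\<^bsub>B\<^esub> b) (b' \<otimes>\<^bsub>B\<^esub> target B i)"
    using balanced3_middle2[OF g, of "x \<otimes>\<^bsub>T\<^esub> t" i "e \<otimes>\<^bsub>B\<^esub> b" b'] x e
    by (simp add: rb.B.m_assoc)
qed

text \<open>Coassociativity of \<open>T\<close> makes \<open>can\<close> right colinear: \<open>t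
  b_- \<otimes> (b_+)_0 \<otimes> (b_+)_1 = t (b1)_- \<otimes> (b1)_+ \<otimes> b2\<close>. The
  hypotheses say that \<open>G\<close> is a functional on \<open>T \<otimes>_S T\<close> tensored
  over \<open>R\<close> with \<open>B\<close>, where \<open>R\<close> acts through the second
  leg.\<close>

lemma gal_coaction_plus:
  assumes G: "\<And>c. c \<in> carrier B \<Longrightarrow> TT.bal H (\<lambda>x y. G x y c)"
    and add: "\<And>x y. x \<in> carrier T \<Longrightarrow> y \<in> carrier T \<Longrightarrow> additive_mod (add_monoid B) H (G x y)"
    and mid: "\<And>x y r c. x \<in> carrier T \<Longrightarrow> y \<in> carrier T \<Longrightarrow> r \<in> carrier R \<Longrightarrow> c \<in> carrier B \<Longrightarrow>
      G x (y \<otimes>\<^bsub>T\<^esub> iota r) c \<approx>\<^bsub>H\<^esub> G x y (c \<otimes>\<^bsub>B\<^esub> target B r)"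
    and t: "t \<in> carrier T" and b: "b \<in> carrier B"
  shows "tsum (gal t b) (\<lambda>x y. tsum (coaction T y) (\<lambda>a c. G x a c)) \<approx>\<^bsub>H\<^esub>
    tsum (comult B b) (\<lambda>b1 b2. tsum (gal t b1) (\<lambda>x y. G x y b2))"
proof -
  let ?g = "\<lambda>t b b'. tsum (gal t b) (\<lambda>x y. G x y b')"
  have g: "tc.bal3 H ?g"
  proof (rule balanced3I)
    fix b b' assume "b \<in> carrier (add_monoid B)" "b' \<in> carrier (add_monoid B)"
    then show "additive_mod (add_monoid T) H (\<lambda>t. ?g t b b')"
      by (intro balanced_left[OF gal_bal[OF G]]) auto
  next
    fix t b' assume "t \<in> carrier (add_monoid T)" "b' \<in> carrier (add_monoid B)"
    then show "additive_mod (add_monoid B) H (\<lambda>b. ?g t b b')"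
      by (intro balanced_right[OF gal_bal[OF G]]) auto
  next
    fix t b assume "t \<in> carrier (add_monoid T)" "b \<in> carrier (add_monoid B)"
    then show "additive_mod (add_monoid B) H (?g t b)"
      by (intro TT.additive_tsum_param gal_closed add) auto
  next
    fix t i b b' assume "t \<in> carrier (add_monoid T)" "i \<in> carrier R" "b \<in> carrier (add_monoid B)" "b' \<in> carrier (add_monoid B)"
    then show "?g (right_act T t i) b b' \<approx>\<^bsub>H\<^esub> ?g t (b \<otimes>\<^bsub>B\<^esub> target B i) b'"
      by (intro balanced_middle[OF gal_bal[OF G]]) auto
  next
    fix t i b b' assume *: "t \<in> carrier (add_monoid T)" "i \<in> carrier R" "b \<in> carrier (add_monoid B)" "b' \<in> carrier (add_monoid B)"
    then have "?g t (b \<otimes>\<^bsub>B\<^esub> source B i) b' \<approx>\<^bsub>H\<^esub> tsum (gal t b) (\<lambda>x y. G x (y \<otimes>\<^bsub>T\<^esub> iota i) b')"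
      by (intro gal_source_right[OF G]) auto
    also have "\<dots> \<approx>\<^bsub>H\<^esub> ?g t b (b' \<otimes>\<^bsub>B\<^esub> target B i)"
      using * by (intro TT.tsum_cong gal_closed mid) auto
    finally show "?g t (b \<otimes>\<^bsub>B\<^esub> source B i) b' \<approx>\<^bsub>H\<^esub> ?g t b (b' \<otimes>\<^bsub>B\<^esub> target B i)" .
  qed
  have "tsum (gal t b) (\<lambda>x y. tsum (coaction T y) (\<lambda>a c. G x a c)) \<approx>\<^bsub>H\<^esub>
      tsum (gal t b) (\<lambda>x y. tsum (coaction T y) (\<lambda>a c. tsum (comult B c) (\<lambda>c1 c2. ?g (x \<otimes>\<^bsub>T\<^esub> a) c1 c2)))"
  proof (rule TT.tsum_cong[OF gal_closed[OF t b]])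
    fix x y assume "x \<in> carrier (add_monoid T)" "y \<in> carrier (add_monoid T)"
    then have xy: "x \<in> carrier T" "y \<in> carrier T" by auto
    have "tsum (coaction T y) (\<lambda>a c. G x a c) \<approx>\<^bsub>H\<^esub>
        tsum (coaction T y) (\<lambda>a c. tsum (coaction T a) (\<lambda>a' c'. ?g (x \<otimes>\<^bsub>T\<^esub> a') (\<one>\<^bsub>B\<^esub> \<otimes>\<^bsub>B\<^esub> c') c))"
    proof (rule tc.MB.tsum_cong[OF coaction_closed[OF xy(2)]])
      fix a c assume "a \<in> carrier (add_monoid T)" "c \<in> carrier (add_monoid B)"
      then have ac: "a \<in> carrier T" "c \<in> carrier B" by auto
      have "G x a c \<approx>\<^bsub>H\<^esub> tsum (coaction T a) (\<lambda>a' c'. ?g (x \<otimes>\<^bsub>T\<^esub> a') c' c)"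
        by (rule cong_mod_sym[OF coaction_gal[OF G]]) (use ac xy in auto)
      also have "\<dots> \<approx>\<^bsub>H\<^esub> tsum (coaction T a) (\<lambda>a' c'. ?g (x \<otimes>\<^bsub>T\<^esub> a') (\<one>\<^bsub>B\<^esub> \<otimes>\<^bsub>B\<^esub> c') c)"
        by (rule tc.MB.tsum_cong[OF coaction_closed[OF ac(1)]]) simp
      finally show "G x a c \<approx>\<^bsub>H\<^esub> tsum (coaction T a) (\<lambda>a' c'. ?g (x \<otimes>\<^bsub>T\<^esub> a') (\<one>\<^bsub>B\<^esub> \<otimes>\<^bsub>B\<^esub> c') c)" .
    qed
    also have "\<dots> \<approx>\<^bsub>H\<^esub> tsum (coaction T y) (\<lambda>a c. tsum (comult B c) (\<lambda>c1 c2. ?g (x \<otimes>\<^bsub>T\<^esub> a) (\<one>\<^bsub>B\<^esub> \<otimes>\<^bsub>B\<^esub> c1) c2))"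
      by (rule cong_mod_sym, rule tc.coact_coassoc[OF bal3_lmult[OF g xy(1) rb.B.one_closed]]) (use xy in simp)
    also have "\<dots> \<approx>\<^bsub>H\<^esub> tsum (coaction T y) (\<lambda>a c. tsum (comult B c) (\<lambda>c1 c2. ?g (x \<otimes>\<^bsub>T\<^esub> a) c1 c2))"
      using xy by (intro tc.MB.tsum_cong rb.BB.tsum_cong coaction_closed rb.comult_closed) auto
    finally show "tsum (coaction T y) (\<lambda>a c. G x a c) \<approx>\<^bsub>H\<^esub>
        tsum (coaction T y) (\<lambda>a c. tsum (comult B c) (\<lambda>c1 c2. ?g (x \<otimes>\<^bsub>T\<^esub> a) c1 c2))" .
  qed
  also have "\<dots> \<approx>\<^bsub>H\<^esub> tsum (comult B b) (\<lambda>b1 b2. ?g t b1 b2)"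
    by (rule tsum_gal[OF tc.bal3_comult[OF g] t b])
  finally show ?thesis .
qed

text \<open>In Sweedler form \<open>(t b_-)_0 \<otimes> b_+ \<otimes> (t b_-)_1 = t_0 (b^+)_-
  \<otimes> (b^+)_+ \<otimes> t_1 b^-\<close>. The second leg is expanded with \<open>can^-1\<close>
  of \<open>can\<close> and its \<open>B\<close>-component with \<open>\<nu>^-1\<close> of
  \<open>\<nu>\<close>; what results depends on \<open>x \<otimes> y\<close> only through
  \<open>can\<close> and collapses. The inverse of \<open>\<nu>\<close> does here the work of an
  antipode.\<close>

lemma gal_coaction_minus:
  assumes G: "\<And>c. c \<in> carrier B \<Longrightarrow> TT.bal H (\<lambda>x y. G x y c)"
    and add: "\<And>x y. x \<in> carrier T \<Longrightarrow> y \<in> carrier T \<Longrightarrow> additive_mod (add_monoid B) H (G x y)"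
    and mid: "\<And>x y r c. x \<in> carrier T \<Longrightarrow> y \<in> carrier T \<Longrightarrow> r \<in> carrier R \<Longrightarrow> c \<in> carrier B \<Longrightarrow>
      G (x \<otimes>\<^bsub>T\<^esub> iota r) y c \<approx>\<^bsub>H\<^esub> G x y (c \<otimes>\<^bsub>B\<^esub> target B r)"
    and t: "t \<in> carrier T" and b: "b \<in> carrier B"
  shows "tsum (gal t b) (\<lambda>x y. tsum (coaction T x) (\<lambda>a c. G a y c)) \<approx>\<^bsub>H\<^esub>
    tsum (coaction T t) (\<lambda>a e. tsum (rb.splitting \<one>\<^bsub>B\<^esub> b) (\<lambda>c d. tsum (gal a d) (\<lambda>x y. G x y (e \<otimes>\<^bsub>B\<^esub> c))))"
proof -
  let ?q = "\<lambda>t c d. tsum (gal t d) (\<lambda>x y. G x y c)"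
  \<comment> \<open>Both inverses at once: \<open>\<nu>^-1\<close> splits
    \<open>c \<otimes> b\<close>, and its second leg is fed into \<open>can^-1\<close> together with
    \<open>t\<close>. Balance in all three arguments is what the later collapse needs.\<close>
  let ?p = "\<lambda>t c b. tsum (rb.splitting c b) (?q t)"
  have q: "rb.BoB.bal H (?q t)" if t: "t \<in> carrier T" for t
  proof (rule balancedI)
    fix d assume "d \<in> carrier (add_monoid B)"
    then show "additive_mod (add_monoid B) H (\<lambda>c. ?q t c d)"
      using t by (intro TT.additive_tsum_param gal_closed add) auto
  next
    fix c assume "c \<in> carrier (add_monoid B)"
    then show "additive_mod (add_monoid B) H (?q t c)"
      using t by (intro balanced_right[OF gal_bal[OF G]]) auto
  next
    fix c i d assume *: "c \<in> carrier (add_monoid B)" "i \<in> carrier R" "d \<in> carrier (add_monoid B)"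
    then have "?q t c (target B i \<otimes>\<^bsub>B\<^esub> d) \<approx>\<^bsub>H\<^esub> tsum (gal t d) (\<lambda>x y. G (x \<otimes>\<^bsub>T\<^esub> iota i) y c)"
      using t by (intro gal_target_left[OF G]) auto
    also have "\<dots> \<approx>\<^bsub>H\<^esub> ?q t (c \<otimes>\<^bsub>B\<^esub> target B i) d"
      using t * by (intro TT.tsum_cong gal_closed mid) auto
    finally show "?q t (c \<otimes>\<^bsub>B\<^esub> target B i) d \<approx>\<^bsub>H\<^esub> ?q t c (target B i \<otimes>\<^bsub>B\<^esub> d)"
      by (rule cong_mod_sym)
  qed
  have p: "tc.bal3 H ?p"
  proof (rule balanced3I)
    fix c b assume "c \<in> carrier (add_monoid B)" "b \<in> carrier (add_monoid B)"
    then show "additive_mod (add_monoid T) H (\<lambda>t. ?p t c b)"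
      by (intro rb.BoB.additive_tsum_param rb.splitting_closed balanced_left[OF gal_bal[OF G]]) auto
  next
    fix t b assume "t \<in> carrier (add_monoid T)" "b \<in> carrier (add_monoid B)"
    then show "additive_mod (add_monoid B) H (\<lambda>c. ?p t c b)"
      by (intro balanced_left[OF rb.splitting_bal[OF q]]) auto
  next
    fix t c assume "t \<in> carrier (add_monoid T)" "c \<in> carrier (add_monoid B)"
    then show "additive_mod (add_monoid B) H (?p t c)"
      by (intro balanced_right[OF rb.splitting_bal[OF q]]) auto
  next
    fix t i c b assume *: "t \<in> carrier (add_monoid T)" "i \<in> carrier R" "c \<in> carrier (add_monoid B)" "b \<in> carrier (add_monoid B)"
    then have "?p (right_act T t i) c b \<approx>\<^bsub>H\<^esub> tsum (rb.splitting c b) (\<lambda>x y. ?q t x (y \<otimes>\<^bsub>B\<^esub> target B i))"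
      by (intro rb.BoB.tsum_cong rb.splitting_closed balanced_middle[OF gal_bal[OF G]]) auto
    also have "\<dots> \<approx>\<^bsub>H\<^esub> ?p t (c \<otimes>\<^bsub>B\<^esub> target B i) b"
      using * by (intro cong_mod_sym[OF rb.splitting_target[OF q]]) auto
    finally show "?p (right_act T t i) c b \<approx>\<^bsub>H\<^esub> ?p t (c \<otimes>\<^bsub>B\<^esub> target B i) b" .
  next
    fix t i c b assume *: "t \<in> carrier (add_monoid T)" "i \<in> carrier R" "c \<in> carrier (add_monoid B)" "b \<in> carrier (add_monoid B)"
    then show "?p t (c \<otimes>\<^bsub>B\<^esub> source B i) b \<approx>\<^bsub>H\<^esub> ?p t c (b \<otimes>\<^bsub>B\<^esub> target B i)"
      by (intro balanced_middle[OF rb.splitting_bal[OF q]]) auto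
  qed
  have "tsum (gal t b) (\<lambda>x y. tsum (coaction T x) (\<lambda>a c. G a y c)) \<approx>\<^bsub>H\<^esub>
      tsum (gal t b) (\<lambda>x y. tsum (coaction T y) (\<lambda>a' c'. tsum (coaction T (x \<otimes>\<^bsub>T\<^esub> a')) (\<lambda>a e. ?p a e c')))"
  proof (rule TT.tsum_cong[OF gal_closed[OF t b]])
    fix x y assume "x \<in> carrier (add_monoid T)" "y \<in> carrier (add_monoid T)"
    then have xy: "x \<in> carrier T" "y \<in> carrier T" by auto
    have "tsum (coaction T x) (\<lambda>a e. G a y e) \<approx>\<^bsub>H\<^esub>
        tsum (coaction T x) (\<lambda>a e. tsum (coaction T y) (\<lambda>a' c'. tsum (coaction T a') (\<lambda>a'' c''. ?p (a \<otimes>\<^bsub>T\<^esub> a'') (e \<otimes>\<^bsub>B\<^esub> c'') c')))"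
    proof (rule tc.MB.tsum_cong[OF coaction_closed[OF xy(1)]])
      fix a e assume "a \<in> carrier (add_monoid T)" "e \<in> carrier (add_monoid B)"
      then have ae: "a \<in> carrier T" "e \<in> carrier B" by auto
      have "G a y e \<approx>\<^bsub>H\<^esub> tsum (coaction T y) (\<lambda>a' c'. ?q (a \<otimes>\<^bsub>T\<^esub> a') e c')"
        using ae xy by (intro cong_mod_sym[OF coaction_gal[OF G]]) auto
      also have "\<dots> \<approx>\<^bsub>H\<^esub> tsum (coaction T y) (\<lambda>a' c'. tsum (comult B c') (\<lambda>c1 c2. ?p (a \<otimes>\<^bsub>T\<^esub> a') (e \<otimes>\<^bsub>B\<^esub> c1) c2))"
        using ae xy by (intro tc.MB.tsum_cong coaction_closed cong_mod_sym[OF rb.comult_splitting[OF q]]) auto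
      also have "\<dots> \<approx>\<^bsub>H\<^esub> tsum (coaction T y) (\<lambda>a' c'. tsum (coaction T a') (\<lambda>a'' c''. ?p (a \<otimes>\<^bsub>T\<^esub> a'') (e \<otimes>\<^bsub>B\<^esub> c'') c'))"
        by (rule tc.coact_coassoc[OF bal3_lmult[OF p ae]]) (use xy in simp)
      finally show "G a y e \<approx>\<^bsub>H\<^esub> tsum (coaction T y) (\<lambda>a' c'. tsum (coaction T a') (\<lambda>a'' c''. ?p (a \<otimes>\<^bsub>T\<^esub> a'') (e \<otimes>\<^bsub>B\<^esub> c'') c'))" .
    qed
    also have "\<dots> = tsum (coaction T y) (\<lambda>a' c'. tsum (coaction T x) (\<lambda>a e. tsum (coaction T a') (\<lambda>a'' c''. ?p (a \<otimes>\<^bsub>T\<^esub> a'') (e \<otimes>\<^bsub>B\<^esub> c'') c')))"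
      by (rule tsum_swap)
    \<comment> \<open>The components of \<open>x\<close> and of \<open>a'\<close> now occur only
      multiplied together, which is the coaction of the product \<open>x a'\<close>.\<close>
    also have "\<dots> \<approx>\<^bsub>H\<^esub> tsum (coaction T y) (\<lambda>a' c'. tsum (coaction T (x \<otimes>\<^bsub>T\<^esub> a')) (\<lambda>a e. ?p a e c'))"
      using xy by (intro tc.MB.tsum_cong coaction_closed cong_mod_sym[OF coaction_mult] balanced3_thd[OF p]) auto
    finally show "tsum (coaction T x) (\<lambda>a e. G a y e) \<approx>\<^bsub>H\<^esub>
        tsum (coaction T y) (\<lambda>a' c'. tsum (coaction T (x \<otimes>\<^bsub>T\<^esub> a')) (\<lambda>a e. ?p a e c'))" .
  qed
  also have "\<dots> \<approx>\<^bsub>H\<^esub> tsum (coaction T t) (\<lambda>a e. ?p a e b)"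
    by (rule tsum_gal[OF tc.bal3_coact[OF p] t b])
  also have "\<dots> \<approx>\<^bsub>H\<^esub> tsum (coaction T t) (\<lambda>a e. tsum (rb.splitting \<one>\<^bsub>B\<^esub> b) (\<lambda>c d. ?q a (e \<otimes>\<^bsub>B\<^esub> c) d))"
  proof (rule tc.MB.tsum_cong[OF coaction_closed[OF t]])
    fix a e assume "a \<in> carrier (add_monoid T)" "e \<in> carrier (add_monoid B)"
    then show "?p a e b \<approx>\<^bsub>H\<^esub> tsum (rb.splitting \<one>\<^bsub>B\<^esub> b) (\<lambda>c d. ?q a (e \<otimes>\<^bsub>B\<^esub> c) d)"
      using rb.splitting_lmult[OF q, of a e "\<one>\<^bsub>B\<^esub>" b] b by simp
  qed
  finally show ?thesis .
qed

end

section \<open>Rotating an element through a SAYD module\<close>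

locale sayd_setting = galois_setting R B S K T act
  for R :: "(complex, 'r) module" and B :: "('r, 'b) bialgebroid"
    and S :: "(complex, 't) module" and K :: "('t, 'k) bialgebroid"
    and T :: "('r, 'b, 't) comodule_algebra" and act :: "'k \<Rightarrow> 't \<Rightarrow> 't" +
  fixes M :: "('t, 'k, 'm) rl_module"
  assumes sayd: "rl_sayd S K M"
begin

lemma M_module: "right_module K M (alg_act M)"
  and M_comodule: "left_comodule S K M (base_act M) (coact M)"
  and base_act_eq: "m \<in> carrier M \<Longrightarrow> r \<in> carrier S \<Longrightarrow> base_act M r m = alg_act M m (target K r)"
  and right_action_eq: "m \<in> carrier M \<Longrightarrow> r \<in> carrier S \<Longrightarrow>
        left_comodule_right_action K M (base_act M) (coact M) m r = alg_act M m (source K r)"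
  and value_stable: "m \<in> carrier M \<Longrightarrow> z \<in> coact M m \<Longrightarrow> value_sum M (\<lambda>h n. alg_act M n h) z = m"
  using sayd unfolding rl_sayd_def by blast+

lemma M_comm_group: "comm_group M"
  using M_module by (simp add: right_module_def)

lemma M_monoid: "Group.monoid M"
  using M_comm_group by (simp add: comm_group_def group_def)

lemma alg_act_closed [simp]: "m \<in> carrier M \<Longrightarrow> k \<in> carrier K \<Longrightarrow> alg_act M m k \<in> carrier M"
  and alg_act_add: "m \<in> carrier M \<Longrightarrow> k \<in> carrier K \<Longrightarrow> k' \<in> carrier K \<Longrightarrow>
      alg_act M m (k \<oplus>\<^bsub>K\<^esub> k') = alg_act M m k \<otimes>\<^bsub>M\<^esub> alg_act M m k'"
  and alg_act_hom: "k \<in> carrier K \<Longrightarrow> (\<lambda>m. alg_act M m k) \<in> hom M M"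
  using M_module by (auto simp: right_module_def hom_def)

sublocale KM: tensor_space "left_tensor S K M (base_act M)" "carrier S"
  "add_monoid K" "\<lambda>k r. target K r \<otimes>\<^bsub>K\<^esub> k" M "base_act M"
  by unfold_locales
     (auto simp: left_tensor_def tensor_ok_def M_monoid base_act_eq)

sublocale QM: tensor_space "digamma_group K T act M" "carrier K" M "alg_act M" "add_monoid T" act
  by unfold_locales
     (auto simp: digamma_group_def tensor_ok_def M_monoid)

lemma coact_hom: "coact M \<in> hom M (left_tensor S K M (base_act M))"
  using M_comodule by (simp add: left_comodule_def)

lemma coact_closed: "m \<in> carrier M \<Longrightarrow> coact M m \<in> carrier (left_tensor S K M (base_act M))"
  using coact_hom by (auto simp: hom_def)

lemma rep_coact_mem: "m \<in> carrier M \<Longrightarrow> rep (coact M m) \<in> coact M m"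
  by (rule rep_mem[OF KM.pres coact_closed])

lemma rep_coact: "(\<lambda>m. rep (coact M m)) \<in> Pi (carrier M) (coact M)"
  using rep_coact_mem by auto

lemma rep_coact_keys: "m \<in> carrier M \<Longrightarrow> Poly_Mapping.keys (rep (coact M m)) \<subseteq> carrier K \<times> carrier M"
  using rep_keys[OF KM.pres coact_closed] by simp

lemma coact_additive: "KM.bal H f \<Longrightarrow> additive_mod M H (\<lambda>m. tsum (coact M m) f)"
  by (rule additive_mod_comp[OF KM.tsum_additive coact_hom])

abbreviation "bal3 \<equiv> balanced3 (carrier S)
  (add_monoid K) (\<lambda>k r. target K r \<otimes>\<^bsub>K\<^esub> k)
  (add_monoid K) (\<lambda>r k. source K r \<otimes>\<^bsub>K\<^esub> k) (\<lambda>k r. target K r \<otimes>\<^bsub>K\<^esub> k)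
  M (base_act M)"

abbreviation "KKM \<equiv> tensor3 (carrier S)
  (add_monoid K) (\<lambda>k r. target K r \<otimes>\<^bsub>K\<^esub> k)
  (add_monoid K) (\<lambda>r k. source K r \<otimes>\<^bsub>K\<^esub> k) (\<lambda>k r. target K r \<otimes>\<^bsub>K\<^esub> k)
  M (base_act M)"

abbreviation "rels3 \<equiv> tensor3_rels (carrier S)
  (add_monoid K) (\<lambda>k r. target K r \<otimes>\<^bsub>K\<^esub> k)
  (add_monoid K) (\<lambda>r k. source K r \<otimes>\<^bsub>K\<^esub> k) (\<lambda>k r. target K r \<otimes>\<^bsub>K\<^esub> k)
  M (base_act M)"

lemma pres3: "presented KKM (carrier (add_monoid K) \<times> carrier (add_monoid K) \<times> carrier M) rels3"
  by (rule presented_tensor3) (auto simp: M_monoid base_act_eq)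

lemma coact_coassoc:
  assumes f: "bal3 H f" and m: "m \<in> carrier M"
  shows "tsum (coact M m) (\<lambda>k n. tsum (comult K k) (\<lambda>k1 k2. f k1 k2 n)) \<approx>\<^bsub>H\<^esub>
    tsum (coact M m) (\<lambda>k n. tsum (coact M n) (\<lambda>k' n'. f k k' n'))"
proof -
  have "\<And>D C. D \<in> Pi (carrier K) (comult K) \<Longrightarrow> C \<in> Pi (carrier M) (coact M) \<Longrightarrow>
      tclass KKM (sweedler (C m) (\<lambda>k n. sweedler (D k) (\<lambda>k1 k2. frag_of (k1, k2, n)))) =
      tclass KKM (sweedler (C m) (\<lambda>k n. sweedler (C n) (\<lambda>k' n'. frag_of (k, k', n'))))"
    using M_comodule m unfolding left_comodule_def left_coassociative_def Let_def by blast
  from this[OF lk.rep_comult rep_coact, unfolded tclass_eq_iff[OF pres3]]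
  have "frag_extend (\<lambda>(x, y, z). f x y z) (sweedler (rep (coact M m)) (\<lambda>k n. sweedler (rep (comult K k)) (\<lambda>k1 k2. frag_of (k1, k2, n)))) \<approx>\<^bsub>H\<^esub>
      frag_extend (\<lambda>(x, y, z). f x y z) (sweedler (rep (coact M m)) (\<lambda>k n. sweedler (rep (coact M n)) (\<lambda>k' n'. frag_of (k, k', n'))))"
    by (rule descends_cong_mod[OF balanced3_descends[OF f]])
  then show ?thesis unfolding tsum_def sweedler_sweedler3 by simp
qed

lemma tsum_value_sum:
  assumes "additive_mod M H u" "m \<in> carrier M"
    and "\<And>h n. h \<in> carrier K \<Longrightarrow> n \<in> carrier M \<Longrightarrow> f h n \<in> carrier M"
    and "value_sum M f (rep (coact M m)) = m'"
  shows "tsum (coact M m) (\<lambda>h n. u (f h n)) \<approx>\<^bsub>H\<^esub> u m'"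
proof -
  have "u (value_sum M f (rep (coact M m))) \<approx>\<^bsub>H\<^esub> tsum (coact M m) (\<lambda>h n. u (f h n))"
    unfolding tsum_def
    by (rule additive_mod_value_sum[OF M_comm_group assms(1)])
       (use rep_coact_keys[OF assms(2)] assms(3) in auto)
  then show ?thesis unfolding assms(4) by (rule cong_mod_sym)
qed

lemma stability:
  assumes "additive_mod M H u" "m \<in> carrier M"
  shows "tsum (coact M m) (\<lambda>h n. u (alg_act M n h)) \<approx>\<^bsub>H\<^esub> u m"
  by (rule tsum_value_sum[OF assms _ value_stable[OF assms(2) rep_coact_mem[OF assms(2)]]]) simp

text \<open>The base action on \<open>M\<close> is the action of target elements, so the counit
  axiom can be stated inside the \<open>K\<close>-module \<open>M\<close>.\<close>

lemma coact_counit: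
  assumes "additive_mod M H u" "m \<in> carrier M"
  shows "tsum (coact M m) (\<lambda>h n. u (alg_act M n (target K (counit K h)))) \<approx>\<^bsub>H\<^esub> u m"
proof -
  have "\<And>z. z \<in> coact M m \<Longrightarrow> value_sum M (\<lambda>k n. base_act M (counit K k) n) z = m"
    using M_comodule assms(2) unfolding left_comodule_def by blast
  from tsum_value_sum[OF assms _ this[OF rep_coact_mem[OF assms(2)]]]
  have "tsum (coact M m) (\<lambda>h n. u (base_act M (counit K h) n)) \<approx>\<^bsub>H\<^esub> u m"
    by (simp add: base_act_eq)
  moreover have "tsum (coact M m) (\<lambda>h n. u (alg_act M n (target K (counit K h)))) \<approx>\<^bsub>H\<^esub>
      tsum (coact M m) (\<lambda>h n. u (base_act M (counit K h) n))"
    by (rule KM.tsum_cong[OF coact_closed[OF assms(2)]]) (simp add: base_act_eq)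
  ultimately show ?thesis by (rule cong_mod_trans[rotated])
qed

lemma right_action_bal:
  assumes u: "additive_mod M H u" and c: "c \<in> carrier K"
  shows "KM.bal H (\<lambda>k n. u (base_act M (counit K (k \<otimes>\<^bsub>K\<^esub> c)) n))"
proof (rule balancedI)
  fix n assume "n \<in> carrier M"
  then show "additive_mod (add_monoid K) H (\<lambda>k. u (base_act M (counit K (k \<otimes>\<^bsub>K\<^esub> c)) n))"
    using c by (intro additive_mod_addI) (simp add: lk.K.l_distr lk.counit_add base_act_eq alg_act_add additive_modD[OF u])
next
  fix k assume k: "k \<in> carrier (add_monoid K)"
  have "additive_mod M H (\<lambda>n. u (alg_act M n (target K (counit K (k \<otimes>\<^bsub>K\<^esub> c)))))"
    using k c by (intro additive_mod_comp[OF u alg_act_hom]) simp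
  then show "additive_mod M H (\<lambda>n. u (base_act M (counit K (k \<otimes>\<^bsub>K\<^esub> c)) n))"
    by (rule additive_mod_cong[OF M_monoid]) (use k c in \<open>simp add: base_act_eq\<close>)
next
  fix k i n assume *: "k \<in> carrier (add_monoid K)" "i \<in> carrier S" "n \<in> carrier M"
  have "base_act M (counit K ((target K i \<otimes>\<^bsub>K\<^esub> k) \<otimes>\<^bsub>K\<^esub> c)) n = base_act M (counit K (k \<otimes>\<^bsub>K\<^esub> c)) (base_act M i n)"
    using * c M_comodule
    by (simp add: lk.K.m_assoc lk.counit_target left_comodule_def left_module_def)
  then show "u (base_act M (counit K ((target K i \<otimes>\<^bsub>K\<^esub> k) \<otimes>\<^bsub>K\<^esub> c)) n) \<approx>\<^bsub>H\<^esub>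
      u (base_act M (counit K (k \<otimes>\<^bsub>K\<^esub> c)) (base_act M i n))"
    by simp
qed

text \<open>The canonical right \<open>S\<close>-action is defined through the counit and the base
  action; the first SAYD condition identifies it with source elements and the base action with
  target elements.\<close>

lemma alg_act_source:
  assumes u: "additive_mod M H u" and m: "m \<in> carrier M" and s: "s \<in> carrier S"
  shows "u (alg_act M m (source K s)) \<approx>\<^bsub>H\<^esub>
    tsum (coact M m) (\<lambda>k n. u (alg_act M n (target K (counit K (k \<otimes>\<^bsub>K\<^esub> source K s)))))"
proof -
  let ?f = "\<lambda>k n. base_act M (counit K (k \<otimes>\<^bsub>K\<^esub> source K s)) n"
  have bal: "KM.bal (group_rels M) (\<lambda>k n. frag_of (?f k n))"
    by (rule right_action_bal[OF additive_mod_frag_of]) (simp add: s)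
  have closed: "?f k n \<in> carrier M" if "k \<in> carrier (add_monoid K)" "n \<in> carrier M" for k n
    using that s by (simp add: base_act_eq)
  have v: "value_sum M ?f z = value_sum M ?f (rep (coact M m))" if "z \<in> coact M m" for z
    by (rule KM.value_sum_welldef[OF M_comm_group bal closed coact_closed[OF m] that]; assumption)
  have "left_comodule_right_action K M (base_act M) (coact M) m s = value_sum M ?f (rep (coact M m))"
    unfolding left_comodule_right_action_def
  proof (rule the_elem_eqI, goal_cases)
    case 1 show ?case using rep_coact_mem[OF m] by blast
  next
    case (2 x) then show ?case using v by blast
  qed
  then have "value_sum M ?f (rep (coact M m)) = alg_act M m (source K s)"
    using right_action_eq[OF m s] by simp
  from tsum_value_sum[OF u m _ this]
  have "tsum (coact M m) (\<lambda>k n. u (?f k n)) \<approx>\<^bsub>H\<^esub> u (alg_act M m (source K s))"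
    using s by (simp add: base_act_eq)
  moreover have "tsum (coact M m) (\<lambda>k n. u (alg_act M n (target K (counit K (k \<otimes>\<^bsub>K\<^esub> source K s))))) \<approx>\<^bsub>H\<^esub>
      tsum (coact M m) (\<lambda>k n. u (?f k n))"
    by (rule KM.tsum_cong[OF coact_closed[OF m]]) (simp add: base_act_eq s)
  ultimately show ?thesis by (rule cong_mod_sym[OF cong_mod_trans[rotated]])
qed

text \<open>The value of \<open>f\<close> at
  \<open>m_0 \<otimes> y (m_{-1} \<triangleright> x)\<close>. For
  \<open>x \<otimes> y = t b_- \<otimes> b_+\<close> this is the formula for
  \<open>b \<triangleright> (m \<otimes> t)\<close>.\<close>

definition rot :: "('m \<Rightarrow> 't \<Rightarrow> 'c \<Rightarrow>\<^sub>0 int) \<Rightarrow> 'm \<Rightarrow> 't \<Rightarrow> 't \<Rightarrow> 'c \<Rightarrow>\<^sub>0 int" where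
  "rot f m x y = tsum (coact M m) (\<lambda>h n. f n (y \<otimes>\<^bsub>T\<^esub> act h x))"

lemma QM_target:
  assumes "QM.bal H f" "n \<in> carrier M" "s \<in> carrier S" "t \<in> carrier T"
  shows "f (alg_act M n (target K s)) t \<approx>\<^bsub>H\<^esub> f n (t \<otimes>\<^bsub>T\<^esub> s)"
  using balanced_middle[OF assms(1), of n "target K s" t] assms by (simp add: act_target)

lemma QM_source:
  assumes "QM.bal H f" "n \<in> carrier M" "s \<in> carrier S" "t \<in> carrier T"
  shows "f (alg_act M n (source K s)) t \<approx>\<^bsub>H\<^esub> f n (s \<otimes>\<^bsub>T\<^esub> t)"
  using balanced_middle[OF assms(1), of n "source K s" t] assms by (simp add: act_source)

text \<open>A base element acting on \<open>m_0\<close> moves across the tensor product and becomes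
  a right factor in \<open>T\<close>, which is also what \<open>target K i\<close> produces when it
  multiplies \<open>m_{-1}\<close>.\<close>

lemma rot_KM_bal:
  assumes f: "QM.bal H f" and x: "x \<in> carrier T" and y: "y \<in> carrier T"
  shows "KM.bal H (\<lambda>h n. f n (y \<otimes>\<^bsub>T\<^esub> act h x))"
proof (rule balancedI)
  fix n assume "n \<in> carrier M"
  then show "additive_mod (add_monoid K) H (\<lambda>h. f n (y \<otimes>\<^bsub>T\<^esub> act h x))"
    by (intro additive_act_left[OF T.additive_mod_lmult[OF balanced_right[OF f] y] x])
next
  fix h assume "h \<in> carrier (add_monoid K)"
  then show "additive_mod M H (\<lambda>n. f n (y \<otimes>\<^bsub>T\<^esub> act h x))"
    using x y by (intro balanced_left[OF f]) simp
next
  fix h i n assume *: "h \<in> carrier (add_monoid K)" "i \<in> carrier S" "n \<in> carrier M"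
  have "f (base_act M i n) (y \<otimes>\<^bsub>T\<^esub> act h x) \<approx>\<^bsub>H\<^esub> f n ((y \<otimes>\<^bsub>T\<^esub> act h x) \<otimes>\<^bsub>T\<^esub> i)"
    using * x y QM_target[OF f, of n i "y \<otimes>\<^bsub>T\<^esub> act h x"] by (simp add: base_act_eq)
  also have "\<dots> = f n (y \<otimes>\<^bsub>T\<^esub> act (target K i \<otimes>\<^bsub>K\<^esub> h) x)"
    using * x y by (simp add: act_mult act_target T.m_assoc S_carrier)
  finally show "f n (y \<otimes>\<^bsub>T\<^esub> act (target K i \<otimes>\<^bsub>K\<^esub> h) x) \<approx>\<^bsub>H\<^esub> f (base_act M i n) (y \<otimes>\<^bsub>T\<^esub> act h x)"
    by (rule cong_mod_sym)
qed

lemma rot_additive: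
  "QM.bal H f \<Longrightarrow> x \<in> carrier T \<Longrightarrow> y \<in> carrier T \<Longrightarrow> additive_mod M H (\<lambda>m. rot f m x y)"
  unfolding rot_def by (intro coact_additive rot_KM_bal)

lemma rot_cong:
  assumes "m \<in> carrier M" "\<And>h n. h \<in> carrier K \<Longrightarrow> n \<in> carrier M \<Longrightarrow> f n (y \<otimes>\<^bsub>T\<^esub> act h x) \<approx>\<^bsub>H\<^esub> f' n (y' \<otimes>\<^bsub>T\<^esub> act h x')"
  shows "rot f m x y \<approx>\<^bsub>H\<^esub> rot f' m x' y'"
  unfolding rot_def by (rule KM.tsum_cong[OF coact_closed[OF assms(1)]]) (simp add: assms(2))

lemma act_counit_bal:
  assumes f: "QM.bal H f" and n: "n \<in> carrier M" and x: "x \<in> carrier T" and y: "y \<in> carrier T"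
  shows "lk.KK.bal H (\<lambda>k k'. f n ((y \<otimes>\<^bsub>T\<^esub> act k x) \<otimes>\<^bsub>T\<^esub> counit K k'))"
proof (rule balancedI)
  fix k' assume "k' \<in> carrier (add_monoid K)"
  then show "additive_mod (add_monoid K) H (\<lambda>k. f n ((y \<otimes>\<^bsub>T\<^esub> act k x) \<otimes>\<^bsub>T\<^esub> counit K k'))"
    by (intro additive_act_left[OF T.additive_mod_lmult[OF T.additive_mod_rmult[OF balanced_right[OF f n]] y] x])
       (simp add: S_carrier)
next
  fix k assume "k \<in> carrier (add_monoid K)"
  then show "additive_mod (add_monoid K) H (\<lambda>k'. f n ((y \<otimes>\<^bsub>T\<^esub> act k x) \<otimes>\<^bsub>T\<^esub> counit K k'))"
    using x y by (intro additive_mod_addI)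
      (simp add: lk.counit_add S_ops T.r_distr S_carrier additive_mod_addD[OF balanced_right[OF f n]])
next
  fix k i k' assume "k \<in> carrier (add_monoid K)" "i \<in> carrier S" "k' \<in> carrier (add_monoid K)"
  then show "f n ((y \<otimes>\<^bsub>T\<^esub> act (target K i \<otimes>\<^bsub>K\<^esub> k) x) \<otimes>\<^bsub>T\<^esub> counit K k') \<approx>\<^bsub>H\<^esub>
      f n ((y \<otimes>\<^bsub>T\<^esub> act k x) \<otimes>\<^bsub>T\<^esub> counit K (source K i \<otimes>\<^bsub>K\<^esub> k'))"
    using x y by (intro cong_mod_eq) (simp add: act_mult act_target lk.counit_source S_ops T.m_assoc S_carrier)
qed

text \<open>The factor \<open>s\<close> of \<open>s y\<close> is absorbed into \<open>m_0\<close> as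
  the action of \<open>source K s\<close>, which \<open>alg_act_source\<close> rewrites with a
  second coaction as a right factor given by a counit. Coassociativity merges the two coactions into
  a coproduct, and the Takeuchi condition followed by the counit deposits \<open>target K s\<close>
  on \<open>x\<close>, that is, \<open>x s\<close>.\<close>

lemma rot_middle:
  assumes f: "QM.bal H f" and m: "m \<in> carrier M" and x: "x \<in> carrier T" and s: "s \<in> carrier S" and y: "y \<in> carrier T"
  shows "rot f m (x \<otimes>\<^bsub>T\<^esub> s) y \<approx>\<^bsub>H\<^esub> rot f m x (s \<otimes>\<^bsub>T\<^esub> y)"
proof -
  have sK: "source K s \<in> carrier K" and tK: "target K s \<in> carrier K" and sT: "s \<in> carrier T"
    using s S_carrier by auto
  \<comment> \<open>\<open>k'\<close> carries the second coaction. Its counit lies in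
    \<open>S\<close>, hence in \<open>T\<close>, and stands as the last factor.\<close>
  let ?g = "\<lambda>k k' n. f n ((y \<otimes>\<^bsub>T\<^esub> act k x) \<otimes>\<^bsub>T\<^esub> counit K (k' \<otimes>\<^bsub>K\<^esub> source K s))"
  have gb: "lk.KK.bal H (\<lambda>k k'. ?g k k' n)" if "n \<in> carrier M" for n
    by (rule lk.KK_bal_rmult_right[OF act_counit_bal[OF f that x y] sK])
  have g: "bal3 H ?g"
  proof (rule balanced3I)
    fix k' n assume "k' \<in> carrier (add_monoid K)" "n \<in> carrier M"
    then show "additive_mod (add_monoid K) H (\<lambda>k. ?g k k' n)"
      by (intro balanced_left[OF gb])
  next
    fix k n assume "k \<in> carrier (add_monoid K)" "n \<in> carrier M"
    then show "additive_mod (add_monoid K) H (\<lambda>k'. ?g k k' n)"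
      by (intro balanced_right[OF gb])
  next
    fix k k' assume "k \<in> carrier (add_monoid K)" "k' \<in> carrier (add_monoid K)"
    then show "additive_mod M H (?g k k')"
      using x y sK by (intro balanced_left[OF f]) (simp add: S_carrier)
  next
    fix k i k' n assume "k \<in> carrier (add_monoid K)" "i \<in> carrier S" "k' \<in> carrier (add_monoid K)" "n \<in> carrier M"
    then show "?g (target K i \<otimes>\<^bsub>K\<^esub> k) k' n \<approx>\<^bsub>H\<^esub> ?g k (source K i \<otimes>\<^bsub>K\<^esub> k') n"
      by (intro balanced_middle[OF gb])
  next
    fix k i k' n assume *: "k \<in> carrier (add_monoid K)" "i \<in> carrier S" "k' \<in> carrier (add_monoid K)" "n \<in> carrier M"
    then have "?g k k' (base_act M i n) \<approx>\<^bsub>H\<^esub> f n (((y \<otimes>\<^bsub>T\<^esub> act k x) \<otimes>\<^bsub>T\<^esub> counit K (k' \<otimes>\<^bsub>K\<^esub> source K s)) \<otimes>\<^bsub>T\<^esub> i)"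
      using QM_target[OF f, of n i] x y sK by (simp add: base_act_eq S_carrier)
    also have "\<dots> = ?g k (target K i \<otimes>\<^bsub>K\<^esub> k') n"
      using * x y sK by (simp add: lk.K.m_assoc lk.counit_target S_ops T.m_assoc S_carrier)
    finally show "?g k (target K i \<otimes>\<^bsub>K\<^esub> k') n \<approx>\<^bsub>H\<^esub> ?g k k' (base_act M i n)"
      by (rule cong_mod_sym)
  qed
  have "rot f m x (s \<otimes>\<^bsub>T\<^esub> y) \<approx>\<^bsub>H\<^esub> tsum (coact M m) (\<lambda>h n. tsum (coact M n) (\<lambda>k' n'. ?g h k' n'))"
    unfolding rot_def
  proof (rule KM.tsum_cong[OF coact_closed[OF m]])
    fix h n assume "h \<in> carrier (add_monoid K)" and n: "n \<in> carrier M"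
    then have h: "h \<in> carrier K" by simp
    have z: "y \<otimes>\<^bsub>T\<^esub> act h x \<in> carrier T" using h x y by simp
    have "f n ((s \<otimes>\<^bsub>T\<^esub> y) \<otimes>\<^bsub>T\<^esub> act h x) \<approx>\<^bsub>H\<^esub> f (alg_act M n (source K s)) (y \<otimes>\<^bsub>T\<^esub> act h x)"
      using QM_source[OF f n s z, THEN cong_mod_sym] sT x y h by (simp add: T.m_assoc)
    also have "\<dots> \<approx>\<^bsub>H\<^esub> tsum (coact M n) (\<lambda>k' n'. f (alg_act M n' (target K (counit K (k' \<otimes>\<^bsub>K\<^esub> source K s)))) (y \<otimes>\<^bsub>T\<^esub> act h x))"
      by (rule alg_act_source[OF balanced_left[OF f] n s]) (use z in simp)
    also have "\<dots> \<approx>\<^bsub>H\<^esub> tsum (coact M n) (\<lambda>k' n'. ?g h k' n')"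
      using n sK z by (intro KM.tsum_cong coact_closed QM_target[OF f]) auto
    finally show "f n ((s \<otimes>\<^bsub>T\<^esub> y) \<otimes>\<^bsub>T\<^esub> act h x) \<approx>\<^bsub>H\<^esub> tsum (coact M n) (\<lambda>k' n'. ?g h k' n')" .
  qed
  also have "\<dots> \<approx>\<^bsub>H\<^esub> tsum (coact M m) (\<lambda>h n. tsum (comult K h) (\<lambda>h1 h2. ?g h1 h2 n))"
    by (rule cong_mod_sym[OF coact_coassoc[OF g m]])
  also have "\<dots> \<approx>\<^bsub>H\<^esub> rot f m (x \<otimes>\<^bsub>T\<^esub> s) y"
    unfolding rot_def
  proof (rule KM.tsum_cong[OF coact_closed[OF m]])
    fix h n assume "h \<in> carrier (add_monoid K)" and n: "n \<in> carrier M"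
    then have h: "h \<in> carrier K" by simp
    have "tsum (comult K h) (\<lambda>h1 h2. ?g h1 h2 n) \<approx>\<^bsub>H\<^esub>
        tsum (comult K h) (\<lambda>h1 h2. f n ((y \<otimes>\<^bsub>T\<^esub> act (h1 \<otimes>\<^bsub>K\<^esub> target K s) x) \<otimes>\<^bsub>T\<^esub> counit K h2))"
      by (rule cong_mod_sym[OF lk.takeuchi[OF act_counit_bal[OF f n x y] h s]])
    also have "\<dots> \<approx>\<^bsub>H\<^esub> tsum (comult K h) (\<lambda>h1 h2. f n (y \<otimes>\<^bsub>T\<^esub> act (target K (counit K h2) \<otimes>\<^bsub>K\<^esub> h1) (act (target K s) x)))"
      using h x y tK by (intro lk.KK.tsum_cong lk.comult_closed cong_mod_eq)
        (auto simp: act_mult act_target T.m_assoc S_carrier)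
    also have "\<dots> \<approx>\<^bsub>H\<^esub> f n (y \<otimes>\<^bsub>T\<^esub> act h (act (target K s) x))"
      using x tK by (intro lk.counit_right[OF _ h] additive_act_left[OF T.additive_mod_lmult[OF balanced_right[OF f n] y]]) simp
    finally show "tsum (comult K h) (\<lambda>h1 h2. ?g h1 h2 n) \<approx>\<^bsub>H\<^esub> f n (y \<otimes>\<^bsub>T\<^esub> act h (x \<otimes>\<^bsub>T\<^esub> s))"
      using x s by (simp add: act_target)
  qed
  finally show ?thesis by (rule cong_mod_sym)
qed

lemma rot_bal:
  assumes f: "QM.bal H f" and m: "m \<in> carrier M"
  shows "TT.bal H (rot f m)"
proof (rule balancedI)
  fix y assume "y \<in> carrier (add_monoid T)"
  then show "additive_mod (add_monoid T) H (\<lambda>x. rot f m x y)"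
    unfolding rot_def using m
    by (intro KM.additive_tsum_param coact_closed additive_act_right[OF T.additive_mod_lmult[OF balanced_right[OF f]]]) auto
next
  fix x assume "x \<in> carrier (add_monoid T)"
  then show "additive_mod (add_monoid T) H (rot f m x)"
    unfolding rot_def using m
    by (intro KM.additive_tsum_param coact_closed T.additive_mod_rmult[OF balanced_right[OF f]]) auto
next
  fix x s y assume "x \<in> carrier (add_monoid T)" "s \<in> carrier S" "y \<in> carrier (add_monoid T)"
  then show "rot f m (x \<otimes>\<^bsub>T\<^esub> s) y \<approx>\<^bsub>H\<^esub> rot f m x (s \<otimes>\<^bsub>T\<^esub> y)"
    using rot_middle[OF f m] by simp
qed

lemma act_pair_bal:
  assumes u: "additive_mod (add_monoid T) H u" and y: "y \<in> carrier T" and z: "z \<in> carrier T"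
  shows "lk.KK.bal H (\<lambda>c d. u (act c y \<otimes>\<^bsub>T\<^esub> act d z))"
proof (rule balancedI)
  fix d assume "d \<in> carrier (add_monoid K)"
  then show "additive_mod (add_monoid K) H (\<lambda>c. u (act c y \<otimes>\<^bsub>T\<^esub> act d z))"
    using z by (intro additive_act_left[OF T.additive_mod_rmult[OF u] y]) simp
next
  fix c assume "c \<in> carrier (add_monoid K)"
  then show "additive_mod (add_monoid K) H (\<lambda>d. u (act c y \<otimes>\<^bsub>T\<^esub> act d z))"
    using y by (intro additive_act_left[OF T.additive_mod_lmult[OF u] z]) simp
next
  fix c i d assume "c \<in> carrier (add_monoid K)" "i \<in> carrier S" "d \<in> carrier (add_monoid K)"
  then show "u (act (target K i \<otimes>\<^bsub>K\<^esub> c) y \<otimes>\<^bsub>T\<^esub> act d z) \<approx>\<^bsub>H\<^esub> u (act c y \<otimes>\<^bsub>T\<^esub> act (source K i \<otimes>\<^bsub>K\<^esub> d) z)"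
    using y z by (intro cong_mod_eq) (simp add: act_mult act_target act_source T.m_assoc S_carrier)
qed

lemma coact_alg_act:
  assumes f: "KM.bal H f" and m: "m \<in> carrier M" and k: "k \<in> carrier K"
  shows "tsum (coact M (alg_act M m k)) f \<approx>\<^bsub>H\<^esub> tsum (comult K k) (\<lambda>k1 k2.
    tsum (left_translation S K k2) (\<lambda>a b. tsum (coact M m) (\<lambda>h n. f ((b \<otimes>\<^bsub>K\<^esub> h) \<otimes>\<^bsub>K\<^esub> k1) (alg_act M n a))))"
proof -
  have "\<And>D W C. D \<in> Pi (carrier K) (comult K) \<Longrightarrow> W \<in> Pi (carrier K) (left_translation S K) \<Longrightarrow>
      C \<in> Pi (carrier M) (coact M) \<Longrightarrow> coact M (alg_act M m k) = tclass (left_tensor S K M (base_act M))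
        (sweedler (D k) (\<lambda>k1 k2. sweedler (W k2) (\<lambda>a b. sweedler (C m) (\<lambda>h n.
           frag_of ((b \<otimes>\<^bsub>K\<^esub> h) \<otimes>\<^bsub>K\<^esub> k1, alg_act M n a)))))"
    using sayd m k unfolding rl_sayd_def by blast
  from KM.tsum_tclass_sweedler[OF f this[OF lk.rep_comult lk.rep_left_translation rep_coact]]
  show ?thesis unfolding tsum_def sweedler_sweedler by simp
qed

text \<open>By the anti Yetter-Drinfeld condition the left side is
  \<open>m_0 k2^- \<otimes> y (k2^+ m_{-1} k1 \<triangleright> x)\<close>. Moved across the tensor
  product, \<open>k2^-\<close> distributes over the product, and
  \<open>tsum_left_translation\<close> cancels it against \<open>k2^+\<close>, leaving
  \<open>k2\<close> on \<open>y\<close>.\<close>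

lemma rot_alg_act:
  assumes f: "QM.bal H f" and m: "m \<in> carrier M" and k: "k \<in> carrier K" and x: "x \<in> carrier T" and y: "y \<in> carrier T"
  shows "rot f (alg_act M m k) x y \<approx>\<^bsub>H\<^esub> tsum (comult K k) (\<lambda>k1 k2. rot f m (act k1 x) (act k2 y))"
proof -
  have "rot f (alg_act M m k) x y \<approx>\<^bsub>H\<^esub> tsum (comult K k) (\<lambda>k1 k2.
      tsum (left_translation S K k2) (\<lambda>a b. tsum (coact M m) (\<lambda>h n. f (alg_act M n a) (y \<otimes>\<^bsub>T\<^esub> act ((b \<otimes>\<^bsub>K\<^esub> h) \<otimes>\<^bsub>K\<^esub> k1) x))))"
    unfolding rot_def by (rule coact_alg_act[OF rot_KM_bal[OF f x y] m k])
  also have "\<dots> \<approx>\<^bsub>H\<^esub> tsum (comult K k) (\<lambda>k1 k2. rot f m (act k1 x) (act k2 y))"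
  proof (rule lk.KK.tsum_cong[OF lk.comult_closed[OF k]])
    fix k1 k2 assume "k1 \<in> carrier (add_monoid K)" "k2 \<in> carrier (add_monoid K)"
    then have kk: "k1 \<in> carrier K" "k2 \<in> carrier K" by auto
    have "tsum (left_translation S K k2) (\<lambda>a b. tsum (coact M m) (\<lambda>h n. f (alg_act M n a) (y \<otimes>\<^bsub>T\<^esub> act ((b \<otimes>\<^bsub>K\<^esub> h) \<otimes>\<^bsub>K\<^esub> k1) x))) =
        tsum (coact M m) (\<lambda>h n. tsum (left_translation S K k2) (\<lambda>a b. f (alg_act M n a) (y \<otimes>\<^bsub>T\<^esub> act ((b \<otimes>\<^bsub>K\<^esub> h) \<otimes>\<^bsub>K\<^esub> k1) x)))"
      by (rule tsum_swap)
    also have "\<dots> \<approx>\<^bsub>H\<^esub> rot f m (act k1 x) (act k2 y)"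
      unfolding rot_def
    proof (rule KM.tsum_cong[OF coact_closed[OF m]])
      fix h n assume "h \<in> carrier (add_monoid K)" and n: "n \<in> carrier M"
      then have h: "h \<in> carrier K" by simp
      let ?z = "act h (act k1 x)"
      have z: "?z \<in> carrier T" using h kk x by simp
      have "tsum (left_translation S K k2) (\<lambda>a b. f (alg_act M n a) (y \<otimes>\<^bsub>T\<^esub> act ((b \<otimes>\<^bsub>K\<^esub> h) \<otimes>\<^bsub>K\<^esub> k1) x)) \<approx>\<^bsub>H\<^esub>
          tsum (left_translation S K k2) (\<lambda>a b. tsum (comult K a) (\<lambda>a1 a2. f n (act a1 y \<otimes>\<^bsub>T\<^esub> act (a2 \<otimes>\<^bsub>K\<^esub> b) ?z)))"
      proof (rule lk.KoK.tsum_cong[OF lk.left_translation_closed[OF kk(2)]])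
        fix a b assume "a \<in> carrier (add_monoid K)" "b \<in> carrier (add_monoid K)"
        then have ab: "a \<in> carrier K" "b \<in> carrier K" by auto
        have "f (alg_act M n a) (y \<otimes>\<^bsub>T\<^esub> act ((b \<otimes>\<^bsub>K\<^esub> h) \<otimes>\<^bsub>K\<^esub> k1) x) \<approx>\<^bsub>H\<^esub> f n (act a (y \<otimes>\<^bsub>T\<^esub> act b ?z))"
          using balanced_middle[OF f n ab(1), of "y \<otimes>\<^bsub>T\<^esub> act b ?z"] ab h kk x y by (simp add: act_mult)
        also have "\<dots> \<approx>\<^bsub>H\<^esub> tsum (comult K a) (\<lambda>a1 a2. f n (act a1 y \<otimes>\<^bsub>T\<^esub> act a2 (act b ?z)))"
          using ab z y by (intro act_mult_algebra[OF balanced_right[OF f n]]) auto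
        also have "\<dots> \<approx>\<^bsub>H\<^esub> tsum (comult K a) (\<lambda>a1 a2. f n (act a1 y \<otimes>\<^bsub>T\<^esub> act (a2 \<otimes>\<^bsub>K\<^esub> b) ?z))"
          using ab z by (intro lk.KK.tsum_cong lk.comult_closed) (auto simp: act_mult)
        finally show "f (alg_act M n a) (y \<otimes>\<^bsub>T\<^esub> act ((b \<otimes>\<^bsub>K\<^esub> h) \<otimes>\<^bsub>K\<^esub> k1) x) \<approx>\<^bsub>H\<^esub>
            tsum (comult K a) (\<lambda>a1 a2. f n (act a1 y \<otimes>\<^bsub>T\<^esub> act (a2 \<otimes>\<^bsub>K\<^esub> b) ?z))" .
      qed
      also have "\<dots> \<approx>\<^bsub>H\<^esub> f n (act k2 y \<otimes>\<^bsub>T\<^esub> act \<one>\<^bsub>K\<^esub> ?z)"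
        by (rule lk.tsum_left_translation[OF act_pair_bal[OF balanced_right[OF f n] y z] kk(2)])
      finally show "tsum (left_translation S K k2) (\<lambda>a b. f (alg_act M n a) (y \<otimes>\<^bsub>T\<^esub> act ((b \<otimes>\<^bsub>K\<^esub> h) \<otimes>\<^bsub>K\<^esub> k1) x)) \<approx>\<^bsub>H\<^esub>
          f n (act k2 y \<otimes>\<^bsub>T\<^esub> ?z)"
        using z by (simp add: act_one)
    qed
    finally show "tsum (left_translation S K k2) (\<lambda>a b. tsum (coact M m) (\<lambda>h n. f (alg_act M n a) (y \<otimes>\<^bsub>T\<^esub> act ((b \<otimes>\<^bsub>K\<^esub> h) \<otimes>\<^bsub>K\<^esub> k1) x))) \<approx>\<^bsub>H\<^esub>
        rot f m (act k1 x) (act k2 y)" .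
  qed
  finally show ?thesis .
qed

text \<open>Move \<open>m_{-1}\<close> back across the tensor product over \<open>K\<close> and use
  stability of \<open>M\<close>.\<close>

lemma rot_act:
  assumes f: "QM.bal H f" and m: "m \<in> carrier M" and x: "x \<in> carrier T"
  shows "tsum (coact M m) (\<lambda>h n. f n (act h x)) \<approx>\<^bsub>H\<^esub> f m x"
proof -
  have "tsum (coact M m) (\<lambda>h n. f n (act h x)) \<approx>\<^bsub>H\<^esub> tsum (coact M m) (\<lambda>h n. f (alg_act M n h) x)"
    using x by (intro KM.tsum_cong coact_closed m cong_mod_sym[OF balanced_middle[OF f]]) auto
  also have "\<dots> \<approx>\<^bsub>H\<^esub> f m x"
    using x by (intro stability[OF balanced_left[OF f] m]) simp
  finally show ?thesis .
qed

lemma rot_one_right: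
  assumes f: "QM.bal H f" and m: "m \<in> carrier M" and x: "x \<in> carrier T"
  shows "rot f m x \<one>\<^bsub>T\<^esub> \<approx>\<^bsub>H\<^esub> f m x"
proof -
  have "rot f m x \<one>\<^bsub>T\<^esub> \<approx>\<^bsub>H\<^esub> tsum (coact M m) (\<lambda>h n. f n (act h x))"
    unfolding rot_def using x by (intro KM.tsum_cong coact_closed m) auto
  also have "\<dots> \<approx>\<^bsub>H\<^esub> f m x" by (rule rot_act[OF assms])
  finally show ?thesis .
qed

text \<open>On 1 the element \<open>m_{-1}\<close> acts through its counit, so here the counit axiom
  of \<open>M\<close> takes the place of stability.\<close>

lemma rot_one_left:
  assumes f: "QM.bal H f" and m: "m \<in> carrier M" and y: "y \<in> carrier T"
  shows "rot f m \<one>\<^bsub>T\<^esub> y \<approx>\<^bsub>H\<^esub> f m y"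
proof -
  have "rot f m \<one>\<^bsub>T\<^esub> y \<approx>\<^bsub>H\<^esub> tsum (coact M m) (\<lambda>h n. f (alg_act M n (target K (counit K h))) y)"
    unfolding rot_def
  proof (rule KM.tsum_cong[OF coact_closed[OF m]])
    fix h n assume "h \<in> carrier (add_monoid K)" "n \<in> carrier M"
    then show "f n (y \<otimes>\<^bsub>T\<^esub> act h \<one>\<^bsub>T\<^esub>) \<approx>\<^bsub>H\<^esub> f (alg_act M n (target K (counit K h))) y"
      using QM_target[OF f, of n "counit K h" y, THEN cong_mod_sym] y by (simp add: act_unit)
  qed
  also have "\<dots> \<approx>\<^bsub>H\<^esub> f m y"
    using y by (intro coact_counit[OF balanced_left[OF f] m]) simp
  finally show ?thesis .
qed

lemma rot_act_bal:
  assumes f: "QM.bal H f" and m: "m \<in> carrier M" and x: "x \<in> carrier T" and y: "y \<in> carrier T"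
  shows "lk.KK.bal H (\<lambda>c d. rot f m (act c x) (act d y))"
proof (rule balancedI)
  fix d assume "d \<in> carrier (add_monoid K)"
  then show "additive_mod (add_monoid K) H (\<lambda>c. rot f m (act c x) (act d y))"
    using y by (intro additive_act_left[OF balanced_left[OF rot_bal[OF f m]] x]) simp
next
  fix c assume "c \<in> carrier (add_monoid K)"
  then show "additive_mod (add_monoid K) H (\<lambda>d. rot f m (act c x) (act d y))"
    using x by (intro additive_act_left[OF balanced_right[OF rot_bal[OF f m]] y]) simp
next
  fix c i d assume "c \<in> carrier (add_monoid K)" "i \<in> carrier S" "d \<in> carrier (add_monoid K)"
  then show "rot f m (act (target K i \<otimes>\<^bsub>K\<^esub> c) x) (act d y) \<approx>\<^bsub>H\<^esub> rot f m (act c x) (act (source K i \<otimes>\<^bsub>K\<^esub> d) y)"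
    using rot_middle[OF f m, of "act c x" i "act d y"] x y by (simp add: act_mult act_target act_source)
qed

text \<open>A case of \<open>rot_alg_act\<close> in which the coproduct has the single term
  \<open>1 \<otimes> t(s)\<close>.\<close>

lemma rot_target:
  assumes f: "QM.bal H f" and m: "m \<in> carrier M" and s: "s \<in> carrier S" and x: "x \<in> carrier T" and y: "y \<in> carrier T"
  shows "rot f (alg_act M m (target K s)) x y \<approx>\<^bsub>H\<^esub> rot f m x (act (target K s) y)"
proof -
  have "rot f (alg_act M m (target K s)) x y \<approx>\<^bsub>H\<^esub> tsum (comult K (target K s)) (\<lambda>k1 k2. rot f m (act k1 x) (act k2 y))"
    using s by (intro rot_alg_act f m x y) simp
  also have "\<dots> \<approx>\<^bsub>H\<^esub> rot f m (act \<one>\<^bsub>K\<^esub> x) (act (target K s) y)"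
    unfolding lk.comult_target_eq[OF s] by (rule lk.KK.tsum_pure[OF rot_act_bal[OF f m x y]])
  finally show ?thesis using x by (simp add: act_one)
qed

end

context right_hopf
begin

lemma BB_bal_source_right:
  assumes f: "BB.bal H f" and r: "r \<in> carrier R"
  shows "BB.bal H (\<lambda>x y. f x (y \<otimes>\<^bsub>B\<^esub> source B r))"
proof (rule balancedI)
  fix n assume "n \<in> carrier (add_monoid B)"
  then show "additive_mod (add_monoid B) H (\<lambda>m. f m (n \<otimes>\<^bsub>B\<^esub> source B r))"
    using r by (intro balanced_left[OF f]) simp
next
  fix m assume "m \<in> carrier (add_monoid B)"
  then show "additive_mod (add_monoid B) H (\<lambda>n. f m (n \<otimes>\<^bsub>B\<^esub> source B r))"
    using r by (intro B.additive_mod_rmult[OF balanced_right[OF f]]) auto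
next
  fix m i n assume *: "m \<in> carrier (add_monoid B)" "i \<in> carrier R" "n \<in> carrier (add_monoid B)"
  then have "(n \<otimes>\<^bsub>B\<^esub> target B i) \<otimes>\<^bsub>B\<^esub> source B r = (n \<otimes>\<^bsub>B\<^esub> source B r) \<otimes>\<^bsub>B\<^esub> target B i"
    using r by (simp add: B.m_assoc source_target_commute)
  then show "f (m \<otimes>\<^bsub>B\<^esub> source B i) (n \<otimes>\<^bsub>B\<^esub> source B r) \<approx>\<^bsub>H\<^esub> f m ((n \<otimes>\<^bsub>B\<^esub> target B i) \<otimes>\<^bsub>B\<^esub> source B r)"
    using balanced_middle[OF f, of m i "n \<otimes>\<^bsub>B\<^esub> source B r"] * r by simp
qed

text \<open>The coproduct of \<open>y s(r)\<close> is \<open>y1 \<otimes> y2 s(r)\<close>, so a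
  right factor \<open>s(r)\<close> of \<open>b\<close> passes to the second leg of the
  splitting.\<close>

lemma splitting_source:
  assumes g: "BoB.bal H g" and c: "c \<in> carrier B" and r: "r \<in> carrier R" and b: "b \<in> carrier B"
  shows "tsum (splitting c (b \<otimes>\<^bsub>B\<^esub> source B r)) g \<approx>\<^bsub>H\<^esub> tsum (splitting c b) (\<lambda>x y. g x (y \<otimes>\<^bsub>B\<^esub> source B r))"
proof -
  have "tsum (splitting c b) (\<lambda>x y. g x (y \<otimes>\<^bsub>B\<^esub> source B r)) \<approx>\<^bsub>H\<^esub>
      tsum (splitting c b) (\<lambda>x y. tsum (comult B y) (\<lambda>y1 y2. tsum (splitting (x \<otimes>\<^bsub>B\<^esub> y1) (y2 \<otimes>\<^bsub>B\<^esub> source B r)) g))"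
  proof (rule BoB.tsum_cong[OF splitting_closed[OF c b]])
    fix x y assume "x \<in> carrier (add_monoid B)" "y \<in> carrier (add_monoid B)"
    then have xy: "x \<in> carrier B" "y \<in> carrier B" by auto
    have "g x (y \<otimes>\<^bsub>B\<^esub> source B r) \<approx>\<^bsub>H\<^esub>
        tsum (comult B (y \<otimes>\<^bsub>B\<^esub> source B r)) (\<lambda>y1 y2. tsum (splitting (x \<otimes>\<^bsub>B\<^esub> y1) y2) g)"
      using xy r by (intro cong_mod_sym[OF comult_splitting[OF g]]) auto
    also have "\<dots> \<approx>\<^bsub>H\<^esub> tsum (comult B y) (\<lambda>y1 y2. tsum (splitting (x \<otimes>\<^bsub>B\<^esub> y1) (y2 \<otimes>\<^bsub>B\<^esub> source B r)) g)"
      by (rule comult_source[OF BB_bal_lmult_left[OF splitting_bal[OF g] xy(1)] xy(2) r])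
    finally show "g x (y \<otimes>\<^bsub>B\<^esub> source B r) \<approx>\<^bsub>H\<^esub>
        tsum (comult B y) (\<lambda>y1 y2. tsum (splitting (x \<otimes>\<^bsub>B\<^esub> y1) (y2 \<otimes>\<^bsub>B\<^esub> source B r)) g)" .
  qed
  also have "\<dots> \<approx>\<^bsub>H\<^esub> tsum (splitting c (b \<otimes>\<^bsub>B\<^esub> source B r)) g"
    by (rule tsum_splitting[OF BB_bal_source_right[OF splitting_bal[OF g] r] c b])
  finally show ?thesis by (rule cong_mod_sym)
qed

end

lemma the_elem_constI:
  assumes "x \<in> A" "\<And>y. y \<in> A \<Longrightarrow> y = c" shows "the_elem A = c"
  using assms by (metis the_elem_eqI)

lemma tsum_add: "tsum U (\<lambda>x y. f x y + g x y) = tsum U f + tsum U g"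
  unfolding tsum_def case_prod_unfold by (rule frag_extend_add_fun)

section \<open>The action of \<open>B\<close> on \<open>M \<otimes>\<^sub>K T\<close>\<close>

context sayd_setting
begin

text \<open>The core of associativity: the left side is what \<open>b\<close> does to the already
  rotated element \<open>m_0 \<otimes> q (m_{-1} \<triangleright> p)\<close>. The laws of
  \<open>can^-1\<close> bring in \<open>q (h1 \<triangleright> x)\<close> and
  \<open>h2 \<triangleright> y\<close>. Two uses of coassociativity arrange that the inner coaction
  acts on the product of \<open>y\<close> with \<open>q (h \<triangleright> x)\<close>, where
  stability removes it.\<close>

lemma rot_gal:
  assumes f: "QM.bal H f" and m: "m \<in> carrier M" and p: "p \<in> carrier T" and q: "q \<in> carrier T" and b: "b \<in> carrier B"
  shows "tsum (coact M m) (\<lambda>h n. tsum (gal (q \<otimes>\<^bsub>T\<^esub> act h p) b) (rot f n)) \<approx>\<^bsub>H\<^esub>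
    tsum (gal p b) (\<lambda>x y. rot f m x (y \<otimes>\<^bsub>T\<^esub> q))"
proof -
  have "tsum (coact M m) (\<lambda>h n. tsum (gal (q \<otimes>\<^bsub>T\<^esub> act h p) b) (rot f n)) \<approx>\<^bsub>H\<^esub>
      tsum (coact M m) (\<lambda>h n. tsum (gal p b) (\<lambda>x y. tsum (comult K h) (\<lambda>h1 h2. rot f n (q \<otimes>\<^bsub>T\<^esub> act h1 x) (act h2 y))))"
  proof (rule KM.tsum_cong[OF coact_closed[OF m]])
    fix h n assume "h \<in> carrier (add_monoid K)" and n: "n \<in> carrier M"
    then have h: "h \<in> carrier K" by simp
    have "tsum (gal (q \<otimes>\<^bsub>T\<^esub> act h p) b) (rot f n) \<approx>\<^bsub>H\<^esub> tsum (gal (act h p) b) (\<lambda>x y. rot f n (q \<otimes>\<^bsub>T\<^esub> x) y)"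
      using h p by (intro gal_lmult[OF rot_bal[OF f n] q _ b]) simp
    also have "\<dots> \<approx>\<^bsub>H\<^esub> tsum (gal p b) (\<lambda>x y. tsum (comult K h) (\<lambda>h1 h2. rot f n (q \<otimes>\<^bsub>T\<^esub> act h1 x) (act h2 y)))"
      by (rule gal_act[OF TT_bal_lmult[OF rot_bal[OF f n] q] h p b])
    finally show "tsum (gal (q \<otimes>\<^bsub>T\<^esub> act h p) b) (rot f n) \<approx>\<^bsub>H\<^esub>
        tsum (gal p b) (\<lambda>x y. tsum (comult K h) (\<lambda>h1 h2. rot f n (q \<otimes>\<^bsub>T\<^esub> act h1 x) (act h2 y)))" .
  qed
  also have "\<dots> = tsum (gal p b) (\<lambda>x y. tsum (coact M m) (\<lambda>h n. tsum (comult K h) (\<lambda>h1 h2. rot f n (q \<otimes>\<^bsub>T\<^esub> act h1 x) (act h2 y))))"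
    by (rule tsum_swap)
  also have "\<dots> \<approx>\<^bsub>H\<^esub> tsum (gal p b) (\<lambda>x y. rot f m x (y \<otimes>\<^bsub>T\<^esub> q))"
  proof (rule TT.tsum_cong[OF gal_closed[OF p b]])
    fix x y assume "x \<in> carrier (add_monoid T)" "y \<in> carrier (add_monoid T)"
    then have x: "x \<in> carrier T" and y: "y \<in> carrier T" by auto
    let ?f1 = "\<lambda>h1 h2 n. rot f n (q \<otimes>\<^bsub>T\<^esub> act h1 x) (act h2 y)"
    have f1: "bal3 H ?f1"
    proof (rule balanced3I)
      fix h2 n assume "h2 \<in> carrier (add_monoid K)" "n \<in> carrier M"
      then show "additive_mod (add_monoid K) H (\<lambda>h1. ?f1 h1 h2 n)"
        using y by (intro additive_act_left[OF T.additive_mod_lmult[OF balanced_left[OF rot_bal[OF f]] q] x]) auto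
    next
      fix h1 n assume "h1 \<in> carrier (add_monoid K)" "n \<in> carrier M"
      then show "additive_mod (add_monoid K) H (\<lambda>h2. ?f1 h1 h2 n)"
        using x q by (intro additive_act_left[OF balanced_right[OF rot_bal[OF f]] y]) auto
    next
      fix h1 h2 assume "h1 \<in> carrier (add_monoid K)" "h2 \<in> carrier (add_monoid K)"
      then show "additive_mod M H (?f1 h1 h2)"
        using x y q by (intro rot_additive[OF f]) auto
    next
      fix h1 i h2 n assume "h1 \<in> carrier (add_monoid K)" "i \<in> carrier S" "h2 \<in> carrier (add_monoid K)" "n \<in> carrier M"
      then show "?f1 (target K i \<otimes>\<^bsub>K\<^esub> h1) h2 n \<approx>\<^bsub>H\<^esub> ?f1 h1 (source K i \<otimes>\<^bsub>K\<^esub> h2) n"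
        using rot_middle[OF f, of n "q \<otimes>\<^bsub>T\<^esub> act h1 x" i "act h2 y"] x y q
        by (simp add: act_mult act_target act_source T.m_assoc S_carrier)
    next
      fix h1 i h2 n assume "h1 \<in> carrier (add_monoid K)" "i \<in> carrier S" "h2 \<in> carrier (add_monoid K)" "n \<in> carrier M"
      then show "?f1 h1 (target K i \<otimes>\<^bsub>K\<^esub> h2) n \<approx>\<^bsub>H\<^esub> ?f1 h1 h2 (base_act M i n)"
        using rot_target[OF f, of n i "q \<otimes>\<^bsub>T\<^esub> act h1 x" "act h2 y", THEN cong_mod_sym] x y q
        by (simp add: act_mult base_act_eq)
    qed
    have "tsum (coact M m) (\<lambda>h n. tsum (comult K h) (\<lambda>h1 h2. ?f1 h1 h2 n)) \<approx>\<^bsub>H\<^esub>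
        tsum (coact M m) (\<lambda>h n. tsum (coact M n) (\<lambda>h' n'. ?f1 h h' n'))"
      by (rule coact_coassoc[OF f1 m])
    also have "\<dots> \<approx>\<^bsub>H\<^esub> tsum (coact M m) (\<lambda>h n. f n ((y \<otimes>\<^bsub>T\<^esub> q) \<otimes>\<^bsub>T\<^esub> act h x))"
    proof (rule KM.tsum_cong[OF coact_closed[OF m]])
      fix h n assume "h \<in> carrier (add_monoid K)" and n: "n \<in> carrier M"
      then have h: "h \<in> carrier K" by simp
      let ?z = "q \<otimes>\<^bsub>T\<^esub> act h x"
      have z: "?z \<in> carrier T" using h q x by simp
      let ?f2 = "\<lambda>k k' n. f n (act k y \<otimes>\<^bsub>T\<^esub> act k' ?z)"
      have f2: "bal3 H ?f2"
      proof (rule balanced3I)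
        fix k' n assume "k' \<in> carrier (add_monoid K)" "n \<in> carrier M"
        then show "additive_mod (add_monoid K) H (\<lambda>k. ?f2 k k' n)"
          by (intro balanced_left[OF act_pair_bal[OF balanced_right[OF f] y z]])
      next
        fix k n assume "k \<in> carrier (add_monoid K)" "n \<in> carrier M"
        then show "additive_mod (add_monoid K) H (\<lambda>k'. ?f2 k k' n)"
          by (intro balanced_right[OF act_pair_bal[OF balanced_right[OF f] y z]])
      next
        fix k k' assume "k \<in> carrier (add_monoid K)" "k' \<in> carrier (add_monoid K)"
        then show "additive_mod M H (?f2 k k')"
          using y z by (intro balanced_left[OF f]) simp
      next
        fix k i k' n assume "k \<in> carrier (add_monoid K)" "i \<in> carrier S" "k' \<in> carrier (add_monoid K)" "n \<in> carrier M"
        then show "?f2 (target K i \<otimes>\<^bsub>K\<^esub> k) k' n \<approx>\<^bsub>H\<^esub> ?f2 k (source K i \<otimes>\<^bsub>K\<^esub> k') n"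
          by (intro balanced_middle[OF act_pair_bal[OF balanced_right[OF f] y z]])
      next
        fix k i k' n assume *: "k \<in> carrier (add_monoid K)" "i \<in> carrier S" "k' \<in> carrier (add_monoid K)" "n \<in> carrier M"
        then show "?f2 k (target K i \<otimes>\<^bsub>K\<^esub> k') n \<approx>\<^bsub>H\<^esub> ?f2 k k' (base_act M i n)"
          using balanced_middle[OF rot_KM_bal[OF f z, of "act k y"], of k' i n] y by simp
      qed
      \<comment> \<open>The coaction inside \<open>rot\<close> and the one on \<open>n\<close> are
        merged into a coproduct, so that a single element of \<open>K\<close> acts on
        \<open>y\<close> and \<open>?z\<close> together.\<close>
      have "tsum (coact M n) (\<lambda>h' n'. ?f1 h h' n') \<approx>\<^bsub>H\<^esub> tsum (coact M n) (\<lambda>h' n'. tsum (comult K h') (\<lambda>k1 k2. ?f2 k1 k2 n'))"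
        unfolding rot_def by (rule cong_mod_sym[OF coact_coassoc[OF f2 n]])
      also have "\<dots> \<approx>\<^bsub>H\<^esub> tsum (coact M n) (\<lambda>h' n'. f n' (act h' (y \<otimes>\<^bsub>T\<^esub> ?z)))"
        using n y z by (intro KM.tsum_cong coact_closed cong_mod_sym[OF act_mult_algebra[OF balanced_right[OF f]]]) auto
      also have "\<dots> \<approx>\<^bsub>H\<^esub> f n (y \<otimes>\<^bsub>T\<^esub> ?z)"
        using y z by (intro rot_act[OF f n]) simp
      finally show "tsum (coact M n) (\<lambda>h' n'. ?f1 h h' n') \<approx>\<^bsub>H\<^esub> f n ((y \<otimes>\<^bsub>T\<^esub> q) \<otimes>\<^bsub>T\<^esub> act h x)"
        using h x y q by (simp add: T.m_assoc)
    qed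
    finally show "tsum (coact M m) (\<lambda>h n. tsum (comult K h) (\<lambda>h1 h2. ?f1 h1 h2 n)) \<approx>\<^bsub>H\<^esub> rot f m x (y \<otimes>\<^bsub>T\<^esub> q)"
      by (simp add: rot_def)
  qed
  finally show ?thesis .
qed

text \<open>The value of \<open>f\<close> at \<open>b \<triangleright> (m \<otimes> t)\<close>.\<close>

definition Phi :: "('m \<Rightarrow> 't \<Rightarrow> 'c \<Rightarrow>\<^sub>0 int) \<Rightarrow> 'b \<Rightarrow> 'm \<Rightarrow> 't \<Rightarrow> 'c \<Rightarrow>\<^sub>0 int" where
  "Phi f b m t = tsum (gal t b) (rot f m)"

text \<open>The action of \<open>B\<close> respects the tensor product over \<open>K\<close>:
  \<open>rot_alg_act\<close>, for \<open>k\<close> acting on \<open>m\<close>, and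
  \<open>gal_act\<close>, for \<open>k\<close> acting on \<open>t\<close>, lead to the same sum over
  the coproduct of \<open>k\<close>.\<close>

lemma Phi_bal:
  assumes f: "QM.bal H f" and b: "b \<in> carrier B"
  shows "QM.bal H (Phi f b)"
proof (rule balancedI)
  fix t assume "t \<in> carrier (add_monoid T)"
  then show "additive_mod M H (\<lambda>m. Phi f b m t)"
    unfolding Phi_def using b by (intro TT.additive_tsum_param gal_closed rot_additive[OF f]) auto
next
  fix m assume "m \<in> carrier M"
  then show "additive_mod (add_monoid T) H (Phi f b m)"
    unfolding Phi_def using b by (intro balanced_left[OF gal_bal[OF rot_bal[OF f]]]) auto
next
  fix m k t assume *: "m \<in> carrier M" "k \<in> carrier K" "t \<in> carrier (add_monoid T)"
  then have "Phi f b (alg_act M m k) t \<approx>\<^bsub>H\<^esub> tsum (gal t b) (\<lambda>x y. tsum (comult K k) (\<lambda>k1 k2. rot f m (act k1 x) (act k2 y)))"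
    unfolding Phi_def using b by (intro TT.tsum_cong gal_closed rot_alg_act[OF f]) auto
  also have "\<dots> \<approx>\<^bsub>H\<^esub> Phi f b m (act k t)"
    unfolding Phi_def using * b by (intro cong_mod_sym[OF gal_act[OF rot_bal[OF f]]]) auto
  finally show "Phi f b (alg_act M m k) t \<approx>\<^bsub>H\<^esub> Phi f b m (act k t)" .
qed

lemma Phi_additive:
  assumes "QM.bal H f" "m \<in> carrier M" "t \<in> carrier T"
  shows "additive_mod (add_monoid B) H (\<lambda>b. Phi f b m t)"
  unfolding Phi_def using assms by (intro balanced_right[OF gal_bal[OF rot_bal]]) auto

lemma Phi_one:
  assumes "QM.bal H f" "m \<in> carrier M" "t \<in> carrier T"
  shows "Phi f \<one>\<^bsub>B\<^esub> m t \<approx>\<^bsub>H\<^esub> f m t"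
  unfolding Phi_def
  by (rule cong_mod_trans[OF gal_one[OF rot_bal[OF assms(1,2)] assms(3)] rot_one_right[OF assms]])

text \<open>Functionals compose contravariantly, so the left side tests
  \<open>b \<triangleright> (b' \<triangleright> (m \<otimes> t))\<close>. \<open>rot_gal\<close>
  collects the second legs as \<open>y y'\<close>, in the order that \<open>gal_mult\<close>
  expects.\<close>

lemma Phi_mult:
  assumes f: "QM.bal H f" and b: "b \<in> carrier B" "b' \<in> carrier B" and m: "m \<in> carrier M" and t: "t \<in> carrier T"
  shows "Phi (Phi f b) b' m t \<approx>\<^bsub>H\<^esub> Phi f (b \<otimes>\<^bsub>B\<^esub> b') m t"
proof -
  have "Phi (Phi f b) b' m t \<approx>\<^bsub>H\<^esub> tsum (gal t b') (\<lambda>x' y'. tsum (gal x' b) (\<lambda>x y. rot f m x (y \<otimes>\<^bsub>T\<^esub> y')))"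
    unfolding Phi_def[of "Phi f b"]
  proof (rule TT.tsum_cong[OF gal_closed[OF t b(2)]])
    fix x' y' assume "x' \<in> carrier (add_monoid T)" "y' \<in> carrier (add_monoid T)"
    then have "tsum (coact M m) (\<lambda>h n. tsum (gal (y' \<otimes>\<^bsub>T\<^esub> act h x') b) (rot f n)) \<approx>\<^bsub>H\<^esub>
        tsum (gal x' b) (\<lambda>x y. rot f m x (y \<otimes>\<^bsub>T\<^esub> y'))"
      by (intro rot_gal[OF f m _ _ b(1)]) auto
    then show "rot (Phi f b) m x' y' \<approx>\<^bsub>H\<^esub> tsum (gal x' b) (\<lambda>x y. rot f m x (y \<otimes>\<^bsub>T\<^esub> y'))"
      by (simp only: rot_def[of "Phi f b"] Phi_def[of f b])
  qed
  also have "\<dots> \<approx>\<^bsub>H\<^esub> Phi f (b \<otimes>\<^bsub>B\<^esub> b') m t"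
    unfolding Phi_def by (rule gal_mult[OF rot_bal[OF f m] t b])
  finally show ?thesis .
qed

text \<open>For a target element the second leg of \<open>can^-1\<close> is 1, and rotating past 1
  changes nothing because \<open>M\<close> is stable.\<close>

lemma Phi_target:
  assumes f: "QM.bal H f" and m: "m \<in> carrier M" and t: "t \<in> carrier T" and r: "r \<in> carrier R"
  shows "Phi f (target B r) m t \<approx>\<^bsub>H\<^esub> f m (t \<otimes>\<^bsub>T\<^esub> iota r)"
  unfolding Phi_def
  by (rule cong_mod_trans[OF gal_target[OF rot_bal[OF f m] t r] rot_one_right[OF f m]]) (simp add: t r)

text \<open>\<open>act h\<close> commutes with left multiplication by \<open>iota r\<close>; its
  commutation with right multiplication gives \<open>rot_iota_left\<close>.\<close>

lemma rot_iota_right: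
  assumes m: "m \<in> carrier M" and x: "x \<in> carrier T" and y: "y \<in> carrier T" and r: "r \<in> carrier R"
  shows "rot f m x (y \<otimes>\<^bsub>T\<^esub> iota r) \<approx>\<^bsub>H\<^esub> rot f m (iota r \<otimes>\<^bsub>T\<^esub> x) y"
  using x y r by (intro rot_cong m cong_mod_eq) (simp add: act_iota_left T.m_assoc)

lemma rot_iota_left:
  assumes m: "m \<in> carrier M" and x: "x \<in> carrier T" and y: "y \<in> carrier T" and r: "r \<in> carrier R"
  shows "rot f m (x \<otimes>\<^bsub>T\<^esub> iota r) y \<approx>\<^bsub>H\<^esub> rot (\<lambda>n t. f n (t \<otimes>\<^bsub>T\<^esub> iota r)) m x y"
  using x y r by (intro rot_cong m cong_mod_eq) (simp add: act_iota_right T.m_assoc)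

lemma Phi_source:
  assumes f: "QM.bal H f" and m: "m \<in> carrier M" and t: "t \<in> carrier T" and r: "r \<in> carrier R"
  shows "Phi f (source B r) m t \<approx>\<^bsub>H\<^esub> f m (iota r \<otimes>\<^bsub>T\<^esub> t)"
proof -
  \<comment> \<open>The second leg \<open>iota r\<close> is written with a factor 1 in front, so
    that \<open>rot_iota_right\<close> can carry it to the left of \<open>t\<close>.\<close>
  have "Phi f (source B r) m t \<approx>\<^bsub>H\<^esub> rot f m t (\<one>\<^bsub>T\<^esub> \<otimes>\<^bsub>T\<^esub> iota r)"
    unfolding Phi_def using gal_source[OF rot_bal[OF f m] t r] r by simp
  also have "\<dots> \<approx>\<^bsub>H\<^esub> rot f m (iota r \<otimes>\<^bsub>T\<^esub> t) \<one>\<^bsub>T\<^esub>"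
    by (rule rot_iota_right[OF m t T.one_closed r])
  also have "\<dots> \<approx>\<^bsub>H\<^esub> f m (iota r \<otimes>\<^bsub>T\<^esub> t)"
    by (rule rot_one_right[OF f m]) (simp add: t r)
  finally show ?thesis .
qed

text \<open>\<open>can^-1(t_0 \<otimes> t_1)\<close> is \<open>1 \<otimes> t\<close>, and rotating
  with first leg 1 is trivial by the counit axiom of \<open>M\<close>.\<close>

lemma Phi_stable:
  assumes f: "QM.bal H f" and m: "m \<in> carrier M" and t: "t \<in> carrier T"
  shows "tsum (coaction T t) (\<lambda>a c. Phi f c m a) \<approx>\<^bsub>H\<^esub> f m t"
  unfolding Phi_def
  by (rule cong_mod_trans[OF coaction_gal_one[OF rot_bal[OF f m] t] rot_one_left[OF f m t]])

text \<open>The anti Yetter-Drinfeld condition of \<open>M \<otimes>_K T\<close> on pure tensors,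
  with \<open>F\<close> a functional on \<open>M \<otimes>_K T\<close> tensored over
  \<open>R\<close> with \<open>B\<close>. By equivariance
  \<open>y (m_{-1} \<triangleright> x)\<close> coacts as
  \<open>y_0 (m_{-1} \<triangleright> x_0) \<otimes> y_1 x_1\<close>;
  \<open>gal_coaction_plus\<close> converts \<open>y_1\<close> into \<open>b2\<close> and
  \<open>gal_coaction_minus\<close> converts \<open>x_1\<close> into
  \<open>t_1 b1^-\<close>.\<close>

lemma Phi_coaction:
  assumes F: "\<And>c. c \<in> carrier B \<Longrightarrow> QM.bal H (\<lambda>n t. F n t c)"
    and add: "\<And>n t. n \<in> carrier M \<Longrightarrow> t \<in> carrier T \<Longrightarrow> additive_mod (add_monoid B) H (F n t)"
    and mid: "\<And>n t r c. n \<in> carrier M \<Longrightarrow> t \<in> carrier T \<Longrightarrow> r \<in> carrier R \<Longrightarrow> c \<in> carrier B \<Longrightarrow>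
      F n (t \<otimes>\<^bsub>T\<^esub> iota r) c \<approx>\<^bsub>H\<^esub> F n t (c \<otimes>\<^bsub>B\<^esub> target B r)"
    and m: "m \<in> carrier M" and t: "t \<in> carrier T" and b: "b \<in> carrier B"
  shows "Phi (\<lambda>n t. tsum (coaction T t) (\<lambda>a c. F n a c)) b m t \<approx>\<^bsub>H\<^esub>
    tsum (comult B b) (\<lambda>b1 b2. tsum (coaction T t) (\<lambda>a e. tsum (rb.splitting \<one>\<^bsub>B\<^esub> b1) (\<lambda>c d.
      Phi (\<lambda>n t. F n t (b2 \<otimes>\<^bsub>B\<^esub> (e \<otimes>\<^bsub>B\<^esub> c))) d m a)))"
proof -
  have F_TB: "tc.MB.bal H (F n)" if n: "n \<in> carrier M" for n
  proof (rule balancedI)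
    fix c assume "c \<in> carrier (add_monoid B)"
    then show "additive_mod (add_monoid T) H (\<lambda>t. F n t c)"
      using n by (intro balanced_right[OF F]) auto
  next
    fix t assume "t \<in> carrier (add_monoid T)"
    then show "additive_mod (add_monoid B) H (F n t)" using n by (intro add) auto
  next
    fix t i c assume "t \<in> carrier (add_monoid T)" "i \<in> carrier R" "c \<in> carrier (add_monoid B)"
    then show "F n (right_act T t i) c \<approx>\<^bsub>H\<^esub> F n t (c \<otimes>\<^bsub>B\<^esub> target B i)"
      using mid[OF n, of t i c] by (simp add: right_act_eq_iota)
  qed
  let ?r = "\<lambda>c x y. rot (\<lambda>n t. F n t c) m x y"
  have r_add: "additive_mod (add_monoid B) H (\<lambda>c. ?r c x y)" if "x \<in> carrier T" "y \<in> carrier T" for x y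
    unfolding rot_def using that m by (intro KM.additive_tsum_param coact_closed add) auto
  have r_mid: "?r c (x \<otimes>\<^bsub>T\<^esub> iota i) y \<approx>\<^bsub>H\<^esub> ?r (c \<otimes>\<^bsub>B\<^esub> target B i) x y"
    if "x \<in> carrier T" "y \<in> carrier T" "i \<in> carrier R" "c \<in> carrier B" for x y i c
  proof -
    have "?r c (x \<otimes>\<^bsub>T\<^esub> iota i) y \<approx>\<^bsub>H\<^esub> rot (\<lambda>n t. F n (t \<otimes>\<^bsub>T\<^esub> iota i) c) m x y"
      using that by (intro rot_iota_left m)
    also have "\<dots> \<approx>\<^bsub>H\<^esub> ?r (c \<otimes>\<^bsub>B\<^esub> target B i) x y"
      using that by (intro rot_cong m mid) auto
    finally show ?thesis .
  qed
  have r_TB: "tc.MB.bal H (\<lambda>x c. ?r c x y)" if y: "y \<in> carrier T" for y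
  proof (rule balancedI)
    fix c assume "c \<in> carrier (add_monoid B)"
    then show "additive_mod (add_monoid T) H (\<lambda>x. ?r c x y)"
      using y by (intro balanced_left[OF rot_bal[OF F m]]) auto
  next
    fix x assume "x \<in> carrier (add_monoid T)"
    then show "additive_mod (add_monoid B) H (\<lambda>c. ?r c x y)" using y by (intro r_add) auto
  next
    fix x i c assume "x \<in> carrier (add_monoid T)" "i \<in> carrier R" "c \<in> carrier (add_monoid B)"
    then show "?r c (right_act T x i) y \<approx>\<^bsub>H\<^esub> ?r (c \<otimes>\<^bsub>B\<^esub> target B i) x y"
      using r_mid[of x y i c] y by (simp add: right_act_eq_iota)
  qed
  \<comment> \<open>The coaction of the first leg is hidden inside this functional, so that only the
    second leg visibly coacts and \<open>gal_coaction_plus\<close> applies.\<close>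
  let ?G = "\<lambda>x y c. tsum (coaction T x) (\<lambda>a' c'. ?r (c \<otimes>\<^bsub>B\<^esub> c') a' y)"
  have "Phi (\<lambda>n t. tsum (coaction T t) (\<lambda>a c. F n a c)) b m t \<approx>\<^bsub>H\<^esub>
      tsum (gal t b) (\<lambda>x y. tsum (coaction T y) (\<lambda>a c. ?G x a c))"
    unfolding Phi_def
  proof (rule TT.tsum_cong[OF gal_closed[OF t b]])
    fix x y assume "x \<in> carrier (add_monoid T)" "y \<in> carrier (add_monoid T)"
    then have x: "x \<in> carrier T" and y: "y \<in> carrier T" by auto
    have "rot (\<lambda>n t. tsum (coaction T t) (\<lambda>a c. F n a c)) m x y \<approx>\<^bsub>H\<^esub>
        tsum (coact M m) (\<lambda>h n. tsum (coaction T y) (\<lambda>a c. tsum (coaction T x) (\<lambda>a' c'. F n (a \<otimes>\<^bsub>T\<^esub> act h a') (c \<otimes>\<^bsub>B\<^esub> c'))))"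
      unfolding rot_def
    proof (rule KM.tsum_cong[OF coact_closed[OF m]])
      fix h n assume "h \<in> carrier (add_monoid K)" and n: "n \<in> carrier M"
      then have h: "h \<in> carrier K" by simp
      have "tsum (coaction T (y \<otimes>\<^bsub>T\<^esub> act h x)) (F n) \<approx>\<^bsub>H\<^esub>
          tsum (coaction T y) (\<lambda>a c. tsum (coaction T (act h x)) (\<lambda>a' c'. F n (a \<otimes>\<^bsub>T\<^esub> a') (c \<otimes>\<^bsub>B\<^esub> c')))"
        using h x y by (intro coaction_mult[OF F_TB[OF n]]) auto
      also have "\<dots> \<approx>\<^bsub>H\<^esub> tsum (coaction T y) (\<lambda>a c. tsum (coaction T x) (\<lambda>a' c'. F n (a \<otimes>\<^bsub>T\<^esub> act h a') (c \<otimes>\<^bsub>B\<^esub> c')))"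
        using h x y by (intro tc.MB.tsum_cong coaction_closed coaction_act[OF TB_bal_rmult[OF TB_bal_lmult[OF F_TB[OF n]]]]) auto
      finally show "tsum (coaction T (y \<otimes>\<^bsub>T\<^esub> act h x)) (\<lambda>a c. F n a c) \<approx>\<^bsub>H\<^esub>
          tsum (coaction T y) (\<lambda>a c. tsum (coaction T x) (\<lambda>a' c'. F n (a \<otimes>\<^bsub>T\<^esub> act h a') (c \<otimes>\<^bsub>B\<^esub> c')))" .
    qed
    also have "\<dots> = tsum (coaction T y) (\<lambda>a c. tsum (coact M m) (\<lambda>h n. tsum (coaction T x) (\<lambda>a' c'. F n (a \<otimes>\<^bsub>T\<^esub> act h a') (c \<otimes>\<^bsub>B\<^esub> c'))))"
      by (rule tsum_swap)
    also have "\<dots> = tsum (coaction T y) (\<lambda>a c. tsum (coaction T x) (\<lambda>a' c'. tsum (coact M m) (\<lambda>h n. F n (a \<otimes>\<^bsub>T\<^esub> act h a') (c \<otimes>\<^bsub>B\<^esub> c'))))"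
      by (subst tsum_swap) (rule refl)
    finally show "rot (\<lambda>n t. tsum (coaction T t) (\<lambda>a c. F n a c)) m x y \<approx>\<^bsub>H\<^esub> tsum (coaction T y) (\<lambda>a c. ?G x a c)"
      by (simp add: rot_def)
  qed
  also have "\<dots> \<approx>\<^bsub>H\<^esub> tsum (comult B b) (\<lambda>b1 b2. tsum (gal t b1) (\<lambda>x y. ?G x y b2))"
  proof (rule gal_coaction_plus[OF _ _ _ t b])
    fix c assume c: "c \<in> carrier B"
    show "TT.bal H (\<lambda>x y. ?G x y c)"
    proof (rule balancedI)
      fix y assume "y \<in> carrier (add_monoid T)"
      then show "additive_mod (add_monoid T) H (\<lambda>x. ?G x y c)"
        by (intro tc.coact_additive TB_bal_rmult[OF r_TB] c) auto
    next
      fix x assume "x \<in> carrier (add_monoid T)"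
      then show "additive_mod (add_monoid T) H (\<lambda>y. ?G x y c)"
        using c by (intro tc.MB.additive_tsum_param coaction_closed balanced_right[OF rot_bal[OF F m]]) auto
    next
      fix x s y assume *: "x \<in> carrier (add_monoid T)" "s \<in> carrier S" "y \<in> carrier (add_monoid T)"
      then have "?G (x \<otimes>\<^bsub>T\<^esub> s) y c \<approx>\<^bsub>H\<^esub> tsum (coaction T x) (\<lambda>a' c'. ?r (c \<otimes>\<^bsub>B\<^esub> c') (a' \<otimes>\<^bsub>T\<^esub> s) y)"
        by (intro coaction_S_right[OF TB_bal_rmult[OF r_TB]] c) auto
      also have "\<dots> \<approx>\<^bsub>H\<^esub> ?G x (s \<otimes>\<^bsub>T\<^esub> y) c"
        using * c by (intro tc.MB.tsum_cong coaction_closed rot_middle[OF F m]) auto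
      finally show "?G (x \<otimes>\<^bsub>T\<^esub> s) y c \<approx>\<^bsub>H\<^esub> ?G x (s \<otimes>\<^bsub>T\<^esub> y) c" .
    qed
  next
    fix x y assume "x \<in> carrier T" "y \<in> carrier T"
    then show "additive_mod (add_monoid B) H (?G x y)"
      by (intro tc.MB.additive_tsum_param coaction_closed rb.B.additive_mod_rmult[OF r_add]) auto
  next
    fix x y i c assume *: "x \<in> carrier T" "y \<in> carrier T" "i \<in> carrier R" "c \<in> carrier B"
    then have "?G x (y \<otimes>\<^bsub>T\<^esub> iota i) c \<approx>\<^bsub>H\<^esub> tsum (coaction T x) (\<lambda>a' c'. ?r (c \<otimes>\<^bsub>B\<^esub> c') (iota i \<otimes>\<^bsub>T\<^esub> a') y)"
      by (intro tc.MB.tsum_cong coaction_closed rot_iota_right m) auto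
    also have "\<dots> \<approx>\<^bsub>H\<^esub> tsum (coaction T x) (\<lambda>a' c'. ?r (c \<otimes>\<^bsub>B\<^esub> (target B i \<otimes>\<^bsub>B\<^esub> c')) a' y)"
      using * by (intro coaction_iota_left[OF TB_bal_rmult[OF r_TB]]) auto
    also have "\<dots> \<approx>\<^bsub>H\<^esub> ?G x y (c \<otimes>\<^bsub>B\<^esub> target B i)"
      using * by (intro tc.MB.tsum_cong coaction_closed) (auto simp: rb.B.m_assoc)
    finally show "?G x (y \<otimes>\<^bsub>T\<^esub> iota i) c \<approx>\<^bsub>H\<^esub> ?G x y (c \<otimes>\<^bsub>B\<^esub> target B i)" .
  qed
  also have "\<dots> \<approx>\<^bsub>H\<^esub> tsum (comult B b) (\<lambda>b1 b2. tsum (coaction T t) (\<lambda>a e. tsum (rb.splitting \<one>\<^bsub>B\<^esub> b1) (\<lambda>c d.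
      Phi (\<lambda>n t. F n t (b2 \<otimes>\<^bsub>B\<^esub> (e \<otimes>\<^bsub>B\<^esub> c))) d m a)))"
    unfolding Phi_def
  proof (rule rb.BB.tsum_cong[OF rb.comult_closed[OF b]])
    fix b1 b2 assume "b1 \<in> carrier (add_monoid B)" "b2 \<in> carrier (add_monoid B)"
    then have b12: "b1 \<in> carrier B" "b2 \<in> carrier B" by auto
    show "tsum (gal t b1) (\<lambda>x y. ?G x y b2) \<approx>\<^bsub>H\<^esub>
      tsum (coaction T t) (\<lambda>a e. tsum (rb.splitting \<one>\<^bsub>B\<^esub> b1) (\<lambda>c d. tsum (gal a d) (\<lambda>x y. ?r (b2 \<otimes>\<^bsub>B\<^esub> (e \<otimes>\<^bsub>B\<^esub> c)) x y)))"
    \<comment> \<open>\<open>b2\<close> is already determined and stays as a fixed left factor while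
      the first leg is treated.\<close>
    proof (rule gal_coaction_minus[of H "\<lambda>x y c. ?r (b2 \<otimes>\<^bsub>B\<^esub> c) x y", OF _ _ _ t b12(1)])
      fix c assume "c \<in> carrier B"
      then show "TT.bal H (\<lambda>x y. ?r (b2 \<otimes>\<^bsub>B\<^esub> c) x y)"
        using b12 by (intro rot_bal[OF F m]) simp
    next
      fix x y assume "x \<in> carrier T" "y \<in> carrier T"
      then show "additive_mod (add_monoid B) H (\<lambda>c. ?r (b2 \<otimes>\<^bsub>B\<^esub> c) x y)"
        using b12 by (intro rb.B.additive_mod_lmult[OF r_add]) auto
    next
      fix x y i c assume "x \<in> carrier T" "y \<in> carrier T" "i \<in> carrier R" "c \<in> carrier B"
      then show "?r (b2 \<otimes>\<^bsub>B\<^esub> c) (x \<otimes>\<^bsub>T\<^esub> iota i) y \<approx>\<^bsub>H\<^esub> ?r (b2 \<otimes>\<^bsub>B\<^esub> (c \<otimes>\<^bsub>B\<^esub> target B i)) x y"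
        using r_mid[of x y i "b2 \<otimes>\<^bsub>B\<^esub> c"] b12 by (simp add: rb.B.m_assoc)
    qed
  qed
  finally show ?thesis .
qed

end

section \<open>The comodule \<open>M \<otimes>\<^sub>K T\<close>\<close>

text \<open>Both tensors are described by sums over one common tensor \<open>V'\<close>, so only the
  integrands need comparison, on pairs from the carriers.\<close>

lemma (in tensor_space) eq_by_tsum:
  assumes "U \<in> carrier Q" "V \<in> carrier Q" "V' \<in> carrier Q"
    and "tsum U (\<lambda>x y. frag_of (x, y)) \<approx>\<^bsub>rels\<^esub> tsum V' f"
    and "tsum V (\<lambda>x y. frag_of (x, y)) \<approx>\<^bsub>rels\<^esub> tsum V' g"
    and "\<And>x y. x \<in> carrier M \<Longrightarrow> y \<in> carrier N \<Longrightarrow> f x y \<approx>\<^bsub>rels\<^esub> g x y"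
  shows "U = V"
proof (rule carrier_eqI[OF assms(1,2)])
  have "tsum U (\<lambda>x y. frag_of (x, y)) \<approx>\<^bsub>rels\<^esub> tsum V' f" by fact
  also have "\<dots> \<approx>\<^bsub>rels\<^esub> tsum V' g" by (rule tsum_cong[OF assms(3,6)])
  also have "\<dots> \<approx>\<^bsub>rels\<^esub> tsum V (\<lambda>x y. frag_of (x, y))" by (rule cong_mod_sym[OF assms(5)])
  finally show "tsum U (\<lambda>x y. frag_of (x, y)) \<approx>\<^bsub>rels\<^esub> tsum V (\<lambda>x y. frag_of (x, y))" .
qed

text \<open>The universal functional separates elements of \<open>Q\<close>, so additivity of its
  composite with \<open>g\<close> already makes \<open>g\<close> a homomorphism.\<close>

lemma (in tensor_space) hom_by_tsum:
  assumes "\<And>U. U \<in> carrier P \<Longrightarrow> g U \<in> carrier Q" "Group.monoid P"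
    and "additive_mod P rels u"
    and "\<And>U. U \<in> carrier P \<Longrightarrow> tsum (g U) (\<lambda>x y. frag_of (x, y)) \<approx>\<^bsub>rels\<^esub> u U"
  shows "g \<in> hom P Q"
proof (rule homI)
  fix U V assume UV: "U \<in> carrier P" "V \<in> carrier P"
  then have UV': "U \<otimes>\<^bsub>P\<^esub> V \<in> carrier P" using assms(2) by (simp add: Group.monoid.m_closed)
  show "g (U \<otimes>\<^bsub>P\<^esub> V) = g U \<otimes>\<^bsub>Q\<^esub> g V"
  proof (rule carrier_eqI)
    show "g (U \<otimes>\<^bsub>P\<^esub> V) \<in> carrier Q" by (rule assms(1)[OF UV'])
    show "g U \<otimes>\<^bsub>Q\<^esub> g V \<in> carrier Q"
      using UV assms(1) by (intro Group.monoid.m_closed[OF group(3)]) auto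
    have "tsum (g (U \<otimes>\<^bsub>P\<^esub> V)) (\<lambda>x y. frag_of (x, y)) \<approx>\<^bsub>rels\<^esub> u (U \<otimes>\<^bsub>P\<^esub> V)" by (rule assms(4)[OF UV'])
    also have "\<dots> \<approx>\<^bsub>rels\<^esub> u U + u V" by (rule additive_modD[OF assms(3) UV])
    also have "\<dots> \<approx>\<^bsub>rels\<^esub> tsum (g U) (\<lambda>x y. frag_of (x, y)) + tsum (g V) (\<lambda>x y. frag_of (x, y))"
      by (intro cong_mod_add cong_mod_sym[OF assms(4)] UV)
    also have "\<dots> \<approx>\<^bsub>rels\<^esub> tsum (g U \<otimes>\<^bsub>Q\<^esub> g V) (\<lambda>x y. frag_of (x, y))"
      by (intro cong_mod_sym[OF additive_modD[OF tsum_additive[OF balanced_frag_of]]] assms(1) UV)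
    finally show "tsum (g (U \<otimes>\<^bsub>P\<^esub> V)) (\<lambda>x y. frag_of (x, y)) \<approx>\<^bsub>rels\<^esub> tsum (g U \<otimes>\<^bsub>Q\<^esub> g V) (\<lambda>x y. frag_of (x, y))" .
  qed
qed (use assms(1) in auto)

text \<open>Transfers the group structure to the module record, which shares carrier, product and
  unit with the tensor product but has another type.\<close>

lemma comm_group_cong:
  assumes "comm_group G" "carrier G' = carrier G" "monoid.mult G' = monoid.mult G" "\<one>\<^bsub>G'\<^esub> = \<one>\<^bsub>G\<^esub>"
  shows "comm_group G'"
proof -
  interpret G: comm_group G by fact
  have u: "Units G' = Units G" by (simp add: Units_def assms(2-4))
  show ?thesis
    by unfold_locales (auto simp: assms(2-4) u G.m_assoc intro: G.m_comm)
qed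

context sayd_setting
begin

abbreviation "QQ \<equiv> digamma_group K T act M"
abbreviation "FM \<equiv> digamma_obj R B K T act M"
abbreviation "ract \<equiv> digamma_ract K T act M"
abbreviation "lact \<equiv> digamma_lact R B K T act M"
abbreviation "coactQ \<equiv> digamma_coact R B K T act M"

lemma FM_simps [simp]:
  "carrier FM = carrier QQ" "monoid.mult FM = monoid.mult QQ" "\<one>\<^bsub>FM\<^esub> = \<one>\<^bsub>QQ\<^esub>"
  "base_ract FM = ract" "alg_lact FM = lact" "rcoact FM = coactQ"
  by (simp_all add: digamma_obj_def Let_def)

lemma FM_comm_group: "comm_group FM"
  by (rule comm_group_cong[OF QM.group(1)]) simp_all

lemma additive_FM [simp]: "additive_mod FM H u = additive_mod QQ H u"
  by (simp add: additive_mod_def)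

lemma hom_FM [simp]: "hom FM G = hom QQ G" "hom G FM = hom G QQ"
  by (simp_all add: hom_def)

text \<open>\<open>digamma_coact\<close> forms its classes over the bare tensor product and the
  comodule axioms over the module record. Only carrier and product enter the quotient, so the two
  coincide.\<close>

lemma right_tensor_FM: "right_tensor R B QQ ra = right_tensor R B FM ra"
  by (simp add: right_tensor_def tensor_def tensor_rels_def)

lemma QM_bal_ract:
  assumes f: "QM.bal H f" and r: "r \<in> carrier R"
  shows "QM.bal H (\<lambda>m t. f m (right_act T t r))"
proof (rule balancedI)
  fix t assume "t \<in> carrier (add_monoid T)"
  then show "additive_mod M H (\<lambda>m. f m (right_act T t r))"
    using r tc.ra_closed by (intro balanced_left[OF f]) auto
next
  fix m assume "m \<in> carrier M"
  then show "additive_mod (add_monoid T) H (\<lambda>t. f m (right_act T t r))"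
    by (intro additive_mod_comp[OF balanced_right[OF f] tc.ra_hom] r)
next
  fix m k t assume "m \<in> carrier M" "k \<in> carrier K" "t \<in> carrier (add_monoid T)"
  then show "f (alg_act M m k) (right_act T t r) \<approx>\<^bsub>H\<^esub> f m (right_act T (act k t) r)"
    using balanced_middle[OF f, of m k "right_act T t r"] tc.ra_closed[of t r] r by (simp add: act_right_act)
qed

text \<open>By balance all representatives give the same class, so \<open>the_elem\<close> returns
  it. \<open>coactQ_eq\<close> and \<open>lact_eq\<close> follow the same plan.\<close>

lemma ract_eq:
  assumes U: "U \<in> carrier QQ" and r: "r \<in> carrier R"
  shows "ract U r = tclass QQ (tsum U (\<lambda>m t. frag_of (m, right_act T t r)))"
  unfolding digamma_ract_def
proof (rule the_elem_constI[of "tclass QQ (sweedler (rep U) (\<lambda>m t. frag_of (m, right_act T t r)))"], goal_cases)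
  case 1
  show ?case using rep_mem[OF QM.pres U] by blast
next
  case (2 V)
  then obtain z where z: "z \<in> U" "V = tclass QQ (sweedler z (\<lambda>m t. frag_of (m, right_act T t r)))" by blast
  show ?case unfolding z(2)
    by (rule tclass_eqI[OF QM.pres QM.tsum_welldef[OF QM_bal_ract[OF balanced_frag_of r] U z(1)]])
qed

lemma ract_closed: "U \<in> carrier QQ \<Longrightarrow> r \<in> carrier R \<Longrightarrow> ract U r \<in> carrier QQ"
  unfolding ract_eq tsum_def using tc.ra_closed[of _ r]
  by (intro tclass_closed[OF QM.pres] keys_sweedler[OF rep_keys[OF QM.pres]]) auto

lemma tsum_ract:
  assumes "QM.bal H f" "U \<in> carrier QQ" "r \<in> carrier R"
  shows "tsum (ract U r) f \<approx>\<^bsub>H\<^esub> tsum U (\<lambda>m t. f m (right_act T t r))"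
  using QM.tsum_tclass[OF assms(1), of "tsum U (\<lambda>m t. frag_of (m, right_act T t r))"]
  unfolding ract_eq[OF assms(2,3)] sweedler_tsum by simp

lemma ract_pure: "m \<in> carrier M \<Longrightarrow> t \<in> carrier T \<Longrightarrow> r \<in> carrier R \<Longrightarrow> ract (QM.pure m t) r = QM.pure m (right_act T t r)"
  by (simp add: ract_eq QM.pure_closed tclass_eqI[OF QM.pres QM.tsum_pure[OF QM_bal_ract[OF balanced_frag_of]]])

lemma FM_right_module: "right_module R FM ract"
  unfolding right_module_def
proof (intro conjI ballI)
  show "Ring.ring R" by (rule rb.R.ring_axioms)
  show "comm_group FM" by (rule FM_comm_group)
next
  fix r assume r: "r \<in> carrier R"
  have "(\<lambda>U. ract U r) \<in> hom QQ QQ"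
    by (rule QM.hom_by_tsum[OF ract_closed[OF _ r] QM.group(3) QM.tsum_additive[OF QM_bal_ract[OF balanced_frag_of r]]
          tsum_ract[OF balanced_frag_of _ r]])
  then show "(\<lambda>U. ract U r) \<in> hom FM FM" by simp
next
  fix r r' U assume r: "r \<in> carrier R" "r' \<in> carrier R" and "U \<in> carrier FM"
  then have U: "U \<in> carrier QQ" by simp
  note rr = rb.R.add.m_closed[OF r] rb.R.m_closed[OF r]
  have m: "ract U r \<otimes>\<^bsub>QQ\<^esub> ract U r' \<in> carrier QQ"
    by (intro Group.monoid.m_closed[OF QM.group(3)] ract_closed U r)
  have "ract U (r \<oplus>\<^bsub>R\<^esub> r') = ract U r \<otimes>\<^bsub>QQ\<^esub> ract U r'"
  proof (rule QM.eq_by_tsum[OF ract_closed[OF U rr(1)] m U tsum_ract[OF balanced_frag_of U rr(1)]])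
    have "tsum (ract U r \<otimes>\<^bsub>QQ\<^esub> ract U r') (\<lambda>x y. frag_of (x, y)) \<approx>\<^bsub>QM.rels\<^esub>
        tsum (ract U r) (\<lambda>x y. frag_of (x, y)) + tsum (ract U r') (\<lambda>x y. frag_of (x, y))"
      by (intro additive_modD[OF QM.tsum_additive[OF balanced_frag_of]] ract_closed U r)
    also have "\<dots> \<approx>\<^bsub>QM.rels\<^esub> tsum U (\<lambda>m t. frag_of (m, right_act T t r)) + tsum U (\<lambda>m t. frag_of (m, right_act T t r'))"
      by (intro cong_mod_add tsum_ract[OF balanced_frag_of] U r)
    finally show "tsum (ract U r \<otimes>\<^bsub>QQ\<^esub> ract U r') (\<lambda>x y. frag_of (x, y)) \<approx>\<^bsub>QM.rels\<^esub>
        tsum U (\<lambda>m t. frag_of (m, right_act T t r) + frag_of (m, right_act T t r'))"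
      unfolding tsum_add .
  next
    fix m t assume m: "m \<in> carrier M" and t: "t \<in> carrier (add_monoid T)"
    have "QM.bal QM.rels (\<lambda>x y. frag_of (x, y))" by (rule balanced_frag_of)
    from additive_mod_addD[OF balanced_right[OF this m], of "right_act T t r" "right_act T t r'"]
    show "frag_of (m, right_act T t (r \<oplus>\<^bsub>R\<^esub> r')) \<approx>\<^bsub>QM.rels\<^esub> frag_of (m, right_act T t r) + frag_of (m, right_act T t r')"
      using tc.ra_add[of t r r'] tc.ra_closed[of t] r t by simp
  qed
  then show "ract U (r \<oplus>\<^bsub>R\<^esub> r') = ract U r \<otimes>\<^bsub>FM\<^esub> ract U r'" by simp
  have t: "tsum (ract (ract U r) r') (\<lambda>x y. frag_of (x, y)) \<approx>\<^bsub>QM.rels\<^esub> tsum U (\<lambda>m t. frag_of (m, right_act T (right_act T t r) r'))"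
    by (rule cong_mod_trans[OF tsum_ract[OF balanced_frag_of ract_closed[OF U r(1)] r(2)]
          tsum_ract[OF QM_bal_ract[OF balanced_frag_of r(2)] U r(1)]])
  show "ract U (r \<otimes>\<^bsub>R\<^esub> r') = ract (ract U r) r'"
    by (rule QM.eq_by_tsum[OF ract_closed[OF U rr(2)] ract_closed[OF ract_closed[OF U r(1)] r(2)] U
          tsum_ract[OF balanced_frag_of U rr(2)] t]) (use tc.ra_mult r in simp)
next
  fix U assume "U \<in> carrier FM"
  then have U: "U \<in> carrier QQ" by simp
  show "ract U \<one>\<^bsub>R\<^esub> = U"
    by (rule QM.eq_by_tsum[OF ract_closed[OF U rb.R.one_closed] U U
          tsum_ract[OF balanced_frag_of U rb.R.one_closed] cong_mod_refl]) (use tc.ra_one in simp)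
qed

text \<open>Makes the tensor product of \<open>M \<otimes>_K T\<close> with \<open>B\<close> over
  \<open>R\<close> available before the coaction is known to satisfy the comodule axioms.\<close>

sublocale fm: right_mod R B FM ract
  by unfold_locales (rule FM_right_module)

lemma pure_closed_FM: "m \<in> carrier M \<Longrightarrow> t \<in> carrier T \<Longrightarrow> QM.pure m t \<in> carrier FM"
  using QM.pure_closed by simp

lemma pure_TB_bal:
  assumes f: "fm.MB.bal H f" and m: "m \<in> carrier M"
  shows "tc.MB.bal H (\<lambda>a c. f (QM.pure m a) c)"
proof (rule balancedI)
  fix c assume "c \<in> carrier (add_monoid B)"
  then have "additive_mod QQ H (\<lambda>U. f U c)" using balanced_left[OF f] by simp
  then show "additive_mod (add_monoid T) H (\<lambda>a. f (QM.pure m a) c)"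
    by (intro balanced_right[OF QM.balanced_additive] m)
next
  fix a assume "a \<in> carrier (add_monoid T)"
  then show "additive_mod (add_monoid B) H (f (QM.pure m a))"
    using m by (intro balanced_right[OF f] pure_closed_FM) auto
next
  fix a r c assume "a \<in> carrier (add_monoid T)" "r \<in> carrier R" "c \<in> carrier (add_monoid B)"
  then show "f (QM.pure m (right_act T a r)) c \<approx>\<^bsub>H\<^esub> f (QM.pure m a) (c \<otimes>\<^bsub>B\<^esub> target B r)"
    using balanced_middle[OF f, of "QM.pure m a" r c] m pure_closed_FM[of m a] by (simp add: ract_pure)
qed

lemma pure_QM_bal:
  assumes f: "fm.MB.bal H f" and c: "c \<in> carrier B"
  shows "QM.bal H (\<lambda>m t. f (QM.pure m t) c)"
proof -
  have "additive_mod QQ H (\<lambda>U. f U c)" using balanced_left[OF f, of c] c by simp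
  then show ?thesis by (rule QM.balanced_additive)
qed

text \<open>The pullback of a functional along the coaction of \<open>M \<otimes>_K T\<close>, on
  pure tensors.\<close>

definition pull :: "(('m \<times> 't) tensor \<Rightarrow> 'b \<Rightarrow> 'c \<Rightarrow>\<^sub>0 int) \<Rightarrow> 'm \<Rightarrow> 't \<Rightarrow> 'c \<Rightarrow>\<^sub>0 int" where
  "pull f m t = tsum (coaction T t) (\<lambda>a c. f (QM.pure m a) c)"

text \<open>Balance over \<open>K\<close> expresses equivariance of the coaction of
  \<open>T\<close>; this is why the coaction descends to \<open>M \<otimes>_K T\<close>.\<close>

lemma pull_bal:
  assumes f: "fm.MB.bal H f" shows "QM.bal H (pull f)"
proof (rule balancedI)
  fix t assume "t \<in> carrier (add_monoid T)"
  then show "additive_mod M H (\<lambda>m. pull f m t)"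
    unfolding pull_def
    by (intro tc.MB.additive_tsum_param coaction_closed balanced_left[OF pure_QM_bal[OF f]]) auto
next
  fix m assume "m \<in> carrier M"
  then show "additive_mod (add_monoid T) H (pull f m)"
    unfolding pull_def by (intro tc.coact_additive pure_TB_bal[OF f])
next
  fix m k t assume *: "m \<in> carrier M" "k \<in> carrier K" "t \<in> carrier (add_monoid T)"
  then have "pull f m (act k t) \<approx>\<^bsub>H\<^esub> tsum (coaction T t) (\<lambda>a c. f (QM.pure m (act k a)) c)"
    unfolding pull_def by (intro coaction_act[OF pure_TB_bal[OF f]]) auto
  also have "\<dots> \<approx>\<^bsub>H\<^esub> pull f (alg_act M m k) t"
    unfolding pull_def using * by (intro tc.MB.tsum_cong coaction_closed cong_mod_eq) (auto simp: QM.pure_middle)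
  finally show "pull f (alg_act M m k) t \<approx>\<^bsub>H\<^esub> pull f m (act k t)"
    by (rule cong_mod_sym)
qed

lemma pull_sweedler:
  assumes f: "fm.MB.bal H f" and "m \<in> carrier M" "t \<in> carrier T" "z \<in> coaction T t"
  shows "sweedler z (\<lambda>a c. f (QM.pure m a) c) \<approx>\<^bsub>H\<^esub> pull f m t"
  unfolding pull_def by (rule tc.MB.tsum_welldef[OF pure_TB_bal[OF f assms(2)] coaction_closed[OF assms(3)] assms(4)])

lemma pull_frag:
  "sweedler (pull (\<lambda>n b. frag_of (n, b)) m t) f = pull f m t"
  unfolding pull_def sweedler_tsum by simp

lemma pull_keys:
  "m \<in> carrier M \<Longrightarrow> t \<in> carrier T \<Longrightarrow> Poly_Mapping.keys (pull (\<lambda>n b. frag_of (n, b)) m t) \<subseteq> carrier FM \<times> carrier (add_monoid B)"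
  unfolding pull_def tsum_def
  by (intro keys_sweedler[OF rep_keys[OF tc.MB.pres coaction_closed]]) (auto intro: QM.pure_closed)

lemma coactQ_eq:
  assumes U: "U \<in> carrier QQ"
  shows "coactQ U = tclass (right_tensor R B FM ract) (tsum U (pull (\<lambda>n b. frag_of (n, b))))"
  unfolding digamma_coact_def Let_def right_tensor_FM
proof (rule the_elem_constI[of "tclass (right_tensor R B FM ract) (sweedler (rep U)
    (\<lambda>m t. sweedler (rep (coaction T t)) (\<lambda>t0 t1. frag_of (QM.pure m t0, t1))))"], goal_cases)
  case 1
  show ?case
    by (intro CollectI exI[of _ "rep U"] exI[of _ "\<lambda>t. rep (coaction T t)"] conjI refl rep_mem[OF QM.pres U])
       (use rep_coaction in auto)
next
  case (2 V)
  then obtain z C where z: "z \<in> U" and C: "C \<in> Pi (carrier T) (coaction T)"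
    and V: "V = tclass (right_tensor R B FM ract) (sweedler z (\<lambda>m t. sweedler (C t) (\<lambda>t0 t1. frag_of (QM.pure m t0, t1))))"
    by blast
  have "sweedler z (\<lambda>m t. sweedler (C t) (\<lambda>t0 t1. frag_of (QM.pure m t0, t1))) \<approx>\<^bsub>fm.MB.rels\<^esub>
      sweedler z (pull (\<lambda>n b. frag_of (n, b)))"
    using C by (intro sweedler_cong_mod[OF mem_carrier_keys[OF QM.pres U z]] pull_sweedler[OF balanced_frag_of]) auto
  also have "\<dots> \<approx>\<^bsub>fm.MB.rels\<^esub> tsum U (pull (\<lambda>n b. frag_of (n, b)))"
    by (rule QM.tsum_welldef[OF pull_bal[OF balanced_frag_of] U z])
  finally show ?case unfolding V by (rule tclass_eqI[OF fm.MB.pres])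
qed

lemma coactQ_closed: "U \<in> carrier QQ \<Longrightarrow> coactQ U \<in> carrier (right_tensor R B FM ract)"
  unfolding coactQ_eq tsum_def
  by (intro tclass_closed[OF fm.MB.pres] keys_sweedler[OF rep_keys[OF QM.pres] pull_keys]) auto

lemma tsum_coactQ:
  assumes "fm.MB.bal H f" "U \<in> carrier QQ"
  shows "tsum (coactQ U) f \<approx>\<^bsub>H\<^esub> tsum U (pull f)"
  using fm.MB.tsum_tclass[OF assms(1), of "tsum U (pull (\<lambda>n b. frag_of (n, b)))"]
  unfolding coactQ_eq[OF assms(2)] sweedler_tsum pull_frag .

lemma coactQ_sweedler:
  assumes "fm.MB.bal H f" "U \<in> carrier QQ" "z \<in> coactQ U"
  shows "sweedler z f \<approx>\<^bsub>H\<^esub> tsum U (pull f)"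
  by (rule cong_mod_trans[OF fm.MB.tsum_welldef[OF assms(1) coactQ_closed[OF assms(2)] assms(3)] tsum_coactQ[OF assms(1,2)]])

lemma coactQ_hom: "coactQ \<in> hom FM (right_tensor R B FM ract)"
proof -
  have "coactQ \<in> hom QQ (right_tensor R B FM ract)"
    by (rule fm.MB.hom_by_tsum[OF coactQ_closed QM.group(3) QM.tsum_additive[OF pull_bal[OF balanced_frag_of]]
          tsum_coactQ[OF balanced_frag_of]])
  then show ?thesis by simp
qed

lemma FM_source_bal:
  assumes f: "fm.MB.bal H f" and r: "r \<in> carrier R"
  shows "fm.MB.bal H (\<lambda>n b. f n (b \<otimes>\<^bsub>B\<^esub> source B r))"
proof (rule balancedI)
  fix b assume "b \<in> carrier (add_monoid B)"
  then show "additive_mod FM H (\<lambda>n. f n (b \<otimes>\<^bsub>B\<^esub> source B r))"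
    using r by (intro balanced_left[OF f]) simp
next
  fix n assume "n \<in> carrier FM"
  then show "additive_mod (add_monoid B) H (\<lambda>b. f n (b \<otimes>\<^bsub>B\<^esub> source B r))"
    using r by (intro rb.B.additive_mod_rmult[OF balanced_right[OF f]]) auto
next
  fix n i b assume *: "n \<in> carrier FM" "i \<in> carrier R" "b \<in> carrier (add_monoid B)"
  then have "(b \<otimes>\<^bsub>B\<^esub> target B i) \<otimes>\<^bsub>B\<^esub> source B r = (b \<otimes>\<^bsub>B\<^esub> source B r) \<otimes>\<^bsub>B\<^esub> target B i"
    using r by (simp add: rb.B.m_assoc rb.source_target_commute)
  then show "f (ract n i) (b \<otimes>\<^bsub>B\<^esub> source B r) \<approx>\<^bsub>H\<^esub> f n ((b \<otimes>\<^bsub>B\<^esub> target B i) \<otimes>\<^bsub>B\<^esub> source B r)"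
    using balanced_middle[OF f, of n i "b \<otimes>\<^bsub>B\<^esub> source B r"] * r by simp
qed

lemma tsum_coactQ_ract:
  assumes f: "fm.MB.bal H f" and U: "U \<in> carrier QQ" and r: "r \<in> carrier R"
  shows "tsum (coactQ (ract U r)) f \<approx>\<^bsub>H\<^esub> tsum (coactQ U) (\<lambda>n b. f n (b \<otimes>\<^bsub>B\<^esub> source B r))"
proof -
  have "tsum (coactQ (ract U r)) f \<approx>\<^bsub>H\<^esub> tsum (ract U r) (pull f)"
    by (rule tsum_coactQ[OF f ract_closed[OF U r]])
  also have "\<dots> \<approx>\<^bsub>H\<^esub> tsum U (\<lambda>m t. pull f m (right_act T t r))"
    by (rule tsum_ract[OF pull_bal[OF f] U r])
  also have "\<dots> \<approx>\<^bsub>H\<^esub> tsum U (pull (\<lambda>n b. f n (b \<otimes>\<^bsub>B\<^esub> source B r)))"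
    by (rule QM.tsum_cong[OF U], unfold pull_def, rule tc.coact_ra[OF pure_TB_bal[OF f] _ r]) auto
  also have "\<dots> \<approx>\<^bsub>H\<^esub> tsum (coactQ U) (\<lambda>n b. f n (b \<otimes>\<^bsub>B\<^esub> source B r))"
    by (rule cong_mod_sym[OF tsum_coactQ[OF FM_source_bal[OF f r] U]])
  finally show ?thesis .
qed

section \<open>Coassociativity and counit of \<open>M \<otimes>_K T\<close>\<close>

abbreviation "FM_bal3 \<equiv> balanced3 (carrier R) FM ract
  (add_monoid B) (\<lambda>r b. b \<otimes>\<^bsub>B\<^esub> target B r) (\<lambda>b r. b \<otimes>\<^bsub>B\<^esub> source B r)
  (add_monoid B) (\<lambda>r b. b \<otimes>\<^bsub>B\<^esub> target B r)"

lemma FM_bal3_comult: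
  assumes g: "FM_bal3 H g" shows "fm.MB.bal H (\<lambda>n b. tsum (comult B b) (\<lambda>b1 b2. g n b1 b2))"
proof (rule balancedI)
  fix b assume "b \<in> carrier (add_monoid B)"
  then show "additive_mod FM H (\<lambda>m. tsum (comult B b) (\<lambda>b1 b2. g m b1 b2))"
    by (intro rb.BB.additive_tsum_param rb.comult_closed balanced3_additive_fst[OF g]) auto
next
  fix m assume "m \<in> carrier FM"
  then show "additive_mod (add_monoid B) H (\<lambda>b. tsum (comult B b) (\<lambda>b1 b2. g m b1 b2))"
    by (intro rb.comult_additive balanced3_fst[OF g])
next
  fix m i b assume *: "m \<in> carrier FM" "i \<in> carrier R" "b \<in> carrier (add_monoid B)"
  then have "tsum (comult B b) (\<lambda>b1 b2. g (ract m i) b1 b2) \<approx>\<^bsub>H\<^esub> tsum (comult B b) (\<lambda>b1 b2. g m (b1 \<otimes>\<^bsub>B\<^esub> target B i) b2)"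
    by (intro rb.BB.tsum_cong rb.comult_closed balanced3_middle1[OF g]) auto
  also have "\<dots> \<approx>\<^bsub>H\<^esub> tsum (comult B (b \<otimes>\<^bsub>B\<^esub> target B i)) (\<lambda>b1 b2. g m b1 b2)"
    using * by (intro cong_mod_sym[OF rb.comult_target] balanced3_fst[OF g]) auto
  finally show "tsum (comult B b) (\<lambda>b1 b2. g (ract m i) b1 b2) \<approx>\<^bsub>H\<^esub> tsum (comult B (b \<otimes>\<^bsub>B\<^esub> target B i)) (\<lambda>b1 b2. g m b1 b2)" .
qed

lemma FM_bal3_coact:
  assumes g: "FM_bal3 H g" shows "fm.MB.bal H (\<lambda>m b. tsum (coactQ m) (\<lambda>n c. g n c b))"
proof (rule balancedI)
  fix b assume "b \<in> carrier (add_monoid B)"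
  then show "additive_mod FM H (\<lambda>m. tsum (coactQ m) (\<lambda>n c. g n c b))"
    by (intro additive_mod_comp[OF fm.MB.tsum_additive coactQ_hom] balanced3_thd[OF g])
next
  fix m assume "m \<in> carrier FM"
  then show "additive_mod (add_monoid B) H (\<lambda>b. tsum (coactQ m) (\<lambda>n c. g n c b))"
    by (intro fm.MB.additive_tsum_param coactQ_closed balanced_right[OF balanced3_fst[OF g]]) auto
next
  fix m i b assume *: "m \<in> carrier FM" "i \<in> carrier R" "b \<in> carrier (add_monoid B)"
  then have "tsum (coactQ (ract m i)) (\<lambda>n c. g n c b) \<approx>\<^bsub>H\<^esub> tsum (coactQ m) (\<lambda>n c. g n (c \<otimes>\<^bsub>B\<^esub> source B i) b)"
    by (intro tsum_coactQ_ract balanced3_thd[OF g]) auto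
  also have "\<dots> \<approx>\<^bsub>H\<^esub> tsum (coactQ m) (\<lambda>n c. g n c (b \<otimes>\<^bsub>B\<^esub> target B i))"
    using * by (intro fm.MB.tsum_cong coactQ_closed balanced3_middle2[OF g]) auto
  finally show "tsum (coactQ (ract m i)) (\<lambda>n c. g n c b) \<approx>\<^bsub>H\<^esub> tsum (coactQ m) (\<lambda>n c. g n c (b \<otimes>\<^bsub>B\<^esub> target B i))" .
qed

lemma pure_bal3:
  assumes g: "FM_bal3 H g" and m: "m \<in> carrier M"
  shows "tc.bal3 H (\<lambda>a b c. g (QM.pure m a) b c)"
proof (rule balanced3I)
  fix b c assume "b \<in> carrier (add_monoid B)" "c \<in> carrier (add_monoid B)"
  then show "additive_mod (add_monoid T) H (\<lambda>a. g (QM.pure m a) b c)"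
    by (intro balanced_left[OF pure_TB_bal[OF balanced3_thd[OF g] m]])
next
  fix a c assume "a \<in> carrier (add_monoid T)" "c \<in> carrier (add_monoid B)"
  then show "additive_mod (add_monoid B) H (\<lambda>b. g (QM.pure m a) b c)"
    by (intro balanced_right[OF pure_TB_bal[OF balanced3_thd[OF g] m]])
next
  fix a b assume "a \<in> carrier (add_monoid T)" "b \<in> carrier (add_monoid B)"
  then show "additive_mod (add_monoid B) H (g (QM.pure m a) b)"
    using m by (intro balanced_right[OF balanced3_fst[OF g]] pure_closed_FM) auto
next
  fix a i b c assume "a \<in> carrier (add_monoid T)" "i \<in> carrier R" "b \<in> carrier (add_monoid B)" "c \<in> carrier (add_monoid B)"
  then show "g (QM.pure m (right_act T a i)) b c \<approx>\<^bsub>H\<^esub> g (QM.pure m a) (b \<otimes>\<^bsub>B\<^esub> target B i) c"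
    by (intro balanced_middle[OF pure_TB_bal[OF balanced3_thd[OF g] m]])
next
  fix a i b c assume "a \<in> carrier (add_monoid T)" "i \<in> carrier R" "b \<in> carrier (add_monoid B)" "c \<in> carrier (add_monoid B)"
  then show "g (QM.pure m a) (b \<otimes>\<^bsub>B\<^esub> source B i) c \<approx>\<^bsub>H\<^esub> g (QM.pure m a) b (c \<otimes>\<^bsub>B\<^esub> target B i)"
    using m by (intro balanced3_middle2[OF g] pure_closed_FM) auto
qed

text \<open>The coaction touches only the leg in \<open>T\<close>, so coassociativity of
  \<open>T\<close> suffices, with \<open>m\<close> as a spectator.\<close>

lemma coactQ_coassoc:
  assumes g: "FM_bal3 H g" and U: "U \<in> carrier QQ"
  shows "tsum (coactQ U) (\<lambda>n b. tsum (comult B b) (\<lambda>b1 b2. g n b1 b2)) \<approx>\<^bsub>H\<^esub>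
    tsum (coactQ U) (\<lambda>n b. tsum (coactQ n) (\<lambda>n' b'. g n' b' b))"
proof -
  have "tsum (coactQ U) (\<lambda>n b. tsum (comult B b) (\<lambda>b1 b2. g n b1 b2)) \<approx>\<^bsub>H\<^esub>
      tsum U (pull (\<lambda>n b. tsum (comult B b) (\<lambda>b1 b2. g n b1 b2)))"
    by (rule tsum_coactQ[OF FM_bal3_comult[OF g] U])
  also have "\<dots> \<approx>\<^bsub>H\<^esub> tsum U (pull (\<lambda>n b. tsum (coactQ n) (\<lambda>n' b'. g n' b' b)))"
  proof (rule QM.tsum_cong[OF U])
    fix m t assume m: "m \<in> carrier M" and "t \<in> carrier (add_monoid T)"
    then have t: "t \<in> carrier T" by simp
    have "pull (\<lambda>n b. tsum (comult B b) (\<lambda>b1 b2. g n b1 b2)) m t \<approx>\<^bsub>H\<^esub>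
        tsum (coaction T t) (\<lambda>a c. tsum (coaction T a) (\<lambda>a' c'. g (QM.pure m a') c' c))"
      unfolding pull_def by (rule tc.coact_coassoc[OF pure_bal3[OF g m]]) (simp add: t)
    also have "\<dots> \<approx>\<^bsub>H\<^esub> pull (\<lambda>n b. tsum (coactQ n) (\<lambda>n' b'. g n' b' b)) m t"
      unfolding pull_def[of "\<lambda>n b. tsum (coactQ n) (\<lambda>n' b'. g n' b' b)"]
    proof (rule tc.MB.tsum_cong[OF coaction_closed[OF t]])
      fix a c assume a: "a \<in> carrier (add_monoid T)" and c: "c \<in> carrier (add_monoid B)"
      have "tsum (coactQ (QM.pure m a)) (\<lambda>n' b'. g n' b' c) \<approx>\<^bsub>H\<^esub> tsum (QM.pure m a) (pull (\<lambda>n' b'. g n' b' c))"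
        using a m by (intro tsum_coactQ[OF balanced3_thd[OF g c]] QM.pure_closed) auto
      also have "\<dots> \<approx>\<^bsub>H\<^esub> pull (\<lambda>n' b'. g n' b' c) m a"
        by (rule QM.tsum_pure[OF pull_bal[OF balanced3_thd[OF g c]]])
      finally show "tsum (coaction T a) (\<lambda>a' c'. g (QM.pure m a') c' c) \<approx>\<^bsub>H\<^esub> tsum (coactQ (QM.pure m a)) (\<lambda>n' b'. g n' b' c)"
        unfolding pull_def by (rule cong_mod_sym)
    qed
    finally show "pull (\<lambda>n b. tsum (comult B b) (\<lambda>b1 b2. g n b1 b2)) m t \<approx>\<^bsub>H\<^esub>
        pull (\<lambda>n b. tsum (coactQ n) (\<lambda>n' b'. g n' b' b)) m t" .
  qed
  also have "\<dots> \<approx>\<^bsub>H\<^esub> tsum (coactQ U) (\<lambda>n b. tsum (coactQ n) (\<lambda>n' b'. g n' b' b))"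
    by (rule cong_mod_sym[OF tsum_coactQ[OF FM_bal3_coact[OF g] U]])
  finally show ?thesis .
qed

text \<open>Evaluates a sum over the coaction of \<open>U\<close> to an element of
  \<open>M \<otimes>_K T\<close>. The hypothesis \<open>eq\<close> is a statement about pure
  tensors, accessible to \<open>pull\<close> and \<open>Phi\<close>; the counit axiom and stability
  are both proved through it.\<close>

lemma FM_value_sum:
  assumes U: "U \<in> carrier QQ" "V \<in> carrier QQ" and z: "z \<in> coactQ U"
    and closed: "\<And>n b. n \<in> carrier QQ \<Longrightarrow> b \<in> carrier B \<Longrightarrow> g n b \<in> carrier QQ"
    and bal: "fm.MB.bal (group_rels FM) (\<lambda>n b. frag_of (g n b))"
    and eq: "tsum U (pull (\<lambda>n b. frag_of (g n b))) \<approx>\<^bsub>group_rels FM\<^esub> frag_of V"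
  shows "value_sum FM g z = V"
proof (rule group_rels_separate[OF FM_comm_group])
  have keys: "Poly_Mapping.keys z \<subseteq> carrier QQ \<times> carrier B"
    using mem_carrier_keys[OF fm.MB.pres coactQ_closed[OF U(1)] z] by simp
  then show "value_sum FM g z \<in> carrier FM"
    using closed by (intro value_sum_closed[OF FM_comm_group]) auto
  show "V \<in> carrier FM" using U by simp
  have "frag_of (value_sum FM g z) \<approx>\<^bsub>group_rels FM\<^esub> sweedler z (\<lambda>n b. frag_of (g n b))"
    using keys closed by (intro additive_mod_value_sum[OF FM_comm_group additive_mod_frag_of]) auto
  also have "\<dots> \<approx>\<^bsub>group_rels FM\<^esub> tsum U (pull (\<lambda>n b. frag_of (g n b)))"
    by (rule coactQ_sweedler[OF bal U(1) z])
  also note eq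
  finally show "frag_of (value_sum FM g z) \<approx>\<^bsub>group_rels FM\<^esub> frag_of V" .
qed

lemma additive_frag_FM: "additive_mod QQ (group_rels FM) frag_of"
  using additive_mod_frag_of[of FM] by simp

lemma tsum_frag_FM: "U \<in> carrier QQ \<Longrightarrow> tsum U (\<lambda>m t. frag_of (QM.pure m t)) \<approx>\<^bsub>group_rels FM\<^esub> frag_of U"
  by (rule cong_mod_sym[OF QM.additive_tsum[OF additive_frag_FM]])

lemma FM_right_comodule: "right_comodule R B FM ract coactQ"
  unfolding right_comodule_def
proof (intro conjI ballI)
  show "right_module R FM ract" by (rule FM_right_module)
  show "coactQ \<in> hom FM (right_tensor R B FM ract)" by (rule coactQ_hom)
next
  fix C r U assume C: "C \<in> Pi (carrier FM) coactQ" and r: "r \<in> carrier R" and "U \<in> carrier FM"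
  then have U: "U \<in> carrier QQ" and CU: "C U \<in> coactQ U" by auto
  have "tsum (coactQ (ract U r)) (\<lambda>n b. frag_of (n, b)) \<approx>\<^bsub>fm.MB.rels\<^esub> tsum (coactQ U) (\<lambda>n b. frag_of (n, b \<otimes>\<^bsub>B\<^esub> source B r))"
    by (rule tsum_coactQ_ract[OF balanced_frag_of U r])
  also have "\<dots> \<approx>\<^bsub>fm.MB.rels\<^esub> sweedler (C U) (\<lambda>n b. frag_of (n, b \<otimes>\<^bsub>B\<^esub> source B r))"
    by (rule cong_mod_sym[OF fm.MB.tsum_welldef[OF FM_source_bal[OF balanced_frag_of r] coactQ_closed[OF U] CU]])
  finally show "coactQ (ract U r) = tclass (right_tensor R B FM ract) (sweedler (C U) (\<lambda>n b. frag_of (n, b \<otimes>\<^bsub>B\<^esub> source B r)))"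
    using tclass_eqI[OF fm.MB.pres] fm.MB.tclass_tsum[OF coactQ_closed[OF ract_closed[OF U r]]] by metis
next
  show "right_coassociative R B FM ract coactQ"
    unfolding right_coassociative_def Let_def
  proof (intro ballI)
    fix D C U assume D: "D \<in> Pi (carrier B) (comult B)" and C: "C \<in> Pi (carrier FM) coactQ" and "U \<in> carrier FM"
    then have U: "U \<in> carrier QQ" and CU: "C U \<in> coactQ U" by auto
    let ?Q3 = "tensor3 (carrier R) FM ract (add_monoid B) (\<lambda>r b. b \<otimes>\<^bsub>B\<^esub> target B r)
        (\<lambda>b r. b \<otimes>\<^bsub>B\<^esub> source B r) (add_monoid B) (\<lambda>r b. b \<otimes>\<^bsub>B\<^esub> target B r)"
    let ?r3 = "tensor3_rels (carrier R) FM ract (add_monoid B) (\<lambda>r b. b \<otimes>\<^bsub>B\<^esub> target B r)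
        (\<lambda>b r. b \<otimes>\<^bsub>B\<^esub> source B r) (add_monoid B) (\<lambda>r b. b \<otimes>\<^bsub>B\<^esub> target B r)"
    let ?g = "\<lambda>n b c. frag_of (n, b, c)"
    have g: "FM_bal3 ?r3 ?g" by (rule balanced3_frag_of)
    have pres: "presented ?Q3 (carrier FM \<times> carrier (add_monoid B) \<times> carrier (add_monoid B)) ?r3"
      by (rule presented_tensor3) (auto simp: fm.monoid ract_closed)
    have keys: "Poly_Mapping.keys (C U) \<subseteq> carrier FM \<times> carrier (add_monoid B)"
      by (rule mem_carrier_keys[OF fm.MB.pres coactQ_closed[OF U] CU])
    have "sweedler (C U) (\<lambda>n b. sweedler (D b) (\<lambda>b1 b2. ?g n b1 b2)) \<approx>\<^bsub>?r3\<^esub>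
        sweedler (C U) (\<lambda>n b. tsum (comult B b) (\<lambda>b1 b2. ?g n b1 b2))"
      using D by (intro sweedler_cong_mod[OF keys] rb.BB.tsum_welldef[OF balanced3_fst[OF g]] rb.comult_closed) auto
    also have "\<dots> \<approx>\<^bsub>?r3\<^esub> tsum (coactQ U) (\<lambda>n b. tsum (comult B b) (\<lambda>b1 b2. ?g n b1 b2))"
      by (rule fm.MB.tsum_welldef[OF FM_bal3_comult[OF g] coactQ_closed[OF U] CU])
    also have "\<dots> \<approx>\<^bsub>?r3\<^esub> tsum (coactQ U) (\<lambda>n b. tsum (coactQ n) (\<lambda>n' b'. ?g n' b' b))"
      by (rule coactQ_coassoc[OF g U])
    also have "\<dots> \<approx>\<^bsub>?r3\<^esub> sweedler (C U) (\<lambda>n b. tsum (coactQ n) (\<lambda>n' b'. ?g n' b' b))"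
      by (rule cong_mod_sym[OF fm.MB.tsum_welldef[OF FM_bal3_coact[OF g] coactQ_closed[OF U] CU]])
    also have "\<dots> \<approx>\<^bsub>?r3\<^esub> sweedler (C U) (\<lambda>n b. sweedler (C n) (\<lambda>n' b'. ?g n' b' b))"
      using C by (intro sweedler_cong_mod[OF keys] cong_mod_sym[OF fm.MB.tsum_welldef[OF balanced3_thd[OF g]]] coactQ_closed) auto
    finally show "tclass ?Q3 (sweedler (C U) (\<lambda>n b. sweedler (D b) (\<lambda>b1 b2. ?g n b1 b2))) =
        tclass ?Q3 (sweedler (C U) (\<lambda>n b. sweedler (C n) (\<lambda>n' b'. ?g n' b' b)))"
      by (rule tclass_eqI[OF pres])
  qed
next
  fix U z assume "U \<in> carrier FM" and z: "z \<in> coactQ U"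
  then have U: "U \<in> carrier QQ" by simp
  show "value_sum FM (\<lambda>n b. ract n (counit B b)) z = U"
  proof (rule FM_value_sum[OF U U z])
    fix n b assume "n \<in> carrier QQ" "b \<in> carrier B"
    then show "ract n (counit B b) \<in> carrier QQ" by (intro ract_closed) auto
  next
    \<comment> \<open>The counit integrand is the case \<open>c = 1\<close> of
      \<open>left_act_bal\<close>; the factor 1 disappears on the carrier of
      \<open>B\<close>.\<close>
    have "fm.MB.bal (group_rels FM) (\<lambda>n b. frag_of (ract n (counit B (\<one>\<^bsub>B\<^esub> \<otimes>\<^bsub>B\<^esub> b))))"
      by (rule fm.left_act_bal[OF additive_mod_frag_of rb.B.one_closed])
    moreover have "fm.MB.bal (group_rels FM) (\<lambda>n b. frag_of (ract n (counit B (\<one>\<^bsub>B\<^esub> \<otimes>\<^bsub>B\<^esub> b)))) =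
        fm.MB.bal (group_rels FM) (\<lambda>n b. frag_of (ract n (counit B b)))"
      unfolding balanced_def additive_mod_def by simp
    ultimately show "fm.MB.bal (group_rels FM) (\<lambda>n b. frag_of (ract n (counit B b)))" by simp
  next
    have "tsum U (pull (\<lambda>n b. frag_of (ract n (counit B b)))) \<approx>\<^bsub>group_rels FM\<^esub> tsum U (\<lambda>m t. frag_of (QM.pure m t))"
    proof (rule QM.tsum_cong[OF U])
      fix m t assume m: "m \<in> carrier M" and t: "t \<in> carrier (add_monoid T)"
      have "pull (\<lambda>n b. frag_of (ract n (counit B b))) m t \<approx>\<^bsub>group_rels FM\<^esub>
          tsum (coaction T t) (\<lambda>a c. frag_of (QM.pure m (right_act T a (counit B c))))"
        unfolding pull_def using m t by (intro tc.MB.tsum_cong coaction_closed) (auto simp: ract_pure)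
      also have "\<dots> \<approx>\<^bsub>group_rels FM\<^esub> frag_of (QM.pure m t)"
        by (rule tc.coact_counit[OF balanced_right[OF QM.balanced_additive[OF additive_frag_FM] m] t])
      finally show "pull (\<lambda>n b. frag_of (ract n (counit B b))) m t \<approx>\<^bsub>group_rels FM\<^esub> frag_of (QM.pure m t)" .
    qed
    also have "\<dots> \<approx>\<^bsub>group_rels FM\<^esub> frag_of U" by (rule tsum_frag_FM[OF U])
    finally show "tsum U (pull (\<lambda>n b. frag_of (ract n (counit B b)))) \<approx>\<^bsub>group_rels FM\<^esub> frag_of U" .
  qed
qed

sublocale fc: right_comod R B FM ract coactQ
  by unfold_locales (rule FM_right_comodule)

end

section \<open>The SAYD module \<open>M \<otimes>\<^sub>K T\<close>\<close>

context sayd_setting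
begin

text \<open>The defining formula takes \<open>can^-1(1 \<otimes> b)\<close>, multiplies
  \<open>t\<close> in afterwards and allows any representatives. Left linearity of
  \<open>can^-1\<close> identifies it with the version used in \<open>Phi\<close>.\<close>

lemma Phi_sweedler:
  assumes f: "QM.bal H f" and m: "m \<in> carrier M" and t: "t \<in> carrier T" and b: "b \<in> carrier B"
    and z: "z \<in> coact M m" and w: "w \<in> galois_translation R B T b"
  shows "sweedler z (\<lambda>h n. sweedler w (\<lambda>x y. f n (y \<otimes>\<^bsub>T\<^esub> act h (t \<otimes>\<^bsub>T\<^esub> x)))) \<approx>\<^bsub>H\<^esub> Phi f b m t"
proof -
  have gal: "gal \<one>\<^bsub>T\<^esub> b \<in> carrier (galois_domain S T)" by (rule gal_closed[OF T.one_closed b])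
  have w': "w \<in> gal \<one>\<^bsub>T\<^esub> b" using w by (simp only: galois_translation_eq)
  have "sweedler z (\<lambda>h n. sweedler w (\<lambda>x y. f n (y \<otimes>\<^bsub>T\<^esub> act h (t \<otimes>\<^bsub>T\<^esub> x)))) =
      sweedler w (\<lambda>x y. sweedler z (\<lambda>h n. f n (y \<otimes>\<^bsub>T\<^esub> act h (t \<otimes>\<^bsub>T\<^esub> x))))"
    by (rule sweedler_swap)
  also have "\<dots> \<approx>\<^bsub>H\<^esub> sweedler w (\<lambda>x y. rot f m (t \<otimes>\<^bsub>T\<^esub> x) y)"
    unfolding rot_def using t z m
    by (intro sweedler_cong_mod[OF mem_carrier_keys[OF TT.pres gal w']] KM.tsum_welldef[OF rot_KM_bal[OF f]] coact_closed) auto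
  also have "\<dots> \<approx>\<^bsub>H\<^esub> tsum (gal \<one>\<^bsub>T\<^esub> b) (\<lambda>x y. rot f m (t \<otimes>\<^bsub>T\<^esub> x) y)"
    by (rule TT.tsum_welldef[OF TT_bal_lmult[OF rot_bal[OF f m] t] gal w'])
  also have "\<dots> \<approx>\<^bsub>H\<^esub> tsum (gal (t \<otimes>\<^bsub>T\<^esub> \<one>\<^bsub>T\<^esub>) b) (rot f m)"
    by (rule cong_mod_sym[OF gal_lmult[OF rot_bal[OF f m] t T.one_closed b]])
  finally show ?thesis using t by (simp add: Phi_def)
qed

lemma Phi_frag: "sweedler (Phi (\<lambda>m t. frag_of (m, t)) b m t) f = Phi f b m t"
  unfolding Phi_def rot_def sweedler_tsum by simp

lemma Phi_keys:
  assumes "m \<in> carrier M" "t \<in> carrier T" "b \<in> carrier B"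
  shows "Poly_Mapping.keys (Phi (\<lambda>m t. frag_of (m, t)) b m t) \<subseteq> carrier M \<times> carrier (add_monoid T)"
  unfolding Phi_def rot_def tsum_def using assms
  by (intro keys_sweedler[OF rep_keys[OF TT.pres gal_closed]] keys_sweedler[OF rep_coact_keys]) auto

lemma lact_eq:
  assumes U: "U \<in> carrier QQ" and b: "b \<in> carrier B"
  shows "lact b U = tclass QQ (tsum U (Phi (\<lambda>m t. frag_of (m, t)) b))"
  unfolding digamma_lact_def
proof (rule the_elem_constI[of "tclass QQ (sweedler (rep U) (\<lambda>m t. sweedler (rep (coact M m)) (\<lambda>h n.
    sweedler (rep (galois_translation R B T b)) (\<lambda>x y. frag_of (n, y \<otimes>\<^bsub>T\<^esub> act h (t \<otimes>\<^bsub>T\<^esub> x))))))"], goal_cases)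
  case 1
  have "rep (galois_translation R B T b) \<in> galois_translation R B T b"
    unfolding galois_translation_eq by (rule rep_mem[OF TT.pres gal_closed[OF T.one_closed b]])
  then show ?case
    by (intro CollectI exI[of _ "rep U"] exI[of _ "\<lambda>m. rep (coact M m)"] exI[of _ "rep (galois_translation R B T b)"]
        conjI refl rep_mem[OF QM.pres U] rep_coact)
next
  case (2 V)
  then obtain z C w where z: "z \<in> U" and C: "C \<in> Pi (carrier M) (coact M)" and w: "w \<in> galois_translation R B T b"
    and V: "V = tclass QQ (sweedler z (\<lambda>m t. sweedler (C m) (\<lambda>h n. sweedler w (\<lambda>x y. frag_of (n, y \<otimes>\<^bsub>T\<^esub> act h (t \<otimes>\<^bsub>T\<^esub> x))))))"
    by blast
  have "sweedler z (\<lambda>m t. sweedler (C m) (\<lambda>h n. sweedler w (\<lambda>x y. frag_of (n, y \<otimes>\<^bsub>T\<^esub> act h (t \<otimes>\<^bsub>T\<^esub> x))))) \<approx>\<^bsub>QM.rels\<^esub>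
      sweedler z (Phi (\<lambda>m t. frag_of (m, t)) b)"
    using C b w by (intro sweedler_cong_mod[OF mem_carrier_keys[OF QM.pres U z]] Phi_sweedler[OF balanced_frag_of]) auto
  also have "\<dots> \<approx>\<^bsub>QM.rels\<^esub> tsum U (Phi (\<lambda>m t. frag_of (m, t)) b)"
    by (rule QM.tsum_welldef[OF Phi_bal[OF balanced_frag_of b] U z])
  finally show ?case unfolding V by (rule tclass_eqI[OF QM.pres])
qed

lemma lact_closed: "U \<in> carrier QQ \<Longrightarrow> b \<in> carrier B \<Longrightarrow> lact b U \<in> carrier QQ"
  unfolding lact_eq tsum_def
  by (intro tclass_closed[OF QM.pres] keys_sweedler[OF rep_keys[OF QM.pres] Phi_keys]) auto

lemma tsum_lact:
  assumes "QM.bal H f" "U \<in> carrier QQ" "b \<in> carrier B"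
  shows "tsum (lact b U) f \<approx>\<^bsub>H\<^esub> tsum U (Phi f b)"
  using QM.tsum_tclass[OF assms(1), of "tsum U (Phi (\<lambda>m t. frag_of (m, t)) b)"]
  unfolding lact_eq[OF assms(2,3)] sweedler_tsum Phi_frag .

lemma lact_hom: "b \<in> carrier B \<Longrightarrow> lact b \<in> hom QQ QQ"
  by (rule QM.hom_by_tsum[OF lact_closed QM.group(3) QM.tsum_additive[OF Phi_bal[OF balanced_frag_of]] tsum_lact[OF balanced_frag_of]])

lemma lact_add:
  assumes U: "U \<in> carrier QQ" and b: "b \<in> carrier B" "c \<in> carrier B"
  shows "lact (b \<oplus>\<^bsub>B\<^esub> c) U = lact b U \<otimes>\<^bsub>QQ\<^esub> lact c U"
proof -
  have bc: "b \<oplus>\<^bsub>B\<^esub> c \<in> carrier B" using b by simp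
  have m: "lact b U \<otimes>\<^bsub>QQ\<^esub> lact c U \<in> carrier QQ"
    by (intro Group.monoid.m_closed[OF QM.group(3)] lact_closed U b)
  show ?thesis
  proof (rule QM.eq_by_tsum[OF lact_closed[OF U bc] m U tsum_lact[OF balanced_frag_of U bc]])
    have "tsum (lact b U \<otimes>\<^bsub>QQ\<^esub> lact c U) (\<lambda>x y. frag_of (x, y)) \<approx>\<^bsub>QM.rels\<^esub>
        tsum (lact b U) (\<lambda>x y. frag_of (x, y)) + tsum (lact c U) (\<lambda>x y. frag_of (x, y))"
      by (intro additive_modD[OF QM.tsum_additive[OF balanced_frag_of]] lact_closed U b)
    also have "\<dots> \<approx>\<^bsub>QM.rels\<^esub> tsum U (Phi (\<lambda>m t. frag_of (m, t)) b) + tsum U (Phi (\<lambda>m t. frag_of (m, t)) c)"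
      by (intro cong_mod_add tsum_lact[OF balanced_frag_of] U b)
    finally show "tsum (lact b U \<otimes>\<^bsub>QQ\<^esub> lact c U) (\<lambda>x y. frag_of (x, y)) \<approx>\<^bsub>QM.rels\<^esub>
        tsum U (\<lambda>m t. Phi (\<lambda>m t. frag_of (m, t)) b m t + Phi (\<lambda>m t. frag_of (m, t)) c m t)"
      unfolding tsum_add .
  next
    fix m t assume "m \<in> carrier M" "t \<in> carrier (add_monoid T)"
    then show "Phi (\<lambda>m t. frag_of (m, t)) (b \<oplus>\<^bsub>B\<^esub> c) m t \<approx>\<^bsub>QM.rels\<^esub>
        Phi (\<lambda>m t. frag_of (m, t)) b m t + Phi (\<lambda>m t. frag_of (m, t)) c m t"
      using b by (intro additive_mod_addD[OF Phi_additive[OF balanced_frag_of]]) auto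
  qed
qed

lemma lact_mult:
  assumes U: "U \<in> carrier QQ" and b: "b \<in> carrier B" "c \<in> carrier B"
  shows "lact (b \<otimes>\<^bsub>B\<^esub> c) U = lact b (lact c U)"
proof -
  have bc: "b \<otimes>\<^bsub>B\<^esub> c \<in> carrier B" using b by simp
  have t: "tsum (lact b (lact c U)) (\<lambda>x y. frag_of (x, y)) \<approx>\<^bsub>QM.rels\<^esub> tsum U (Phi (Phi (\<lambda>m t. frag_of (m, t)) b) c)"
    by (rule cong_mod_trans[OF tsum_lact[OF balanced_frag_of lact_closed[OF U b(2)] b(1)]
          tsum_lact[OF Phi_bal[OF balanced_frag_of b(1)] U b(2)]])
  show ?thesis
    by (rule QM.eq_by_tsum[OF lact_closed[OF U bc] lact_closed[OF lact_closed[OF U b(2)] b(1)] U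
          tsum_lact[OF balanced_frag_of U bc] t], rule cong_mod_sym, rule Phi_mult[OF balanced_frag_of b]) auto
qed

lemma lact_one: "U \<in> carrier QQ \<Longrightarrow> lact \<one>\<^bsub>B\<^esub> U = U"
  by (rule QM.eq_by_tsum[OF lact_closed[OF _ rb.B.one_closed] _ _ tsum_lact[OF balanced_frag_of _ rb.B.one_closed] cong_mod_refl])
     (auto intro!: Phi_one[OF balanced_frag_of])

lemma lact_target:
  assumes U: "U \<in> carrier QQ" and r: "r \<in> carrier R"
  shows "lact (target B r) U = ract U r"
proof -
  have tr: "target B r \<in> carrier B" using r by simp
  show ?thesis
  proof (rule QM.eq_by_tsum[OF lact_closed[OF U tr] ract_closed[OF U r] U
        tsum_lact[OF balanced_frag_of U tr] tsum_ract[OF balanced_frag_of U r]])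
    fix m t assume m: "m \<in> carrier M" and "t \<in> carrier (add_monoid T)"
    then have t: "t \<in> carrier T" by simp
    show "Phi (\<lambda>m t. frag_of (m, t)) (target B r) m t \<approx>\<^bsub>QM.rels\<^esub> frag_of (m, right_act T t r)"
      unfolding right_act_eq_iota[OF r t] by (rule Phi_target[OF balanced_frag_of m t r])
  qed
qed

lemma FM_left_module: "left_module B FM lact"
  unfolding left_module_def
  using rb.B.ring_axioms FM_comm_group lact_hom lact_add lact_mult lact_one by simp

lemma additive_lact:
  assumes u: "additive_mod QQ H u" and U: "U \<in> carrier QQ" and b: "b \<in> carrier B"
  shows "u (lact b U) \<approx>\<^bsub>H\<^esub> tsum U (Phi (\<lambda>m t. u (QM.pure m t)) b)"
  by (rule cong_mod_trans[OF QM.additive_tsum[OF u lact_closed[OF U b]] tsum_lact[OF QM.balanced_additive[OF u] U b]])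

lemma additive_lact_pure:
  assumes u: "additive_mod QQ H u" and m: "m \<in> carrier M" and t: "t \<in> carrier T" and b: "b \<in> carrier B"
  shows "u (lact b (QM.pure m t)) \<approx>\<^bsub>H\<^esub> Phi (\<lambda>m t. u (QM.pure m t)) b m t"
proof -
  have "QM.pure m t \<in> carrier QQ" using m t by (intro QM.pure_closed) auto
  from additive_lact[OF u this b] show ?thesis
    by (rule cong_mod_trans[OF _ QM.tsum_pure[OF Phi_bal[OF QM.balanced_additive[OF u] b]]])
qed

text \<open>On pure tensors the canonical left action reduces to that of \<open>T\<close>, which is
  left multiplication by \<open>iota r\<close>; \<open>Phi_source\<close> computes the same value
  from the action of \<open>B\<close>.\<close>

lemma lact_source:
  assumes U: "U \<in> carrier QQ" and r: "r \<in> carrier R"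
  shows "fc.left_act r U = lact (source B r) U"
proof (rule group_rels_separate[OF FM_comm_group])
  let ?H = "group_rels FM"
  have sr: "source B r \<in> carrier B" using r by simp
  have U': "U \<in> carrier FM" using U by simp
  show "fc.left_act r U \<in> carrier FM" by (rule fc.left_act_eq(2)[OF U' r])
  show "lact (source B r) U \<in> carrier FM" using lact_closed[OF U sr] by simp
  let ?g = "\<lambda>n b. frag_of (ract n (counit B (source B r \<otimes>\<^bsub>B\<^esub> b)))"
  have "frag_of (fc.left_act r U) \<approx>\<^bsub>?H\<^esub> tsum (coactQ U) ?g"
    by (rule fc.tsum_left_act[OF additive_mod_frag_of U' r])
  also have "\<dots> \<approx>\<^bsub>?H\<^esub> tsum U (pull ?g)"
    by (rule tsum_coactQ[OF fm.left_act_bal[OF additive_mod_frag_of sr] U])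
  also have "\<dots> \<approx>\<^bsub>?H\<^esub> tsum U (Phi (\<lambda>m t. frag_of (QM.pure m t)) (source B r))"
  proof (rule QM.tsum_cong[OF U])
    fix m t assume m: "m \<in> carrier M" and t': "t \<in> carrier (add_monoid T)"
    then have t: "t \<in> carrier T" by simp
    have "pull ?g m t \<approx>\<^bsub>?H\<^esub> tsum (coaction T t) (\<lambda>a c. frag_of (QM.pure m (right_act T a (counit B (source B r \<otimes>\<^bsub>B\<^esub> c)))))"
      unfolding pull_def using m t r by (intro tc.MB.tsum_cong coaction_closed) (auto simp: ract_pure)
    also have "\<dots> \<approx>\<^bsub>?H\<^esub> frag_of (QM.pure m (tc.left_act r t))"
      by (rule cong_mod_sym, rule tc.tsum_left_act[OF balanced_right[OF QM.balanced_additive[OF additive_frag_FM] m] t' r])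
    also have "\<dots> \<approx>\<^bsub>?H\<^esub> Phi (\<lambda>m t. frag_of (QM.pure m t)) (source B r) m t"
      unfolding left_act_eq_iota[OF r t]
      by (rule cong_mod_sym[OF Phi_source[OF QM.balanced_additive[OF additive_frag_FM] m t r]])
    finally show "pull ?g m t \<approx>\<^bsub>?H\<^esub> Phi (\<lambda>m t. frag_of (QM.pure m t)) (source B r) m t" .
  qed
  also have "\<dots> \<approx>\<^bsub>?H\<^esub> frag_of (lact (source B r) U)"
    by (rule cong_mod_sym[OF additive_lact[OF additive_frag_FM U sr]])
  finally show "frag_of (fc.left_act r U) \<approx>\<^bsub>?H\<^esub> frag_of (lact (source B r) U)" .
qed

text \<open>The contribution of \<open>n \<otimes> h\<close> to the anti Yetter-Drinfeld condition, for fixed \<open>b\<^sup>1\<close> and \<open>b\<^sup>2\<close>.\<close>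

definition ayd :: "(('m \<times> 't) tensor \<Rightarrow> 'b \<Rightarrow> 'c \<Rightarrow>\<^sub>0 int) \<Rightarrow> 'b \<Rightarrow> 'b \<Rightarrow> ('m \<times> 't) tensor \<Rightarrow> 'b \<Rightarrow> 'c \<Rightarrow>\<^sub>0 int" where
  "ayd f b1 b2 n h = tsum (rb.splitting \<one>\<^bsub>B\<^esub> b1) (\<lambda>c d. f (lact d n) ((b2 \<otimes>\<^bsub>B\<^esub> h) \<otimes>\<^bsub>B\<^esub> c))"

text \<open>A left factor \<open>target B i\<close> of \<open>d\<close> acts last, as the right
  \<open>R\<close>-action of the comodule, and this is balanced against \<open>B\<close>.\<close>

lemma ayd_inner_bal:
  assumes f: "fm.MB.bal H f" and n: "n \<in> carrier QQ" and e: "e \<in> carrier B"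
  shows "rb.BoB.bal H (\<lambda>c d. f (lact d n) (e \<otimes>\<^bsub>B\<^esub> c))"
proof (rule balancedI)
  fix d assume "d \<in> carrier (add_monoid B)"
  then show "additive_mod (add_monoid B) H (\<lambda>c. f (lact d n) (e \<otimes>\<^bsub>B\<^esub> c))"
    using lact_closed[OF n] e by (intro rb.B.additive_mod_lmult[OF balanced_right[OF f]]) auto
next
  fix c assume c: "c \<in> carrier (add_monoid B)"
  show "additive_mod (add_monoid B) H (\<lambda>d. f (lact d n) (e \<otimes>\<^bsub>B\<^esub> c))"
  proof (rule additive_mod_addI)
    fix d d' assume d: "d \<in> carrier B" "d' \<in> carrier B"
    have "additive_mod QQ H (\<lambda>V. f V (e \<otimes>\<^bsub>B\<^esub> c))"
      using balanced_left[OF f, of "e \<otimes>\<^bsub>B\<^esub> c"] c e by simp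
    from additive_modD[OF this lact_closed[OF n d(1)] lact_closed[OF n d(2)]]
    show "f (lact (d \<oplus>\<^bsub>B\<^esub> d') n) (e \<otimes>\<^bsub>B\<^esub> c) \<approx>\<^bsub>H\<^esub> f (lact d n) (e \<otimes>\<^bsub>B\<^esub> c) + f (lact d' n) (e \<otimes>\<^bsub>B\<^esub> c)"
      by (simp add: lact_add[OF n d])
  qed
next
  fix c i d assume *: "c \<in> carrier (add_monoid B)" "i \<in> carrier R" "d \<in> carrier (add_monoid B)"
  have V: "lact d n \<in> carrier QQ" using * lact_closed[OF n] by simp
  have "f (lact d n) (e \<otimes>\<^bsub>B\<^esub> (c \<otimes>\<^bsub>B\<^esub> target B i)) \<approx>\<^bsub>H\<^esub> f (ract (lact d n) i) (e \<otimes>\<^bsub>B\<^esub> c)"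
    using balanced_middle[OF f, of "lact d n" i "e \<otimes>\<^bsub>B\<^esub> c", THEN cong_mod_sym] V * e by (simp add: rb.B.m_assoc)
  also have "ract (lact d n) i = lact (target B i \<otimes>\<^bsub>B\<^esub> d) n"
    using * n V by (simp add: lact_mult lact_target)
  finally show "f (lact d n) (e \<otimes>\<^bsub>B\<^esub> (c \<otimes>\<^bsub>B\<^esub> target B i)) \<approx>\<^bsub>H\<^esub> f (lact (target B i \<otimes>\<^bsub>B\<^esub> d) n) (e \<otimes>\<^bsub>B\<^esub> c)" .
qed

text \<open>\<open>R\<close> acting on \<open>n\<close> gives a right factor \<open>t(i)\<close> of
  \<open>b1^+\<close>. By \<open>splitting_target\<close> and left linearity of the splitting this
  equals a left factor \<open>t(i)\<close> of \<open>b1^-\<close>, which stands next to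
  \<open>h\<close>.\<close>

lemma ayd_bal:
  assumes f: "fm.MB.bal H f" and b: "b1 \<in> carrier B" "b2 \<in> carrier B"
  shows "fm.MB.bal H (ayd f b1 b2)"
proof (rule balancedI)
  fix h assume "h \<in> carrier (add_monoid B)"
  moreover have "additive_mod QQ H (\<lambda>V. f V c)" if "c \<in> carrier B" for c
    using balanced_left[OF f, of c] that by simp
  ultimately have "additive_mod QQ H (\<lambda>n. ayd f b1 b2 n h)"
    unfolding ayd_def using b
    by (intro rb.BoB.additive_tsum_param rb.splitting_closed additive_mod_comp[OF _ lact_hom]) auto
  then show "additive_mod FM H (\<lambda>n. ayd f b1 b2 n h)" by simp
next
  fix n assume "n \<in> carrier FM"
  then show "additive_mod (add_monoid B) H (ayd f b1 b2 n)"
    unfolding ayd_def using b lact_closed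
    by (intro rb.BoB.additive_tsum_param rb.splitting_closed
        rb.B.additive_mod_lmult[OF rb.B.additive_mod_rmult[OF balanced_right[OF f]]]) auto
next
  fix n i h assume n': "n \<in> carrier FM" and i: "i \<in> carrier R" and h': "h \<in> carrier (add_monoid B)"
  then have n: "n \<in> carrier QQ" and h: "h \<in> carrier B" by auto
  have ti: "target B i \<in> carrier B" and bh: "b2 \<otimes>\<^bsub>B\<^esub> h \<in> carrier B" using i b h by auto
  let ?q = "\<lambda>c d. f (lact d n) ((b2 \<otimes>\<^bsub>B\<^esub> h) \<otimes>\<^bsub>B\<^esub> c)"
  have q: "rb.BoB.bal H ?q" by (rule ayd_inner_bal[OF f n bh])
  have "ayd f b1 b2 (ract n i) h \<approx>\<^bsub>H\<^esub> tsum (rb.splitting \<one>\<^bsub>B\<^esub> b1) (\<lambda>c d. ?q c (d \<otimes>\<^bsub>B\<^esub> target B i))"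
    unfolding ayd_def using b n i ti
    by (intro rb.BoB.tsum_cong rb.splitting_closed cong_mod_eq) (auto simp: lact_mult lact_target)
  also have "\<dots> \<approx>\<^bsub>H\<^esub> tsum (rb.splitting (target B i \<otimes>\<^bsub>B\<^esub> \<one>\<^bsub>B\<^esub>) b1) ?q"
    using rb.splitting_target[OF q rb.B.one_closed i b(1), THEN cong_mod_sym] ti by simp
  also have "\<dots> \<approx>\<^bsub>H\<^esub> tsum (rb.splitting \<one>\<^bsub>B\<^esub> b1) (\<lambda>c d. ?q (target B i \<otimes>\<^bsub>B\<^esub> c) d)"
    by (rule rb.splitting_lmult[OF q ti rb.B.one_closed b(1)])
  also have "\<dots> \<approx>\<^bsub>H\<^esub> ayd f b1 b2 n (h \<otimes>\<^bsub>B\<^esub> target B i)"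
    unfolding ayd_def using b h ti
    by (intro rb.BoB.tsum_cong rb.splitting_closed cong_mod_eq) (auto simp: rb.B.m_assoc)
  finally show "ayd f b1 b2 (ract n i) h \<approx>\<^bsub>H\<^esub> ayd f b1 b2 n (h \<otimes>\<^bsub>B\<^esub> target B i)" .
qed

text \<open>A right factor \<open>s(i)\<close> of \<open>b1\<close> passes to \<open>b1^+\<close>
  and acts on \<open>n\<close> as the canonical left \<open>R\<close>-action;
  \<open>coact_left_act\<close> for the comodule \<open>M \<otimes>_K T\<close> trades it for a left
  factor \<open>t(i)\<close> of \<open>h\<close>, next to \<open>b2\<close>. This makes the
  condition independent of the representative of the coproduct of \<open>b\<close>.\<close>

lemma ayd_BB_bal:
  assumes f: "fm.MB.bal H f" and U: "U \<in> carrier QQ"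
  shows "rb.BB.bal H (\<lambda>b1 b2. tsum (coactQ U) (ayd f b1 b2))"
proof (rule balancedI)
  fix b2 assume "b2 \<in> carrier (add_monoid B)"
  then show "additive_mod (add_monoid B) H (\<lambda>b1. tsum (coactQ U) (ayd f b1 b2))"
    unfolding ayd_def using U
    by (intro fm.MB.additive_tsum_param coactQ_closed balanced_right[OF rb.splitting_bal[OF ayd_inner_bal[OF f]]]) auto
next
  fix b1 assume "b1 \<in> carrier (add_monoid B)"
  then show "additive_mod (add_monoid B) H (\<lambda>b2. tsum (coactQ U) (ayd f b1 b2))"
    unfolding ayd_def using U lact_closed
    by (intro fm.MB.additive_tsum_param coactQ_closed rb.BoB.additive_tsum_param rb.splitting_closed
        rb.B.additive_mod_rmult[OF rb.B.additive_mod_rmult[OF balanced_right[OF f]]]) auto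
next
  fix b1 i b2 assume b1': "b1 \<in> carrier (add_monoid B)" and i: "i \<in> carrier R" and b2': "b2 \<in> carrier (add_monoid B)"
  then have b: "b1 \<in> carrier B" "b2 \<in> carrier B" and si: "source B i \<in> carrier B" and ti: "target B i \<in> carrier B" by auto
  have "tsum (coactQ U) (ayd f (b1 \<otimes>\<^bsub>B\<^esub> source B i) b2) \<approx>\<^bsub>H\<^esub> tsum (coactQ U) (\<lambda>n h. ayd f b1 b2 (fc.left_act i n) h)"
  proof (rule fm.MB.tsum_cong[OF coactQ_closed[OF U]])
    fix n h assume "n \<in> carrier FM" "h \<in> carrier (add_monoid B)"
    then have n: "n \<in> carrier QQ" and h: "h \<in> carrier B" by auto
    have bh: "b2 \<otimes>\<^bsub>B\<^esub> h \<in> carrier B" using b h by simp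
    have "ayd f (b1 \<otimes>\<^bsub>B\<^esub> source B i) b2 n h \<approx>\<^bsub>H\<^esub>
        tsum (rb.splitting \<one>\<^bsub>B\<^esub> b1) (\<lambda>c d. f (lact (d \<otimes>\<^bsub>B\<^esub> source B i) n) ((b2 \<otimes>\<^bsub>B\<^esub> h) \<otimes>\<^bsub>B\<^esub> c))"
      unfolding ayd_def by (rule rb.splitting_source[OF ayd_inner_bal[OF f n bh] rb.B.one_closed i b(1)])
    also have "\<dots> \<approx>\<^bsub>H\<^esub> ayd f b1 b2 (fc.left_act i n) h"
      unfolding ayd_def lact_source[OF n i] using b n si
      by (intro rb.BoB.tsum_cong rb.splitting_closed cong_mod_eq) (auto simp: lact_mult)
    finally show "ayd f (b1 \<otimes>\<^bsub>B\<^esub> source B i) b2 n h \<approx>\<^bsub>H\<^esub> ayd f b1 b2 (fc.left_act i n) h" .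
  qed
  also have "\<dots> \<approx>\<^bsub>H\<^esub> tsum (coactQ U) (\<lambda>n h. ayd f b1 b2 n (target B i \<otimes>\<^bsub>B\<^esub> h))"
    using U by (intro fc.coact_left_act[OF ayd_bal[OF f b] _ i]) simp
  also have "\<dots> \<approx>\<^bsub>H\<^esub> tsum (coactQ U) (ayd f b1 (b2 \<otimes>\<^bsub>B\<^esub> target B i))"
    unfolding ayd_def using U b ti
    by (intro fm.MB.tsum_cong coactQ_closed rb.BoB.tsum_cong rb.splitting_closed cong_mod_eq) (auto simp: rb.B.m_assoc)
  finally show "tsum (coactQ U) (ayd f (b1 \<otimes>\<^bsub>B\<^esub> source B i) b2) \<approx>\<^bsub>H\<^esub> tsum (coactQ U) (ayd f b1 (b2 \<otimes>\<^bsub>B\<^esub> target B i))" .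
qed

text \<open>\<open>Phi_coaction\<close> settles pure tensors; interchanging the sums over
  \<open>U\<close> and over the coproduct of \<open>b\<close> extends it to all
  \<open>U\<close>.\<close>

lemma coactQ_lact:
  assumes f: "fm.MB.bal H f" and U: "U \<in> carrier QQ" and b: "b \<in> carrier B"
  shows "tsum (coactQ (lact b U)) f \<approx>\<^bsub>H\<^esub> tsum (comult B b) (\<lambda>b1 b2. tsum (coactQ U) (ayd f b1 b2))"
proof -
  have f_add: "additive_mod QQ H (\<lambda>V. f V c)" if "c \<in> carrier B" for c
    using balanced_left[OF f, of c] that by simp
  have pull_eq: "pull f = (\<lambda>n t. tsum (coaction T t) (\<lambda>a c. f (QM.pure n a) c))"
    by (intro ext) (rule pull_def)
  have "tsum (coactQ (lact b U)) f \<approx>\<^bsub>H\<^esub> tsum U (Phi (pull f) b)"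
    by (rule cong_mod_trans[OF tsum_coactQ[OF f lact_closed[OF U b]] tsum_lact[OF pull_bal[OF f] U b]])
  also have "\<dots> \<approx>\<^bsub>H\<^esub> tsum U (\<lambda>m t. tsum (comult B b) (\<lambda>b1 b2. pull (ayd f b1 b2) m t))"
  proof (rule QM.tsum_cong[OF U])
    fix m t assume m: "m \<in> carrier M" and "t \<in> carrier (add_monoid T)"
    then have t: "t \<in> carrier T" by simp
    have "Phi (\<lambda>n t. tsum (coaction T t) (\<lambda>a c. f (QM.pure n a) c)) b m t \<approx>\<^bsub>H\<^esub>
        tsum (comult B b) (\<lambda>b1 b2. tsum (coaction T t) (\<lambda>a e. tsum (rb.splitting \<one>\<^bsub>B\<^esub> b1) (\<lambda>c d.
          Phi (\<lambda>n t. f (QM.pure n t) (b2 \<otimes>\<^bsub>B\<^esub> (e \<otimes>\<^bsub>B\<^esub> c))) d m a)))"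
    proof (rule Phi_coaction[OF pure_QM_bal[OF f] _ _ m t b])
      fix n t assume "n \<in> carrier M" "t \<in> carrier T"
      then show "additive_mod (add_monoid B) H (f (QM.pure n t))"
        by (intro balanced_right[OF f] pure_closed_FM)
    next
      fix n t r c assume "n \<in> carrier M" "t \<in> carrier T" "r \<in> carrier R" "c \<in> carrier B"
      then show "f (QM.pure n (t \<otimes>\<^bsub>T\<^esub> iota r)) c \<approx>\<^bsub>H\<^esub> f (QM.pure n t) (c \<otimes>\<^bsub>B\<^esub> target B r)"
        by (intro coaction_iota_right[OF pure_TB_bal[OF f]])
    qed
    also have "\<dots> \<approx>\<^bsub>H\<^esub> tsum (comult B b) (\<lambda>b1 b2. pull (ayd f b1 b2) m t)"
      unfolding pull_def ayd_def
    proof (intro rb.BB.tsum_cong[OF rb.comult_closed[OF b]] tc.MB.tsum_cong[OF coaction_closed[OF t]] rb.BoB.tsum_cong rb.splitting_closed)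
      fix b1 b2 a e c d assume "b1 \<in> carrier (add_monoid B)" "b2 \<in> carrier (add_monoid B)" "a \<in> carrier (add_monoid T)"
        "e \<in> carrier (add_monoid B)" "c \<in> carrier (add_monoid B)" "d \<in> carrier (add_monoid B)"
      then have *: "b2 \<otimes>\<^bsub>B\<^esub> (e \<otimes>\<^bsub>B\<^esub> c) \<in> carrier B" "a \<in> carrier T" "d \<in> carrier B"
        and assoc: "(b2 \<otimes>\<^bsub>B\<^esub> e) \<otimes>\<^bsub>B\<^esub> c = b2 \<otimes>\<^bsub>B\<^esub> (e \<otimes>\<^bsub>B\<^esub> c)"
        by (auto simp: rb.B.m_assoc)
      show "Phi (\<lambda>n t. f (QM.pure n t) (b2 \<otimes>\<^bsub>B\<^esub> (e \<otimes>\<^bsub>B\<^esub> c))) d m a \<approx>\<^bsub>H\<^esub>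
          f (lact d (QM.pure m a)) ((b2 \<otimes>\<^bsub>B\<^esub> e) \<otimes>\<^bsub>B\<^esub> c)"
        unfolding assoc by (rule cong_mod_sym[OF additive_lact_pure[OF f_add[OF *(1)] m *(2,3)]])
    qed auto
    finally show "Phi (pull f) b m t \<approx>\<^bsub>H\<^esub> tsum (comult B b) (\<lambda>b1 b2. pull (ayd f b1 b2) m t)"
      unfolding pull_eq .
  qed
  also have "\<dots> = tsum (comult B b) (\<lambda>b1 b2. tsum U (\<lambda>m t. pull (ayd f b1 b2) m t))"
    by (rule tsum_swap)
  also have "\<dots> \<approx>\<^bsub>H\<^esub> tsum (comult B b) (\<lambda>b1 b2. tsum (coactQ U) (ayd f b1 b2))"
    using b U by (intro rb.BB.tsum_cong rb.comult_closed cong_mod_sym[OF tsum_coactQ] ayd_bal[OF f]) auto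
  finally show ?thesis .
qed

text \<open>The condition is demanded for all representatives. \<open>ayd_BB_bal\<close>,
  \<open>ayd_bal\<close> and \<open>ayd_inner_bal\<close> allow them to be exchanged for the
  coproduct of \<open>b\<close>, the coaction of \<open>U\<close> and the splitting of
  \<open>b1\<close>, in this order.\<close>

lemma coactQ_lact_eq:
  assumes D: "D \<in> Pi (carrier B) (comult B)" and W: "W \<in> Pi (carrier B) (right_translation R B)"
    and C: "C U \<in> coactQ U" and U: "U \<in> carrier QQ" and b: "b \<in> carrier B"
  shows "coactQ (lact b U) = tclass (right_tensor R B FM ract)
    (sweedler (D b) (\<lambda>b1 b2. sweedler (W b1) (\<lambda>c d. sweedler (C U) (\<lambda>n h. frag_of (lact d n, (b2 \<otimes>\<^bsub>B\<^esub> h) \<otimes>\<^bsub>B\<^esub> c)))))"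
proof -
  let ?f = "\<lambda>n b. frag_of (n, b)" and ?H = fm.MB.rels
  have f: "fm.MB.bal ?H ?f" by (rule balanced_frag_of)
  have Db: "D b \<in> comult B b" using D b by auto
  have keysD: "Poly_Mapping.keys (D b) \<subseteq> carrier (add_monoid B) \<times> carrier (add_monoid B)"
    by (rule mem_carrier_keys[OF rb.BB.pres rb.comult_closed[OF b] Db])
  have keysC: "Poly_Mapping.keys (C U) \<subseteq> carrier FM \<times> carrier (add_monoid B)"
    by (rule mem_carrier_keys[OF fm.MB.pres coactQ_closed[OF U] C])
  have "tsum (coactQ (lact b U)) ?f \<approx>\<^bsub>?H\<^esub> tsum (comult B b) (\<lambda>b1 b2. tsum (coactQ U) (ayd ?f b1 b2))"
    by (rule coactQ_lact[OF f U b])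
  also have "\<dots> \<approx>\<^bsub>?H\<^esub> sweedler (D b) (\<lambda>b1 b2. tsum (coactQ U) (ayd ?f b1 b2))"
    by (rule cong_mod_sym[OF rb.BB.tsum_welldef[OF ayd_BB_bal[OF f U] rb.comult_closed[OF b] Db]])
  also have "\<dots> \<approx>\<^bsub>?H\<^esub> sweedler (D b) (\<lambda>b1 b2. sweedler (W b1) (\<lambda>c d. sweedler (C U) (\<lambda>n h. ?f (lact d n) ((b2 \<otimes>\<^bsub>B\<^esub> h) \<otimes>\<^bsub>B\<^esub> c))))"
  proof (rule sweedler_cong_mod[OF keysD])
    fix b1 b2 assume "b1 \<in> carrier (add_monoid B)" "b2 \<in> carrier (add_monoid B)"
    then have b12: "b1 \<in> carrier B" "b2 \<in> carrier B" by auto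
    have W1: "W b1 \<in> rb.splitting \<one>\<^bsub>B\<^esub> b1" using W b12 by (auto simp: rb.right_translation_eq)
    have "tsum (coactQ U) (ayd ?f b1 b2) \<approx>\<^bsub>?H\<^esub> sweedler (C U) (ayd ?f b1 b2)"
      by (rule cong_mod_sym[OF fm.MB.tsum_welldef[OF ayd_bal[OF f b12] coactQ_closed[OF U] C]])
    also have "\<dots> \<approx>\<^bsub>?H\<^esub> sweedler (C U) (\<lambda>n h. sweedler (W b1) (\<lambda>c d. ?f (lact d n) ((b2 \<otimes>\<^bsub>B\<^esub> h) \<otimes>\<^bsub>B\<^esub> c)))"
      unfolding ayd_def using b12 W1
      by (intro sweedler_cong_mod[OF keysC] cong_mod_sym[OF rb.BoB.tsum_welldef[OF ayd_inner_bal[OF f]]] rb.splitting_closed) auto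
    also have "\<dots> = sweedler (W b1) (\<lambda>c d. sweedler (C U) (\<lambda>n h. ?f (lact d n) ((b2 \<otimes>\<^bsub>B\<^esub> h) \<otimes>\<^bsub>B\<^esub> c)))"
      by (rule sweedler_swap)
    finally show "tsum (coactQ U) (ayd ?f b1 b2) \<approx>\<^bsub>?H\<^esub>
        sweedler (W b1) (\<lambda>c d. sweedler (C U) (\<lambda>n h. ?f (lact d n) ((b2 \<otimes>\<^bsub>B\<^esub> h) \<otimes>\<^bsub>B\<^esub> c)))" .
  qed
  finally have "tclass (right_tensor R B FM ract) (tsum (coactQ (lact b U)) ?f) = tclass (right_tensor R B FM ract)
      (sweedler (D b) (\<lambda>b1 b2. sweedler (W b1) (\<lambda>c d. sweedler (C U) (\<lambda>n h. frag_of (lact d n, (b2 \<otimes>\<^bsub>B\<^esub> h) \<otimes>\<^bsub>B\<^esub> c)))))"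
    by (rule tclass_eqI[OF fm.MB.pres])
  then show ?thesis
    unfolding fm.MB.tclass_tsum[OF coactQ_closed[OF lact_closed[OF U b]]] .
qed

lemma FM_stable:
  assumes U: "U \<in> carrier QQ" and z: "z \<in> coactQ U"
  shows "value_sum FM (\<lambda>n h. lact h n) z = U"
proof (rule FM_value_sum[OF U U z])
  fix n b assume "n \<in> carrier QQ" "b \<in> carrier B"
  then show "lact b n \<in> carrier QQ" by (rule lact_closed)
next
  let ?H = "group_rels FM"
  show "fm.MB.bal ?H (\<lambda>n b. frag_of (lact b n))"
  proof (rule balancedI)
    fix b assume "b \<in> carrier (add_monoid B)"
    then have "additive_mod QQ ?H (\<lambda>n. frag_of (lact b n))"
      by (intro additive_mod_comp[OF additive_frag_FM lact_hom]) simp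
    then show "additive_mod FM ?H (\<lambda>n. frag_of (lact b n))" by simp
  next
    fix n assume "n \<in> carrier FM"
    then have n: "n \<in> carrier QQ" by simp
    show "additive_mod (add_monoid B) ?H (\<lambda>b. frag_of (lact b n))"
      by (rule additive_mod_addI)
         (simp only: lact_add[OF n] additive_modD[OF additive_frag_FM lact_closed[OF n] lact_closed[OF n]])
  next
    fix n i b assume "n \<in> carrier FM" "i \<in> carrier R" "b \<in> carrier (add_monoid B)"
    then show "frag_of (lact b (ract n i)) \<approx>\<^bsub>?H\<^esub> frag_of (lact (b \<otimes>\<^bsub>B\<^esub> target B i) n)"
      by (intro cong_mod_eq) (simp add: lact_mult lact_target)
  qed
  have "tsum U (pull (\<lambda>n h. frag_of (lact h n))) \<approx>\<^bsub>?H\<^esub> tsum U (\<lambda>m t. frag_of (QM.pure m t))"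
  proof (rule QM.tsum_cong[OF U])
    fix m t assume m: "m \<in> carrier M" and "t \<in> carrier (add_monoid T)"
    then have t: "t \<in> carrier T" by simp
    have "pull (\<lambda>n h. frag_of (lact h n)) m t \<approx>\<^bsub>?H\<^esub> tsum (coaction T t) (\<lambda>a c. Phi (\<lambda>m t. frag_of (QM.pure m t)) c m a)"
      unfolding pull_def using m t by (intro tc.MB.tsum_cong coaction_closed additive_lact_pure[OF additive_frag_FM]) auto
    also have "\<dots> \<approx>\<^bsub>?H\<^esub> frag_of (QM.pure m t)"
      by (rule Phi_stable[OF QM.balanced_additive[OF additive_frag_FM] m t])
    finally show "pull (\<lambda>n h. frag_of (lact h n)) m t \<approx>\<^bsub>?H\<^esub> frag_of (QM.pure m t)" .
  qed
  also have "\<dots> \<approx>\<^bsub>?H\<^esub> frag_of U" by (rule tsum_frag_FM[OF U])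
  finally show "tsum U (pull (\<lambda>n h. frag_of (lact h n))) \<approx>\<^bsub>?H\<^esub> frag_of U" .
qed

theorem FM_sayd: "lr_sayd R B FM"
  unfolding lr_sayd_def FM_simps(4-6)
proof (intro conjI ballI)
  show "left_module B FM lact" by (rule FM_left_module)
  show "right_comodule R B FM ract coactQ" by (rule FM_right_comodule)
next
  fix U r assume "U \<in> carrier FM" "r \<in> carrier R"
  then show "ract U r = lact (target B r) U" "fc.left_act r U = lact (source B r) U"
    using lact_target lact_source by auto
next
  fix D W C U b
  assume "D \<in> Pi (carrier B) (comult B)" "W \<in> Pi (carrier B) (right_translation R B)"
    "C \<in> Pi (carrier FM) coactQ" "U \<in> carrier FM" "b \<in> carrier B"
  then show "coactQ (lact b U) = tclass (right_tensor R B FM ract)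
    (sweedler (D b) (\<lambda>b1 b2. sweedler (W b1) (\<lambda>c d. sweedler (C U) (\<lambda>n h. frag_of (lact d n, (b2 \<otimes>\<^bsub>B\<^esub> h) \<otimes>\<^bsub>B\<^esub> c)))))"
    by (intro coactQ_lact_eq) auto
next
  fix U z assume "U \<in> carrier FM" "z \<in> coactQ U"
  then show "value_sum FM (\<lambda>n h. lact h n) z = U" by (intro FM_stable) auto
qed

lemma FM_formulas:
  assumes m: "m \<in> carrier M" and t: "t \<in> carrier T"
  shows "b \<in> carrier B \<Longrightarrow> z \<in> coact M m \<Longrightarrow> w \<in> galois_translation R B T b \<Longrightarrow>
      lact b (QM.pure m t) = tclass QQ (sweedler z (\<lambda>h n. sweedler w (\<lambda>x y. frag_of (n, y \<otimes>\<^bsub>T\<^esub> act h (t \<otimes>\<^bsub>T\<^esub> x)))))"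
    and "z' \<in> coaction T t \<Longrightarrow>
      coactQ (QM.pure m t) = tclass (right_tensor R B FM ract) (sweedler z' (\<lambda>a c. frag_of (QM.pure m a, c)))"
proof -
  have U: "QM.pure m t \<in> carrier QQ" using m t by (intro QM.pure_closed) auto
  show "lact b (QM.pure m t) = tclass QQ (sweedler z (\<lambda>h n. sweedler w (\<lambda>x y. frag_of (n, y \<otimes>\<^bsub>T\<^esub> act h (t \<otimes>\<^bsub>T\<^esub> x)))))"
    if b: "b \<in> carrier B" and z: "z \<in> coact M m" and w: "w \<in> galois_translation R B T b"
    unfolding lact_eq[OF U b]
    by (rule tclass_eqI[OF QM.pres cong_mod_trans[OF QM.tsum_pure[OF Phi_bal[OF balanced_frag_of b]]
          cong_mod_sym[OF Phi_sweedler[OF balanced_frag_of m t b z w]]]])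
  show "coactQ (QM.pure m t) = tclass (right_tensor R B FM ract) (sweedler z' (\<lambda>a c. frag_of (QM.pure m a, c)))"
    if z': "z' \<in> coaction T t"
    unfolding coactQ_eq[OF U]
    by (rule tclass_eqI[OF fm.MB.pres cong_mod_trans[OF QM.tsum_pure[OF pull_bal[OF balanced_frag_of]]
          cong_mod_sym[OF pull_sweedler[OF balanced_frag_of m t z']]]])
qed

end

section \<open>Functoriality\<close>

lemma frag_extend_keys_cong:
  "Poly_Mapping.keys z \<subseteq> A \<times> C \<Longrightarrow> (\<And>x y. x \<in> A \<Longrightarrow> y \<in> C \<Longrightarrow> f x y = g x y) \<Longrightarrow> sweedler z f = sweedler z g"
  by (rule frag_extend_eq) auto

lemma sweedler_frag_of: "sweedler z (\<lambda>x y. frag_of (x, y)) = z"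
proof -
  have "sweedler z (\<lambda>x y. frag_of (x, y)) = frag_extend frag_of z" by (simp add: case_prod_unfold)
  also have "\<dots> = z" by (rule frag_expansion[symmetric])
  finally show ?thesis .
qed

lemma compose_mem_hom:
  assumes "Group.monoid L"
  shows "\<phi> \<in> hom L M \<Longrightarrow> \<psi> \<in> hom M N \<Longrightarrow> compose (carrier L) \<psi> \<phi> \<in> hom L N"
  using assms unfolding hom_def compose_def by (auto simp: Group.monoid.m_closed Pi_iff)

lemma restrict_mem_hom: "Group.monoid M \<Longrightarrow> restrict (\<lambda>m. m) (carrier M) \<in> hom M M"
  by (auto simp: hom_def Group.monoid.m_closed)

text \<open>Stated from the bialgebroid alone, so that the category of SAYD modules over
  \<open>K\<close> can be set up without the extension \<open>T\<close> in the context.\<close>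

lemma rl_sayd_KM:
  fixes S :: "(complex, 's) module" and K :: "('s, 'k) bialgebroid"
  assumes "left_bialgebroid S K" "rl_sayd S K M"
  shows "presented (left_tensor S K M (base_act M)) (carrier K \<times> carrier M)
      (tensor_rels (carrier S) (add_monoid K) (\<lambda>k r. target K r \<otimes>\<^bsub>K\<^esub> k) M (base_act M))"
    and "m \<in> carrier M \<Longrightarrow> coact M m \<in> carrier (left_tensor S K M (base_act M))"
    and "Group.monoid M"
    and "m \<in> carrier M \<Longrightarrow> k \<in> carrier K \<Longrightarrow> alg_act M m k \<in> carrier M"
    and "m \<in> carrier M \<Longrightarrow> r \<in> carrier S \<Longrightarrow> base_act M r m \<in> carrier M"
proof -
  interpret left_bialg S K by unfold_locales fact
  have mod: "right_module K M (alg_act M)" and com: "left_comodule S K M (base_act M) (coact M)"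
    using assms(2) by (simp_all add: rl_sayd_def)
  then show M: "Group.monoid M" by (simp add: right_module_def comm_group_def group_def)
  show "m \<in> carrier M \<Longrightarrow> k \<in> carrier K \<Longrightarrow> alg_act M m k \<in> carrier M"
    using mod by (auto simp: right_module_def hom_def)
  show b: "m \<in> carrier M \<Longrightarrow> r \<in> carrier S \<Longrightarrow> base_act M r m \<in> carrier M" for m r
    using com by (auto simp: left_comodule_def left_module_def hom_def)
  show "presented (left_tensor S K M (base_act M)) (carrier K \<times> carrier M)
      (tensor_rels (carrier S) (add_monoid K) (\<lambda>k r. target K r \<otimes>\<^bsub>K\<^esub> k) M (base_act M))"
    using presented_tensor[of "carrier S" "add_monoid K" "\<lambda>k r. target K r \<otimes>\<^bsub>K\<^esub> k" M "base_act M"] b M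
    by (simp add: left_tensor_def tensor_ok_def)
  show "m \<in> carrier M \<Longrightarrow> coact M m \<in> carrier (left_tensor S K M (base_act M))"
    using com by (auto simp: left_comodule_def hom_def)
qed

lemma rl_sayd_category_is_category:
  fixes S :: "(complex, 's) module" and K :: "('s, 'k) bialgebroid"
  assumes "left_bialgebroid S K" shows "is_category (rl_sayd_category S K)"
  unfolding is_category_def rl_sayd_category_def category.simps mem_Collect_eq
proof (intro conjI ballI allI impI; (unfold mem_Collect_eq)?)
  fix M :: "('s, 'k, 'm) rl_module" assume M: "rl_sayd S K M"
  note KM = rl_sayd_KM[OF assms M]
  show "restrict (\<lambda>m. m) (carrier M) \<in> rl_sayd_hom S K M M"
    unfolding rl_sayd_hom_def
  proof (intro CollectI conjI ballI IntI restrict_mem_hom KM(3))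
    fix m z assume m: "m \<in> carrier M" and z: "z \<in> coact M m"
    have "sweedler z (\<lambda>k n. frag_of (k, restrict (\<lambda>m. m) (carrier M) n)) = sweedler z (\<lambda>k n. frag_of (k, n))"
      by (rule frag_extend_keys_cong[OF mem_carrier_keys[OF KM(1) KM(2)[OF m] z]]) simp
    then show "coact M (restrict (\<lambda>m. m) (carrier M) m) = tclass (left_tensor S K M (base_act M))
        (sweedler z (\<lambda>k n. frag_of (k, restrict (\<lambda>m. m) (carrier M) n)))"
      using mem_carrier_tclass[OF KM(1) KM(2)[OF m] z] m by (simp only: sweedler_frag_of restrict_apply')
  qed (simp_all add: KM)
next
  fix L M N :: "('s, 'k, 'm) rl_module" and \<phi> \<psi>
  assume L: "rl_sayd S K L" and M: "rl_sayd S K M" and N: "rl_sayd S K N"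
    and \<phi>: "\<phi> \<in> rl_sayd_hom S K L M" and \<psi>: "\<psi> \<in> rl_sayd_hom S K M N"
  note KL = rl_sayd_KM[OF assms L] and KM = rl_sayd_KM[OF assms M]
  have closed: "m \<in> carrier L \<Longrightarrow> \<phi> m \<in> carrier M" for m
    using \<phi> by (auto simp: rl_sayd_hom_def hom_def)
  show "compose (carrier L) \<psi> \<phi> \<in> rl_sayd_hom S K L N"
    unfolding rl_sayd_hom_def
  proof (intro CollectI conjI ballI IntI)
    show "compose (carrier L) \<psi> \<phi> \<in> hom L N"
      by (rule compose_mem_hom[OF KL(3)]) (use \<phi> \<psi> in \<open>auto simp: rl_sayd_hom_def\<close>)
    fix m assume m: "m \<in> carrier L"
    show "compose (carrier L) \<psi> \<phi> (alg_act L m k) = alg_act N (compose (carrier L) \<psi> \<phi> m) k" if "k \<in> carrier K" for k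
      using \<phi> \<psi> m that KL(4) closed by (simp add: compose_def rl_sayd_hom_def)
    show "compose (carrier L) \<psi> \<phi> (base_act L r m) = base_act N r (compose (carrier L) \<psi> \<phi> m)" if "r \<in> carrier S" for r
      using \<phi> \<psi> m that KL(5) closed by (simp add: compose_def rl_sayd_hom_def)
    fix z assume z: "z \<in> coact L m"
    let ?z = "sweedler z (\<lambda>k n. frag_of (k, \<phi> n))"
    have "coact M (\<phi> m) = tclass (left_tensor S K M (base_act M)) ?z"
      using \<phi> m z by (simp add: rl_sayd_hom_def)
    \<comment> \<open>The transported sum is itself a representative for the middle module, and the
      colinearity condition on \<open>\<psi>\<close> holds for every representative.\<close>
    then have "?z \<in> coact M (\<phi> m)" by (simp add: self_mem_tclass[OF KM(1)])
    then have "coact N (\<psi> (\<phi> m)) = tclass (left_tensor S K N (base_act N)) (sweedler ?z (\<lambda>k n. frag_of (k, \<psi> n)))"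
      using \<psi> closed[OF m] by (simp add: rl_sayd_hom_def)
    also have "sweedler ?z (\<lambda>k n. frag_of (k, \<psi> n)) = sweedler z (\<lambda>k n. frag_of (k, \<psi> (\<phi> n)))"
      unfolding sweedler_sweedler by simp
    also have "\<dots> = sweedler z (\<lambda>k n. frag_of (k, compose (carrier L) \<psi> \<phi> n))"
      by (rule frag_extend_keys_cong[OF mem_carrier_keys[OF KL(1) KL(2)[OF m] z]]) (simp add: compose_def)
    finally show "coact N (compose (carrier L) \<psi> \<phi> m) = tclass (left_tensor S K N (base_act N))
        (sweedler z (\<lambda>k n. frag_of (k, compose (carrier L) \<psi> \<phi> n)))"
      using m by (simp add: compose_def)
  qed (simp add: compose_def)
next
  fix M N :: "('s, 'k, 'm) rl_module" and \<phi>
  assume \<phi>: "\<phi> \<in> rl_sayd_hom S K M N"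
  then have e: "\<phi> \<in> extensional (carrier M)" and c: "\<And>m. m \<in> carrier M \<Longrightarrow> \<phi> m \<in> carrier N"
    by (auto simp: rl_sayd_hom_def hom_def)
  show "compose (carrier M) \<phi> (restrict (\<lambda>m. m) (carrier M)) = \<phi>"
    using e by (auto simp: compose_def restrict_def extensional_def fun_eq_iff)
  show "compose (carrier M) (restrict (\<lambda>m. m) (carrier N)) \<phi> = \<phi>"
    using e c by (auto simp: compose_def restrict_def extensional_def fun_eq_iff)
next
  fix L0 L M N :: "('s, 'k, 'm) rl_module" and \<phi> \<psi> \<chi>
  assume "\<phi> \<in> rl_sayd_hom S K L0 L"
  then have "\<And>m. m \<in> carrier L0 \<Longrightarrow> \<phi> m \<in> carrier L" by (auto simp: rl_sayd_hom_def hom_def)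
  then show "compose (carrier L0) (compose (carrier L) \<chi> \<psi>) \<phi> = compose (carrier L0) \<chi> (compose (carrier L0) \<psi> \<phi>)"
    by (auto simp: compose_def restrict_def fun_eq_iff)
qed

lemma lr_sayd_MB:
  fixes R :: "(complex, 'r) module" and B :: "('r, 'b) bialgebroid"
  assumes "right_bialgebroid R B" "lr_sayd R B M"
  shows "presented (right_tensor R B M (base_ract M)) (carrier M \<times> carrier B)
      (tensor_rels (carrier R) M (base_ract M) (add_monoid B) (\<lambda>r b. b \<otimes>\<^bsub>B\<^esub> target B r))"
    and "m \<in> carrier M \<Longrightarrow> rcoact M m \<in> carrier (right_tensor R B M (base_ract M))"
    and "Group.monoid M"
    and "m \<in> carrier M \<Longrightarrow> b \<in> carrier B \<Longrightarrow> alg_lact M b m \<in> carrier M"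
    and "m \<in> carrier M \<Longrightarrow> r \<in> carrier R \<Longrightarrow> base_ract M m r \<in> carrier M"
proof -
  have mod: "left_module B M (alg_lact M)" and com: "right_comodule R B M (base_ract M) (rcoact M)"
    using assms(2) by (simp_all add: lr_sayd_def)
  interpret right_mod R B M "base_ract M"
    by unfold_locales (use assms(1) com in \<open>simp_all add: right_comodule_def\<close>)
  show "presented (right_tensor R B M (base_ract M)) (carrier M \<times> carrier B)
      (tensor_rels (carrier R) M (base_ract M) (add_monoid B) (\<lambda>r b. b \<otimes>\<^bsub>B\<^esub> target B r))"
    using MB.pres by simp
  show "m \<in> carrier M \<Longrightarrow> rcoact M m \<in> carrier (right_tensor R B M (base_ract M))"
    using com by (auto simp: right_comodule_def hom_def)
  show "Group.monoid M" by (rule monoid)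
  show "m \<in> carrier M \<Longrightarrow> b \<in> carrier B \<Longrightarrow> alg_lact M b m \<in> carrier M"
    using mod by (auto simp: left_module_def hom_def)
  show "m \<in> carrier M \<Longrightarrow> r \<in> carrier R \<Longrightarrow> base_ract M m r \<in> carrier M" by simp
qed

lemma lr_sayd_category_is_category:
  fixes R :: "(complex, 'r) module" and B :: "('r, 'b) bialgebroid"
  assumes "right_bialgebroid R B" shows "is_category (lr_sayd_category R B)"
  unfolding is_category_def lr_sayd_category_def category.simps mem_Collect_eq
proof (intro conjI ballI allI impI; (unfold mem_Collect_eq)?)
  fix M :: "('r, 'b, 'm) lr_module" assume M: "lr_sayd R B M"
  note MB = lr_sayd_MB[OF assms M]
  show "restrict (\<lambda>m. m) (carrier M) \<in> lr_sayd_hom R B M M"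
    unfolding lr_sayd_hom_def
  proof (intro CollectI conjI ballI IntI restrict_mem_hom MB(3))
    fix m z assume m: "m \<in> carrier M" and z: "z \<in> rcoact M m"
    have "sweedler z (\<lambda>n b. frag_of (restrict (\<lambda>m. m) (carrier M) n, b)) = sweedler z (\<lambda>n b. frag_of (n, b))"
      by (rule frag_extend_keys_cong[OF mem_carrier_keys[OF MB(1) MB(2)[OF m] z]]) simp
    then show "rcoact M (restrict (\<lambda>m. m) (carrier M) m) = tclass (right_tensor R B M (base_ract M))
        (sweedler z (\<lambda>n b. frag_of (restrict (\<lambda>m. m) (carrier M) n, b)))"
      using mem_carrier_tclass[OF MB(1) MB(2)[OF m] z] m by (simp only: sweedler_frag_of restrict_apply')
  qed (simp_all add: MB)
next
  fix L M N :: "('r, 'b, 'm) lr_module" and \<phi> \<psi>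
  assume L: "lr_sayd R B L" and M: "lr_sayd R B M" and N: "lr_sayd R B N"
    and \<phi>: "\<phi> \<in> lr_sayd_hom R B L M" and \<psi>: "\<psi> \<in> lr_sayd_hom R B M N"
  note LB = lr_sayd_MB[OF assms L] and MB = lr_sayd_MB[OF assms M]
  have closed: "m \<in> carrier L \<Longrightarrow> \<phi> m \<in> carrier M" for m
    using \<phi> by (auto simp: lr_sayd_hom_def hom_def)
  show "compose (carrier L) \<psi> \<phi> \<in> lr_sayd_hom R B L N"
    unfolding lr_sayd_hom_def
  proof (intro CollectI conjI ballI IntI)
    show "compose (carrier L) \<psi> \<phi> \<in> hom L N"
      by (rule compose_mem_hom[OF LB(3)]) (use \<phi> \<psi> in \<open>auto simp: lr_sayd_hom_def\<close>)
    fix m assume m: "m \<in> carrier L"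
    show "compose (carrier L) \<psi> \<phi> (alg_lact L b m) = alg_lact N b (compose (carrier L) \<psi> \<phi> m)" if "b \<in> carrier B" for b
      using \<phi> \<psi> m that LB(4) closed by (simp add: compose_def lr_sayd_hom_def)
    show "compose (carrier L) \<psi> \<phi> (base_ract L m r) = base_ract N (compose (carrier L) \<psi> \<phi> m) r" if "r \<in> carrier R" for r
      using \<phi> \<psi> m that LB(5) closed by (simp add: compose_def lr_sayd_hom_def)
    fix z assume z: "z \<in> rcoact L m"
    let ?z = "sweedler z (\<lambda>n b. frag_of (\<phi> n, b))"
    have "rcoact M (\<phi> m) = tclass (right_tensor R B M (base_ract M)) ?z"
      using \<phi> m z by (simp add: lr_sayd_hom_def)
    then have "?z \<in> rcoact M (\<phi> m)" by (simp add: self_mem_tclass[OF MB(1)])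
    then have "rcoact N (\<psi> (\<phi> m)) = tclass (right_tensor R B N (base_ract N)) (sweedler ?z (\<lambda>n b. frag_of (\<psi> n, b)))"
      using \<psi> closed[OF m] by (simp add: lr_sayd_hom_def)
    also have "sweedler ?z (\<lambda>n b. frag_of (\<psi> n, b)) = sweedler z (\<lambda>n b. frag_of (\<psi> (\<phi> n), b))"
      unfolding sweedler_sweedler by simp
    also have "\<dots> = sweedler z (\<lambda>n b. frag_of (compose (carrier L) \<psi> \<phi> n, b))"
      by (rule frag_extend_keys_cong[OF mem_carrier_keys[OF LB(1) LB(2)[OF m] z]]) (simp add: compose_def)
    finally show "rcoact N (compose (carrier L) \<psi> \<phi> m) = tclass (right_tensor R B N (base_ract N))
        (sweedler z (\<lambda>n b. frag_of (compose (carrier L) \<psi> \<phi> n, b)))"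
      using m by (simp add: compose_def)
  qed (simp add: compose_def)
next
  fix M N :: "('r, 'b, 'm) lr_module" and \<phi>
  assume \<phi>: "\<phi> \<in> lr_sayd_hom R B M N"
  then have e: "\<phi> \<in> extensional (carrier M)" and c: "\<And>m. m \<in> carrier M \<Longrightarrow> \<phi> m \<in> carrier N"
    by (auto simp: lr_sayd_hom_def hom_def)
  show "compose (carrier M) \<phi> (restrict (\<lambda>m. m) (carrier M)) = \<phi>"
    using e by (auto simp: compose_def restrict_def extensional_def fun_eq_iff)
  show "compose (carrier M) (restrict (\<lambda>m. m) (carrier N)) \<phi> = \<phi>"
    using e c by (auto simp: compose_def restrict_def extensional_def fun_eq_iff)
next
  fix L0 L M N :: "('r, 'b, 'm) lr_module" and \<phi> \<psi> \<chi>
  assume "\<phi> \<in> lr_sayd_hom R B L0 L"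
  then have "\<And>m. m \<in> carrier L0 \<Longrightarrow> \<phi> m \<in> carrier L" by (auto simp: lr_sayd_hom_def hom_def)
  then show "compose (carrier L0) (compose (carrier L) \<chi> \<psi>) \<phi> = compose (carrier L0) \<chi> (compose (carrier L0) \<psi> \<phi>)"
    by (auto simp: compose_def restrict_def fun_eq_iff)
qed

section \<open>The functor on morphisms\<close>

locale sayd_morphism =
  M: sayd_setting R B S K T act M + N: sayd_setting R B S K T act N
  for R :: "(complex, 'r) module" and B :: "('r, 'b) bialgebroid"
    and S :: "(complex, 't) module" and K :: "('t, 'k) bialgebroid"
    and T :: "('r, 'b, 't) comodule_algebra" and act :: "'k \<Rightarrow> 't \<Rightarrow> 't"
    and M N :: "('t, 'k, 'm) rl_module" +
  fixes \<phi> :: "'m \<Rightarrow> 'm"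
  assumes morphism: "\<phi> \<in> rl_sayd_hom S K M N"
begin

lemma phi_hom: "\<phi> \<in> hom M N"
  and phi_closed [simp]: "m \<in> carrier M \<Longrightarrow> \<phi> m \<in> carrier N"
  and phi_act: "m \<in> carrier M \<Longrightarrow> k \<in> carrier K \<Longrightarrow> \<phi> (alg_act M m k) = alg_act N (\<phi> m) k"
  and phi_coact: "m \<in> carrier M \<Longrightarrow> z \<in> coact M m \<Longrightarrow>
      coact N (\<phi> m) = tclass (left_tensor S K N (base_act N)) (sweedler z (\<lambda>k n. frag_of (k, \<phi> n)))"
  using morphism by (auto simp: rl_sayd_hom_def hom_def)

abbreviation "mor \<equiv> digamma_mor K T act M N \<phi>"

lemma phi_bal:
  assumes f: "N.QM.bal H f" shows "M.QM.bal H (\<lambda>m t. f (\<phi> m) t)"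
proof (rule balancedI)
  fix t assume "t \<in> carrier (add_monoid T)"
  then show "additive_mod M H (\<lambda>m. f (\<phi> m) t)"
    by (intro additive_mod_comp[OF balanced_left[OF f] phi_hom])
next
  fix m assume "m \<in> carrier M"
  then show "additive_mod (add_monoid T) H (f (\<phi> m))" by (intro balanced_right[OF f]) simp
next
  fix m k t assume "m \<in> carrier M" "k \<in> carrier K" "t \<in> carrier (add_monoid T)"
  then show "f (\<phi> (alg_act M m k)) t \<approx>\<^bsub>H\<^esub> f (\<phi> m) (act k t)"
    using balanced_middle[OF f, of "\<phi> m" k t] by (simp add: phi_act)
qed

lemma mor_eq:
  assumes U: "U \<in> carrier M.QQ"
  shows "mor U = tclass N.QQ (tsum U (\<lambda>m t. frag_of (\<phi> m, t)))"
proof -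
  have "the_elem {tclass N.QQ (sweedler z (\<lambda>m t. frag_of (\<phi> m, t))) | z. z \<in> U} = tclass N.QQ (tsum U (\<lambda>m t. frag_of (\<phi> m, t)))"
  proof (rule the_elem_constI[of "tclass N.QQ (sweedler (rep U) (\<lambda>m t. frag_of (\<phi> m, t)))"], goal_cases)
    case 1
    show ?case using rep_mem[OF M.QM.pres U] by blast
  next
    case (2 V)
    then obtain z where z: "z \<in> U" "V = tclass N.QQ (sweedler z (\<lambda>m t. frag_of (\<phi> m, t)))" by blast
    show ?case unfolding z(2)
      by (rule tclass_eqI[OF N.QM.pres M.QM.tsum_welldef[OF phi_bal[OF balanced_frag_of] U z(1)]])
  qed
  then show ?thesis using U by (simp add: digamma_mor_def)
qed

lemma mor_closed: "U \<in> carrier M.QQ \<Longrightarrow> mor U \<in> carrier N.QQ"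
  unfolding mor_eq tsum_def
  by (intro tclass_closed[OF N.QM.pres] keys_sweedler[OF rep_keys[OF M.QM.pres]]) auto

lemma tsum_mor:
  assumes "N.QM.bal H f" "U \<in> carrier M.QQ"
  shows "tsum (mor U) f \<approx>\<^bsub>H\<^esub> tsum U (\<lambda>m t. f (\<phi> m) t)"
  using N.QM.tsum_tclass[OF assms(1), of "tsum U (\<lambda>m t. frag_of (\<phi> m, t))"]
  unfolding mor_eq[OF assms(2)] sweedler_tsum by simp

lemma mor_pure: "m \<in> carrier M \<Longrightarrow> t \<in> carrier T \<Longrightarrow> mor (M.QM.pure m t) = N.QM.pure (\<phi> m) t"
  by (simp add: mor_eq M.QM.pure_closed tclass_eqI[OF N.QM.pres M.QM.tsum_pure[OF phi_bal[OF balanced_frag_of]]])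

lemma mor_hom: "mor \<in> hom M.QQ N.QQ"
  by (rule N.QM.hom_by_tsum[OF mor_closed M.QM.group(3) M.QM.tsum_additive[OF phi_bal[OF balanced_frag_of]]
        tsum_mor[OF balanced_frag_of]])

text \<open>Colinearity computes the coaction of \<open>\<phi> m\<close> from that of
  \<open>m\<close>, and rotation uses nothing else about \<open>m\<close>.\<close>

lemma rot_phi:
  assumes f: "N.QM.bal H f" and m: "m \<in> carrier M" and x: "x \<in> carrier T" and y: "y \<in> carrier T"
  shows "N.rot f (\<phi> m) x y \<approx>\<^bsub>H\<^esub> M.rot (\<lambda>m t. f (\<phi> m) t) m x y"
  using N.KM.tsum_tclass_sweedler[OF N.rot_KM_bal[OF f x y] phi_coact[OF m M.rep_coact_mem[OF m]]]
  unfolding M.rot_def N.rot_def by (simp add: tsum_def)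

lemma Phi_phi:
  assumes f: "N.QM.bal H f" and m: "m \<in> carrier M" and t: "t \<in> carrier T" and b: "b \<in> carrier B"
  shows "N.Phi f b (\<phi> m) t \<approx>\<^bsub>H\<^esub> M.Phi (\<lambda>m t. f (\<phi> m) t) b m t"
  unfolding M.Phi_def N.Phi_def
  by (rule M.TT.tsum_cong[OF M.gal_closed[OF t b]]) (simp add: rot_phi[OF f m])

lemma mor_lact:
  assumes U: "U \<in> carrier M.QQ" and b: "b \<in> carrier B"
  shows "mor (M.lact b U) = N.lact b (mor U)"
proof (rule N.QM.carrier_eqI)
  show "mor (M.lact b U) \<in> carrier N.QQ" by (rule mor_closed[OF M.lact_closed[OF U b]])
  show "N.lact b (mor U) \<in> carrier N.QQ" by (rule N.lact_closed[OF mor_closed[OF U] b])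
  let ?f = "\<lambda>x y. frag_of (x, y)"
  have f: "N.QM.bal N.QM.rels ?f" by (rule balanced_frag_of)
  have "tsum (mor (M.lact b U)) ?f \<approx>\<^bsub>N.QM.rels\<^esub> tsum (M.lact b U) (\<lambda>m t. ?f (\<phi> m) t)"
    by (rule tsum_mor[OF f M.lact_closed[OF U b]])
  also have "\<dots> \<approx>\<^bsub>N.QM.rels\<^esub> tsum U (M.Phi (\<lambda>m t. ?f (\<phi> m) t) b)"
    by (rule M.tsum_lact[OF phi_bal[OF f] U b])
  also have "\<dots> \<approx>\<^bsub>N.QM.rels\<^esub> tsum U (\<lambda>m t. N.Phi ?f b (\<phi> m) t)"
    by (rule M.QM.tsum_cong[OF U], rule cong_mod_sym, rule Phi_phi[OF f]) (simp_all add: b)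
  also have "\<dots> \<approx>\<^bsub>N.QM.rels\<^esub> tsum (mor U) (N.Phi ?f b)"
    by (rule cong_mod_sym[OF tsum_mor[OF N.Phi_bal[OF f b] U]])
  also have "\<dots> \<approx>\<^bsub>N.QM.rels\<^esub> tsum (N.lact b (mor U)) ?f"
    by (rule cong_mod_sym[OF N.tsum_lact[OF f mor_closed[OF U] b]])
  finally show "tsum (mor (M.lact b U)) ?f \<approx>\<^bsub>N.QM.rels\<^esub> tsum (N.lact b (mor U)) ?f" .
qed

text \<open>The base action of \<open>R\<close> is the action of target elements, so it is covered
  by linearity over \<open>B\<close>.\<close>

lemma mor_ract:
  assumes U: "U \<in> carrier M.QQ" and r: "r \<in> carrier R"
  shows "mor (M.ract U r) = N.ract (mor U) r"
  using mor_lact[OF U, of "target B r"] r by (simp add: M.lact_target[OF U r] N.lact_target[OF mor_closed[OF U] r])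

lemma mor_fm_bal:
  assumes f: "N.fm.MB.bal H f" shows "M.fm.MB.bal H (\<lambda>n b. f (mor n) b)"
proof (rule balancedI)
  fix b assume b: "b \<in> carrier (add_monoid B)"
  have "additive_mod N.QQ H (\<lambda>n. f n b)" using balanced_left[OF f b] by simp
  from additive_mod_comp[OF this mor_hom]
  show "additive_mod M.FM H (\<lambda>n. f (mor n) b)" by simp
next
  fix n assume "n \<in> carrier M.FM"
  then show "additive_mod (add_monoid B) H (f (mor n))"
    using mor_closed by (intro balanced_right[OF f]) simp
next
  fix n r b assume "n \<in> carrier M.FM" "r \<in> carrier R" "b \<in> carrier (add_monoid B)"
  then show "f (mor (M.ract n r)) b \<approx>\<^bsub>H\<^esub> f (mor n) (b \<otimes>\<^bsub>B\<^esub> target B r)"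
    using balanced_middle[OF f, of "mor n" r b] mor_closed[of n] by (simp add: mor_ract)
qed

text \<open>The coaction changes only the leg in \<open>T\<close> and \<open>\<phi>\<close> only the
  leg in \<open>M\<close>, so they commute on pure tensors.\<close>

lemma mor_coact:
  assumes U: "U \<in> carrier M.QQ" and z: "z \<in> M.coactQ U"
  shows "N.coactQ (mor U) = tclass (right_tensor R B N.FM N.ract) (sweedler z (\<lambda>n b. frag_of (mor n, b)))"
proof -
  let ?f = "\<lambda>x y. frag_of (x, y)" and ?H = "N.fm.MB.rels"
  have f: "N.fm.MB.bal ?H ?f" by (rule balanced_frag_of)
  have "tsum (N.coactQ (mor U)) ?f \<approx>\<^bsub>?H\<^esub> tsum (mor U) (N.pull ?f)"
    by (rule N.tsum_coactQ[OF f mor_closed[OF U]])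
  also have "\<dots> \<approx>\<^bsub>?H\<^esub> tsum U (\<lambda>m t. N.pull ?f (\<phi> m) t)"
    by (rule tsum_mor[OF N.pull_bal[OF f] U])
  also have "\<dots> \<approx>\<^bsub>?H\<^esub> tsum U (M.pull (\<lambda>n b. ?f (mor n) b))"
    by (rule M.QM.tsum_cong[OF U], unfold M.pull_def N.pull_def, rule M.tc.MB.tsum_cong[OF M.coaction_closed])
       (auto simp: mor_pure)
  also have "\<dots> \<approx>\<^bsub>?H\<^esub> sweedler z (\<lambda>n b. ?f (mor n) b)"
    by (rule cong_mod_sym[OF M.coactQ_sweedler[OF mor_fm_bal[OF f] U z]])
  finally have "tclass (right_tensor R B N.FM N.ract) (tsum (N.coactQ (mor U)) ?f) =
      tclass (right_tensor R B N.FM N.ract) (sweedler z (\<lambda>n b. ?f (mor n) b))"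
    by (rule tclass_eqI[OF N.fm.MB.pres])
  then show ?thesis unfolding N.fm.MB.tclass_tsum[OF N.coactQ_closed[OF mor_closed[OF U]]] .
qed

lemma mor_sayd_hom: "mor \<in> lr_sayd_hom R B M.FM N.FM"
  unfolding lr_sayd_hom_def
  using mor_hom mor_lact mor_ract mor_coact by (auto simp: digamma_mor_def)

end

text \<open>Actions, coaction and morphisms are defined through \<open>the_elem\<close>, so
  functoriality alone would not show that they obey the intended formulas. The further conjuncts
  give their values on pure tensors, for every choice of representatives.\<close>

theorem proposition3p4:
  fixes R :: "(complex, 'r) module"
    and B :: "('r, 'b) bialgebroid"
    and T :: "('r, 'b, 't) comodule_algebra"
    and S :: "(complex, 't) module"
    and K :: "('t, 'k) bialgebroid"
    and act :: "'k \<Rightarrow> 't \<Rightarrow> 't"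
  assumes "complex_algebra R"
    and "right_hopf_algebroid R B"
    and "right_comodule_algebra R B T"
    and "S = coinvariants R B T"
    and "left_hopf_algebroid S K"
    and "left_module_algebra S K T act"
    and "equivariant_galois_extension R B T K act"
  shows "covariant_functor
           (rl_sayd_category S K :: (('t, 'k, 'm) rl_module, 'm \<Rightarrow> 'm) category)
           (lr_sayd_category R B)
           (digamma_obj R B K T act) (digamma_mor K T act) \<and>
         (\<forall>M :: ('t, 'k, 'm) rl_module. rl_sayd S K M \<longrightarrow>
           (let Q = digamma_group K T act M; FM = digamma_obj R B K T act M in
            \<forall>m\<in>carrier M. \<forall>t\<in>carrier T.
              (\<forall>b\<in>carrier B. \<forall>z\<in>coact M m. \<forall>w\<in>galois_translation R B T b.
                 alg_lact FM b (tclass Q (frag_of (m, t))) =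
                 tclass Q (sweedler z (\<lambda>h n. sweedler w (\<lambda>b_minus b_plus.
                   frag_of (n, b_plus \<otimes>\<^bsub>T\<^esub> act h (t \<otimes>\<^bsub>T\<^esub> b_minus)))))) \<and>
              (\<forall>r\<in>carrier R.
                 base_ract FM (tclass Q (frag_of (m, t))) r =
                 tclass Q (frag_of (m, right_act T t r))) \<and>
              (\<forall>z\<in>coaction T t.
                 rcoact FM (tclass Q (frag_of (m, t))) =
                 tclass (right_tensor R B FM (base_ract FM))
                   (sweedler z (\<lambda>t0 t1. frag_of (tclass Q (frag_of (m, t0)), t1)))))) \<and>
         (\<forall>(M :: ('t, 'k, 'm) rl_module) N. rl_sayd S K M \<longrightarrow> rl_sayd S K N \<longrightarrow>
           (\<forall>\<phi>\<in>rl_sayd_hom S K M N. \<forall>m\<in>carrier M. \<forall>t\<in>carrier T.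
              digamma_mor K T act M N \<phi> (tclass (digamma_group K T act M) (frag_of (m, t))) =
              tclass (digamma_group K T act N) (frag_of (\<phi> m, t))))"
proof -
  have bialg: "right_bialgebroid R B" "left_bialgebroid S K"
    using assms by (simp_all add: right_hopf_algebroid_def left_hopf_algebroid_def)
  have setting: "sayd_setting R B S K T act M" if "rl_sayd S K M" for M :: "('t, 'k, 'm) rl_module"
    using assms that
    by unfold_locales (simp_all add: right_hopf_algebroid_def left_hopf_algebroid_def)
  have morphism: "sayd_morphism R B S K T act M N \<phi>"
    if "rl_sayd S K M" "rl_sayd S K N" "\<phi> \<in> rl_sayd_hom S K M N" for M N :: "('t, 'k, 'm) rl_module" and \<phi>
    using setting[OF that(1)] setting[OF that(2)] that(3)
    by (simp add: sayd_morphism_def sayd_morphism_axioms_def)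
  let ?rl = "rl_sayd_category S K :: (('t, 'k, 'm) rl_module, 'm \<Rightarrow> 'm) category"
  have cov: "covariant_functor ?rl (lr_sayd_category R B) (digamma_obj R B K T act) (digamma_mor K T act)"
    unfolding covariant_functor_def
  proof (intro conjI ballI)
    show "is_category ?rl" by (rule rl_sayd_category_is_category[OF bialg(2)])
    show "is_category (lr_sayd_category R B)" by (rule lr_sayd_category_is_category[OF bialg(1)])
  next
    fix M assume "M \<in> Ob ?rl"
    then have M: "rl_sayd S K M" by (simp add: rl_sayd_category_def)
    interpret M: sayd_setting R B S K T act M by (rule setting[OF M])
    show "digamma_obj R B K T act M \<in> Ob (lr_sayd_category R B)"
      using M.FM_sayd by (simp add: lr_sayd_category_def)
    \<comment> \<open>The restricted identity is first recognized as a morphism, so that the general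
      description of \<open>mor\<close> can be instantiated with it.\<close>
    have id: "restrict (\<lambda>m. m) (carrier M) \<in> rl_sayd_hom S K M M"
      using rl_sayd_category_is_category[OF bialg(2)] M by (force simp: is_category_def rl_sayd_category_def)
    interpret i: sayd_morphism R B S K T act M M "restrict (\<lambda>m. m) (carrier M)"
      by (rule morphism[OF M M id])
    have "i.mor U = U" if U: "U \<in> carrier M.QQ" for U
      by (rule M.QM.eq_by_tsum[OF i.mor_closed[OF U] U U i.tsum_mor[OF balanced_frag_of U] cong_mod_refl]) simp
    then show "digamma_mor K T act M M (Ident ?rl M) = Ident (lr_sayd_category R B) (digamma_obj R B K T act M)"
      by (auto simp: rl_sayd_category_def lr_sayd_category_def fun_eq_iff digamma_mor_def)
  next
    fix M N \<phi> assume "M \<in> Ob ?rl" "N \<in> Ob ?rl" "\<phi> \<in> Hom ?rl M N"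
    then interpret sayd_morphism R B S K T act M N \<phi>
      by (intro morphism) (simp_all add: rl_sayd_category_def)
    show "digamma_mor K T act M N \<phi> \<in> Hom (lr_sayd_category R B) (digamma_obj R B K T act M) (digamma_obj R B K T act N)"
      using mor_sayd_hom by (simp add: lr_sayd_category_def)
  next
    fix L M N \<phi> \<psi>
    assume "L \<in> Ob ?rl" "M \<in> Ob ?rl" "N \<in> Ob ?rl" "\<phi> \<in> Hom ?rl L M" "\<psi> \<in> Hom ?rl M N"
    then have ob: "rl_sayd S K L" "rl_sayd S K M" "rl_sayd S K N"
      and mo: "\<phi> \<in> rl_sayd_hom S K L M" "\<psi> \<in> rl_sayd_hom S K M N"
      by (simp_all add: rl_sayd_category_def)
    have co: "compose (carrier L) \<psi> \<phi> \<in> rl_sayd_hom S K L N"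
      using rl_sayd_category_is_category[OF bialg(2)] ob mo by (force simp: is_category_def rl_sayd_category_def)
    interpret f: sayd_morphism R B S K T act L M \<phi> by (rule morphism[OF ob(1,2) mo(1)])
    interpret g: sayd_morphism R B S K T act M N \<psi> by (rule morphism[OF ob(2,3) mo(2)])
    interpret gf: sayd_morphism R B S K T act L N "compose (carrier L) \<psi> \<phi>" by (rule morphism[OF ob(1,3) co])
    \<comment> \<open>Both sides are reduced to sums over \<open>U\<close> with the universal
      functional; the composite is reached in two steps, through the tensor product of the middle
      module with \<open>T\<close>.\<close>
    have "gf.mor U = g.mor (f.mor U)" if U: "U \<in> carrier f.M.QQ" for U
    proof (rule g.N.QM.carrier_eqI[OF gf.mor_closed[OF U] g.mor_closed[OF f.mor_closed[OF U]]])
      let ?f = "\<lambda>x y. frag_of (x, y)" and ?H = g.N.QM.rels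
      have f: "g.N.QM.bal ?H ?f" by (rule balanced_frag_of)
      have "tsum (gf.mor U) ?f \<approx>\<^bsub>?H\<^esub> tsum U (\<lambda>m t. ?f (compose (carrier L) \<psi> \<phi> m) t)"
        by (rule gf.tsum_mor[OF f U])
      also have "\<dots> \<approx>\<^bsub>?H\<^esub> tsum U (\<lambda>m t. ?f (\<psi> (\<phi> m)) t)"
        by (rule f.M.QM.tsum_cong[OF U]) (simp add: compose_def)
      also have "\<dots> \<approx>\<^bsub>?H\<^esub> tsum (f.mor U) (\<lambda>m t. ?f (\<psi> m) t)"
        by (rule cong_mod_sym[OF f.tsum_mor[OF g.phi_bal[OF f] U]])
      also have "\<dots> \<approx>\<^bsub>?H\<^esub> tsum (g.mor (f.mor U)) ?f"
        by (rule cong_mod_sym[OF g.tsum_mor[OF f f.mor_closed[OF U]]])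
      finally show "tsum (gf.mor U) ?f \<approx>\<^bsub>?H\<^esub> tsum (g.mor (f.mor U)) ?f" .
    qed
    then show "digamma_mor K T act L N (Comp ?rl L M N \<psi> \<phi>) =
        Comp (lr_sayd_category R B) (digamma_obj R B K T act L) (digamma_obj R B K T act M)
          (digamma_obj R B K T act N) (digamma_mor K T act M N \<psi>) (digamma_mor K T act L M \<phi>)"
      by (auto simp: rl_sayd_category_def lr_sayd_category_def fun_eq_iff digamma_mor_def compose_def)
  qed
  have obj: "b \<in> carrier B \<Longrightarrow> z \<in> coact M m \<Longrightarrow> w \<in> galois_translation R B T b \<Longrightarrow>
      alg_lact (digamma_obj R B K T act M) b (tclass (digamma_group K T act M) (frag_of (m, t))) =
      tclass (digamma_group K T act M) (sweedler z (\<lambda>h n. sweedler w (\<lambda>b_minus b_plus.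
        frag_of (n, b_plus \<otimes>\<^bsub>T\<^esub> act h (t \<otimes>\<^bsub>T\<^esub> b_minus)))))"
    "r \<in> carrier R \<Longrightarrow>
      base_ract (digamma_obj R B K T act M) (tclass (digamma_group K T act M) (frag_of (m, t))) r =
      tclass (digamma_group K T act M) (frag_of (m, right_act T t r))"
    "z' \<in> coaction T t \<Longrightarrow>
      rcoact (digamma_obj R B K T act M) (tclass (digamma_group K T act M) (frag_of (m, t))) =
      tclass (right_tensor R B (digamma_obj R B K T act M) (base_ract (digamma_obj R B K T act M)))
        (sweedler z' (\<lambda>t0 t1. frag_of (tclass (digamma_group K T act M) (frag_of (m, t0)), t1)))"
    if "rl_sayd S K M" "m \<in> carrier M" "t \<in> carrier T"
    for M :: "('t, 'k, 'm) rl_module" and m t b z w r z'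
  proof -
    interpret sayd_setting R B S K T act M by (rule setting[OF that(1)])
    show "b \<in> carrier B \<Longrightarrow> z \<in> coact M m \<Longrightarrow> w \<in> galois_translation R B T b \<Longrightarrow>
        alg_lact FM b (QM.pure m t) = tclass QQ (sweedler z (\<lambda>h n. sweedler w (\<lambda>b_minus b_plus.
          frag_of (n, b_plus \<otimes>\<^bsub>T\<^esub> act h (t \<otimes>\<^bsub>T\<^esub> b_minus)))))"
      unfolding FM_simps(5) by (rule FM_formulas(1)[OF that(2,3)])
    show "r \<in> carrier R \<Longrightarrow> base_ract FM (QM.pure m t) r = QM.pure m (right_act T t r)"
      unfolding FM_simps(4) by (rule ract_pure[OF that(2,3)])
    show "z' \<in> coaction T t \<Longrightarrow> rcoact FM (QM.pure m t) =
        tclass (right_tensor R B FM (base_ract FM)) (sweedler z' (\<lambda>t0 t1. frag_of (QM.pure m t0, t1)))"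
      unfolding FM_simps(4,6) by (rule FM_formulas(2)[OF that(2,3)])
  qed
  have mor: "digamma_mor K T act M N \<phi> (tclass (digamma_group K T act M) (frag_of (m, t))) =
      tclass (digamma_group K T act N) (frag_of (\<phi> m, t))"
    if "rl_sayd S K M" "rl_sayd S K N" "\<phi> \<in> rl_sayd_hom S K M N" "m \<in> carrier M" "t \<in> carrier T"
    for M N :: "('t, 'k, 'm) rl_module" and \<phi> m t
    using sayd_morphism.mor_pure[OF morphism[OF that(1-3)] that(4,5)] .
  show ?thesis
    unfolding Let_def
    by (intro conjI allI impI ballI) (rule cov obj mor; assumption)+
qed

end
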